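(* Let $s\in(n/2,\infty]$. There exists a universal constant $\mathbf{k}>0$ such that the following holds. Fix $0<r_0<3/4$ such that $\Omega^{4r_0}$ is nonempty, let $0<r<r_0$ and $x_0\in\Omega^{4r}$. For all $V\in\mathscr{V}_s$ and all $u\in X_s$ satisfying $(-\Delta+V)u=0$ in $\Omega$ and $\|u\|_{L^2(\Omega)}=1$, $$\|u\|_{L^2(B(x_0,2\rho))}\le\rho^{-\bar{\lambda}_s}\,\mathbf{M}_s\,\|u\|_{L^2(B(x_0,\rho))},\qquad 0<\rho<r/8,$$ where $$\tilde{\lambda}_s:=\frac{1}{\ln(9/4)}\ln\left(1+4r^{-1}\mathbf{k}\,\tilde{\vartheta}_V(1+\kappa_V^{\iota})\,\frac{\|u(x_0+\cdot)\|_{L^2([\![r,13r/4]\!])}}{\|u(x_0+\cdot)\|_{L^2([\![r/4,r/2]\!])}}\right),$$ $$\bar{\lambda}_s:=2+\max\left(\tilde{\lambda}_s+1,\;8+\tfrac12+\tfrac{n-2}{2}\right),\qquad \mathbf{M}_s:=\mathbf{k}\,(1+\kappa_V^{\iota})\,\bar{\lambda}_s^2 .$$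
   Context: $n\ge 3$ is an integer, $\Omega\subset\mathbb{R}^n$ is a bounded Lipschitz domain, $p:=2n/(n+2)$, $p':=2n/(n-2)$. For $r>0$, $\Omega^r:=\{x\in\Omega:\ \mathrm{dist}(x,\mathbb{R}^n\setminus\Omega)>r\}$. For $0\le a<b$, $[\![a,b]\!]:=\{x\in\mathbb{R}^n:\ a<|x|<b\}$. $X_s:=W^{2,p}(\Omega)$ if $s\in(n/2,\infty)$ and $X_\infty:=H^2(\Omega)$. A universal constant depends on none of the data. Let $\Lambda:=\{\lambda>0:\ \mathrm{dist}(\lambda,\mathbb{N}+(n-2)/2)=1/2\}$. The constant $\vartheta=\vartheta(n)\ge 1$ is a fixed constant for which the (known, Jerison–Kenig) Carleman inequality $\||x|^{-\lambda}u\|_{L^{p'}(B)}\le\vartheta\||x|^{-\lambda}\Delta u\|_{L^p(B)}$ holds for every ball $B$ centered at $0$, every $\lambda\in\Lambda$ and every $u\in W^{2,p}(B)$ with $\mathrm{supp}(u)\subset B\setminus\{0\}$. For $V\in L^s(\Omega)$: $\kappa_V:=\|V\|_{L^s(\Omega)}$, $\tilde{\kappa}_V:=\|V\|_{L^{n/2}(\Omega)}$; $\mathscr{V}_s:=\{V\in L^s(\Omega):\ \vartheta\tilde{\kappa}_V<1\}$, and for $V\in\mathscr{V}_s$, $\tilde{\vartheta}_V:=\vartheta(1-\vartheta\tilde{\kappa}_V)^{-1}$. Also $\iota:=s/(2s-n)$ if $s\in(n/2,\infty)$ and $\iota:=1$ if $s=\infty$. (The denominator in $\tilde\lambda_s$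 is nonzero by unique continuation.) *)

theory Defs
  imports "HOL-Analysis.Analysis" "HOL-Probability.Essential_Supremum"
begin

text \<open>
  The dimension n is quantified inside the statement (after the universal constant), so
  Euclidean n-space is the product of n copies of the real line, its points being the functions
  in \<open>{..<n} \<rightarrow>\<^sub>E UNIV\<close>. This is the common carrier of the library's product topology and product
  measure. The type \<open>nat \<Rightarrow> real\<close> has its own type-class metric, which is not the Euclidean
  distance and is not used here.
\<close>

type_synonym point = "nat \<Rightarrow> real"

definition Rn :: "nat \<Rightarrow> point set" where
  "Rn n = ({..<n} \<rightarrow>\<^sub>E UNIV)"

definition Rn_top :: "nat \<Rightarrow> point topology" where
  "Rn_top n = product_topology (\<lambda>_. euclideanreal) {..<n}"

definition leb :: "nat \<Rightarrow> point measure" where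
  "leb n = completion (Pi\<^sub>M {..<n} (\<lambda>_. lborel))"

abbreviation leb_on :: "nat \<Rightarrow> point set \<Rightarrow> point measure" where
  "leb_on n A \<equiv> restrict_space (leb n) A"

definition origin :: "nat \<Rightarrow> point" where
  "origin n = (\<lambda>i\<in>{..<n}. 0)"

definition padd :: "nat \<Rightarrow> point \<Rightarrow> point \<Rightarrow> point" where
  "padd n x y = (\<lambda>i\<in>{..<n}. x i + y i)"

definition pscale :: "nat \<Rightarrow> real \<Rightarrow> point \<Rightarrow> point" where
  "pscale n c x = (\<lambda>i\<in>{..<n}. c * x i)"

definition pinner :: "nat \<Rightarrow> point \<Rightarrow> point \<Rightarrow> real" where
  "pinner n x y = (\<Sum>i<n. x i * y i)"

definition pnorm :: "nat \<Rightarrow> point \<Rightarrow> real" where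
  "pnorm n x = L2_set x {..<n}"

definition pdist :: "nat \<Rightarrow> point \<Rightarrow> point \<Rightarrow> real" where
  "pdist n x y = L2_set (\<lambda>i. x i - y i) {..<n}"

definition pball :: "nat \<Rightarrow> point \<Rightarrow> real \<Rightarrow> point set" where
  "pball n x r = {y \<in> Rn n. pdist n x y < r}"

definition shell :: "nat \<Rightarrow> real \<Rightarrow> real \<Rightarrow> point set" where
  "shell n a b = {x \<in> Rn n. a < pnorm n x \<and> pnorm n x < b}"

text \<open>The set \<open>\<Omega>\<^sup>r\<close>; the infimum is over a nonempty set whenever \<open>\<Omega> \<noteq> Rn n\<close>.\<close>

definition inner_set :: "nat \<Rightarrow> point set \<Rightarrow> real \<Rightarrow> point set" where
  "inner_set n \<Omega> r = {x \<in> \<Omega>. (INF y\<in>Rn n - \<Omega>. pdist n x y) > r}"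

text \<open>
  Near each boundary point the domain is the strict epigraph, in some direction \<open>\<nu>\<close>, of a
  Lipschitz function on the hyperplane orthogonal to \<open>\<nu>\<close>. Using the unit vector \<open>\<nu>\<close> avoids an
  explicit rigid change of coordinates.
\<close>

definition lipschitz_boundary_at :: "nat \<Rightarrow> point set \<Rightarrow> point \<Rightarrow> bool" where
  "lipschitz_boundary_at n \<Omega> x \<longleftrightarrow>
     (\<exists>U \<nu> \<phi> L. openin (Rn_top n) U \<and> x \<in> U \<and> \<nu> \<in> Rn n \<and> pnorm n \<nu> = 1 \<and>
        (\<forall>y\<in>Rn n. \<forall>z\<in>Rn n. pinner n y \<nu> = 0 \<and> pinner n z \<nu> = 0
            \<longrightarrow> \<bar>\<phi> y - \<phi> z\<bar> \<le> L * pdist n y z) \<and>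
        \<Omega> \<inter> U = {y \<in> U. pinner n y \<nu> > \<phi> (padd n y (pscale n (- pinner n y \<nu>) \<nu>))})"

definition bounded_lipschitz_domain :: "nat \<Rightarrow> point set \<Rightarrow> bool" where
  "bounded_lipschitz_domain n \<Omega> \<longleftrightarrow>
     \<Omega> \<noteq> {} \<and> openin (Rn_top n) \<Omega> \<and> connectedin (Rn_top n) \<Omega> \<and>
     (\<exists>R. \<Omega> \<subseteq> pball n (origin n) R) \<and>
     (\<forall>x \<in> Rn_top n frontier_of \<Omega>. lipschitz_boundary_at n \<Omega> x)"

text \<open>
  Lebesgue spaces of real-valued functions, with exponent \<open>q \<in> (0,\<infinity>]\<close>. The value of \<open>Lp_norm\<close>
  is meaningful only for members of \<open>Lp_space\<close>: otherwise the Bochner integral is 0 by convention.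
\<close>

definition Lp_space :: "'a measure \<Rightarrow> ereal \<Rightarrow> ('a \<Rightarrow> real) set" where
  "Lp_space M q = {f \<in> borel_measurable M.
     if q = \<infinity> then \<exists>C. AE x in M. \<bar>f x\<bar> \<le> C
     else integrable M (\<lambda>x. \<bar>f x\<bar> powr real_of_ereal q)}"

definition Lp_norm :: "'a measure \<Rightarrow> ereal \<Rightarrow> ('a \<Rightarrow> real) \<Rightarrow> real" where
  "Lp_norm M q f =
     (if q = \<infinity> then real_of_ereal (esssup M (\<lambda>x. ereal \<bar>f x\<bar>))
      else (LINT x|M. \<bar>f x\<bar> powr real_of_ereal q) powr (1 / real_of_ereal q))"

definition partial_deriv :: "nat \<Rightarrow> (point \<Rightarrow> real) \<Rightarrow> point \<Rightarrow> real" where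
  "partial_deriv i f x = deriv (\<lambda>t. f (x(i := t))) (x i)"

primrec Ck :: "nat \<Rightarrow> nat \<Rightarrow> (point \<Rightarrow> real) \<Rightarrow> bool" where
  "Ck n 0 f \<longleftrightarrow> continuous_map (Rn_top n) euclideanreal f"
| "Ck n (Suc k) f \<longleftrightarrow> continuous_map (Rn_top n) euclideanreal f \<and>
     (\<forall>i<n. (\<forall>x\<in>Rn n. (\<lambda>t. f (x(i := t))) differentiable (at (x i))) \<and>
            Ck n k (partial_deriv i f))"

definition test_functions :: "nat \<Rightarrow> point set \<Rightarrow> (point \<Rightarrow> real) set" where
  "test_functions n \<Omega> = {\<phi>. (\<forall>k. Ck n k \<phi>) \<and>
     (\<exists>K. compactin (Rn_top n) K \<and> K \<subseteq> \<Omega> \<and> (\<forall>x\<in>Rn n - K. \<phi> x = 0))}"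

definition locally_integrable :: "nat \<Rightarrow> point set \<Rightarrow> (point \<Rightarrow> real) \<Rightarrow> bool" where
  "locally_integrable n \<Omega> f \<longleftrightarrow>
     (\<forall>K. compactin (Rn_top n) K \<and> K \<subseteq> \<Omega> \<longrightarrow> integrable (leb_on n K) f)"

definition weak_pderiv :: "nat \<Rightarrow> point set \<Rightarrow> nat \<Rightarrow> (point \<Rightarrow> real) \<Rightarrow> (point \<Rightarrow> real) \<Rightarrow> bool" where
  "weak_pderiv n \<Omega> i f g \<longleftrightarrow>
     locally_integrable n \<Omega> f \<and> locally_integrable n \<Omega> g \<and>
     (\<forall>\<phi>\<in>test_functions n \<Omega>.
        (LINT x|leb_on n \<Omega>. f x * partial_deriv i \<phi> x) = - (LINT x|leb_on n \<Omega>. g x * \<phi> x))"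

primrec sobolev :: "nat \<Rightarrow> point set \<Rightarrow> nat \<Rightarrow> ereal \<Rightarrow> (point \<Rightarrow> real) set" where
  "sobolev n \<Omega> 0 q = Lp_space (leb_on n \<Omega>) q"
| "sobolev n \<Omega> (Suc k) q = {f \<in> Lp_space (leb_on n \<Omega>) q.
     \<forall>i<n. \<exists>g \<in> sobolev n \<Omega> k q. weak_pderiv n \<Omega> i f g}"

text \<open>\<open>w\<close> is (a representative of) the weak Laplacian of \<open>u\<close>; it is unique almost everywhere.\<close>

definition weak_laplacian :: "nat \<Rightarrow> point set \<Rightarrow> (point \<Rightarrow> real) \<Rightarrow> (point \<Rightarrow> real) \<Rightarrow> bool" where
  "weak_laplacian n \<Omega> u w \<longleftrightarrow>
     (\<exists>D H. (\<forall>i<n. weak_pderiv n \<Omega> i u (D i) \<and> weak_pderiv n \<Omega> i (D i) (H i)) \<and>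
            (AE x in leb_on n \<Omega>. w x = (\<Sum>i<n. H i x)))"

definition schrodinger_solution ::
    "nat \<Rightarrow> point set \<Rightarrow> (point \<Rightarrow> real) \<Rightarrow> (point \<Rightarrow> real) \<Rightarrow> bool" where
  "schrodinger_solution n \<Omega> V u \<longleftrightarrow>
     (\<exists>w. weak_laplacian n \<Omega> u w \<and> (AE x in leb_on n \<Omega>. - w x + V x * u x = 0))"

definition exponent_p :: "nat \<Rightarrow> real" where
  "exponent_p n = 2 * real n / (real n + 2)"

definition exponent_p' :: "nat \<Rightarrow> real" where
  "exponent_p' n = 2 * real n / (real n - 2)"

definition X_space :: "nat \<Rightarrow> point set \<Rightarrow> ereal \<Rightarrow> (point \<Rightarrow> real) set" where
  "X_space n \<Omega> s =
     (if s = \<infinity> then sobolev n \<Omega> 2 2 else sobolev n \<Omega> 2 (ereal (exponent_p n)))"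

text \<open>
  The support of a measurable function on \<open>\<Omega>\<close>, taken as a closed subset of the whole space and
  not of \<open>\<Omega>\<close>: if \<open>\<Omega>\<close> is bounded and contains the support, then the support is compact.
\<close>

definition ess_support :: "nat \<Rightarrow> point set \<Rightarrow> (point \<Rightarrow> real) \<Rightarrow> point set" where
  "ess_support n \<Omega> u =
     {x \<in> Rn n. \<forall>\<epsilon>>0. \<not> (AE y in leb_on n \<Omega>. y \<in> pball n x \<epsilon> \<longrightarrow> u y = 0)}"

definition Carleman_exponents :: "nat \<Rightarrow> real set" where
  "Carleman_exponents n =
     {\<mu>. \<mu> > 0 \<and> infdist \<mu> (range (\<lambda>k::nat. real k + (real n - 2) / 2)) = 1 / 2}"

definition Carleman_constant :: "nat \<Rightarrow> real \<Rightarrow> bool" where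
  "Carleman_constant n \<theta> \<longleftrightarrow> \<theta> \<ge> 1 \<and>
     (\<forall>R>0. \<forall>\<mu>\<in>Carleman_exponents n.
        \<forall>u\<in>sobolev n (pball n (origin n) R) 2 (ereal (exponent_p n)). \<forall>w.
          ess_support n (pball n (origin n) R) u \<subseteq> pball n (origin n) R - {origin n} \<and>
          weak_laplacian n (pball n (origin n) R) u w \<longrightarrow>
          Lp_norm (leb_on n (pball n (origin n) R)) (ereal (exponent_p' n))
              (\<lambda>x. pnorm n x powr (- \<mu>) * u x)
          \<le> \<theta> * Lp_norm (leb_on n (pball n (origin n) R)) (ereal (exponent_p n))
              (\<lambda>x. pnorm n x powr (- \<mu>) * w x))"

definition kappa :: "nat \<Rightarrow> point set \<Rightarrow> ereal \<Rightarrow> (point \<Rightarrow> real) \<Rightarrow> real" where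
  "kappa n \<Omega> s V = Lp_norm (leb_on n \<Omega>) s V"

definition kappa_tilde :: "nat \<Rightarrow> point set \<Rightarrow> (point \<Rightarrow> real) \<Rightarrow> real" where
  "kappa_tilde n \<Omega> V = Lp_norm (leb_on n \<Omega>) (ereal (real n / 2)) V"

definition potentials :: "nat \<Rightarrow> real \<Rightarrow> point set \<Rightarrow> ereal \<Rightarrow> (point \<Rightarrow> real) set" where
  "potentials n \<theta> \<Omega> s = {V \<in> Lp_space (leb_on n \<Omega>) s. \<theta> * kappa_tilde n \<Omega> V < 1}"

definition theta_tilde :: "nat \<Rightarrow> real \<Rightarrow> point set \<Rightarrow> (point \<Rightarrow> real) \<Rightarrow> real" where
  "theta_tilde n \<theta> \<Omega> V = \<theta> / (1 - \<theta> * kappa_tilde n \<Omega> V)"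

definition iota_exp :: "nat \<Rightarrow> ereal \<Rightarrow> real" where
  "iota_exp n s =
     (if s = \<infinity> then 1 else real_of_ereal s / (2 * real_of_ereal s - real n))"

end

theory Submission
  imports Defs "HOL-Probability.Probability" "HOL-Computational_Algebra.Polynomial"
begin

text \<open>
  Put \<open>x0\<close> at the origin. The smallness of \<open>V\<close> in \<open>L\<^sup>n\<^sup>/\<^sup>2\<close>, together with a Sobolev inequality whose constant is
  below \<open>1\<close> in every dimension, makes \<open>- \<Delta> + V\<close> coercive with a universal constant; hence the \<open>L\<^sup>2\<close> norm of
  \<open>u\<close> on a ball is controlled by the norm on a surrounding annulus. In the Carleman inequality for a cutoff
  of \<open>u\<close>, the term \<open>V u\<close> is absorbed on the left, and two commutator terms remain, one inside \<open>\<rho>/4 < \<bar>x\<bar> < \<rho>\<close> and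
  one inside \<open>r < \<bar>x\<bar> < 13r/4\<close>. An admissible exponent \<open>\<mu>\<close> with \<open>lam_tilde \<le> \<mu> \<le> lam_bar - 2\<close> makes the outer term at
  most half of the left side on \<open>r/4 < \<bar>x\<bar> < r/2\<close>, so both terms are bounded by the inner one; the same exponent,
  with \<open>\<rho> < \<bar>x\<bar> < 2\<rho>\<close> on the left side, then gives the doubling inequality.

  The Carleman inequality is only applied to twice differentiable functions, namely cut-off mollifications of
  \<open>u\<close>: the mollified equation converges in \<open>L\<^sup>p\<close>, and coercivity gives the convergence in the dual space.
  The losses of order \<open>n\<close> from \<open>\<Delta>\<close> of the cutoffs are compensated by the volume of the ball, whose \<open>n\<close>-th root
  is of order \<open>n powr (-1/2)\<close>, so that the final constant does not depend on the dimension.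
\<close>

section \<open>Real \<open>L\<^sup>q\<close> spaces\<close>

text \<open>The constant \<open>k\<close> is chosen before \<open>n\<close>, so every inequality has
  to be uniform in the dimension. The other obstacle is regularity: with \<open>u\<close> only known
  in L^2, Hoelder's inequality does not put \<open>V u\<close> into L^p. It lies there because it
  coincides with a weak Laplacian of \<open>u\<close>. A mollification \<open>f\<close> of
  \<open>u\<close> solves the equation up to the residual (V u mollified) - V f, and this tends to 0
  in L^p once \<open>f\<close> tends to \<open>u\<close> in the dual space; that convergence comes
  from the energy inequality with zero potential, applied to differences of mollifications. The
  number 9/4 in \<open>lam_tilde\<close> is the quotient of 9r/8, where the outer cutoff starts to
  fall, by r/2, the outer radius of the annulus kept on the left: its power \<open>\<mu>\<close>
  outweighs the ratio of the two annulus norms. Admissible exponents have spacing 1, whence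
  \<open>lam_tilde + 1\<close>. The energy inequality also bounds the quotient of the annulus norms
  from below, and this is what removes \<open>\<theta>\<close> from the doubling constant.\<close>

definition in_Lq :: "'a measure \<Rightarrow> real \<Rightarrow> ('a \<Rightarrow> real) \<Rightarrow> bool" where
  "in_Lq M q f \<longleftrightarrow> f \<in> borel_measurable M \<and> integrable M (\<lambda>x. \<bar>f x\<bar> powr q)"

definition Lq_norm :: "'a measure \<Rightarrow> real \<Rightarrow> ('a \<Rightarrow> real) \<Rightarrow> real" where
  "Lq_norm M q f = (LINT x|M. \<bar>f x\<bar> powr q) powr (1 / q)"

lemma in_Lq_measurable [measurable_dest]: "in_Lq M q f \<Longrightarrow> f \<in> borel_measurable M"
  by (simp add: in_Lq_def)

lemma in_Lq_integrable: "in_Lq M q f \<Longrightarrow> integrable M (\<lambda>x. \<bar>f x\<bar> powr q)"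
  by (simp add: in_Lq_def)

lemma Lq_norm_nonneg [simp]: "0 \<le> Lq_norm M q f"
  by (simp add: Lq_norm_def)

lemma Lq_norm_powr: "q \<noteq> 0 \<Longrightarrow> Lq_norm M q f powr q = (LINT x|M. \<bar>f x\<bar> powr q)"
  by (simp add: Lq_norm_def powr_powr)

lemma Lp_norm_eq_Lq_norm: "Lp_norm M (ereal q) f = Lq_norm M q f"
  by (simp add: Lp_norm_def Lq_norm_def)

lemma Lp_norm_2_eq_Lq_norm: "Lp_norm M 2 f = Lq_norm M 2 f"
  using Lp_norm_eq_Lq_norm[of M 2 f] by simp

lemma in_Lq_bounded:
  assumes "f \<in> borel_measurable M" "in_Lq M q g" "AE x in M. \<bar>f x\<bar> \<le> \<bar>g x\<bar>" "0 \<le> q"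
  shows "in_Lq M q f"
  unfolding in_Lq_def
proof
  have [measurable]: "f \<in> borel_measurable M" by fact
  show "integrable M (\<lambda>x. \<bar>f x\<bar> powr q)"
    by (rule Bochner_Integration.integrable_bound[OF in_Lq_integrable[OF assms(2)]])
       (use assms(3,4) in \<open>auto elim!: eventually_mono intro: powr_mono2\<close>)
qed fact

lemma Lq_norm_mono_AE:
  assumes "f \<in> borel_measurable M" "in_Lq M q g" "AE x in M. \<bar>f x\<bar> \<le> \<bar>g x\<bar>" "0 < q"
  shows "Lq_norm M q f \<le> Lq_norm M q g"
  unfolding Lq_norm_def
  using assms
  by (intro powr_mono2 integral_mono_AE in_Lq_integrable in_Lq_bounded[of f M q g])
     (auto elim!: eventually_mono intro: powr_mono2)

lemma Lq_norm_mono: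
  assumes "f \<in> borel_measurable M" "in_Lq M q g" "\<And>x. x \<in> space M \<Longrightarrow> \<bar>f x\<bar> \<le> \<bar>g x\<bar>" "0 < q"
  shows "Lq_norm M q f \<le> Lq_norm M q g"
  using assms by (intro Lq_norm_mono_AE) auto

lemma Lq_norm_cong_AE:
  assumes "f \<in> borel_measurable M" "g \<in> borel_measurable M" "AE x in M. \<bar>f x\<bar> = \<bar>g x\<bar>"
  shows "Lq_norm M q f = Lq_norm M q g"
proof -
  have [measurable]: "f \<in> borel_measurable M" "g \<in> borel_measurable M" by fact+
  have "(LINT x|M. \<bar>f x\<bar> powr q) = (LINT x|M. \<bar>g x\<bar> powr q)"
    using assms(3) by (intro integral_cong_AE) (auto elim!: eventually_mono)
  then show ?thesis by (simp add: Lq_norm_def)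
qed

lemma Lq_norm_cong:
  assumes "\<And>x. x \<in> space M \<Longrightarrow> \<bar>f x\<bar> = \<bar>g x\<bar>"
  shows "Lq_norm M q f = Lq_norm M q g"
  unfolding Lq_norm_def using assms by (simp cong: Bochner_Integration.integral_cong)

lemma in_Lq_cong:
  assumes "\<And>x. x \<in> space M \<Longrightarrow> f x = g x"
  shows "in_Lq M q f \<longleftrightarrow> in_Lq M q g"
  unfolding in_Lq_def using assms 
  by (simp cong: measurable_cong Bochner_Integration.integrable_cong)

lemma in_Lq_cmult: "in_Lq M q f \<Longrightarrow> in_Lq M q (\<lambda>x. c * f x)"
  unfolding in_Lq_def by (auto simp: abs_mult powr_mult)

lemma Lq_norm_cmult: "q > 0 \<Longrightarrow> Lq_norm M q (\<lambda>x. c * f x) = \<bar>c\<bar> * Lq_norm M q f"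
  unfolding Lq_norm_def by (simp add: abs_mult powr_mult powr_powr)

lemma Lq_norm_minus_commute: "Lq_norm M q (\<lambda>x. f x - g x) = Lq_norm M q (\<lambda>x. g x - f x)"
  by (simp add: Lq_norm_def abs_minus_commute)

lemma Lq_norm_abs [simp]: "Lq_norm M q (\<lambda>x. \<bar>f x\<bar>) = Lq_norm M q f"
  by (simp add: Lq_norm_def)

lemma in_Lq_indicator:
  assumes "in_Lq M q f" "A \<in> sets M" "0 \<le> q" shows "in_Lq M q (\<lambda>x. indicator A x * f x)"
proof -
  have [measurable]: "A \<in> sets M" "f \<in> borel_measurable M" using assms by (auto simp: in_Lq_def)
  show ?thesis by (rule in_Lq_bounded[OF _ assms(1)]) (use assms in \<open>auto simp: indicator_def\<close>)
qed

lemma Lq_norm_indicator_mono: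
  assumes "in_Lq M q f" "A \<in> sets M" "0 < q" "A \<subseteq> B" "B \<in> sets M"
  shows "Lq_norm M q (\<lambda>x. indicator A x * f x) \<le> Lq_norm M q (\<lambda>x. indicator B x * f x)"
proof -
  have [measurable]: "A \<in> sets M" "f \<in> borel_measurable M" using assms by (auto simp: in_Lq_def)
  show ?thesis using assms by (intro Lq_norm_mono in_Lq_indicator) (auto simp: indicator_def)
qed

lemma Lq_norm_eq_0_AE:
  assumes "in_Lq M q f" "Lq_norm M q f = 0" "0 < q"
  shows "AE x in M. f x = 0"
proof -
  have "(LINT x|M. \<bar>f x\<bar> powr q) = 0"
    using assms Lq_norm_powr[of q M f] by auto
  then have "AE x in M. \<bar>f x\<bar> powr q = 0"
    using in_Lq_integrable[OF assms(1)] by (subst (asm) integral_nonneg_eq_0_iff_AE) auto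
  then show ?thesis by (auto elim!: eventually_mono)
qed

section \<open>Hoelder's and Minkowski's inequalities\<close>

lemma integrable_mult_Holder:
  assumes f: "in_Lq M a f" and g: "in_Lq M b g" and ab: "a > 1" "b > 1" "1/a + 1/b = 1"
  shows "integrable M (\<lambda>x. f x * g x)"
proof -
  have [measurable]: "f \<in> borel_measurable M" "g \<in> borel_measurable M"
    using f g by (auto simp: in_Lq_def)
  show ?thesis
  proof (rule Bochner_Integration.integrable_bound)
    show "integrable M (\<lambda>x. \<bar>f x\<bar> powr a / a + \<bar>g x\<bar> powr b / b)"
      using in_Lq_integrable[OF f] in_Lq_integrable[OF g] by auto
    show "AE x in M. norm (f x * g x) \<le> norm (\<bar>f x\<bar> powr a / a + \<bar>g x\<bar> powr b / b)"
      using Youngs_inequality[of a b "\<bar>f _\<bar>" "\<bar>g _\<bar>"] ab by (auto simp: abs_mult intro!: AE_I2)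
  qed measurable
qed

text \<open>Young's inequality is integrated after both factors are divided by their norms; a
  vanishing norm makes the product vanish almost everywhere and is treated apart.\<close>

lemma Holder_inequality:
  assumes f: "in_Lq M a f" and g: "in_Lq M b g" and ab: "a > 1" "b > 1" "1/a + 1/b = 1"
  shows "(LINT x|M. \<bar>f x * g x\<bar>) \<le> Lq_norm M a f * Lq_norm M b g"
proof -
  have [measurable]: "f \<in> borel_measurable M" "g \<in> borel_measurable M"
    using f g by (auto simp: in_Lq_def)
  define A where "A = Lq_norm M a f"
  define B where "B = Lq_norm M b g"
  show ?thesis
  proof (cases "A = 0 \<or> B = 0")
    case True
    then have "AE x in M. f x * g x = 0"
      using Lq_norm_eq_0_AE[OF f] Lq_norm_eq_0_AE[OF g] ab unfolding A_def B_def
      by (auto elim!: eventually_mono)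
    then have "AE x in M. \<bar>f x * g x\<bar> = 0" by auto
    then have "(LINT x|M. \<bar>f x * g x\<bar>) = (LINT x|M. 0)"
      by (intro integral_cong_AE) auto
    then show ?thesis by (simp add: A_def B_def)
  next
    case False
    then have pos: "A > 0" "B > 0" by (auto simp: A_def B_def less_le)
    have "(LINT x|M. \<bar>f x * g x\<bar> / (A * B)) \<le>
      (LINT x|M. (\<bar>f x\<bar> powr a / a) / A powr a + (\<bar>g x\<bar> powr b / b) / B powr b)"
    proof (rule integral_mono)
      show "integrable M (\<lambda>x. \<bar>f x * g x\<bar> / (A * B))"
        using integrable_mult_Holder[OF assms] by auto
      show "integrable M (\<lambda>x. (\<bar>f x\<bar> powr a / a) / A powr a + (\<bar>g x\<bar> powr b / b) / B powr b)"
        using in_Lq_integrable[OF f] in_Lq_integrable[OF g] by auto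
      fix x
      show "\<bar>f x * g x\<bar> / (A * B) \<le> (\<bar>f x\<bar> powr a / a) / A powr a + (\<bar>g x\<bar> powr b / b) / B powr b"
        using Youngs_inequality[of a b "\<bar>f x\<bar>/A" "\<bar>g x\<bar>/B"] ab pos
        by (simp add: abs_mult powr_divide field_simps)
    qed
    also have "\<dots> = 1 / a + 1 / b"
    proof -
      have "A powr a = (LINT x|M. \<bar>f x\<bar> powr a)" "B powr b = (LINT x|M. \<bar>g x\<bar> powr b)"
        using Lq_norm_powr[of a M f] Lq_norm_powr[of b M g] ab by (auto simp: A_def B_def)
      moreover have "A powr a \<noteq> 0" "B powr b \<noteq> 0" using pos by auto
      ultimately show ?thesis
        using in_Lq_integrable[OF f] in_Lq_integrable[OF g] by simp
    qed
    finally have "(LINT x|M. \<bar>f x * g x\<bar>) / (A * B) \<le> 1" using ab by simp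
    then show ?thesis using pos by (simp add: A_def B_def)
  qed
qed

text \<open>The case of conjugate exponents is applied to |f|^c and |g|^c, whose exponents a/c and
  b/c are conjugate.\<close>

lemma Holder_gen:
  assumes f: "in_Lq M a f" and g: "in_Lq M b g" and pos: "a > 0" "b > 0" "c > 0" "1/c = 1/a + 1/b"
  shows "in_Lq M c (\<lambda>x. f x * g x)" "Lq_norm M c (\<lambda>x. f x * g x) \<le> Lq_norm M a f * Lq_norm M b g"
proof -
  have [measurable]: "f \<in> borel_measurable M" "g \<in> borel_measurable M"
    using f g by (auto simp: in_Lq_def)
  have "1/c > 1/a" "1/c > 1/b" using pos by auto
  then have "c < a" "c < b" using pos(1-3) by (simp_all add: field_simps)
  then have c: "a / c > 1" "b / c > 1" using pos by auto
  have "c * (1 / c) = c * (1 / a + 1 / b)" unfolding pos(4) ..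
  then have c1: "1 / (a / c) + 1 / (b / c) = 1" using pos(1-3) by (simp add: distrib_left)
  have F: "in_Lq M (a/c) (\<lambda>x. \<bar>f x\<bar> powr c)" 
    using f pos by (simp add: in_Lq_def powr_powr)
  have G: "in_Lq M (b/c) (\<lambda>x. \<bar>g x\<bar> powr c)" 
    using g pos by (simp add: in_Lq_def powr_powr)
  show "in_Lq M c (\<lambda>x. f x * g x)"
    using integrable_mult_Holder[OF F G c c1] by (simp add: in_Lq_def abs_mult powr_mult)
  have "(LINT x|M. \<bar>f x * g x\<bar> powr c) \<le> Lq_norm M (a/c) (\<lambda>x. \<bar>f x\<bar> powr c) * Lq_norm M (b/c) (\<lambda>x. \<bar>g x\<bar> powr c)"
    using Holder_inequality[OF F G c c1] by (simp add: in_Lq_def abs_mult powr_mult)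
  also have "Lq_norm M (a/c) (\<lambda>x. \<bar>f x\<bar> powr c) = Lq_norm M a f powr c"
    using pos by (simp add: Lq_norm_def powr_powr)
  also have "Lq_norm M (b/c) (\<lambda>x. \<bar>g x\<bar> powr c) = Lq_norm M b g powr c"
    using pos by (simp add: Lq_norm_def powr_powr)
  finally have "(LINT x|M. \<bar>f x * g x\<bar> powr c) \<le> (Lq_norm M a f * Lq_norm M b g) powr c"
    by (simp add: powr_mult)
  then have "Lq_norm M c (\<lambda>x. f x * g x) \<le> ((Lq_norm M a f * Lq_norm M b g) powr c) powr (1 / c)"
    unfolding Lq_norm_def[of M c] using pos by (intro powr_mono2) auto
  then show "Lq_norm M c (\<lambda>x. f x * g x) \<le> Lq_norm M a f * Lq_norm M b g"
    using pos(1-3) by (simp add: powr_powr)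
qed

text \<open>Convexity of t^q at the points x/s and y/(1-s). The free weight \<open>s\<close> is what
  gives Minkowski's inequality with constant 1.\<close>

lemma abs_add_powr_le:
  fixes x y q :: real
  assumes "q \<ge> 1" "0 < s" "s < 1"
  shows "\<bar>x + y\<bar> powr q \<le> s * (\<bar>x\<bar> / s) powr q + (1 - s) * (\<bar>y\<bar> / (1 - s)) powr q"
proof -
  have mono: "\<bar>x + y\<bar> powr q \<le> (\<bar>x\<bar> + \<bar>y\<bar>) powr q"
    using assms by (intro powr_mono2) auto
  show ?thesis
  proof (cases "x = 0 \<or> y = 0")
    case True
    \<comment> \<open>Convexity is only used at positive points; when one summand vanishes, s^q
      \<le> s does the work.\<close>
    have *: "t powr q \<le> s' * (t / s') powr q" if "0 < s'" "s' < 1" "t \<ge> 0" for s' t :: real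
    proof -
      have "s' powr q \<le> s' powr 1" using that assms by (intro powr_mono') auto
      then have "t powr q * s' powr q \<le> t powr q * s'" using that by (intro mult_left_mono) auto
      then show ?thesis using that by (simp add: powr_divide field_simps)
    qed
    show ?thesis using True *[of s "\<bar>x\<bar>"] *[of "1-s" "\<bar>y\<bar>"] assms by auto
  next
    case False
    have "((1 - (1-s)) *\<^sub>R (\<bar>x\<bar> / s) + (1 - s) *\<^sub>R (\<bar>y\<bar> / (1 - s))) powr q \<le> (1 - (1-s)) * (\<bar>x\<bar> / s) powr q + (1 - s) * (\<bar>y\<bar> / (1 - s)) powr q"
      by (rule convex_onD[OF powr_convex[OF assms(1)], of "1-s"]) (use assms False in auto)
    then show ?thesis using assms mono by simp
  qed
qed

lemma in_Lq_add:
  assumes f: "in_Lq M q f" and g: "in_Lq M q g" and q: "q \<ge> 1"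
  shows "in_Lq M q (\<lambda>x. f x + g x)"
proof -
  have [measurable]: "f \<in> borel_measurable M" "g \<in> borel_measurable M"
    using f g by (auto simp: in_Lq_def)
  show ?thesis unfolding in_Lq_def
  proof
    show "integrable M (\<lambda>x. \<bar>f x + g x\<bar> powr q)"
    proof (rule Bochner_Integration.integrable_bound)
      show "integrable M (\<lambda>x. (1/2) * (2 powr q * \<bar>f x\<bar> powr q) + (1/2) * (2 powr q * \<bar>g x\<bar> powr q))"
        using in_Lq_integrable[OF f] in_Lq_integrable[OF g] by auto
      show "AE x in M. norm (\<bar>f x + g x\<bar> powr q) \<le> norm ((1/2) * (2 powr q * \<bar>f x\<bar> powr q) + (1/2) * (2 powr q * \<bar>g x\<bar> powr q))"
        using abs_add_powr_le[of q "1/2" "f _" "g _"] q by (auto intro!: AE_I2 simp: powr_mult mult.commute)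
    qed measurable
  qed measurable
qed

lemma in_Lq_diff: "in_Lq M q f \<Longrightarrow> in_Lq M q g \<Longrightarrow> q \<ge> 1 \<Longrightarrow> in_Lq M q (\<lambda>x. f x - g x)"
  using in_Lq_add[of M q f "\<lambda>x. (-1) * g x"] in_Lq_cmult[of M q g "-1"] by simp

lemma in_Lq_sum: "finite A \<Longrightarrow> (\<And>i. i \<in> A \<Longrightarrow> in_Lq M q (f i)) \<Longrightarrow> q \<ge> 1 \<Longrightarrow> in_Lq M q (\<lambda>x. \<Sum>i\<in>A. f i x)"
proof (induction A rule: finite_induct)
  case empty then show ?case by (simp add: in_Lq_def)
next
  case (insert a A) then show ?case using in_Lq_add[of M q "f a" "\<lambda>x. \<Sum>i\<in>A. f i x"] by simp
qed

lemma Minkowski: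
  assumes f: "in_Lq M q f" and g: "in_Lq M q g" and q: "q \<ge> 1"
  shows "Lq_norm M q (\<lambda>x. f x + g x) \<le> Lq_norm M q f + Lq_norm M q g"
proof -
  have [measurable]: "f \<in> borel_measurable M" "g \<in> borel_measurable M"
    using f g by (auto simp: in_Lq_def)
  define A where "A = Lq_norm M q f"
  define B where "B = Lq_norm M q g"
  show ?thesis
  proof (cases "A = 0 \<or> B = 0")
    case True
    have "AE x in M. f x = 0" if "A = 0" using Lq_norm_eq_0_AE[OF f] q that by (auto simp: A_def)
    moreover have "AE x in M. g x = 0" if "B = 0" using Lq_norm_eq_0_AE[OF g] q that by (auto simp: B_def)
    ultimately have "(AE x in M. \<bar>f x + g x\<bar> = \<bar>g x\<bar>) \<or> (AE x in M. \<bar>f x + g x\<bar> = \<bar>f x\<bar>)"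
    proof (cases "A = 0")
      case True
      with \<open>A = 0 \<Longrightarrow> AE x in M. f x = 0\<close> have "AE x in M. f x = 0" by blast
      then show ?thesis by (intro disjI1) (auto elim!: eventually_mono)
    next
      case False
      with True \<open>B = 0 \<Longrightarrow> AE x in M. g x = 0\<close> have "AE x in M. g x = 0" by blast
      then show ?thesis by (intro disjI2) (auto elim!: eventually_mono)
    qed
    then have "Lq_norm M q (\<lambda>x. f x + g x) = Lq_norm M q g \<or> Lq_norm M q (\<lambda>x. f x + g x) = Lq_norm M q f"
      using Lq_norm_cong_AE[of "\<lambda>x. f x + g x" M g q] Lq_norm_cong_AE[of "\<lambda>x. f x + g x" M f q] by auto
    then show ?thesis by (auto simp: add_increasing add_increasing2)
  next
    case False
    then have pos: "A > 0" "B > 0" by (auto simp: A_def B_def less_le)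
    \<comment> \<open>With this weight A/s and B/(1-s) are both A + B, so the convex combination
      collapses to (A + B)^q.\<close>
    define s where "s = A / (A + B)"
    have s: "0 < s" "s < 1" "1 - s = B / (A + B)" using pos by (auto simp: s_def field_simps)
    have Ap: "A powr q = (LINT x|M. \<bar>f x\<bar> powr q)" "B powr q = (LINT x|M. \<bar>g x\<bar> powr q)"
      using Lq_norm_powr[of q M f] Lq_norm_powr[of q M g] q by (auto simp: A_def B_def)
    have "(LINT x|M. \<bar>f x + g x\<bar> powr q) \<le> (LINT x|M. (s / s powr q) * \<bar>f x\<bar> powr q + ((1 - s) / (1 - s) powr q) * \<bar>g x\<bar> powr q)"
    proof (rule integral_mono)
      show "integrable M (\<lambda>x. \<bar>f x + g x\<bar> powr q)" using in_Lq_add[OF assms] by (simp add: in_Lq_def)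
      show "integrable M (\<lambda>x. (s / s powr q) * \<bar>f x\<bar> powr q + ((1 - s) / (1 - s) powr q) * \<bar>g x\<bar> powr q)"
        using in_Lq_integrable[OF f] in_Lq_integrable[OF g] by auto
      show "\<bar>f x + g x\<bar> powr q \<le> (s / s powr q) * \<bar>f x\<bar> powr q + ((1 - s) / (1 - s) powr q) * \<bar>g x\<bar> powr q" for x
        using abs_add_powr_le[of q s "f x" "g x"] s(1,2) q by (simp add: powr_divide)
    qed
    also have "\<dots> = (s / s powr q) * A powr q + ((1 - s) / (1 - s) powr q) * B powr q"
      using in_Lq_integrable[OF f] in_Lq_integrable[OF g] by (simp add: Ap)
    also have "\<dots> = s * (A / s) powr q + (1 - s) * (B / (1 - s)) powr q"
      using pos s by (simp add: powr_divide)
    also have "A / s = A + B" using pos by (simp add: s_def)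
    also have "B / (1 - s) = A + B" using pos s(3) by (simp del: )
    finally have "(LINT x|M. \<bar>f x + g x\<bar> powr q) \<le> (A + B) powr q" by (simp add: algebra_simps)
    then have "Lq_norm M q (\<lambda>x. f x + g x) \<le> ((A + B) powr q) powr (1 / q)"
      unfolding Lq_norm_def[of M q] using q by (intro powr_mono2) auto
    then show ?thesis using pos q by (simp add: powr_powr A_def B_def)
  qed
qed

lemma Lq_norm_diff_triangle:
  assumes "in_Lq M q f" "in_Lq M q g" "in_Lq M q h" "q \<ge> 1"
  shows "Lq_norm M q (\<lambda>x. f x - h x) \<le> Lq_norm M q (\<lambda>x. f x - g x) + Lq_norm M q (\<lambda>x. g x - h x)"
  using Minkowski[of M q "\<lambda>x. f x - g x" "\<lambda>x. g x - h x"] assms by (simp add: in_Lq_diff)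

lemma Lq_norm_le_add_diff:
  assumes "in_Lq M q f" "in_Lq M q g" "q \<ge> 1"
  shows "Lq_norm M q f \<le> Lq_norm M q g + Lq_norm M q (\<lambda>x. f x - g x)"
  using Minkowski[of M q g "\<lambda>x. f x - g x"] assms by (simp add: in_Lq_diff)

section \<open>Limits in \<open>L^q\<close>\<close>

lemma tendsto_Lq_norm:
  assumes "\<And>k. in_Lq M q (f k)" "in_Lq M q g" "q \<ge> 1" "(\<lambda>k. Lq_norm M q (\<lambda>x. f k x - g x)) \<longlonglongrightarrow> 0"
  shows "(\<lambda>k. Lq_norm M q (f k)) \<longlonglongrightarrow> Lq_norm M q g"
proof (rule LIM_zero_cancel, rule Lim_null_comparison[OF _ assms(4)], intro always_eventually allI)
  fix k
  show "norm (Lq_norm M q (f k) - Lq_norm M q g) \<le> Lq_norm M q (\<lambda>x. f k x - g x)"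
    using Lq_norm_le_add_diff[OF assms(1)[of k] assms(2,3)] Lq_norm_le_add_diff[OF assms(2) assms(1)[of k] assms(3)]
      Lq_norm_minus_commute[of M q "f k" g] by simp
qed

text \<open>The subsequence theorem for L^1, applied to the functions |f k - g|^q.\<close>

lemma Lq_norm_tendsto_AE_subseq:
  assumes f: "\<And>k. in_Lq M q (f k)" and g: "in_Lq M q g" and q: "q \<ge> 1" and lim: "(\<lambda>k. Lq_norm M q (\<lambda>x. f k x - g x)) \<longlonglongrightarrow> 0"
  shows "\<exists>r::nat\<Rightarrow>nat. strict_mono r \<and> (AE x in M. (\<lambda>k. f (r k) x) \<longlonglongrightarrow> g x)"
proof -
  have d: "in_Lq M q (\<lambda>x. f k x - g x)" for k using in_Lq_diff[OF f g q] .
  have "(\<lambda>k. Lq_norm M q (\<lambda>x. f k x - g x) powr q) \<longlonglongrightarrow> 0 powr q"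
    by (rule tendsto_powr2[OF lim tendsto_const]) (use q in auto)
  then have "(\<lambda>k. LINT x|M. norm (\<bar>f k x - g x\<bar> powr q)) \<longlonglongrightarrow> 0"
    using q by (simp add: Lq_norm_powr)
  from tendsto_L1_AE_subseq[OF in_Lq_integrable[OF d] this]
  obtain r :: "nat \<Rightarrow> nat" where r: "strict_mono r" and ae: "AE x in M. (\<lambda>k. \<bar>f (r k) x - g x\<bar> powr q) \<longlonglongrightarrow> 0"
    by blast
  from ae have "AE x in M. (\<lambda>k. f (r k) x) \<longlonglongrightarrow> g x"
  proof (rule eventually_mono)
    fix x assume "(\<lambda>k. \<bar>f (r k) x - g x\<bar> powr q) \<longlonglongrightarrow> 0"
    then have "(\<lambda>k. (\<bar>f (r k) x - g x\<bar> powr q) powr (1/q)) \<longlonglongrightarrow> 0 powr (1/q)"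
      by (intro tendsto_powr2 tendsto_const) (use q in auto)
    then have "(\<lambda>k. \<bar>f (r k) x - g x\<bar>) \<longlonglongrightarrow> 0" using q by (simp add: powr_powr)
    then show "(\<lambda>k. f (r k) x) \<longlonglongrightarrow> g x" by (simp add: LIM_zero_iff tendsto_rabs_zero_iff)
  qed
  with r show ?thesis by blast
qed

text \<open>Membership of the limit in L^q is a conclusion here. This is how the mollification error
  gets into the dual space, where nothing is known in advance about the limit.\<close>

lemma Fatou_Lq_norm:
  assumes f: "\<And>k. in_Lq M q (f k)" and g: "g \<in> borel_measurable M" and q: "q > 0"
    and lim: "AE x in M. (\<lambda>k. f k x) \<longlonglongrightarrow> g x" and bd: "\<And>k. Lq_norm M q (f k) \<le> C"
  shows "in_Lq M q g" "Lq_norm M q g \<le> C"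
proof -
  have [measurable]: "g \<in> borel_measurable M" "\<And>k. f k \<in> borel_measurable M" using g f by (auto simp: in_Lq_def)
  have C0: "0 \<le> C" using bd[of 0] Lq_norm_nonneg order_trans by blast
  have le: "(\<integral>\<^sup>+x. ennreal (\<bar>f k x\<bar> powr q) \<partial>M) \<le> ennreal (C powr q)" for k
  proof -
    have "(\<integral>\<^sup>+x. ennreal (\<bar>f k x\<bar> powr q) \<partial>M) = ennreal (Lq_norm M q (f k) powr q)"
      using in_Lq_integrable[OF f[of k]] q by (subst Lq_norm_powr) (auto intro!: nn_integral_eq_integral)
    then show ?thesis using bd[of k] q by (auto intro!: ennreal_leI powr_mono2)
  qed
  have "(\<integral>\<^sup>+x. ennreal (\<bar>g x\<bar> powr q) \<partial>M) = (\<integral>\<^sup>+x. liminf (\<lambda>k. ennreal (\<bar>f k x\<bar> powr q)) \<partial>M)"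
  proof (rule nn_integral_cong_AE, rule eventually_mono[OF lim])
    fix x assume "(\<lambda>k. f k x) \<longlonglongrightarrow> g x"
    then have "(\<lambda>k. ennreal (\<bar>f k x\<bar> powr q)) \<longlonglongrightarrow> ennreal (\<bar>g x\<bar> powr q)"
      by (intro tendsto_intros tendsto_powr2) (use q in auto)
    then show "ennreal (\<bar>g x\<bar> powr q) = liminf (\<lambda>k. ennreal (\<bar>f k x\<bar> powr q))"
      using lim_imp_Liminf[of sequentially] by fastforce
  qed
  also have "\<dots> \<le> liminf (\<lambda>k. \<integral>\<^sup>+x. ennreal (\<bar>f k x\<bar> powr q) \<partial>M)"
    by (rule nn_integral_liminf) measurable
  also have "\<dots> \<le> ennreal (C powr q)"
    using le by (intro Liminf_le) auto
  finally have *: "(\<integral>\<^sup>+x. ennreal (\<bar>g x\<bar> powr q) \<partial>M) \<le> ennreal (C powr q)" .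
  have int: "integrable M (\<lambda>x. \<bar>g x\<bar> powr q)"
    using * by (intro integrableI_bounded) (auto intro: le_less_trans)
  then show "in_Lq M q g" by (simp add: in_Lq_def)
  have "ennreal (LINT x|M. \<bar>g x\<bar> powr q) \<le> ennreal (C powr q)"
    using * nn_integral_eq_integral[OF int] by simp
  then have "(LINT x|M. \<bar>g x\<bar> powr q) \<le> C powr q" using C0 by (simp add: ennreal_le_iff)
  then have "Lq_norm M q g \<le> (C powr q) powr (1/q)" unfolding Lq_norm_def using q by (intro powr_mono2) auto
  then show "Lq_norm M q g \<le> C" using C0 q by (simp add: powr_powr)
qed

lemma in_Lq_indicator_set:
  assumes "A \<in> sets M" "emeasure M A < \<infinity>"
  shows "in_Lq M q (indicator A)" "Lq_norm M q (indicator A) = measure M A powr (1/q)"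
proof -
  have *: "(\<lambda>x. \<bar>indicator A x\<bar> powr q) = (indicator A :: _ \<Rightarrow> real)" by (auto simp: indicator_def)
  show "in_Lq M q (indicator A)" unfolding in_Lq_def * using assms by auto
  show "Lq_norm M q (indicator A) = measure M A powr (1/q)" using assms sets.sets_into_space[of A M]
    unfolding Lq_norm_def * by (simp add: Int_absorb2)
qed

section \<open>Partial derivatives and integration by slices\<close>

text \<open>The Borel product measure, without the completion in \<open>leb\<close>. The analysis
  takes place here; Lebesgue measurable functions are replaced by Borel versions at the end.\<close>

abbreviation LM :: "nat \<Rightarrow> point measure" where
  "LM n \<equiv> Pi\<^sub>M {..<n} (\<lambda>_. lborel)"

interpretation lb: product_sigma_finite "\<lambda>_::nat. lborel::real measure"
  by standard

lemma sigma_finite_LM: "sigma_finite_measure (LM n)"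
  by (rule lb.sigma_finite) simp

lemma space_LM [simp]: "space (LM n) = Rn n"
  by (simp add: space_PiM Rn_def)

lemma Rn_upd: "x \<in> Rn n \<Longrightarrow> i < n \<Longrightarrow> x(i := t) \<in> Rn n"
  by (auto simp: Rn_def PiE_def extensional_def)

lemma Rn_upd_Suc: "x \<in> Rn n \<Longrightarrow> x(n := t) \<in> Rn (Suc n)"
  by (auto simp: Rn_def PiE_def extensional_def)

lemma measurable_upd_LM: "x \<in> Rn n \<Longrightarrow> i < n \<Longrightarrow> (\<lambda>t. x(i := t)) \<in> lborel \<rightarrow>\<^sub>M LM n"
  by (rule measurable_fun_upd[where J="{..<n}"]) (auto simp: Rn_def measurable_const)

lemma measurable_upd_Suc_LM: "(\<lambda>x. x(n := t)) \<in> LM n \<rightarrow>\<^sub>M LM (Suc n)"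
  by (rule measurable_fun_upd[where J="{..<n}"]) auto

text \<open>The derivative is an explicit argument instead of \<open>partial_deriv i f\<close>, so
  that product and chain rules build the derivatives of composite functions along with the
  functions.\<close>

definition has_pderiv :: "nat \<Rightarrow> nat \<Rightarrow> (point \<Rightarrow> real) \<Rightarrow> (point \<Rightarrow> real) \<Rightarrow> bool" where
  "has_pderiv n i f g \<longleftrightarrow> (\<forall>x\<in>Rn n. ((\<lambda>t. f (x(i := t))) has_real_derivative g x) (at (x i)))"

lemma pdD:
  assumes "has_pderiv n i f g" "x \<in> Rn n" "i < n"
  shows "((\<lambda>t. f (x(i := t))) has_real_derivative g (x(i := t))) (at t)"
  using assms(1)[unfolded has_pderiv_def, rule_format, OF Rn_upd[OF assms(2,3), of t]] by simp

section \<open>Bounded measurable functions and functions of bounded support\<close>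

definition bdd_meas :: "nat \<Rightarrow> (point \<Rightarrow> real) \<Rightarrow> bool" where
  "bdd_meas n f \<longleftrightarrow> f \<in> borel_measurable (LM n) \<and> (\<exists>B. \<forall>x\<in>Rn n. \<bar>f x\<bar> \<le> B)"

text \<open>Coordinates are bounded rather than \<open>pnorm\<close>, because this passes to lines
  and hyperplane slices at once.\<close>

definition box_supp :: "nat \<Rightarrow> (point \<Rightarrow> real) \<Rightarrow> bool" where
  "box_supp n f \<longleftrightarrow> (\<exists>R. \<forall>x\<in>Rn n. f x \<noteq> 0 \<longrightarrow> (\<forall>i<n. \<bar>x i\<bar> \<le> R))"

definition bdd_supp :: "nat \<Rightarrow> (point \<Rightarrow> real) \<Rightarrow> bool" where
  "bdd_supp n f \<longleftrightarrow> bdd_meas n f \<and> box_supp n f"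

lemma bdd_meas_measurable [measurable_dest]: "bdd_meas n f \<Longrightarrow> f \<in> borel_measurable (LM n)"
  by (simp add: bdd_meas_def)

lemma bdd_supp_measurable [measurable_dest]: "bdd_supp n f \<Longrightarrow> f \<in> borel_measurable (LM n)"
  by (simp add: bdd_meas_def bdd_supp_def)

lemma bdd_supp_bdd_meas: "bdd_supp n f \<Longrightarrow> bdd_meas n f"
  by (simp add: bdd_supp_def)

lemma bndE:
  assumes "bdd_meas n f" obtains B where "B > 0" "\<And>x. x \<in> Rn n \<Longrightarrow> \<bar>f x\<bar> \<le> B"
proof -
  obtain B where B: "\<forall>x\<in>Rn n. \<bar>f x\<bar> \<le> B" using assms by (auto simp: bdd_meas_def)
  show thesis by (rule that[of "\<bar>B\<bar> + 1"]) (use B in force)+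
qed

lemma bsE:
  assumes "bdd_supp n f" obtains B R where "B > 0" "R > 0" "\<And>x. x \<in> Rn n \<Longrightarrow> \<bar>f x\<bar> \<le> B"
    "\<And>x i. x \<in> Rn n \<Longrightarrow> i < n \<Longrightarrow> \<bar>x i\<bar> > R \<Longrightarrow> f x = 0"
proof -
  obtain B where B: "B > 0" "\<And>x. x \<in> Rn n \<Longrightarrow> \<bar>f x\<bar> \<le> B"
    using assms bndE unfolding bdd_supp_def by metis
  obtain R where R: "\<And>x. x \<in> Rn n \<Longrightarrow> f x \<noteq> 0 \<Longrightarrow> (\<forall>i<n. \<bar>x i\<bar> \<le> R)"
    using assms by (auto simp: bdd_supp_def box_supp_def)
  show thesis by (rule that[of B "\<bar>R\<bar> + 1"]) (use B R in force)+
qed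

lemma bdd_meas_const [simp]: "bdd_meas n (\<lambda>_. c)"
  by (auto simp: bdd_meas_def)

lemma bdd_meas_add: "bdd_meas n f \<Longrightarrow> bdd_meas n g \<Longrightarrow> bdd_meas n (\<lambda>x. f x + g x)"
  unfolding bdd_meas_def
proof (safe, goal_cases)
  case (1 B C)
  then show ?case by (intro borel_measurable_add)
next
  case (2 B C)
  then show ?case by (intro exI[of _ "B + C"]) (auto intro: order_trans[OF abs_triangle_ineq add_mono])
qed

lemma bdd_meas_mult: "bdd_meas n f \<Longrightarrow> bdd_meas n g \<Longrightarrow> bdd_meas n (\<lambda>x. f x * g x)"
  unfolding bdd_meas_def
proof (safe, goal_cases)
  case (1 B C)
  then show ?case by (intro borel_measurable_times)
next
  case (2 B C)
  then show ?case by (intro exI[of _ "\<bar>B\<bar> * \<bar>C\<bar>"]) (auto simp: abs_mult intro!: mult_mono intro: order_trans)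
qed

lemma bdd_meas_cmult: "bdd_meas n f \<Longrightarrow> bdd_meas n (\<lambda>x. c * f x)"
  using bdd_meas_mult[of n "\<lambda>_. c" f] by simp

lemma bdd_meas_diff: "bdd_meas n f \<Longrightarrow> bdd_meas n g \<Longrightarrow> bdd_meas n (\<lambda>x. f x - g x)"
  using bdd_meas_add[of n f "\<lambda>x. (-1) * g x"] bdd_meas_cmult[of n g "-1"] by simp

lemma bdd_meas_sum: "(\<And>i. i \<in> A \<Longrightarrow> bdd_meas n (f i)) \<Longrightarrow> bdd_meas n (\<lambda>x. \<Sum>i\<in>A. f i x)"
  by (induction A rule: infinite_finite_induct) (auto simp: bdd_meas_add)

lemma bdd_meas_abs: "bdd_meas n f \<Longrightarrow> bdd_meas n (\<lambda>x. \<bar>f x\<bar>)"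
  unfolding bdd_meas_def by auto

lemma bdd_meas_power: "bdd_meas n f \<Longrightarrow> bdd_meas n (\<lambda>x. f x ^ k)"
  by (induction k) (auto simp: bdd_meas_mult)

lemma bdd_meas_powr: "bdd_meas n f \<Longrightarrow> q \<ge> 0 \<Longrightarrow> bdd_meas n (\<lambda>x. \<bar>f x\<bar> powr q)"
  unfolding bdd_meas_def
proof (safe, goal_cases)
  case (1 B)
  then show ?case by (intro measurable_abs_powr)
next
  case (2 B)
  then show ?case by (intro exI[of _ "\<bar>B\<bar> powr q"]) (auto intro!: powr_mono2 intro: order_trans[OF _ abs_ge_self])
qed

lemma bdd_supp_mult: "bdd_supp n f \<Longrightarrow> bdd_meas n g \<Longrightarrow> bdd_supp n (\<lambda>x. f x * g x)"
  unfolding bdd_supp_def by (auto simp: bdd_meas_mult box_supp_def)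

lemma bdd_supp_mult2: "bdd_meas n f \<Longrightarrow> bdd_supp n g \<Longrightarrow> bdd_supp n (\<lambda>x. f x * g x)"
  unfolding bdd_supp_def by (auto simp: bdd_meas_mult box_supp_def)

lemma bdd_supp_cmult: "bdd_supp n f \<Longrightarrow> bdd_supp n (\<lambda>x. c * f x)"
  by (rule bdd_supp_mult2) auto

lemma bdd_supp_add: "bdd_supp n f \<Longrightarrow> bdd_supp n g \<Longrightarrow> bdd_supp n (\<lambda>x. f x + g x)"
  unfolding bdd_supp_def
proof (safe intro!: bdd_meas_add)
  assume "box_supp n f" "box_supp n g"
  then obtain R S where "\<forall>x\<in>Rn n. f x \<noteq> 0 \<longrightarrow> (\<forall>i<n. \<bar>x i\<bar> \<le> R)" "\<forall>x\<in>Rn n. g x \<noteq> 0 \<longrightarrow> (\<forall>i<n. \<bar>x i\<bar> \<le> S)"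
    by (auto simp: box_supp_def)
  then show "box_supp n (\<lambda>x. f x + g x)"
    unfolding box_supp_def by (intro exI[of _ "max R S"]) (metis add_0 le_max_iff_disj)
qed

lemma bdd_supp_zero [simp]: "bdd_supp n (\<lambda>_. 0)"
  by (auto simp: bdd_supp_def box_supp_def)

lemma bdd_supp_sum: "(\<And>i. i \<in> A \<Longrightarrow> bdd_supp n (f i)) \<Longrightarrow> bdd_supp n (\<lambda>x. \<Sum>i\<in>A. f i x)"
  by (induction A rule: infinite_finite_induct) (auto simp: bdd_supp_add)

lemma bdd_supp_diff: "bdd_supp n f \<Longrightarrow> bdd_supp n g \<Longrightarrow> bdd_supp n (\<lambda>x. f x - g x)"
  using bdd_supp_add[of n f "\<lambda>x. (-1) * g x"] bdd_supp_cmult[of n g "-1"] by simp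

lemma bdd_supp_abs: "bdd_supp n f \<Longrightarrow> bdd_supp n (\<lambda>x. \<bar>f x\<bar>)"
  unfolding bdd_supp_def by (auto simp: bdd_meas_abs box_supp_def)

lemma bdd_supp_powr: "bdd_supp n f \<Longrightarrow> q \<ge> 0 \<Longrightarrow> bdd_supp n (\<lambda>x. \<bar>f x\<bar> powr q)"
  unfolding bdd_supp_def by (auto simp: bdd_meas_powr box_supp_def)

lemma bdd_supp_power: "bdd_supp n f \<Longrightarrow> k > 0 \<Longrightarrow> bdd_supp n (\<lambda>x. f x ^ k)"
  unfolding bdd_supp_def by (auto simp: bdd_meas_power box_supp_def)

definition cube :: "nat \<Rightarrow> real \<Rightarrow> point set" where
  "cube n R = ({..<n} \<rightarrow>\<^sub>E {-R..R})"

lemma cube_iff: "x \<in> Rn n \<Longrightarrow> x \<in> cube n R \<longleftrightarrow> (\<forall>i<n. \<bar>x i\<bar> \<le> R)"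
  by (auto simp: cube_def Rn_def PiE_iff abs_le_iff minus_le_iff)

lemma sets_cube [measurable]: "cube n R \<in> sets (LM n)"
  unfolding cube_def by (intro sets_PiM_I_finite) auto

lemma emeasure_cube: "emeasure (LM n) (cube n R) < \<infinity>"
proof -
  have "emeasure (LM n) (cube n R) = (\<Prod>i<n. emeasure lborel {-R..R})"
    unfolding cube_def by (rule lb.emeasure_PiM) auto
  also have "\<dots> < \<infinity>"
    by (auto simp: emeasure_lborel_Icc_eq less_top[symmetric] ennreal_prod_eq_top power_eq_top_ennreal)
  finally show ?thesis .
qed

lemma bdd_supp_integrable: assumes "bdd_supp n f" shows "integrable (LM n) f"
proof -
  obtain B R where BR: "B > 0" "R > 0" "\<And>x. x \<in> Rn n \<Longrightarrow> \<bar>f x\<bar> \<le> B"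
    "\<And>x i. x \<in> Rn n \<Longrightarrow> i < n \<Longrightarrow> \<bar>x i\<bar> > R \<Longrightarrow> f x = 0" using bsE[OF assms] by metis
  show ?thesis
  proof (rule Bochner_Integration.integrable_bound[of _ "\<lambda>x. B * indicator (cube n R) x"])
    show "integrable (LM n) (\<lambda>x. B * indicat_real (cube n R) x)"
      using emeasure_cube by (intro integrable_mult_right integrable_real_indicator) auto
    show "f \<in> borel_measurable (LM n)" using assms by measurable
    have "norm (f x) \<le> norm (B * indicat_real (cube n R) x)" if "x \<in> Rn n" for x
    proof (cases "x \<in> cube n R")
      case True then show ?thesis using BR(1,3) that by auto
    next
      case False
      from False have "\<not> (\<forall>i<n. \<bar>x i\<bar> \<le> R)" using that by (auto simp: cube_iff)
      then obtain i where "i < n" "\<not> (\<bar>x i\<bar> \<le> R)" by blast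
      then show ?thesis using BR(4)[OF that] by auto
    qed
    then show "AE x in LM n. norm (f x) \<le> norm (B * indicat_real (cube n R) x)" by auto
  qed
qed

lemma bdd_supp_in_Lq: "bdd_supp n f \<Longrightarrow> q \<ge> 0 \<Longrightarrow> in_Lq (LM n) q f"
  unfolding in_Lq_def using bdd_supp_integrable[OF bdd_supp_powr] by auto

lemma bdd_supp_slice:
  assumes "bdd_supp (Suc n) f" shows "bdd_supp n (\<lambda>x. f (x(n := t)))"
proof -
  obtain B R where BR: "B > 0" "R > 0" "\<And>x. x \<in> Rn (Suc n) \<Longrightarrow> \<bar>f x\<bar> \<le> B"
    "\<And>x i. x \<in> Rn (Suc n) \<Longrightarrow> i < Suc n \<Longrightarrow> \<bar>x i\<bar> > R \<Longrightarrow> f x = 0" using bsE[OF assms] by metis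
  show ?thesis unfolding bdd_supp_def bdd_meas_def box_supp_def
  proof (intro conjI exI ballI impI allI)
    show "(\<lambda>x. f (x(n := t))) \<in> borel_measurable (LM n)"
      by (rule measurable_compose[OF measurable_upd_Suc_LM bdd_supp_measurable[OF assms]])
    fix x assume x: "x \<in> Rn n"
    show "\<bar>f (x(n := t))\<bar> \<le> B" using BR Rn_upd_Suc[OF x] by auto
    fix i assume "i < n" "f (x(n := t)) \<noteq> 0" then show "\<bar>x i\<bar> \<le> R"
      using BR(4)[OF Rn_upd_Suc[OF x], of i t] by force
  qed
qed

lemma bdd_meas_slice:
  assumes "bdd_meas (Suc n) f" shows "bdd_meas n (\<lambda>x. f (x(n := t)))"
  using assms measurable_compose[OF measurable_upd_Suc_LM, of f n borel t] Rn_upd_Suc[of _ n t]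
  unfolding bdd_meas_def by blast

lemma has_pderiv_slice:
  assumes "has_pderiv (Suc n) i f g" "i < n" shows "has_pderiv n i (\<lambda>x. f (x(n := t))) (\<lambda>x. g (x(n := t)))"
  unfolding has_pderiv_def
proof
  fix x assume x: "x \<in> Rn n"
  show "((\<lambda>s. f (x(i := s, n := t))) has_real_derivative g (x(n := t))) (at (x i))"
    using assms(1)[unfolded has_pderiv_def, rule_format, OF Rn_upd_Suc[OF x, of t]] assms(2)
    by (simp add: fun_upd_twist)
qed

lemma bdd_supp_line:
  assumes "bdd_supp n f" "x \<in> Rn n" "i < n"
  shows "integrable lborel (\<lambda>t. f (x(i := t)))"
proof -
  obtain B R where BR: "B > 0" "R > 0" "\<And>x. x \<in> Rn n \<Longrightarrow> \<bar>f x\<bar> \<le> B"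
    "\<And>x i. x \<in> Rn n \<Longrightarrow> i < n \<Longrightarrow> \<bar>x i\<bar> > R \<Longrightarrow> f x = 0" using bsE[OF assms(1)] by metis
  show ?thesis
  proof (rule Bochner_Integration.integrable_bound[of _ "\<lambda>x. B * indicator {-R..R} x"])
    show "(\<lambda>t. f (x(i := t))) \<in> borel_measurable lborel"
      by (rule measurable_compose[OF measurable_upd_LM[OF assms(2,3)] bdd_supp_measurable[OF assms(1)]])
    show "integrable lborel (\<lambda>x. B * indicat_real {-R..R} x)"
      by (intro integrable_mult_right integrable_real_indicator) (auto simp: emeasure_lborel_Icc_eq)
    show "AE t in lborel. norm (f (x(i := t))) \<le> norm (B * indicat_real {- R..R} t)"
    proof (rule AE_I2)
      fix t show "norm (f (x(i := t))) \<le> norm (B * indicat_real {- R..R} t)"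
        using BR(1) BR(3)[OF Rn_upd[OF assms(2,3), of t]] BR(4)[OF Rn_upd[OF assms(2,3), of t] assms(3)]
        by (cases "\<bar>t\<bar> \<le> R") (auto simp: indicator_def)
    qed
  qed
qed

section \<open>Fubini's theorem and the fundamental theorem of calculus along coordinate
  lines\<close>

lemma lessThan_insert: "i < n \<Longrightarrow> insert i ({..<n} - {i}) = {..<n}"
  by auto

lemma integral_LM_line:
  assumes "bdd_supp n f" "i < n"
  shows "integral\<^sup>L (LM n) f = (\<integral>x. (\<integral>t. f (x(i := t)) \<partial>lborel) \<partial>Pi\<^sub>M ({..<n} - {i}) (\<lambda>_. lborel))"
proof -
  have "integral\<^sup>L (Pi\<^sub>M (insert i ({..<n} - {i})) (\<lambda>_. lborel)) f = (\<integral>x. (\<integral>t. f (x(i := t)) \<partial>lborel) \<partial>Pi\<^sub>M ({..<n} - {i}) (\<lambda>_. lborel))"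
    by (rule lb.product_integral_insert) (use bdd_supp_integrable[OF assms(1)] assms(2) in \<open>simp_all only: lessThan_insert finite_Diff finite_lessThan, auto\<close>)
  then show ?thesis unfolding lessThan_insert[OF assms(2)] .
qed

text \<open>Both orders of integration are needed: slices \<open>x n = t\<close> for the induction
  on the dimension, lines in direction \<open>n\<close> for bounding a slice by an integral of the
  derivative.\<close>

lemma integral_LM_slices:
  assumes "bdd_supp (Suc n) f"
  shows "integrable lborel (\<lambda>t. \<integral>x. f (x(n := t)) \<partial>LM n)"
    and "integral\<^sup>L (LM (Suc n)) f = (\<integral>t. (\<integral>x. f (x(n := t)) \<partial>LM n) \<partial>lborel)"
    and "integral\<^sup>L (LM (Suc n)) f = (\<integral>x. (\<integral>t. f (x(n := t)) \<partial>lborel) \<partial>LM n)"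
    and "integrable (LM n) (\<lambda>x. \<integral>t. f (x(n := t)) \<partial>lborel)"
proof -
  interpret A: sigma_finite_measure "LM n" by (rule sigma_finite_LM)
  interpret P: pair_sigma_finite "LM n" "lborel :: real measure" ..
  obtain B R where BR: "B > 0" "R > 0" "\<And>x. x \<in> Rn (Suc n) \<Longrightarrow> \<bar>f x\<bar> \<le> B"
    "\<And>x i. x \<in> Rn (Suc n) \<Longrightarrow> i < Suc n \<Longrightarrow> \<bar>x i\<bar> > R \<Longrightarrow> f x = 0" using bsE[OF assms] by metis
  have int: "integrable (LM n \<Otimes>\<^sub>M lborel) (\<lambda>(x, t). f (x(n := t)))"
  proof (rule Bochner_Integration.integrable_bound[of _ "\<lambda>x. B * indicator (cube n R \<times> {-R..R}) x"])
    have "emeasure (LM n \<Otimes>\<^sub>M lborel) (cube n R \<times> {-R..R}) = emeasure (LM n) (cube n R) * emeasure lborel {-R..R}"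
      by (rule lborel.emeasure_pair_measure_Times) auto
    also have "\<dots> < \<infinity>" using emeasure_cube[of n R] by (auto simp: ennreal_mult_less_top emeasure_lborel_Icc_eq)
    finally show "integrable (LM n \<Otimes>\<^sub>M lborel) (\<lambda>x. B * indicat_real (cube n R \<times> {-R..R}) x)"
      by (intro integrable_mult_right integrable_real_indicator) auto
    have "(\<lambda>(x, t). x(n := t)) \<in> LM n \<Otimes>\<^sub>M lborel \<rightarrow>\<^sub>M LM (Suc n)"
      using measurable_add_dim[of n "{..<n}" "\<lambda>_. lborel"] by (simp add: lessThan_Suc)
    from measurable_compose[OF this bdd_supp_measurable[OF assms]]
    show "(\<lambda>(x, t). f (x(n := t))) \<in> borel_measurable (LM n \<Otimes>\<^sub>M lborel)"
      by (simp add: case_prod_beta')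
    have "\<bar>f (x(n := t))\<bar> \<le> B * indicat_real (cube n R \<times> {-R..R}) (x, t)" if "x \<in> Rn n" for x t
    proof (cases "(x, t) \<in> cube n R \<times> {-R..R}")
      case True then show ?thesis using BR(3)[OF Rn_upd_Suc[OF that, of t]] by auto
    next
      case False
      have "f (x(n := t)) = 0"
      proof (cases "t \<in> {-R..R}")
        case True
        with False have "\<not> (\<forall>i<n. \<bar>x i\<bar> \<le> R)" using that by (auto simp: cube_iff)
      then obtain i where "i < n" "\<not> (\<bar>x i\<bar> \<le> R)" by blast
        then show ?thesis using BR(4)[OF Rn_upd_Suc[OF that, of t], of i] by auto
      next
        case False then show ?thesis using BR(4)[OF Rn_upd_Suc[OF that, of t], of n] by (auto simp: abs_if split: if_splits)
      qed
      then show ?thesis using BR(1) by simp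
    qed
    then show "AE x in LM n \<Otimes>\<^sub>M lborel. norm (case x of (x, t) \<Rightarrow> f (x(n := t))) \<le> norm (B * indicat_real (cube n R \<times> {- R..R}) x)"
      using BR(1) by (auto simp: space_pair_measure intro!: AE_I2)
  qed
  show "integrable lborel (\<lambda>t. \<integral>x. f (x(n := t)) \<partial>LM n)"
    using P.integrable_snd[OF int] by simp
  show "integrable (LM n) (\<lambda>x. \<integral>t. f (x(n := t)) \<partial>lborel)"
    using P.integrable_fst'[OF int] by simp
  have "integral\<^sup>L (Pi\<^sub>M (insert n {..<n}) (\<lambda>_. lborel)) f = (\<integral>x. (\<integral>t. f (x(n := t)) \<partial>lborel) \<partial>LM n)"
    by (rule lb.product_integral_insert) (use bdd_supp_integrable[OF assms(1)] in \<open>auto simp: lessThan_Suc\<close>)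
  then show 1: "integral\<^sup>L (LM (Suc n)) f = (\<integral>x. (\<integral>t. f (x(n := t)) \<partial>lborel) \<partial>LM n)"
    by (simp add: lessThan_Suc)
  show "integral\<^sup>L (LM (Suc n)) f = (\<integral>t. (\<integral>x. f (x(n := t)) \<partial>LM n) \<partial>lborel)"
    unfolding 1 by (rule P.Fubini_integral[OF int, symmetric])
qed

text \<open>The factor 2 comes from representing \<open>F t\<close> both from the left and from the
  right: each representation uses only one part of the integral of |F'|. It helps to keep the
  Sobolev constant small.\<close>

lemma line_FTC:
  fixes F F' :: "real \<Rightarrow> real"
  assumes d: "\<And>t. (F has_real_derivative F' t) (at t)" and z: "\<And>t. \<bar>t\<bar> > R \<Longrightarrow> F t = 0"
    and i: "integrable lborel F'"
  shows "(\<integral>t. F' t \<partial>lborel) = 0" and "2 * \<bar>F t\<bar> \<le> (\<integral>t. \<bar>F' t\<bar> \<partial>lborel)"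
proof -
  have z': "F' t = 0" if "\<bar>t\<bar> > R" for t
  proof -
    have op: "open {t::real. \<bar>t\<bar> > R}" by (intro open_Collect_less continuous_intros)
    have "((\<lambda>_. 0) has_real_derivative F' t) (at t)"
      by (rule DERIV_cong_ev[THEN iffD1, OF refl _ refl d[of t]])
         (use eventually_nhds_in_open[OF op, of t] that z in \<open>auto elim!: eventually_mono\<close>)
    then show ?thesis using DERIV_unique[OF _ DERIV_const[of 0]] by blast
  qed
  have ftc: "(\<integral>t. indicator {a..b} t * F' t \<partial>lborel) = F b - F a" if "a \<le> b" for a b
  proof -
    have "(F' has_integral (F b - F a)) {a..b}"
      by (rule fundamental_theorem_of_calculus[OF that])
         (use d in \<open>auto simp: has_real_derivative_iff_has_vector_derivative[symmetric] intro: has_field_derivative_at_within\<close>)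
    moreover have "set_integrable lborel {a..b} F'"
      unfolding set_integrable_def using integrable_mult_indicator[OF _ i, of "{a..b}"] by auto
    ultimately show ?thesis
      using set_borel_integral_eq_integral(2)[of "{a..b}" F'] by (auto simp: set_lebesgue_integral_def integral_unique)
  qed
  define S where "S = \<bar>R\<bar> + 1"
  have S: "S > R" "S > 0" "F S = 0" "F (-S) = 0" using z[of S] z[of "-S"] by (auto simp: S_def)
  have "(\<integral>t. F' t \<partial>lborel) = (\<integral>t. indicator {-S..S} t * F' t \<partial>lborel)"
  proof (intro Bochner_Integration.integral_cong refl)
    fix t show "F' t = indicator {-S..S} t * F' t" using z'[of t] S by (cases "\<bar>t\<bar> > R") (auto simp: indicator_def)
  qed
  then show "(\<integral>t. F' t \<partial>lborel) = 0" using ftc[of "-S" S] S by simp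
  have ia: "integrable lborel (\<lambda>t. indicator A t * \<bar>F' t\<bar>)" if "A \<in> sets borel" for A
    using integrable_mult_indicator[of A lborel "\<lambda>t. \<bar>F' t\<bar>"] i that by auto
  have abs: "\<bar>\<integral>t. indicator A t * F' t \<partial>lborel\<bar> \<le> (\<integral>t. indicator A t * \<bar>F' t\<bar> \<partial>lborel)" for A
    using integral_abs_bound[of lborel "\<lambda>t. indicator A t * F' t"] by (simp add: abs_mult)
  show "2 * \<bar>F t\<bar> \<le> (\<integral>t. \<bar>F' t\<bar> \<partial>lborel)"
  proof (cases "\<bar>t\<bar> \<le> S")
    case True
    have "F t = (\<integral>s. indicator {-S..t} s * F' s \<partial>lborel)" using ftc[of "-S" t] True S by simp
    \<comment> \<open>Removing the point \<open>t\<close> makes the two intervals disjoint, so that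
      their indicators add up to at most 1.\<close>
    also have "\<dots> = (\<integral>s. indicator {-S..<t} s * F' s \<partial>lborel)"
      using AE_lborel_singleton[of t] i by (intro integral_cong_AE) (auto elim!: eventually_mono simp: indicator_def)
    finally have 1: "\<bar>F t\<bar> \<le> (\<integral>s. indicator {-S..<t} s * \<bar>F' s\<bar> \<partial>lborel)" using abs by metis
    have "- F t = (\<integral>s. indicator {t..S} s * F' s \<partial>lborel)" using ftc[of t S] True S by simp
    then have 2: "\<bar>F t\<bar> \<le> (\<integral>s. indicator {t..S} s * \<bar>F' s\<bar> \<partial>lborel)" using abs abs_minus_cancel by metis
    have "2 * \<bar>F t\<bar> \<le> (\<integral>s. indicator {-S..<t} s * \<bar>F' s\<bar> + indicator {t..S} s * \<bar>F' s\<bar> \<partial>lborel)"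
      using 1 2 ia by (subst Bochner_Integration.integral_add) auto
    also have "\<dots> \<le> (\<integral>t. \<bar>F' t\<bar> \<partial>lborel)"
      using ia[of "{-S..<t}"] ia[of "{t..S}"] i
      by (intro integral_mono Bochner_Integration.integrable_add integrable_abs) (auto simp: indicator_def)
    finally show ?thesis .
  qed (use z S in auto)
qed

text \<open>A function that vanishes near a point along a line has derivative 0 there. In direction
  \<open>j = i\<close> the openness of |t| > R is used; in the other directions the whole line
  misses the support.\<close>

lemma has_pderiv_box_supp:
  assumes "has_pderiv n i f g" "i < n" "box_supp n f" shows "box_supp n g"
proof -
  obtain R where R: "\<And>x. x \<in> Rn n \<Longrightarrow> f x \<noteq> 0 \<Longrightarrow> (\<forall>i<n. \<bar>x i\<bar> \<le> R)"
    using assms(3) by (auto simp: box_supp_def)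
  have "g x = 0" if x: "x \<in> Rn n" and j: "j < n" "\<bar>x j\<bar> > R" for x j
  proof -
    have op: "open {t::real. \<bar>t\<bar> > R}" by (intro open_Collect_less continuous_intros)
    have d: "((\<lambda>t. f (x(i := t))) has_real_derivative g x) (at (x i))"
      using assms(1) x by (auto simp: has_pderiv_def)
    have "eventually (\<lambda>t. f (x(i := t)) = 0) (nhds (x i))"
    proof (cases "j = i")
      case True
      show ?thesis using eventually_nhds_in_open[OF op, of "x i"] j True
        by (auto elim!: eventually_mono) (metis R Rn_upd fun_upd_same not_le x)
    next
      case False
      then have "f (x(i := t)) = 0" for t using R[OF Rn_upd[OF x assms(2)], of t] j by force
      then show ?thesis by simp
    qed
    from DERIV_cong_ev[THEN iffD1, OF refl this refl d]
    have "((\<lambda>_. 0) has_real_derivative g x) (at (x i))" .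
    then show ?thesis using DERIV_unique[OF _ DERIV_const[of 0]] by blast
  qed
  then show ?thesis unfolding box_supp_def by (intro exI[of _ R]) force
qed

lemma has_pderiv_bdd_supp: "has_pderiv n i f g \<Longrightarrow> i < n \<Longrightarrow> bdd_supp n f \<Longrightarrow> bdd_meas n g \<Longrightarrow> bdd_supp n g"
  using has_pderiv_box_supp by (auto simp: bdd_supp_def)

text \<open>The weak derivatives of differentiable functions and the energy identity both come from
  this statement, applied to a product.\<close>

lemma integral_has_pderiv_eq_0:
  assumes "has_pderiv n i f g" "i < n" "bdd_supp n f" "bdd_meas n g"
  shows "integral\<^sup>L (LM n) g = 0"
proof -
  have g: "bdd_supp n g" using assms has_pderiv_bdd_supp by blast
  obtain B R where BR: "B > 0" "R > 0" "\<And>x. x \<in> Rn n \<Longrightarrow> \<bar>f x\<bar> \<le> B"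
    "\<And>x i. x \<in> Rn n \<Longrightarrow> i < n \<Longrightarrow> \<bar>x i\<bar> > R \<Longrightarrow> f x = 0" using bsE[OF assms(3)] by metis
  have "(\<integral>t. g (x(i := t)) \<partial>lborel) = 0" if "x \<in> space (Pi\<^sub>M ({..<n} - {i}) (\<lambda>_. lborel))" for x
  proof -
    \<comment> \<open>A point of the product over the remaining coordinates is
      \<open>undefined\<close> at \<open>i\<close>; any real value there gives a point of
      \<open>Rn n\<close> on the same line.\<close>
    have "x(i := 0) \<in> Rn n" using that assms(2) by (auto simp: space_PiM Rn_def PiE_def extensional_def)
    note x = this
    show ?thesis
      using pdD[OF assms(1) x assms(2)] BR(4)[OF Rn_upd[OF x assms(2)] assms(2)] bdd_supp_line[OF g x assms(2)]
      by (intro line_FTC(1)[where F="\<lambda>t. f (x(i := t))" and F'="\<lambda>t. g (x(i := t))" and R=R]) auto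
  qed
  then show ?thesis unfolding integral_LM_line[OF g assms(2)]
    by (simp cong: Bochner_Integration.integral_cong)
qed

lemma has_pderiv_line_bound:
  assumes "has_pderiv n i f g" "i < n" "bdd_supp n f" "bdd_meas n g" "x \<in> Rn n"
  shows "2 * \<bar>f x\<bar> \<le> (\<integral>t. \<bar>g (x(i := t))\<bar> \<partial>lborel)"
proof -
  have g: "bdd_supp n g" using assms has_pderiv_bdd_supp by blast
  obtain B R where BR: "B > 0" "R > 0" "\<And>x. x \<in> Rn n \<Longrightarrow> \<bar>f x\<bar> \<le> B"
    "\<And>x i. x \<in> Rn n \<Longrightarrow> i < n \<Longrightarrow> \<bar>x i\<bar> > R \<Longrightarrow> f x = 0" using bsE[OF assms(3)] by metis
  have "2 * \<bar>f (x(i := x i))\<bar> \<le> (\<integral>t. \<bar>g (x(i := t))\<bar> \<partial>lborel)"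
    using pdD[OF assms(1,5,2)] BR(4)[OF Rn_upd[OF assms(5,2)] assms(2)] bdd_supp_line[OF g assms(5,2)]
    by (intro line_FTC(2)[where F="\<lambda>t. f (x(i := t))" and F'="\<lambda>t. g (x(i := t))" and R=R]) auto
  then show ?thesis by simp
qed

section \<open>The Sobolev inequality with a dimension-free constant\<close>

lemma integral_LM_0: "(\<integral>x. f x \<partial>Pi\<^sub>M {} M) = (f (\<lambda>_. undefined) :: real)"
  by (simp add: PiM_empty lebesgue_integral_count_space_finite)

lemma Rn_0: "Rn 0 = {\<lambda>_. undefined}"
  by (simp add: Rn_def)

definition pt2 :: "real \<Rightarrow> real \<Rightarrow> point" where
  "pt2 s t = (\<lambda>_. undefined)(0 := s, Suc 0 := t)"

lemma pt2_upd [simp]: "(pt2 s t)(0 := a) = pt2 a t" "(pt2 s t)(Suc 0 := a) = pt2 s a"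
  "pt2 s t 0 = s" "pt2 s t (Suc 0) = t"
  by (auto simp: pt2_def fun_upd_twist)

lemma pt2_Rn: "pt2 s t \<in> Rn (Suc (Suc 0))"
  unfolding pt2_def by (intro Rn_upd_Suc) (simp add: Rn_0)

text \<open>The slices are first integrated over \<open>LM (Suc 0)\<close>. Identifying this
  one-factor product with the image of \<open>lborel\<close> turns both iterated integrals into
  integrals over the real line.\<close>

lemma integral_LM_2:
  assumes "bdd_supp (Suc (Suc 0)) f"
  shows "integrable lborel (\<lambda>t. \<integral>s. f (pt2 s t) \<partial>lborel)"
    "integral\<^sup>L (LM (Suc (Suc 0))) f = (\<integral>t. (\<integral>s. f (pt2 s t) \<partial>lborel) \<partial>lborel)"
    "integrable lborel (\<lambda>s. \<integral>t. f (pt2 s t) \<partial>lborel)"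
    "integral\<^sup>L (LM (Suc (Suc 0))) f = (\<integral>s. (\<integral>t. f (pt2 s t) \<partial>lborel) \<partial>lborel)"
proof -
  have 1: "(\<integral>x. f (x(Suc 0 := t)) \<partial>LM (Suc 0)) = (\<integral>s. f (pt2 s t) \<partial>lborel)" for t
    using integral_LM_slices(2)[OF bdd_supp_slice[OF assms, of t]] by (simp add: integral_LM_0 pt2_def)
  show "integrable lborel (\<lambda>t. \<integral>s. f (pt2 s t) \<partial>lborel)"
    using integral_LM_slices(1)[OF assms] by (simp add: 1)
  show "integral\<^sup>L (LM (Suc (Suc 0))) f = (\<integral>t. (\<integral>s. f (pt2 s t) \<partial>lborel) \<partial>lborel)"
    using integral_LM_slices(2)[OF assms] by (simp add: 1)
  interpret P: pair_sigma_finite "lborel :: real measure" "lborel :: real measure" ..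
  have int: "integrable (LM (Suc 0)) (\<lambda>x. \<integral>t. f (x(Suc 0 := t)) \<partial>lborel)"
    by (rule integral_LM_slices(4)[OF assms])
  let ?M = "Pi\<^sub>M {0} (\<lambda>_::nat. lborel :: real measure)"
  have LM1: "LM (Suc 0) = ?M" by (simp add: lessThan_Suc)
  let ?e = "\<lambda>s. (\<lambda>_. undefined)(0 := s) :: point"
  have me: "?e \<in> lborel \<rightarrow>\<^sub>M LM (Suc 0)"
    unfolding LM1 by (rule measurable_fun_upd[where J="{}"]) (auto simp: space_PiM)
  have d: "distr lborel (LM (Suc 0)) ?e = LM (Suc 0)"
  proof -
    have "LM (Suc 0) = distr lborel (LM (Suc 0)) ?e"
    proof (subst LM1, rule measure_eqI_PiM_finite[OF finite.insertI[OF finite.emptyI]])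
      show "sets ?M = sets ?M" ..
      show "sets (distr lborel (LM (Suc 0)) ?e) = sets ?M" by (simp add: LM1)
      fix A :: "nat \<Rightarrow> real set" assume A: "\<And>i. i \<in> {0} \<Longrightarrow> A i \<in> sets lborel"
      have "emeasure (distr lborel (LM (Suc 0)) ?e) (Pi\<^sub>E {0} A) = emeasure lborel (?e -` (Pi\<^sub>E {0} A) \<inter> space lborel)"
        using A by (intro emeasure_distr[OF me]) (auto simp: LM1 intro!: sets_PiM_I_finite)
      also have "?e -` (Pi\<^sub>E {0} A) \<inter> space lborel = A 0" by (simp add: vimage_def PiE_def Pi_def extensional_def)
      finally have *: "emeasure (distr lborel (LM (Suc 0)) ?e) (Pi\<^sub>E {0} A) = emeasure lborel (A 0)" .
      show "emeasure ?M (Pi\<^sub>E {0} A) = emeasure (distr lborel (LM (Suc 0)) ?e) (Pi\<^sub>E {0} A)"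
        unfolding * using A by (subst lb.emeasure_PiM) auto
    next
      show "range (\<lambda>i::nat. Pi\<^sub>E {0} (\<lambda>_. {- real i..real i})) \<subseteq> prod_algebra {0} (\<lambda>_::nat. lborel::real measure)"
        by (auto intro!: prod_algebraI_finite)
      show "(\<Union>i::nat. Pi\<^sub>E {0} (\<lambda>_. {- real i..real i})) = space ?M"
      proof -
        have "\<exists>i::nat. - real i \<le> x \<and> x \<le> real i" for x :: real
          using real_arch_simple[of "\<bar>x\<bar>"] by (auto simp: abs_le_iff minus_le_iff)
        then show ?thesis by (auto simp: space_PiM PiE_iff)
      qed
      show "emeasure ?M (Pi\<^sub>E {0} (\<lambda>_. {- real i..real i})) \<noteq> \<infinity>" for i :: nat
        by (subst lb.emeasure_PiM) (auto simp: emeasure_lborel_Icc_eq)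
    qed
    then show ?thesis by simp
  qed
  have 2: "integrable lborel (\<lambda>s. g (?e s))" if "integrable (LM (Suc 0)) g" for g :: "point \<Rightarrow> real"
    using integrable_distr[OF me, of g] that by (simp add: d)
  show "integrable lborel (\<lambda>s. \<integral>t. f (pt2 s t) \<partial>lborel)"
    using 2[OF int] by (simp add: pt2_def)
  have "(\<integral>x. (\<integral>t. f (x(Suc 0 := t)) \<partial>lborel) \<partial>LM (Suc 0)) = (\<integral>s. (\<integral>t. f ((?e s)(Suc 0 := t)) \<partial>lborel) \<partial>lborel)"
    using integral_distr[OF me, of "\<lambda>x. \<integral>t. f (x(Suc 0 := t)) \<partial>lborel"] int by (simp add: d borel_measurable_integrable)
  then show "integral\<^sup>L (LM (Suc (Suc 0))) f = (\<integral>s. (\<integral>t. f (pt2 s t) \<partial>lborel) \<partial>lborel)"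
    using integral_LM_slices(3)[OF assms] by (simp add: pt2_def)
qed

text \<open>Each of the two line integrals bounds 2|g|; one depends on \<open>t\<close> only, the
  other on \<open>s\<close> only. The product of the bounds therefore integrates to a product, and
  1/4 is (1/2)^2.\<close>

lemma planar_Sobolev:
  assumes g: "bdd_supp 2 g" and G: "bdd_meas 2 G0" "bdd_meas 2 G1" and has_pderiv: "has_pderiv 2 0 g G0" "has_pderiv 2 1 g G1"
  shows "(\<integral>x. (g x)\<^sup>2 \<partial>LM 2) \<le> 1/4 * (\<integral>x. \<bar>G0 x\<bar> \<partial>LM 2) * (\<integral>x. \<bar>G1 x\<bar> \<partial>LM 2)"
proof -
  have 2: "(2::nat) = Suc (Suc 0)" by simp
  note g = g[unfolded 2] note G = G[unfolded 2] note has_pderiv = has_pderiv[unfolded 2 One_nat_def]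
  have G': "bdd_supp (Suc (Suc 0)) G0" "bdd_supp (Suc (Suc 0)) G1"
    using has_pderiv_bdd_supp[OF has_pderiv(1) _ g G(1)] has_pderiv_bdd_supp[OF has_pderiv(2) _ g G(2)] by auto
  define a where "a t = (\<integral>s. \<bar>G0 (pt2 s t)\<bar> \<partial>lborel)" for t
  define b where "b s = (\<integral>t. \<bar>G1 (pt2 s t)\<bar> \<partial>lborel)" for s
  have ga: "2 * \<bar>g (pt2 s t)\<bar> \<le> a t" for s t
    using has_pderiv_line_bound[OF has_pderiv(1) _ g G(1) pt2_Rn, of s t] by (simp add: a_def)
  have gb: "2 * \<bar>g (pt2 s t)\<bar> \<le> b s" for s t
    using has_pderiv_line_bound[OF has_pderiv(2) _ g G(2) pt2_Rn, of s t] by (simp add: b_def)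
  have a0: "a t \<ge> 0" for t by (simp add: a_def)
  have b0: "b t \<ge> 0" for t by (simp add: b_def)
  have ia: "integrable lborel a" "(\<integral>x. \<bar>G0 x\<bar> \<partial>LM 2) = (\<integral>t. a t \<partial>lborel)"
    using integral_LM_2(1,2)[OF bdd_supp_abs[OF G'(1)]] unfolding 2 a_def by auto
  have ib: "integrable lborel b" "(\<integral>x. \<bar>G1 x\<bar> \<partial>LM 2) = (\<integral>t. b t \<partial>lborel)"
    using integral_LM_2(3,4)[OF bdd_supp_abs[OF G'(2)]] unfolding 2 b_def by auto
  have g2: "bdd_supp (Suc (Suc 0)) (\<lambda>x. (g x)\<^sup>2)" using g by (rule bdd_supp_power) simp
  have sq: "(g (pt2 s t))\<^sup>2 \<le> 1/4 * a t * b s" for s t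
  proof -
    have "(2 * \<bar>g (pt2 s t)\<bar>) * (2 * \<bar>g (pt2 s t)\<bar>) \<le> a t * b s"
      using ga gb a0 b0 by (intro mult_mono) auto
    then show ?thesis by (simp add: power2_eq_square abs_mult[symmetric])
  qed
  have "(\<integral>x. (g x)\<^sup>2 \<partial>LM 2) = (\<integral>t. (\<integral>s. (g (pt2 s t))\<^sup>2 \<partial>lborel) \<partial>lborel)"
    using integral_LM_2(2)[OF g2] by (simp only: 2[symmetric])
  also have "\<dots> \<le> (\<integral>t. (\<integral>s. 1/4 * a t * b s \<partial>lborel) \<partial>lborel)"
  proof (rule integral_mono[OF integral_LM_2(1)[OF g2]])
    show "integrable lborel (\<lambda>t. \<integral>s. 1/4 * a t * b s \<partial>lborel)" using ia by simp
    fix t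
    have "integrable lborel (\<lambda>s. (g ((pt2 0 t)(0 := s)))\<^sup>2)"
      using bdd_supp_line[OF g2 pt2_Rn, of 0 0 t] by simp
    then show "(\<integral>s. (g (pt2 s t))\<^sup>2 \<partial>lborel) \<le> (\<integral>s. 1/4 * a t * b s \<partial>lborel)"
      using sq ib by (intro integral_mono) auto
  qed
  also have "\<dots> = 1/4 * (\<integral>t. a t \<partial>lborel) * (\<integral>t. b t \<partial>lborel)" by simp
  finally show ?thesis using ia ib by simp
qed

section \<open>Powers of functions and bounds that are uniform over slices\<close>

lemma has_pderiv_power:
  assumes "has_pderiv n i f D" shows "has_pderiv n i (\<lambda>x. f x ^ k) (\<lambda>x. real k * f x ^ (k - 1) * D x)"
  unfolding has_pderiv_def
proof
  fix x assume "x \<in> Rn n"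
  then have "((\<lambda>t. f (x(i := t))) has_real_derivative D x) (at (x i))" using assms by (auto simp: has_pderiv_def)
  from DERIV_power[OF this, of k] show "((\<lambda>t. f (x(i := t)) ^ k) has_real_derivative real k * f x ^ (k - 1) * D x) (at (x i))"
    by (simp add: mult_ac)
qed

text \<open>At 0 the difference quotient is at most |h|^(q-1) in absolute value, which tends to 0
  because q > 1.\<close>

lemma DERIV_abs_powr:
  fixes q :: real
  assumes "q > 1" shows "((\<lambda>y. \<bar>y\<bar> powr q) has_real_derivative q * \<bar>y\<bar> powr (q - 1) * sgn y) (at y)"
proof (cases "y = 0")
  case False
  have "(abs has_real_derivative sgn y) (at y)"
  proof (cases "y > 0")
    case True
    have "((\<lambda>y. y) has_real_derivative sgn y) (at y)" using True by simp
    then show ?thesis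
      by (rule DERIV_cong_ev[THEN iffD1, OF refl _ refl, rotated])
         (use eventually_nhds_in_open[of "{0<..}" y] True in \<open>auto elim!: eventually_mono\<close>)
  next
    case F: False
    have "((\<lambda>y. - y) has_real_derivative sgn y) (at y)" using F False by (auto intro!: derivative_eq_intros)
    then show ?thesis
      by (rule DERIV_cong_ev[THEN iffD1, OF refl _ refl, rotated])
         (use eventually_nhds_in_open[of "{..<0}" y] F False in \<open>auto elim!: eventually_mono\<close>)
  qed
  from DERIV_chain2[OF has_real_derivative_powr this, of q]
  have "((\<lambda>y. \<bar>y\<bar> powr q) has_real_derivative (q * \<bar>y\<bar> powr (q - 1)) * sgn y) (at y)"
    using False by simp
  then show ?thesis by simp
next
  case True
  have "((\<lambda>h. \<bar>h\<bar> powr (q - 1)) \<longlongrightarrow> 0) (at (0::real))"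
  proof -
    have "((\<lambda>h::real. \<bar>h\<bar> powr (q - 1)) \<longlongrightarrow> 0 powr (q - 1)) (at 0)"
      by (rule tendsto_powr2) (use assms in \<open>auto intro!: tendsto_eq_intros simp: \<close>)
    then show ?thesis by simp
  qed
  then have "((\<lambda>h. (\<bar>0 + h\<bar> powr q - \<bar>0\<bar> powr q) / h) \<longlongrightarrow> 0) (at (0::real))"
  proof (rule Lim_null_comparison[rotated], intro always_eventually allI)
    fix h :: real
    show "norm ((\<bar>0 + h\<bar> powr q - \<bar>0\<bar> powr q) / h) \<le> \<bar>h\<bar> powr (q - 1)"
      by (cases "h = 0") (auto simp: powr_diff)
  qed
  then show ?thesis using True by (simp add: DERIV_def)
qed

lemma has_pderiv_abs_powr:
  fixes q :: real
  assumes "has_pderiv n i f D" "q > 1"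
  shows "has_pderiv n i (\<lambda>x. \<bar>f x\<bar> powr q) (\<lambda>x. q * \<bar>f x\<bar> powr (q - 1) * sgn (f x) * D x)"
  unfolding has_pderiv_def
proof
  fix x assume "x \<in> Rn n"
  then have "((\<lambda>t. f (x(i := t))) has_real_derivative D x) (at (x i))" using assms by (auto simp: has_pderiv_def)
  from DERIV_chain2[OF _ this, of "\<lambda>y. \<bar>y\<bar> powr q", OF DERIV_abs_powr[OF assms(2)]]
  show "((\<lambda>t. \<bar>f (x(i := t))\<bar> powr q) has_real_derivative q * \<bar>f x\<bar> powr (q - 1) * sgn (f x) * D x) (at (x i))"
    by simp
qed

lemma bdd_meas_sgn: "bdd_meas n f \<Longrightarrow> bdd_meas n (\<lambda>x. sgn (f x))"
  unfolding bdd_meas_def by (auto simp: sgn_if intro!: exI[of _ 1])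

lemma Cauchy_Schwarz_bdd_supp:
  assumes "bdd_supp n f" "bdd_supp n g"
  shows "(\<integral>x. \<bar>f x * g x\<bar> \<partial>LM n) \<le> sqrt (\<integral>x. (f x)\<^sup>2 \<partial>LM n) * sqrt (\<integral>x. (g x)\<^sup>2 \<partial>LM n)"
proof -
  have "(\<integral>x. \<bar>f x * g x\<bar> \<partial>LM n) \<le> Lq_norm (LM n) 2 f * Lq_norm (LM n) 2 g"
    using assms by (intro Holder_inequality bdd_supp_in_Lq) auto
  then show ?thesis by (simp add: Lq_norm_def powr_half_sqrt)
qed

text \<open>The line bound is applied to |f|^q in direction \<open>n\<close>, so its right side no
  longer depends on \<open>t\<close>; Cauchy-Schwarz then separates |f|^(q-1) from the
  derivative.\<close>

lemma slice_sup_bound: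
  fixes q :: real
  assumes f: "bdd_supp (Suc n) f" and D: "bdd_meas (Suc n) D" and has_pderiv: "has_pderiv (Suc n) n f D" and q: "q > 1"
  shows "(\<integral>x. \<bar>f (x(n := t))\<bar> powr q \<partial>LM n) \<le>
    q / 2 * (sqrt (\<integral>x. \<bar>f x\<bar> powr (2 * (q - 1)) \<partial>LM (Suc n)) * sqrt (\<integral>x. (D x)\<^sup>2 \<partial>LM (Suc n)))"
proof -
  let ?F = "\<lambda>x. \<bar>f x\<bar> powr q"
  let ?G = "\<lambda>x. q * \<bar>f x\<bar> powr (q - 1) * sgn (f x) * D x"
  have bF: "bdd_supp (Suc n) ?F" using f q by (intro bdd_supp_powr) auto
  have bG: "bdd_meas (Suc n) ?G"
    using f D q unfolding bdd_supp_def by (intro bdd_meas_mult bdd_meas_sgn bdd_meas_powr) auto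
  have pF: "has_pderiv (Suc n) n ?F ?G" by (rule has_pderiv_abs_powr[OF has_pderiv q])
  have bG': "bdd_supp (Suc n) ?G" using has_pderiv_bdd_supp[OF pF _ bF bG] by simp
  have bD: "bdd_supp (Suc n) D" using has_pderiv_bdd_supp[OF has_pderiv _ f D] by simp
  have "(\<integral>x. ?F (x(n := t)) \<partial>LM n) \<le> (\<integral>x. 1/2 * (\<integral>s. \<bar>?G (x(n := s))\<bar> \<partial>lborel) \<partial>LM n)"
  proof (rule integral_mono)
    show "integrable (LM n) (\<lambda>x. ?F (x(n := t)))" by (rule bdd_supp_integrable[OF bdd_supp_slice[OF bF]])
    show "integrable (LM n) (\<lambda>x. 1/2 * (\<integral>s. \<bar>?G (x(n := s))\<bar> \<partial>lborel))"
      by (intro integrable_mult_right integral_LM_slices(4)[OF bdd_supp_abs[OF bG']])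
    fix x assume "x \<in> space (LM n)"
    then have x: "x(n := t) \<in> Rn (Suc n)" by (simp add: Rn_upd_Suc)
    show "?F (x(n := t)) \<le> 1/2 * (\<integral>s. \<bar>?G (x(n := s))\<bar> \<partial>lborel)"
      using has_pderiv_line_bound[OF pF _ bF bG x] by simp
  qed
  also have "\<dots> = 1/2 * (\<integral>x. \<bar>?G x\<bar> \<partial>LM (Suc n))"
    unfolding integral_LM_slices(3)[OF bdd_supp_abs[OF bG']] by simp
  finally have 1: "(\<integral>x. ?F (x(n := t)) \<partial>LM n) \<le> 1/2 * (\<integral>x. \<bar>?G x\<bar> \<partial>LM (Suc n))" .
  have "(\<integral>x. \<bar>?G x\<bar> \<partial>LM (Suc n)) \<le> (\<integral>x. q * \<bar>\<bar>f x\<bar> powr (q - 1) * D x\<bar> \<partial>LM (Suc n))"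
  proof (rule integral_mono)
    show "integrable (LM (Suc n)) (\<lambda>x. \<bar>?G x\<bar>)" by (rule bdd_supp_integrable[OF bdd_supp_abs[OF bG']])
    show "integrable (LM (Suc n)) (\<lambda>x. q * \<bar>\<bar>f x\<bar> powr (q - 1) * D x\<bar>)"
      using f bD q by (intro bdd_supp_integrable bdd_supp_cmult bdd_supp_abs bdd_supp_mult2 bdd_meas_powr bdd_supp_bdd_meas) auto
    show "\<bar>?G x\<bar> \<le> q * \<bar>\<bar>f x\<bar> powr (q - 1) * D x\<bar>" for x
      using q by (cases "f x = 0") (auto simp: abs_mult abs_sgn_eq)
  qed
  also have "\<dots> = q * (\<integral>x. \<bar>\<bar>f x\<bar> powr (q - 1) * D x\<bar> \<partial>LM (Suc n))" by simp
  finally have 2: "(\<integral>x. \<bar>?G x\<bar> \<partial>LM (Suc n)) \<le> q * (\<integral>x. \<bar>\<bar>f x\<bar> powr (q - 1) * D x\<bar> \<partial>LM (Suc n))" .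
  have "(\<integral>x. \<bar>\<bar>f x\<bar> powr (q - 1) * D x\<bar> \<partial>LM (Suc n)) \<le>
      sqrt (\<integral>x. (\<bar>f x\<bar> powr (q - 1))\<^sup>2 \<partial>LM (Suc n)) * sqrt (\<integral>x. (D x)\<^sup>2 \<partial>LM (Suc n))"
    using f q by (intro Cauchy_Schwarz_bdd_supp bdd_supp_powr bD) auto
  also have "(\<lambda>x. (\<bar>f x\<bar> powr (q - 1))\<^sup>2) = (\<lambda>x. \<bar>f x\<bar> powr (2 * (q - 1)))"
    by (simp add: fun_eq_iff power2_eq_square powr_add[symmetric])
  finally have "q * (\<integral>x. \<bar>\<bar>f x\<bar> powr (q - 1) * D x\<bar> \<partial>LM (Suc n)) \<le>
    q * (sqrt (\<integral>x. \<bar>f x\<bar> powr (2 * (q - 1)) \<partial>LM (Suc n)) * sqrt (\<integral>x. (D x)\<^sup>2 \<partial>LM (Suc n)))"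
    using q by (intro mult_left_mono) auto
  with 1 2 show ?thesis by linarith
qed

text \<open>The planar inequality for f^3 on slices produces |f|^6. Its derivatives 3 f^2 D are
  split by Cauchy-Schwarz, which leaves the fourth moment of the slice;
  \<open>slice_sup_bound\<close> with q = 4 bounds it by the root of the sixth moment over the whole
  space, and this root can be absorbed.\<close>

lemma Sobolev_3:
  assumes f: "bdd_supp 3 f" and D: "\<And>i. i < 3 \<Longrightarrow> bdd_meas 3 (D i)" "\<And>i. i < 3 \<Longrightarrow> has_pderiv 3 i f (D i)"
  shows "(\<integral>x. \<bar>f x\<bar> powr 6 \<partial>LM 3) \<le> 3/4 * (\<Sum>i<3. \<integral>x. (D i x)\<^sup>2 \<partial>LM 3) ^ 3"
proof -
  have S3: "(3::nat) = Suc 2" by simp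
  have bD: "bdd_supp 3 (D i)" if "i < 3" for i using has_pderiv_bdd_supp[OF D(2) _ f D(1)] that by auto
  define I where "I = (\<integral>x. \<bar>f x\<bar> powr 6 \<partial>LM 3)"
  define c where "c i = (\<integral>x. (D i x)\<^sup>2 \<partial>LM 3)" for i
  have I0: "I \<ge> 0" by (simp add: I_def)
  have c0: "c i \<ge> 0" for i by (simp add: c_def)
  have p6: "\<bar>f x\<bar> powr 6 = (f x ^ 3)\<^sup>2" for x
    by (simp add: power_mult[symmetric])
  have p4: "\<bar>f x\<bar> powr 4 = (f x)^4" for x
    by simp
  have q4: "(\<integral>x. (f (x(2 := t)))^4 \<partial>LM 2) \<le> 2 * (sqrt I * sqrt (c 2))" for t
    using slice_sup_bound[of 2 f "D 2" 4 t] f D[of 2] by (simp add: p4 I_def c_def)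
  have slice: "(\<integral>x. (f (x(2 := t)) ^ 3)\<^sup>2 \<partial>LM 2) \<le>
      9/4 * (sqrt I * sqrt (c 2)) * ((\<integral>x. (D 0 (x(2 := t)))\<^sup>2 \<partial>LM 2) + (\<integral>x. (D 1 (x(2 := t)))\<^sup>2 \<partial>LM 2))" for t
  proof -
    let ?f = "\<lambda>x. f (x(2 := t))"
    let ?D = "\<lambda>i x. D i (x(2 := t))"
    have bf: "bdd_supp 2 ?f" using bdd_supp_slice[of 2 f t] f by simp
    have bDt: "bdd_supp 2 (?D i)" if "i < 2" for i using bdd_supp_slice[of 2 "D i" t] bD[of i] that by simp
    have pdt: "has_pderiv 2 i ?f (?D i)" if "i < 2" for i using has_pderiv_slice[of 2 i f "D i" t] D(2)[of i] that by simp
    have b3: "bdd_supp 2 (\<lambda>x. ?f x ^ 3)" using bf by (intro bdd_supp_power) auto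
    have p3: "has_pderiv 2 i (\<lambda>x. ?f x ^ 3) (\<lambda>x. 3 * (?f x)\<^sup>2 * ?D i x)" if "i < 2" for i
      using has_pderiv_power[OF pdt[OF that], of 3] by simp
    have bG: "bdd_meas 2 (\<lambda>x. 3 * (?f x)\<^sup>2 * ?D i x)" if "i < 2" for i
      using bf bDt[OF that] unfolding bdd_supp_def by (intro bdd_meas_mult bdd_meas_power bdd_meas_const) auto
    define Q where "Q = (\<integral>x. (?f x)^4 \<partial>LM 2)"
    define d where "d i = (\<integral>x. (?D i x)\<^sup>2 \<partial>LM 2)" for i
    have Q0: "Q \<ge> 0" by (simp add: Q_def)
    have d0: "d i \<ge> 0" for i by (simp add: d_def)
    have G: "(\<integral>x. \<bar>3 * (?f x)\<^sup>2 * ?D i x\<bar> \<partial>LM 2) \<le> 3 * (sqrt Q * sqrt (d i))" if "i < 2" for i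
    proof -
      have "(\<integral>x. \<bar>(?f x)\<^sup>2 * ?D i x\<bar> \<partial>LM 2) \<le> sqrt (\<integral>x. ((?f x)\<^sup>2)\<^sup>2 \<partial>LM 2) * sqrt (\<integral>x. (?D i x)\<^sup>2 \<partial>LM 2)"
        by (intro Cauchy_Schwarz_bdd_supp bdd_supp_power bf bDt that) auto
      then show ?thesis by (simp add: abs_mult Q_def d_def mult.assoc)
    qed
    have "(\<integral>x. (?f x ^ 3)\<^sup>2 \<partial>LM 2) \<le> 1/4 * (\<integral>x. \<bar>3 * (?f x)\<^sup>2 * ?D 0 x\<bar> \<partial>LM 2) * (\<integral>x. \<bar>3 * (?f x)\<^sup>2 * ?D 1 x\<bar> \<partial>LM 2)"
      by (rule planar_Sobolev[OF b3 bG bG p3 p3]) auto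
    also have "\<dots> \<le> 1/4 * (3 * (sqrt Q * sqrt (d 0))) * (3 * (sqrt Q * sqrt (d 1)))"
      using G[of 0] G[of 1] Q0 d0[of 0] d0[of 1]
      by (intro mult_mono mult_nonneg_nonneg) auto
    also have "\<dots> = 9/4 * (Q * (sqrt (d 0) * sqrt (d 1)))" 
    proof -
      have "1/4 * (3 * (sqrt Q * sqrt (d 0))) * (3 * (sqrt Q * sqrt (d 1))) = 9/4 * ((sqrt Q * sqrt Q) * (sqrt (d 0) * sqrt (d 1)))"
        by (simp only: mult_ac)
      then show ?thesis using Q0 by simp
    qed
    also have "\<dots> \<le> 9/4 * (Q * ((d 0 + d 1) / 2))"
      using arith_geo_mean_sqrt[OF d0[of 0] d0[of 1]] Q0 by (intro mult_left_mono) (auto simp: real_sqrt_mult)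
    also have "\<dots> \<le> 9/4 * ((2 * (sqrt I * sqrt (c 2))) * ((d 0 + d 1) / 2))"
      using q4[of t] d0[of 0] d0[of 1] by (intro mult_left_mono mult_right_mono) (auto simp: Q_def)
    finally show ?thesis by (simp add: d_def algebra_simps)
  qed
  have f6: "bdd_supp (Suc 2) (\<lambda>x. (f x ^ 3)\<^sup>2)" using f by (intro bdd_supp_power) auto
  have D2: "bdd_supp (Suc 2) (\<lambda>x. (D i x)\<^sup>2)" if "i < 3" for i using bD[OF that] by (intro bdd_supp_power) auto
  have "I = (\<integral>t. (\<integral>x. (f (x(2 := t)) ^ 3)\<^sup>2 \<partial>LM 2) \<partial>lborel)"
    unfolding I_def p6 using integral_LM_slices(2)[OF f6] by simp
  also have "\<dots> \<le> (\<integral>t. 9/4 * (sqrt I * sqrt (c 2)) * ((\<integral>x. (D 0 (x(2 := t)))\<^sup>2 \<partial>LM 2) + (\<integral>x. (D 1 (x(2 := t)))\<^sup>2 \<partial>LM 2)) \<partial>lborel)"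
    by (intro integral_mono slice integral_LM_slices(1)[OF f6] integrable_mult_right Bochner_Integration.integrable_add
        integral_LM_slices(1)[OF D2]) auto
  also have "\<dots> = 9/4 * (sqrt I * sqrt (c 2)) * (c 0 + c 1)"
    using integral_LM_slices(1,2)[OF D2[of 0]] integral_LM_slices(1,2)[OF D2[of 1]] by (simp add: c_def)
  finally have *: "I \<le> 9/4 * (sqrt I * sqrt (c 2)) * (c 0 + c 1)" .
  have "I \<le> 81/16 * c 2 * (c 0 + c 1)^2"
  proof (cases "I = 0")
    case True then show ?thesis using c0 by simp
  next
    case False
    then have "I > 0" using I0 by simp
    \<comment> \<open>\<open>I\<close> enters the right side only as sqrt I; squaring and dividing
      by \<open>I\<close> closes the estimate.\<close>
    have "I\<^sup>2 \<le> (9/4 * (sqrt I * sqrt (c 2)) * (c 0 + c 1))\<^sup>2"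
      using * I0 by (intro power_mono) auto
    also have "\<dots> = I * (81/16 * c 2 * (c 0 + c 1)^2)"
      using I0 c0[of 2] by (simp add: power_mult_distrib power2_eq_square[of "9/4"] power_divide)
    finally show ?thesis using \<open>I > 0\<close> by (simp add: power2_eq_square)
  qed
  \<comment> \<open>For fixed a + b the product a^2 b is largest at a = 2 b, where it is 4/27 of (a
    + b)^3, and 81/16 times 4/27 is 3/4. The factor (a - 2 b)^2 below certifies this.\<close>
  also have "81/16 * c 2 * (c 0 + c 1)^2 \<le> 3/4 * (c 0 + c 1 + c 2)^3"
  proof -
    define a where "a = c 0 + c 1"
    define b where "b = c 2"
    have "0 \<le> (a - 2 * b)\<^sup>2 * (4 * a + b)" using c0 unfolding a_def b_def by (intro mult_nonneg_nonneg add_nonneg_nonneg) auto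
    also have "(a - 2 * b)\<^sup>2 * (4 * a + b) = 16/3 * (3/4 * (a + b)^3 - 81/16 * b * a^2)" by algebra
    finally show ?thesis by (simp add: a_def b_def)
  qed
  also have "c 0 + c 1 + c 2 = (\<Sum>i<3. c i)" by (simp add: S3 lessThan_Suc numeral_2_eq_2)
  finally show ?thesis by (simp add: I_def c_def)
qed

text \<open>The left side decreases in \<open>m\<close>, and 9/16 is its value at m = 4, the first
  step of the induction.\<close>

lemma real_Suc_div_bounds:
  assumes "n \<ge> (3::nat)" defines "m \<equiv> real (Suc n)"
  shows "((m - 1) / (m - 2))\<^sup>2 / m \<le> 9/16"
proof -
  have m: "m \<ge> 4" using assms by simp
  then have "(m - 1) / (m - 2) \<le> 3/2" by (simp add: field_simps)
  then have "((m - 1) / (m - 2))\<^sup>2 \<le> (3/2)\<^sup>2" using m by (intro power_mono) auto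
  then have "((m - 1) / (m - 2))\<^sup>2 / m \<le> (3/2)\<^sup>2 / 4" using m by (intro frac_le) auto
  then show ?thesis by (simp add: power2_eq_square)
qed

lemma weighted_AM_GM:
  fixes a b s :: real
  assumes "a \<ge> 0" "b \<ge> 0" "0 < s" "s < 1"
  shows "a powr (1 - s) * b powr s \<le> (1 - s) * a + s * b"
  using Youngs_inequality_0[of "1 - s" s a b] assms by (cases "a = 0 \<or> b = 0") auto

text \<open>
  Induction on \<open>n\<close>: integrating the inequality over the hyperplane slices \<open>x n = t\<close> costs a factor
  that Hoelder's inequality and \<open>slice_sup_bound\<close> (the supremum over \<open>t\<close> of an \<open>L\<^sup>q\<close> norm of the slices) pay for,
  and the weighted AM-GM inequality recombines the derivative in the new direction with the others.
  The constant only has to exceed the cube root of \<open>3/4\<close>, from dimension three, and \<open>9/16\<close>, from the induction step.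
\<close>

theorem Sobolev:
  assumes "n \<ge> 3" "bdd_supp n f" "\<And>i. i < n \<Longrightarrow> bdd_meas n (D i)" "\<And>i. i < n \<Longrightarrow> has_pderiv n i f (D i)"
  shows "(\<integral>x. \<bar>f x\<bar> powr (2 * real n / (real n - 2)) \<partial>LM n) powr ((real n - 2) / real n) \<le>
    10/11 * (\<Sum>i<n. \<integral>x. (D i x)\<^sup>2 \<partial>LM n)"
  using assms
proof (induction n arbitrary: f D rule: nat_induct_at_least)
  case base
  define T where "T = (\<Sum>i<3. \<integral>x. (D i x)\<^sup>2 \<partial>LM 3)"
  have T0: "T \<ge> 0" by (auto simp: T_def intro!: sum_nonneg)
  have "(\<integral>x. \<bar>f x\<bar> powr 6 \<partial>LM 3) \<le> 3/4 * T ^ 3"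
    unfolding T_def by (rule Sobolev_3) (use base in auto)
  \<comment> \<open>(10/11)^3 is 1000/1331, just above 3/4; the cube is forced by the power 1/3 in
    dimension three.\<close>
  also have "\<dots> \<le> (10/11)^3 * T^3" using T0 by (intro mult_right_mono) (auto simp: power3_eq_cube)
  also have "\<dots> = (10/11 * T)^3" by (rule power_mult_distrib[symmetric])
  finally have *: "(\<integral>x. \<bar>f x\<bar> powr 6 \<partial>LM 3) \<le> (10/11 * T)^3" .
  then have "(\<integral>x. \<bar>f x\<bar> powr 6 \<partial>LM 3) powr (1/3) \<le> ((10/11 * T)^3) powr (1/3)"
    by (intro powr_mono2) auto
  also have "(10/11 * T)^3 = (10/11 * T) powr 3" using T0 by simp
  also have "\<dots> powr (1/3) = 10/11 * T" using T0 by (simp only: powr_powr) simp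
  finally show ?case by (simp add: T_def)
next
  case (Suc n)
  have n: "real n \<ge> 3" using Suc.hyps by simp
  define m where "m = real (Suc n)"
  have m: "m \<ge> 4" "real n = m - 1" using n by (auto simp: m_def)
  \<comment> \<open>\<open>q\<close> satisfies 2 (q - 1) = s, so \<open>slice_sup_bound\<close>
    bounds the slice integrals of |f|^q by means of sqrt I, where \<open>I\<close> is the very
    integral to be estimated.\<close>
  define q where "q = 2 * (m - 1) / (m - 2)"
  have q: "q > 1" "q / 2 = (m - 1) / (m - 2)" using m by (auto simp: q_def field_simps)
  define s where "s = 2 * m / (m - 2)"
  define s' where "s' = 2 * (m - 1) / (m - 3)"
  have ss: "s > 0" "s' > 0" "2 * (q - 1) = s" using m by (auto simp: s_def s'_def q_def field_simps)
  \<comment> \<open>\<open>s'\<close> is the Sobolev exponent in dimension m - 1, and the weights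
    interpolate \<open>s\<close> between \<open>s'\<close> and \<open>q\<close> on a slice. The
    weight of \<open>s'\<close> is exactly the power in the induction hypothesis, so the derivatives
    of the slice enter linearly and can be integrated over \<open>t\<close>.\<close>
  define \<alpha> where "\<alpha> = (m - 3) / (m - 1)"
  define \<beta> where "\<beta> = 2 / (m - 1)"
  have ab: "\<alpha> > 0" "\<beta> > 0" "\<alpha> + \<beta> = 1" "\<alpha> * s' + \<beta> * q = s" "\<alpha> < 1" "\<beta> < 1"
  proof -
    show "\<alpha> > 0" "\<beta> > 0" "\<alpha> + \<beta> = 1" "\<alpha> < 1" "\<beta> < 1" using m by (auto simp: \<alpha>_def \<beta>_def field_simps)
    have "\<alpha> * s' = 2" "\<beta> * q = 4 / (m - 2)" using m by (auto simp: \<alpha>_def \<beta>_def s'_def q_def divide_simps) (simp_all add: algebra_simps)?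
    then show "\<alpha> * s' + \<beta> * q = s" using m by (simp add: s_def field_simps)
  qed
  have bD: "bdd_supp (Suc n) (D i)" if "i < Suc n" for i using has_pderiv_bdd_supp[OF Suc.prems(3) that Suc.prems(1,2)] that by auto
  define I where "I = (\<integral>x. \<bar>f x\<bar> powr s \<partial>LM (Suc n))"
  define c where "c i = (\<integral>x. (D i x)\<^sup>2 \<partial>LM (Suc n))" for i
  define T where "T = (\<Sum>i<n. c i)"
  define Y where "Y = q / 2 * (sqrt I * sqrt (c n))"
  have I0: "I \<ge> 0" by (simp add: I_def)
  have c0: "c i \<ge> 0" for i by (simp add: c_def)
  have T0: "T \<ge> 0" by (auto simp: T_def intro!: sum_nonneg c0)
  have Y0: "Y \<ge> 0" using I0 c0[of n] q(1) by (simp add: Y_def)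
  have Y: "(\<integral>x. \<bar>f (x(n := t))\<bar> powr q \<partial>LM n) \<le> Y" for t
    unfolding Y_def I_def c_def
    by (rule slice_sup_bound[OF Suc.prems(1) Suc.prems(2)[OF lessI] Suc.prems(3)[OF lessI] q(1), unfolded ss(3)])
  have slice: "(\<integral>x. \<bar>f (x(n := t))\<bar> powr s \<partial>LM n) \<le> 10/11 * Y powr \<beta> * (\<Sum>i<n. \<integral>x. (D i (x(n := t)))\<^sup>2 \<partial>LM n)" for t
  proof -
    let ?f = "\<lambda>x. f (x(n := t))"
    have bf: "bdd_supp n ?f" by (rule bdd_supp_slice[OF Suc.prems(1)])
    have IH: "(\<integral>x. \<bar>?f x\<bar> powr s' \<partial>LM n) powr \<alpha> \<le> 10/11 * (\<Sum>i<n. \<integral>x. (D i (x(n := t)))\<^sup>2 \<partial>LM n)"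
    proof -
      have *: "s' = 2 * real n / (real n - 2)" "\<alpha> = (real n - 2) / real n" by (auto simp: s'_def \<alpha>_def m)
      show ?thesis unfolding * by (rule Suc.IH[OF bf bdd_meas_slice[OF Suc.prems(2)] has_pderiv_slice[OF Suc.prems(3)]]) (simp_all only: less_SucI)
    qed
    have "(\<integral>x. \<bar>?f x\<bar> powr s \<partial>LM n) = (\<integral>x. \<bar>\<bar>?f x\<bar> powr (\<alpha> * s') * \<bar>?f x\<bar> powr (\<beta> * q)\<bar> \<partial>LM n)"
      unfolding ab(4)[symmetric] powr_add by (simp add: abs_mult)
    also have "\<dots> \<le> Lq_norm (LM n) (1/\<alpha>) (\<lambda>x. \<bar>?f x\<bar> powr (\<alpha> * s')) * Lq_norm (LM n) (1/\<beta>) (\<lambda>x. \<bar>?f x\<bar> powr (\<beta> * q))"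
      using ab(1,2,3,5,6) q(1) ss(2) by (intro Holder_inequality bdd_supp_in_Lq bdd_supp_powr bf) auto
    also have "\<dots> = (\<integral>x. \<bar>?f x\<bar> powr s' \<partial>LM n) powr \<alpha> * (\<integral>x. \<bar>?f x\<bar> powr q \<partial>LM n) powr \<beta>"
      using ab(1,2) by (simp add: Lq_norm_def powr_powr)
    also have "\<dots> \<le> (10/11 * (\<Sum>i<n. \<integral>x. (D i (x(n := t)))\<^sup>2 \<partial>LM n)) * Y powr \<beta>"
      using IH Y[of t] ab by (intro mult_mono powr_mono2) (auto intro!: sum_nonneg)
    finally show ?thesis by (simp add: mult_ac)
  qed
  have fs: "bdd_supp (Suc n) (\<lambda>x. \<bar>f x\<bar> powr s)" using Suc.prems(1) ss by (intro bdd_supp_powr) auto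
  have D2: "bdd_supp (Suc n) (\<lambda>x. (D i x)\<^sup>2)" if "i < Suc n" for i using bD[OF that] by (intro bdd_supp_power) auto
  have "I = (\<integral>t. (\<integral>x. \<bar>f (x(n := t))\<bar> powr s \<partial>LM n) \<partial>lborel)"
    unfolding I_def by (rule integral_LM_slices(2)[OF fs])
  also have "\<dots> \<le> (\<integral>t. 10/11 * Y powr \<beta> * (\<Sum>i<n. \<integral>x. (D i (x(n := t)))\<^sup>2 \<partial>LM n) \<partial>lborel)"
    by (intro integral_mono slice integral_LM_slices(1)[OF fs] integrable_mult_right Bochner_Integration.integrable_sum
        integral_LM_slices(1)[OF D2]) auto
  also have "\<dots> = 10/11 * Y powr \<beta> * (\<Sum>i<n. \<integral>t. \<integral>x. (D i (x(n := t)))\<^sup>2 \<partial>LM n \<partial>lborel)"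
    using integral_LM_slices(1)[OF D2] by (simp add: Bochner_Integration.integral_sum)
  also have "(\<Sum>i<n. \<integral>t. \<integral>x. (D i (x(n := t)))\<^sup>2 \<partial>LM n \<partial>lborel) = T"
    unfolding T_def c_def by (intro sum.cong refl integral_LM_slices(2)[symmetric] D2) auto
  finally have *: "I \<le> 10/11 * Y powr \<beta> * T" .
  have "I powr ((m - 2) / m) \<le> 10/11 * (T + c n)"
  proof (cases "I = 0")
    case True then show ?thesis using T0 c0[of n] by simp
  next
    case False
    then have Ipos: "I > 0" using I0 by simp
    have "(m - 1) / m > 0" using m by simp
    define X where "X = 10/11 * T"
    define Z where "Z = (q/2)\<^sup>2 * c n"
    have XZ: "X \<ge> 0" "Z \<ge> 0" using T0 c0[of n] by (auto simp: X_def Z_def)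
    \<comment> \<open>As \<open>\<beta>\<close> is 2/(m-1), the square roots in \<open>Y\<close>
      disappear and \<open>I\<close> remains with the power 1/(m-1), which is below 1 and can be
      divided out.\<close>
    have "Y powr \<beta> = (Y\<^sup>2) powr (1 / (m - 1))"
    proof -
      have "Y\<^sup>2 = Y powr 2" using Y0 by simp
      then show ?thesis by (simp only: powr_powr \<beta>_def) simp
    qed
    also have "Y\<^sup>2 = I * Z" using I0 c0[of n] by (simp only: Y_def Z_def power_mult_distrib real_sqrt_pow2) simp
    also have "(I * Z) powr (1 / (m - 1)) = I powr (1 / (m - 1)) * Z powr (1 / (m - 1))"
      by (simp add: powr_mult)
    finally have "I \<le> I powr (1 / (m - 1)) * (X * Z powr (1 / (m - 1)))" using * by (simp add: X_def mult_ac)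
    then have "I powr (1 - 1 / (m - 1)) \<le> X * Z powr (1 / (m - 1))"
      using Ipos by (simp add: powr_diff field_simps)
    then have "(I powr (1 - 1 / (m - 1))) powr ((m - 1) / m) \<le> (X * Z powr (1 / (m - 1))) powr ((m - 1) / m)"
      using m by (intro powr_mono2) auto
    moreover have "(1 - 1 / (m - 1)) * ((m - 1) / m) = (m - 2) / m" using m by (simp add: field_simps)
    moreover have "(X * Z powr (1 / (m - 1))) powr ((m - 1) / m) = X powr (1 - 1/m) * Z powr (1/m)"
    proof -
      have e: "1 / (m - 1) * ((m - 1) / m) = 1 / m" "1 - 1/m = (m - 1) / m" using m by (simp_all add: field_simps)
      show ?thesis by (simp only: powr_mult powr_powr e)
    qed
    ultimately have "I powr ((m - 2) / m) \<le> X powr (1 - 1/m) * Z powr (1/m)" by (simp only: powr_powr)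
    also have "\<dots> \<le> (1 - 1/m) * X + 1/m * Z" using XZ m by (intro weighted_AM_GM) auto
    also have "\<dots> \<le> 1 * X + 10/11 * c n"
    proof (rule add_mono)
      show "(1 - 1/m) * X \<le> 1 * X" using XZ m by (intro mult_right_mono) auto
      have "1/m * Z = (((m - 1) / (m - 2))\<^sup>2 / m) * c n" by (simp add: Z_def q)
      also have "\<dots> \<le> 10/11 * c n"
        using real_Suc_div_bounds[OF Suc.hyps] c0[of n] by (intro mult_right_mono) (auto simp: m_def)
      finally show "1/m * Z \<le> 10/11 * c n" .
    qed
    finally show ?thesis by (simp add: X_def distrib_left)
  qed
  then show ?case by (simp add: T_def c_def I_def s_def m_def)
qed

section \<open>Smooth bumps and the volume of balls\<close>

text \<open>Stated through \<open>deriv\<close>, because \<open>Ck\<close> and hence the test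
  functions are built from \<open>partial_deriv\<close>, which is a \<open>deriv\<close> along a
  line.\<close>

primrec sm :: "nat \<Rightarrow> (real \<Rightarrow> real) \<Rightarrow> bool" where
  "sm 0 f \<longleftrightarrow> True"
| "sm (Suc k) f \<longleftrightarrow> (\<forall>t. (f has_real_derivative deriv f t) (at t)) \<and> sm k (deriv f)"

definition smooth :: "(real \<Rightarrow> real) \<Rightarrow> bool" where
  "smooth f \<longleftrightarrow> (\<forall>k. sm k f)"

lemma sm_SucI:
  assumes "\<And>t. (f has_real_derivative f' t) (at t)" "sm k f'"
  shows "sm (Suc k) f"
proof -
  have "deriv f = f'" using DERIV_imp_deriv[OF assms(1)] by blast
  then show ?thesis using assms by simp
qed

lemma sm_Suc_imp: "sm (Suc k) f \<Longrightarrow> sm k f"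
proof (induction k arbitrary: f)
  case (Suc k)
  then show ?case using sm.simps(2)[of "Suc k" f] Suc.IH[of "deriv f"] by auto
qed simp

lemma sm_add: "sm k f \<Longrightarrow> sm k g \<Longrightarrow> sm k (\<lambda>t. f t + g t)"
proof (induction k arbitrary: f g)
  case (Suc k)
  show ?case
    by (rule sm_SucI[where f'="\<lambda>t. deriv f t + deriv g t"]) (use Suc in \<open>auto intro!: derivative_intros\<close>)
qed simp

lemma sm_mult: "sm k f \<Longrightarrow> sm k g \<Longrightarrow> sm k (\<lambda>t. f t * g t)"
proof (induction k arbitrary: f g)
  case (Suc k)
  have "sm k f" "sm k g" using Suc.prems by (auto intro: sm_Suc_imp simp del: sm.simps)
  then show ?case
    using Suc by (intro sm_SucI[where f'="\<lambda>t. deriv f t * g t + f t * deriv g t"] sm_add Suc.IH)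
      (auto intro!: derivative_eq_intros)
qed simp

lemma sm_affine: "sm k f \<Longrightarrow> sm k (\<lambda>t. c * f (a * t + b))"
proof (induction k arbitrary: f c)
  case (Suc k)
  show ?case
  proof (rule sm_SucI[where f'="\<lambda>t. (c * a) * deriv f (a * t + b)"])
    show "sm k (\<lambda>t. (c * a) * deriv f (a * t + b))" by (rule Suc.IH) (use Suc.prems in auto)
    fix t
    have "((\<lambda>t. f (a * t + b)) has_real_derivative deriv f (a * t + b) * a) (at t)"
      by (rule DERIV_chain2[where g="\<lambda>t. a * t + b"]) (use Suc.prems in \<open>auto intro!: derivative_eq_intros\<close>)
    from DERIV_cmult[OF this, of c]
    show "((\<lambda>t. c * f (a * t + b)) has_real_derivative (c * a) * deriv f (a * t + b)) (at t)" by (simp add: mult_ac)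
  qed
qed simp

lemma smooth_affine: "smooth f \<Longrightarrow> smooth (\<lambda>t. c * f (a * t + b))"
  by (simp add: smooth_def sm_affine)

lemma smooth_DERIV: "smooth f \<Longrightarrow> (f has_real_derivative deriv f t) (at t)"
  unfolding smooth_def using sm.simps(2)[of 0 f] by blast

lemma smooth_deriv: "smooth f \<Longrightarrow> smooth (deriv f)"
  unfolding smooth_def using sm.simps(2)[of _ f] by blast

lemma smooth_continuous: "smooth f \<Longrightarrow> continuous_on A f"
  using smooth_DERIV by (meson DERIV_isCont continuous_at_imp_continuous_on)

lemma deriv_affine: "smooth f \<Longrightarrow> deriv (\<lambda>t. c * f (a * t + b)) = (\<lambda>t. (c * a) * deriv f (a * t + b))"
proof
  fix t assume f: "smooth f"
  have "((\<lambda>t. f (a * t + b)) has_real_derivative deriv f (a * t + b) * a) (at t)"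
    by (rule DERIV_chain2[where g="\<lambda>t. a * t + b"]) (use smooth_DERIV[OF f] in \<open>auto intro!: derivative_eq_intros\<close>)
  from DERIV_cmult[OF this, of c]
  show "deriv (\<lambda>t. c * f (a * t + b)) t = (c * a) * deriv f (a * t + b)"
    by (intro DERIV_imp_deriv) (simp add: mult_ac)
qed

text \<open>P(1/t) exp(-1/t), extended by 0, with a polynomial parameter: the family is closed under
  differentiation, which reduces smoothness to one induction.\<close>

definition flat :: "real poly \<Rightarrow> real \<Rightarrow> real" where
  "flat P t = (if t > 0 then poly P (1 / t) * exp (- (1 / t)) else 0)"

lemma poly_exp_tendsto: "((\<lambda>s. poly P s * exp (- s)) \<longlongrightarrow> (0::real)) at_top"
proof -
  have "((\<lambda>s. \<Sum>i\<le>degree P. coeff P i * (s ^ i / exp s)) \<longlongrightarrow> (\<Sum>i\<le>degree P. coeff P i * 0)) at_top"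
    by (intro tendsto_intros tendsto_power_div_exp_0)
  then show ?thesis by (simp add: poly_altdef sum_distrib_right sum_divide_distrib exp_minus field_simps)
qed

text \<open>For t > 0 the derivative is t^(-2) (P - P')(1/t) exp(-1/t), the member of the family
  with polynomial X^2 (P - P'). At 0 the right difference quotient is the member for X P and tends
  to 0.\<close>

lemma flat_DERIV: "(flat P has_real_derivative flat ([:0, 0, 1:] * (P - pderiv P)) t) (at t)"
proof -
  consider "t > 0" | "t < 0" | "t = 0" by linarith
  then show ?thesis
  proof cases
    case 1
    have "((\<lambda>t. poly P (1 / t) * exp (- (1 / t))) has_real_derivative
       (poly (pderiv P) (1 / t) * (- 1 / t\<^sup>2)) * exp (- (1 / t)) + (exp (- (1 / t)) * (1 / t\<^sup>2)) * poly P (1 / t)) (at t)"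
      using 1 by (intro DERIV_mult DERIV_chain2[where f="poly P"] poly_DERIV DERIV_chain2[where f=exp] DERIV_exp)
         (auto intro!: derivative_eq_intros simp: power2_eq_square)
    moreover have "(poly (pderiv P) (1 / t) * (- 1 / t\<^sup>2)) * exp (- (1 / t)) + (exp (- (1 / t)) * (1 / t\<^sup>2)) * poly P (1 / t)
        = flat ([:0, 0, 1:] * (P - pderiv P)) t"
      using 1 by (simp add: flat_def power2_eq_square field_simps)
    ultimately have "((\<lambda>t. poly P (1 / t) * exp (- (1 / t))) has_real_derivative flat ([:0, 0, 1:] * (P - pderiv P)) t) (at t)"
      by simp
    then show ?thesis
      by (rule DERIV_cong_ev[THEN iffD1, OF refl _ refl, rotated])
         (use eventually_nhds_in_open[of "{0<..}" t] 1 in \<open>auto elim!: eventually_mono simp: flat_def\<close>)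
  next
    case 2
    have "((\<lambda>t. 0) has_real_derivative flat ([:0, 0, 1:] * (P - pderiv P)) t) (at t)" using 2 by (simp add: flat_def)
    then show ?thesis
      by (rule DERIV_cong_ev[THEN iffD1, OF refl _ refl, rotated])
         (use eventually_nhds_in_open[of "{..<0}" t] 2 in \<open>auto elim!: eventually_mono simp: flat_def\<close>)
  next
    case 3
    have r: "((\<lambda>h. flat P h / h) \<longlongrightarrow> 0) (at_right 0)"
    proof -
      have "((\<lambda>h. poly ([:0, 1:] * P) (1 / h) * exp (- (1 / h))) \<longlongrightarrow> 0) (at_right 0)"
        by (rule filterlim_compose[OF poly_exp_tendsto]) (use filterlim_inverse_at_top_right in \<open>simp add: inverse_eq_divide\<close>)
      then show ?thesis
        by (rule Lim_transform_eventually) (auto simp: eventually_at_filter flat_def intro!: always_eventually)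
    qed
    have l: "((\<lambda>h. flat P h / h) \<longlongrightarrow> 0) (at_left 0)"
      by (rule Lim_transform_eventually[OF tendsto_const]) (auto simp: eventually_at_filter flat_def intro!: always_eventually)
    have "((\<lambda>h. flat P h / h) \<longlongrightarrow> 0) (at 0)" using filterlim_split_at[OF l r] .
    then show ?thesis using 3 by (simp add: DERIV_def flat_def)
  qed
qed

lemma smooth_flat: "smooth (flat P)"
proof -
  have "sm k (flat P)" for k
    by (induction k arbitrary: P) (simp, rule sm_SucI[OF flat_DERIV], simp)
  then show ?thesis by (simp add: smooth_def)
qed

section \<open>A bump function and a step profile\<close>

definition bump0 :: "real \<Rightarrow> real" where
  "bump0 t = flat 1 (1 - t) * flat 1 (1 + t)"

lemma smooth_bump0: "smooth bump0"
proof -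
  have "smooth (\<lambda>t. 1 * flat 1 ((-1) * t + 1))" "smooth (\<lambda>t. 1 * flat 1 (1 * t + 1))"
    by (intro smooth_affine smooth_flat)+
  then have "smooth (\<lambda>t. flat 1 (1 - t) * flat 1 (1 + t))"
    unfolding smooth_def by (auto intro!: sm_mult simp: add.commute)
  then show ?thesis by (simp add: bump0_def[abs_def])
qed

lemma bump0_nonneg: "bump0 t \<ge> 0"
  by (simp add: bump0_def flat_def)

lemma bump0_zero: "\<bar>t\<bar> \<ge> 1 \<Longrightarrow> bump0 t = 0"
  by (auto simp: bump0_def flat_def abs_if split: if_splits)

lemma bump0_pos: "\<bar>t\<bar> < 1 \<Longrightarrow> bump0 t > 0"
  by (auto simp: bump0_def flat_def abs_if split: if_splits)

lemma deriv_zero_outside: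
  assumes "smooth f" "\<And>t. \<bar>t\<bar> \<ge> R \<Longrightarrow> f t = 0" "\<bar>t\<bar> > R" shows "deriv f t = 0"
proof -
  have op: "open {t::real. \<bar>t\<bar> > R}" by (intro open_Collect_less continuous_intros)
  have "((\<lambda>_. 0) has_real_derivative deriv f t) (at t)"
    by (rule DERIV_cong_ev[THEN iffD1, OF refl _ refl smooth_DERIV[OF assms(1), of t]])
       (use eventually_nhds_in_open[OF op, of t] assms in \<open>auto elim!: eventually_mono\<close>)
  then show ?thesis using DERIV_unique[OF _ DERIV_const[of 0]] by blast
qed

lemma smooth_bounded:
  assumes "smooth f" "\<And>t. \<bar>t\<bar> > R \<Longrightarrow> f t = 0" shows "\<exists>B>0. \<forall>t. \<bar>f t\<bar> \<le> B"
proof -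
  have "compact (f ` {-R..R})" by (intro compact_continuous_image smooth_continuous assms compact_Icc)
  then obtain B where B: "B > 0" "\<And>t. t \<in> {-R..R} \<Longrightarrow> \<bar>f t\<bar> \<le> B"
    using compact_imp_bounded bounded_pos[of "f ` {-R..R}"] by auto
  have "\<bar>f t\<bar> \<le> B" for t using B assms(2)[of t] by (cases "\<bar>t\<bar> \<le> R") (auto simp: abs_le_iff)
  then show ?thesis using B by blast
qed

definition bump :: "real \<Rightarrow> real" where
  "bump t = (1 / (\<integral>s. bump0 s \<partial>lborel)) * bump0 t"

lemma integrable_bump0: "integrable lborel bump0"
proof -
  obtain B where B: "\<And>t. \<bar>bump0 t\<bar> \<le> B" using smooth_bounded[OF smooth_bump0, of 1] bump0_zero by fastforce
  show ?thesis
  proof (rule Bochner_Integration.integrable_bound[of _ "\<lambda>t. B * indicator {-1..1::real} t"])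
    show "integrable lborel (\<lambda>x. B * indicat_real {- 1..1::real} x)"
      by (intro integrable_mult_right integrable_real_indicator) (auto simp: emeasure_lborel_Icc_eq)
    show "bump0 \<in> borel_measurable lborel"
      using borel_measurable_continuous_onI[OF smooth_continuous[OF smooth_bump0]] by simp
    have "norm (bump0 t) \<le> norm (B * indicat_real {- 1..1::real} t)" for t
      using B[of t] bump0_zero[of t] by (cases "\<bar>t\<bar> \<le> 1") (auto simp: indicator_def)
    then show "AE t in lborel. norm (bump0 t) \<le> norm (B * indicat_real {- 1..1::real} t)" by simp
  qed
qed

lemma integral_bump0_pos: "(\<integral>s. bump0 s \<partial>lborel) > 0"
proof -
  have "(\<integral>s. bump0 s \<partial>lborel) \<noteq> 0"
  proof
    assume "(\<integral>s. bump0 s \<partial>lborel) = 0"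
    then have "AE s in lborel. bump0 s = 0"
      using integral_nonneg_eq_0_iff_AE[OF integrable_bump0] bump0_nonneg by auto
    then have "AE s in lborel. s \<notin> {-1<..<1::real}"
      by (rule eventually_mono) (use bump0_pos in \<open>force simp: abs_less_iff\<close>)
    then have "emeasure lborel {-1<..<1::real} = 0" by (subst (asm) AE_iff_measurable[OF _ refl]) (auto simp: greaterThanLessThan_def greaterThan_def lessThan_def Collect_conj_eq)
    then show False by simp
  qed
  then show ?thesis using Bochner_Integration.integral_nonneg[of lborel bump0] bump0_nonneg by (auto simp: less_le)
qed

lemma smooth_bump: "smooth bump"
  using smooth_affine[OF smooth_bump0, of "1 / (\<integral>s. bump0 s \<partial>lborel)" 1 0] by (simp add: bump_def[abs_def])

lemma bump_nonneg: "bump t \<ge> 0"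
  using integral_bump0_pos bump0_nonneg by (simp add: bump_def)

lemma bump_zero: "\<bar>t\<bar> \<ge> 1 \<Longrightarrow> bump t = 0"
  by (simp add: bump_def bump0_zero)

lemma integrable_bump: "integrable lborel bump" "(\<integral>t. bump t \<partial>lborel) = 1"
  using integrable_bump0 integral_bump0_pos by (simp_all add: bump_def[abs_def])

text \<open>All cutoffs are scaled copies of one profile rising on [0,1], so the bound
  \<open>H\<close> on its derivatives is the only trace it leaves in the constants.
  \<open>H_ge_1\<close> allows \<open>H\<close> to be replaced by \<open>H\<^sup>2\<close>.\<close>

locale step_fun =
  fixes S S' S'' :: "real \<Rightarrow> real" and H :: real
  assumes S_DERIV: "(S has_real_derivative S' t) (at t)"
    and S'_DERIV: "(S' has_real_derivative S'' t) (at t)"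
    and S''_meas: "S'' \<in> borel_measurable borel"
    and S_zero: "t \<le> 0 \<Longrightarrow> S t = 0" and S_one: "t \<ge> 1 \<Longrightarrow> S t = 1"
    and S_range: "0 \<le> S t" "S t \<le> 1"
    and S'_zero: "t \<le> 0 \<or> t \<ge> 1 \<Longrightarrow> S' t = 0" "t \<le> 0 \<or> t \<ge> 1 \<Longrightarrow> S'' t = 0"
    and S_bounds: "\<bar>S' t\<bar> \<le> H" "\<bar>S'' t\<bar> \<le> H" and H_ge_1: "H \<ge> 1"

lemma step_fun_exists: "\<exists>S S' S'' H. step_fun S S' S'' H"
proof -
  have "\<exists>F. \<forall>x::real. - \<infinity> < ereal x \<longrightarrow> ereal x < \<infinity> \<longrightarrow> (F has_vector_derivative bump0 x) (at x)"
    by (rule einterval_antiderivative) (use smooth_continuous[OF smooth_bump0, of UNIV] in \<open>auto simp: continuous_on_eq_continuous_at\<close>)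
  then obtain F where F: "\<And>x. (F has_real_derivative bump0 x) (at x)"
    by (auto simp: has_real_derivative_iff_has_vector_derivative)
  have Fmono: "F a \<le> F b" if "a \<le> b" for a b
    by (rule DERIV_nonneg_imp_nondecreasing[OF that]) (use F bump0_nonneg in blast)
  have Fc: "F a = F b" if "a \<le> b" "b \<le> -1 \<or> a \<ge> 1" for a b
  proof (cases "a = b")
    case False
    with that have "a < b" by simp
    from MVT2[OF this, of F bump0] F obtain z where "a < z" "z < b" "F b - F a = (b - a) * bump0 z" by blast
    moreover have "bump0 z = 0" using that calculation by (intro bump0_zero) auto
    ultimately show ?thesis by simp
  qed simp
  define D where "D = F 1 - F (-1)"
  have D: "D > 0"
  proof -
    obtain z where "-1 < z" "z < 1" "F 1 - F (-1) = (1 - (-1)) * bump0 z" using MVT2[of "-1" 1 F bump0] F by auto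
    then show ?thesis using bump0_pos[of z] by (simp add: D_def)
  qed
  \<comment> \<open>The substitution 2 t - 1 carries [0,1] to [-1,1], the support of
    \<open>bump0\<close>; the antiderivative is normalised by its total increase
    \<open>D\<close>.\<close>
  define S where "S t = (F (2 * t - 1) - F (-1)) / D" for t
  define S' where "S' t = (2 / D) * bump0 (2 * t + (-1))" for t
  define S'' where "S'' t = (4 / D) * deriv bump0 (2 * t + (-1))" for t
  have smS': "smooth S'" unfolding S'_def by (intro smooth_affine smooth_bump0)
  have smS'': "smooth S''" unfolding S''_def by (intro smooth_affine smooth_deriv smooth_bump0)
  have dS': "deriv S' = S''" unfolding S'_def S''_def using deriv_affine[OF smooth_bump0, of "2/D" 2 "-1"] by simp
  obtain B1 where B1: "\<And>t. \<bar>S' t\<bar> \<le> B1"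
    using smooth_bounded[OF smS', of 1] by (force simp: S'_def bump0_zero)
  obtain B2 where B2: "\<And>t. \<bar>S'' t\<bar> \<le> B2"
    using smooth_bounded[OF smS'', of 1] deriv_zero_outside[OF smooth_bump0, of 1] by (force simp: S''_def bump0_zero)
  have "step_fun S S' S'' (max 1 (max B1 B2))"
  proof
    fix t
    have "((\<lambda>t. F (2 * t - 1)) has_real_derivative bump0 (2 * t - 1) * 2) (at t)"
      by (rule DERIV_chain2[OF F]) (auto intro!: derivative_eq_intros)
    from DERIV_cmult[OF DERIV_diff[OF this DERIV_const[of "F (-1)"]], of "1/D"]
    show "(S has_real_derivative S' t) (at t)" by (simp add: S_def[abs_def] S'_def mult_ac)
    show "(S' has_real_derivative S'' t) (at t)" using smooth_DERIV[OF smS', of t] by (simp add: dS')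
    show "S'' \<in> borel_measurable borel" by (rule borel_measurable_continuous_onI[OF smooth_continuous[OF smS'']])
    show "S t = 0" if "t \<le> 0" using Fc[of "2*t-1" "-1"] that by (simp add: S_def)
    show "S t = 1" if "t \<ge> 1" using Fc[of "1" "2*t-1"] that D by (simp add: S_def D_def)
    show "0 \<le> S t" using Fmono[of "-1" "2*t-1"] Fc[of "2*t-1" "-1"] D by (cases "t \<ge> 0") (auto simp: S_def)
    show "S t \<le> 1" using Fmono[of "2*t-1" 1] Fc[of 1 "2*t-1"] D by (cases "t \<le> 1") (auto simp: S_def D_def)
    show "S' t = 0" if "t \<le> 0 \<or> t \<ge> 1" using that by (auto simp: S'_def intro!: bump0_zero)
    show "S'' t = 0" if "t \<le> 0 \<or> t \<ge> 1"
    proof -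
      \<comment> \<open>Where the nonnegative \<open>bump0\<close> vanishes it has a minimum, so its
        derivative is 0. This includes the endpoints, which \<open>deriv_zero_outside\<close> does
        not reach.\<close>
      have "deriv bump0 (2 * t + (-1)) = 0"
        by (rule DERIV_local_min[OF smooth_DERIV[OF smooth_bump0], of 1])
           (use that bump0_zero[of "2 * t + (-1)"] bump0_nonneg in auto)
      then show ?thesis by (simp add: S''_def)
    qed
    show "\<bar>S' t\<bar> \<le> max 1 (max B1 B2)" using B1[of t] by simp
    show "\<bar>S'' t\<bar> \<le> max 1 (max B1 B2)" using B2[of t] by simp
  qed simp
  then show ?thesis by blast
qed

section \<open>The volume of balls\<close>

lemma measurable_comp_LM: "i < n \<Longrightarrow> (\<lambda>x. x i) \<in> borel_measurable (LM n)"
  using measurable_component_singleton[of i "{..<n}" "\<lambda>_. lborel::real measure"] by simp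

lemma pnorm_eq: "pnorm n x = sqrt (\<Sum>i<n. (x i)\<^sup>2)"
  by (simp add: pnorm_def L2_set_def)

lemma pnorm_measurable [measurable]: "pnorm n \<in> borel_measurable (LM n)"
  unfolding pnorm_eq[abs_def] using measurable_comp_LM[of _ n]
  by (intro measurable_compose[OF _ borel_measurable_sqrt] borel_measurable_sum borel_measurable_power) auto

lemma pnorm_nonneg [simp]: "pnorm n x \<ge> 0"
  by (simp add: pnorm_eq sum_nonneg)

definition ball0 :: "nat \<Rightarrow> real \<Rightarrow> point set" where
  "ball0 n R = {x \<in> Rn n. pnorm n x < R}"

lemma sets_ball0 [measurable]: "ball0 n R \<in> sets (LM n)"
proof -
  have "{x \<in> space (LM n). pnorm n x < R} \<in> sets (LM n)" by measurable
  then show ?thesis by (simp add: ball0_def)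
qed

lemma gaussian_integral:
  assumes "\<sigma> > 0"
  shows "integrable lborel (\<lambda>t. exp (- (t\<^sup>2 / (2 * \<sigma>\<^sup>2))))" "(\<integral>t. exp (- (t\<^sup>2 / (2 * \<sigma>\<^sup>2))) \<partial>lborel) = sqrt (2 * pi) * \<sigma>"
proof -
  have eq: "exp (- (t\<^sup>2 / (2 * \<sigma>\<^sup>2))) = sqrt (2 * pi * \<sigma>\<^sup>2) * normal_density 0 \<sigma> t" for t
    using assms by (simp add: normal_density_def)
  show "integrable lborel (\<lambda>t. exp (- (t\<^sup>2 / (2 * \<sigma>\<^sup>2))))"
    unfolding eq using integrable_normal_density[OF assms] by auto
  show "(\<integral>t. exp (- (t\<^sup>2 / (2 * \<sigma>\<^sup>2))) \<partial>lborel) = sqrt (2 * pi) * \<sigma>"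
    unfolding eq using integral_normal_density[OF assms] assms by (simp add: real_sqrt_mult)
qed

text \<open>Comparing the indicator of the ball with a Gaussian gives the right order \<open>n powr (-1/2)\<close> of the
  \<open>n\<close>-th root of the volume; this is what makes the final constant independent of the dimension.\<close>

lemma measure_ball0_root:
  assumes "n \<ge> 1" "R > 0"
  shows "emeasure (LM n) (ball0 n R) < \<infinity>" "measure (LM n) (ball0 n R) powr (1 / real n) \<le> 5 * R / sqrt (real n)"
proof -
  \<comment> \<open>With this width the Gaussian is at least exp(-n/2) on the ball, so the factor
    exp(n/2) makes \<open>?g\<close> dominate the indicator.\<close>
  define \<sigma> where "\<sigma> = R / sqrt (real n)"
  have \<sigma>: "\<sigma> > 0" "\<sigma>\<^sup>2 = R\<^sup>2 / real n" using assms by (auto simp: \<sigma>_def power_divide)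
  let ?g = "\<lambda>x. exp (real n / 2) * (\<Prod>i<n. exp (- ((x i)\<^sup>2 / (2 * \<sigma>\<^sup>2))))"
  have ig: "integrable (LM n) ?g"
    by (intro integrable_mult_right lb.product_integrable_prod gaussian_integral \<sigma>) auto
  have le: "indicat_real (ball0 n R) x \<le> ?g x" for x
  proof (cases "x \<in> ball0 n R")
    case True
    then have "(pnorm n x)\<^sup>2 \<le> R\<^sup>2" by (intro power_mono) (auto simp: ball0_def)
    then have "(\<Sum>i<n. (x i)\<^sup>2) \<le> R\<^sup>2" by (simp add: pnorm_eq sum_nonneg)
    then have "(\<Sum>i<n. (x i)\<^sup>2) / (2 * \<sigma>\<^sup>2) \<le> real n / 2"
      unfolding \<sigma> using assms by (simp add: field_simps)
    then have "0 \<le> real n / 2 + (\<Sum>i<n. - ((x i)\<^sup>2 / (2 * \<sigma>\<^sup>2)))"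
      by (simp add: sum_negf sum_divide_distrib)
    then have "1 \<le> exp (real n / 2 + (\<Sum>i<n. - ((x i)\<^sup>2 / (2 * \<sigma>\<^sup>2))))" by simp
    also have "\<dots> = ?g x" by (simp add: exp_add exp_sum)
    finally show ?thesis using True by simp
  next
    case False then show ?thesis by (simp add: prod_nonneg)
  qed
  have "integrable (LM n) (indicat_real (ball0 n R))"
  proof (rule Bochner_Integration.integrable_bound[OF ig])
    show "AE x in LM n. norm (indicat_real (ball0 n R) x) \<le> norm (?g x)"
      using le by (intro AE_I2) (auto simp: prod_nonneg abs_mult intro: order_trans[OF _ abs_ge_self])
  qed measurable
  then show fin: "emeasure (LM n) (ball0 n R) < \<infinity>"
    using sets_ball0[of n R] sets.Int_space_eq2[OF sets_ball0[of n R]] by (simp add: integrable_indicator_iff)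
  have "measure (LM n) (ball0 n R) = (\<integral>x. indicat_real (ball0 n R) x \<partial>LM n)"
    using sets.sets_into_space[OF sets_ball0[of n R]] by (simp add: Int_absorb2)
  also have "\<dots> \<le> (\<integral>x. ?g x \<partial>LM n)"
    by (rule integral_mono) (use fin ig le in auto)
  also have "\<dots> = exp (real n / 2) * (\<Prod>i<n. (\<integral>t. exp (- (t\<^sup>2 / (2 * \<sigma>\<^sup>2))) \<partial>lborel))"
    by (simp only: integral_mult_right_zero) (subst lb.product_integral_prod, auto intro: gaussian_integral \<sigma>)
  also have "\<dots> = exp (real n / 2) * (sqrt (2 * pi) * \<sigma>) ^ n"
    by (simp only: gaussian_integral(2)[OF \<sigma>(1)] prod_constant card_lessThan)
  also have "\<dots> = (exp (1/2) * (sqrt (2 * pi) * \<sigma>)) powr real n"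
    using \<sigma> assms by (simp add: powr_mult powr_realpow exp_powr_real mult_ac power_mult_distrib)
  finally have "measure (LM n) (ball0 n R) powr (1 / real n) \<le> ((exp (1/2) * (sqrt (2 * pi) * \<sigma>)) powr real n) powr (1 / real n)"
    by (intro powr_mono2) auto
  also have "\<dots> = exp (1/2) * (sqrt (2 * pi) * \<sigma>)" using \<sigma> assms by (simp add: powr_powr)
  also have "\<dots> = (exp (1/2) * sqrt (2 * pi)) * \<sigma>" by simp
  also have "\<dots> \<le> 5 * \<sigma>"
  proof (intro mult_right_mono)
    \<comment> \<open>The square of the constant is 2 pi e, less than 24, so 5 is a sufficient bound
      for it.\<close>
    have "(exp (1/2) * sqrt (2 * pi))\<^sup>2 = exp 1 * (2 * pi)"
      by (simp add: power_mult_distrib exp_double[symmetric])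
    also have "\<dots> \<le> 3 * (2 * 4)" using exp_le pi_less_4 by (intro mult_mono) auto
    also have "\<dots> \<le> 5\<^sup>2" by simp
    finally show "exp (1/2) * sqrt (2 * pi) \<le> 5" by (rule power2_le_imp_le) simp
  qed (use \<sigma> in auto)
  finally show "measure (LM n) (ball0 n R) powr (1 / real n) \<le> 5 * R / sqrt (real n)" by (simp add: \<sigma>_def)
qed

section \<open>The Carleman inequality for twice differentiable functions\<close>

lemma topspace_Rn_top [simp]: "topspace (Rn_top n) = Rn n"
  by (simp add: Rn_top_def Rn_def)

text \<open>Borel sets of the space of all real sequences are product measurable. An open set is
  pulled back there along the restriction to the first \<open>n\<close> coordinates, and it returns
  along the extension by 0.\<close>

lemma openin_Rn_sets:
  assumes "openin (Rn_top n) U" shows "U \<in> sets (LM n)"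
proof -
  let ?R = "\<lambda>x::nat \<Rightarrow> real. restrict x {..<n}"
  let ?J = "\<lambda>x i. if i < n then x i else (0::real)"
  have "continuous_map euclidean (Rn_top n) ?R"
    unfolding Rn_top_def continuous_map_componentwise
    by (auto simp: continuous_on_product_coordinates)
  then have "open {x. ?R x \<in> U}"
    using assms openin_continuous_map_preimage[of euclidean "Rn_top n" ?R U] by simp
  then have bo: "{x. ?R x \<in> U} \<in> sets (Pi\<^sub>M UNIV (\<lambda>i::nat. borel :: real measure))"
    by (simp add: sets_PiM_equal_borel)
  have J: "?J \<in> LM n \<rightarrow>\<^sub>M Pi\<^sub>M UNIV (\<lambda>i::nat. borel :: real measure)"
  proof (rule measurable_PiM_single')
    fix i :: nat show "(\<lambda>x. ?J x i) \<in> borel_measurable (LM n)"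
      using measurable_comp_LM[of i n] by (cases "i < n") auto
  qed (auto simp: space_PiM)
  have "?J -` {x. ?R x \<in> U} \<inter> space (LM n) \<in> sets (LM n)"
    by (rule measurable_sets[OF J bo])
  also have "?J -` {x. ?R x \<in> U} \<inter> space (LM n) = U"
  proof -
    have "?R (?J x) = x" if "x \<in> Rn n" for x
      using that by (auto simp: Rn_def PiE_def extensional_def fun_eq_iff restrict_def)
    moreover have "U \<subseteq> Rn n" using openin_subset[OF assms] by simp
    ultimately show ?thesis by auto
  qed
  finally show ?thesis .
qed

lemma continuous_map_Rn_measurable:
  assumes "continuous_map (Rn_top n) euclideanreal f" shows "f \<in> borel_measurable (LM n)"
proof (rule borel_measurableI)
  fix S :: "real set" assume "open S"
  then have "openin (Rn_top n) {x \<in> topspace (Rn_top n). f x \<in> S}"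
    by (intro openin_continuous_map_preimage[OF assms]) auto
  moreover have "{x \<in> topspace (Rn_top n). f x \<in> S} = f -` S \<inter> space (LM n)" by auto
  ultimately show "f -` S \<inter> space (LM n) \<in> sets (LM n)" using openin_Rn_sets by metis
qed

lemma Hausdorff_Rn_top: "Hausdorff_space (Rn_top n)"
  by (simp add: Rn_top_def Hausdorff_space_product_topology)

lemma compactin_Rn_sets: "compactin (Rn_top n) K \<Longrightarrow> K \<in> sets (LM n)"
proof -
  assume K: "compactin (Rn_top n) K"
  have "openin (Rn_top n) (Rn n - K)"
    using compactin_imp_closedin[OF Hausdorff_Rn_top K] by (simp add: closedin_def)
  then have "space (LM n) - (Rn n - K) \<in> sets (LM n)" by (intro sets.compl_sets openin_Rn_sets)
  moreover have "space (LM n) - (Rn n - K) = K" using compactin_subset_topspace[OF K] by auto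
  ultimately show ?thesis by simp
qed

lemma compactin_Rn_bounded:
  assumes K: "compactin (Rn_top n) K" shows "\<exists>R. K \<subseteq> cube n R"
proof -
  have "\<exists>R. \<forall>x\<in>K. \<bar>x i\<bar> \<le> R" if "i < n" for i
  proof -
    have "continuous_map (Rn_top n) euclideanreal (\<lambda>x. x i)"
      unfolding Rn_top_def using that by (intro continuous_map_product_projection) auto
    from image_compactin[OF K this] have "bounded ((\<lambda>x. x i) ` K)" by (simp add: compact_imp_bounded)
    then show ?thesis by (auto simp: bounded_iff)
  qed
  then obtain R where R: "\<And>i x. i < n \<Longrightarrow> x \<in> K \<Longrightarrow> \<bar>x i\<bar> \<le> R i" by metis
  have "K \<subseteq> cube n (\<Sum>i<n. \<bar>R i\<bar>)"
  proof
    fix x assume x: "x \<in> K"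
    have "\<bar>x i\<bar> \<le> (\<Sum>i<n. \<bar>R i\<bar>)" if "i < n" for i
      using R[OF that x] member_le_sum[of i "{..<n}" "\<lambda>i. \<bar>R i\<bar>"] that by auto
    moreover have "x \<in> Rn n" using compactin_subset_topspace[OF K] x by auto
    ultimately show "x \<in> cube n (\<Sum>i<n. \<bar>R i\<bar>)" by (simp add: cube_iff)
  qed
  then show ?thesis ..
qed

section \<open>Integration over subsets with the completed measure\<close>

lemma space_leb [simp]: "space (leb n) = Rn n"
  by (simp add: leb_def)

lemma sets_LM_leb: "A \<in> sets (LM n) \<Longrightarrow> A \<in> sets (leb n)"
  by (simp add: leb_def sets_completionI_sets)

lemma LM_leb_measurable: "f \<in> borel_measurable (LM n) \<Longrightarrow> f \<in> borel_measurable (leb n)"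
  by (simp add: leb_def measurable_completion)

lemma integrable_leb_on_iff:
  assumes "A \<in> sets (LM n)" "(f :: point \<Rightarrow> real) \<in> borel_measurable (LM n)"
  shows "integrable (leb_on n A) f \<longleftrightarrow> integrable (LM n) (\<lambda>x. indicator A x * f x)"
proof -
  have *: "A \<inter> space (leb n) \<in> sets (leb n)" using assms(1) sets_LM_leb by (metis sets.Int_space_eq2)
  have "integrable (leb_on n A) f \<longleftrightarrow> integrable (leb n) (\<lambda>x. indicator A x * f x)"
    using integrable_restrict_space[OF *, of f] by simp
  also have "\<dots> \<longleftrightarrow> integrable (LM n) (\<lambda>x. indicator A x * f x)"
    unfolding leb_def by (rule integrable_completion) (intro borel_measurable_times borel_measurable_indicator assms)
  finally show ?thesis .
qed

lemma integral_leb_on: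
  assumes "A \<in> sets (LM n)" "(f :: point \<Rightarrow> real) \<in> borel_measurable (LM n)"
  shows "(LINT x|leb_on n A. f x) = (LINT x|LM n. indicator A x * f x)"
proof -
  have *: "A \<inter> space (leb n) \<in> sets (leb n)" using assms(1) sets_LM_leb by (metis sets.Int_space_eq2)
  have "(LINT x|leb_on n A. f x) = (LINT x|leb n. indicator A x * f x)"
    using integral_restrict_space[OF *, of f] by simp
  also have "\<dots> = (LINT x|LM n. indicator A x * f x)"
    unfolding leb_def by (rule integral_completion) (intro borel_measurable_times borel_measurable_indicator assms)
  finally show ?thesis .
qed

lemma leb_on_Lq_norm:
  assumes "A \<in> sets (LM n)" "f \<in> borel_measurable (LM n)" "q > 0"
  shows "Lq_norm (leb_on n A) q f = Lq_norm (LM n) q (\<lambda>x. indicator A x * f x)"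
proof -
  have "(\<lambda>x. indicator A x * \<bar>f x\<bar> powr q) = (\<lambda>x. \<bar>indicator A x * f x\<bar> powr q)"
    using assms(3) by (auto simp: indicator_def)
  moreover have "(\<lambda>x. \<bar>f x\<bar> powr q) \<in> borel_measurable (LM n)" using assms(2) by (rule measurable_abs_powr)
  ultimately show ?thesis unfolding Lq_norm_def using integral_leb_on[OF assms(1)] by simp
qed

lemma pball_origin: "pball n (origin n) R = ball0 n R"
  by (auto simp: pball_def ball0_def pdist_def pnorm_def origin_def L2_set_def)

lemma bdd_meas_locally_integrable:
  assumes "bdd_meas n f" shows "locally_integrable n \<Omega> f"
  unfolding locally_integrable_def
proof (intro allI impI)
  fix K assume "compactin (Rn_top n) K \<and> K \<subseteq> \<Omega>"
  then have K: "compactin (Rn_top n) K" by blast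
  obtain R where R: "K \<subseteq> cube n R" using compactin_Rn_bounded[OF K] by blast
  have [measurable]: "K \<in> sets (LM n)" by (rule compactin_Rn_sets[OF K])
  have "bdd_supp n (\<lambda>x. indicator K x * f x)"
  proof (rule bdd_supp_mult[OF _ assms])
    have "bdd_meas n (indicat_real K)" unfolding bdd_meas_def by (auto intro!: exI[of _ 1] simp: indicator_def)
    moreover have "box_supp n (indicat_real K)" unfolding box_supp_def
      by (intro exI[of _ R]) (use R cube_iff in \<open>auto simp: indicator_def\<close>)
    ultimately show "bdd_supp n (indicat_real K)" by (simp add: bdd_supp_def)
  qed
  then show "integrable (leb_on n K) f"
    by (subst integrable_leb_on_iff) (use assms in \<open>auto simp: bdd_meas_def intro: bdd_supp_integrable\<close>)
qed

lemma continuous_pnorm_line: "continuous_on UNIV (\<lambda>t. pnorm n (y(j := t)))"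
proof -
  have "continuous_on UNIV (\<lambda>t. (y(j := t)) i)" for i by (cases "i = j") auto
  then show ?thesis unfolding pnorm_eq by (intro continuous_intros continuous_on_sum)
qed

lemma continuous_map_line:
  assumes "x \<in> Rn n" "i < n" shows "continuous_map euclideanreal (Rn_top n) (\<lambda>t. x(i := t))"
  unfolding Rn_top_def continuous_map_componentwise
  using assms by (auto simp: Rn_def PiE_def extensional_def)

text \<open>A compact set is closed here, so off its support a test function vanishes on a
  neighbourhood, and with it the partial derivatives vanish.\<close>

lemma test_function_facts:
  assumes "\<phi> \<in> test_functions n \<Omega>"
  shows "bdd_supp n \<phi>" "i < n \<Longrightarrow> bdd_supp n (partial_deriv i \<phi>)" "i < n \<Longrightarrow> has_pderiv n i \<phi> (partial_deriv i \<phi>)"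
    "x \<in> Rn n - \<Omega> \<Longrightarrow> \<phi> x = 0" "x \<in> Rn n - \<Omega> \<Longrightarrow> i < n \<Longrightarrow> partial_deriv i \<phi> x = 0"
proof -
  obtain K where K: "compactin (Rn_top n) K" "K \<subseteq> \<Omega>" "\<And>x. x \<in> Rn n - K \<Longrightarrow> \<phi> x = 0"
    using assms by (auto simp: test_functions_def)
  have Ck: "Ck n (Suc 0) \<phi>" using assms unfolding test_functions_def by blast
  obtain R where R: "K \<subseteq> cube n R" using compactin_Rn_bounded[OF K(1)] by blast
  have has_pderiv: "has_pderiv n i \<phi> (partial_deriv i \<phi>)" if "i < n" for i
    using Ck that unfolding has_pderiv_def by (auto simp: partial_deriv_def DERIV_deriv_iff_real_differentiable)
  have op: "openin (Rn_top n) (Rn n - K)"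
    using compactin_imp_closedin[OF Hausdorff_Rn_top K(1)] by (simp add: closedin_def)
  have z: "partial_deriv i \<phi> x = 0" if x: "x \<in> Rn n - K" and i: "i < n" for x i
  proof -
    have x': "x \<in> Rn n" using x by simp
    have "open {t. x(i := t) \<in> Rn n - K}"
      using openin_continuous_map_preimage[OF continuous_map_line[OF x' i] op] by simp
    moreover have "x i \<in> {t. x(i := t) \<in> Rn n - K}" using x by simp
    ultimately have "eventually (\<lambda>t. t \<in> {t. x(i := t) \<in> Rn n - K}) (nhds (x i))"
      by (rule eventually_nhds_in_open)
    then have ev: "eventually (\<lambda>t. \<phi> (x(i := t)) = 0) (nhds (x i))"
      by (rule eventually_mono) (use K(3) in blast)
    have "((\<lambda>t. \<phi> (x(i := t))) has_real_derivative partial_deriv i \<phi> x) (at (x i))"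
      using has_pderiv[OF i] x' by (auto simp: has_pderiv_def)
    from DERIV_cong_ev[THEN iffD1, OF refl ev refl this]
    show ?thesis using DERIV_unique[OF _ DERIV_const[of 0]] by blast
  qed
  have bdd_supp: "bdd_supp n f" if f: "continuous_map (Rn_top n) euclideanreal f" and 0: "\<And>x. x \<in> Rn n - K \<Longrightarrow> f x = 0" for f
  proof -
    have "bounded (f ` K)" using image_compactin[OF K(1) f] by (simp add: compact_imp_bounded)
    then obtain B where B: "\<And>x. x \<in> K \<Longrightarrow> \<bar>f x\<bar> \<le> B" by (auto simp: bounded_iff)
    have "\<forall>x\<in>Rn n. \<bar>f x\<bar> \<le> \<bar>B\<bar>"
    proof
      fix x assume "x \<in> Rn n" then show "\<bar>f x\<bar> \<le> \<bar>B\<bar>" using B[of x] 0[of x] by (cases "x \<in> K") auto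
    qed
    moreover have "\<forall>x\<in>Rn n. f x \<noteq> 0 \<longrightarrow> (\<forall>i<n. \<bar>x i\<bar> \<le> R)"
      using 0 R cube_iff by (metis DiffI subsetD)
    ultimately show ?thesis
      using continuous_map_Rn_measurable[OF f] unfolding bdd_supp_def bdd_meas_def box_supp_def by blast
  qed
  show "bdd_supp n \<phi>" by (rule bdd_supp) (use Ck K in auto)
  show "i < n \<Longrightarrow> bdd_supp n (partial_deriv i \<phi>)" using Ck z by (intro bdd_supp) auto
  show "i < n \<Longrightarrow> has_pderiv n i \<phi> (partial_deriv i \<phi>)" by (rule has_pderiv)
  show "x \<in> Rn n - \<Omega> \<Longrightarrow> \<phi> x = 0" using K by auto
  show "x \<in> Rn n - \<Omega> \<Longrightarrow> i < n \<Longrightarrow> partial_deriv i \<phi> x = 0" using K z by auto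
qed

section \<open>Product rules, weak derivatives and twice differentiable functions\<close>

lemma has_pderiv_mult:
  assumes "has_pderiv n i f D" "has_pderiv n i g E" shows "has_pderiv n i (\<lambda>x. f x * g x) (\<lambda>x. D x * g x + f x * E x)"
  unfolding has_pderiv_def
proof
  fix x assume "x \<in> Rn n"
  then have "((\<lambda>t. f (x(i := t))) has_real_derivative D x) (at (x i))"
    "((\<lambda>t. g (x(i := t))) has_real_derivative E x) (at (x i))" using assms by (auto simp: has_pderiv_def)
  from DERIV_mult[OF this] show "((\<lambda>t. f (x(i := t)) * g (x(i := t))) has_real_derivative D x * g x + f x * E x) (at (x i))"
    by (simp add: algebra_simps)
qed

lemma has_pderiv_add:
  assumes "has_pderiv n i f D" "has_pderiv n i g E" shows "has_pderiv n i (\<lambda>x. f x + g x) (\<lambda>x. D x + E x)"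
  using assms unfolding has_pderiv_def by (auto intro!: derivative_intros)

text \<open>The product with a test function has bounded support, so its derivative integrates to 0
  over the whole space; outside \<Omega> the test function and its derivatives vanish.\<close>

lemma has_pderiv_weak_pderiv:
  assumes "bdd_meas n f" "bdd_meas n g" "has_pderiv n i f g" "i < n" "\<Omega> \<in> sets (LM n)"
  shows "weak_pderiv n \<Omega> i f g"
  unfolding weak_pderiv_def
proof (intro conjI ballI bdd_meas_locally_integrable assms)
  fix \<phi> assume \<phi>: "\<phi> \<in> test_functions n \<Omega>"
  note t = test_function_facts[OF \<phi>]
  note b = t(1) and b' = t(2)[OF assms(4)]
  have b1: "bdd_supp n (\<lambda>x. f x * partial_deriv i \<phi> x)" by (rule bdd_supp_mult2[OF assms(1) b'])
  have b2: "bdd_supp n (\<lambda>x. g x * \<phi> x)" by (rule bdd_supp_mult2[OF assms(2) b])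
  have "(LINT x|LM n. g x * \<phi> x + f x * partial_deriv i \<phi> x) = 0"
    by (rule integral_has_pderiv_eq_0[OF has_pderiv_mult[OF assms(3) t(3)[OF assms(4)]] assms(4)])
       (use b1 b2 bdd_supp_mult2[OF assms(1) b] in \<open>auto intro: bdd_supp_bdd_meas bdd_supp_add\<close>)
  then have "(LINT x|LM n. g x * \<phi> x) + (LINT x|LM n. f x * partial_deriv i \<phi> x) = 0"
    using bdd_supp_integrable[OF b1] bdd_supp_integrable[OF b2] by simp
  moreover have "(LINT x|leb_on n \<Omega>. f x * partial_deriv i \<phi> x) = (LINT x|LM n. f x * partial_deriv i \<phi> x)"
    unfolding integral_leb_on[OF assms(5) bdd_supp_measurable[OF b1]]
    using t(5) assms(4) by (intro Bochner_Integration.integral_cong) (auto simp: indicator_def)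
  moreover have "(LINT x|leb_on n \<Omega>. g x * \<phi> x) = (LINT x|LM n. g x * \<phi> x)"
    unfolding integral_leb_on[OF assms(5) bdd_supp_measurable[OF b2]]
    using t(4) by (intro Bochner_Integration.integral_cong) (auto simp: indicator_def)
  ultimately show "(LINT x|leb_on n \<Omega>. f x * partial_deriv i \<phi> x) = - (LINT x|leb_on n \<Omega>. g x * \<phi> x)" by simp
qed

text \<open>The derivatives are carried along explicitly; in \<open>H i j\<close> the second
  differentiation is in direction \<open>j\<close>. Second derivatives are measurable rather than
  continuous, in accordance with what \<open>step_fun\<close> records of \<open>S''\<close>.\<close>

definition C2 :: "nat \<Rightarrow> (point \<Rightarrow> real) \<Rightarrow> (nat \<Rightarrow> point \<Rightarrow> real) \<Rightarrow> (nat \<Rightarrow> nat \<Rightarrow> point \<Rightarrow> real) \<Rightarrow> bool" where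
  "C2 n f D H \<longleftrightarrow> bdd_meas n f \<and> (\<forall>i<n. bdd_meas n (D i) \<and> has_pderiv n i f (D i)) \<and>
     (\<forall>i<n. \<forall>j<n. bdd_meas n (H i j) \<and> has_pderiv n j (D i) (H i j))"

definition lapl :: "nat \<Rightarrow> (nat \<Rightarrow> nat \<Rightarrow> point \<Rightarrow> real) \<Rightarrow> point \<Rightarrow> real" where
  "lapl n H x = (\<Sum>i<n. H i i x)"

lemma C2_D:
  assumes "C2 n f D H"
  shows "bdd_meas n f" "i < n \<Longrightarrow> bdd_meas n (D i)" "i < n \<Longrightarrow> has_pderiv n i f (D i)"
    "i < n \<Longrightarrow> j < n \<Longrightarrow> bdd_meas n (H i j)" "i < n \<Longrightarrow> j < n \<Longrightarrow> has_pderiv n j (D i) (H i j)" "bdd_meas n (lapl n H)"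
  using assms unfolding C2_def lapl_def[abs_def] by (auto intro!: bdd_meas_sum)

lemma C2_mult:
  assumes f: "C2 n f D H" and g: "C2 n g E K"
  shows "C2 n (\<lambda>x. f x * g x) (\<lambda>i x. D i x * g x + f x * E i x)
    (\<lambda>i j x. (H i j x * g x + D i x * E j x) + (D j x * E i x + f x * K i j x))"
  unfolding C2_def
  using C2_D[OF f] C2_D[OF g] by (auto intro!: bdd_meas_mult bdd_meas_add has_pderiv_mult has_pderiv_add)

lemma C2_diff:
  assumes f: "C2 n f D H" and g: "C2 n g E K"
  shows "C2 n (\<lambda>x. f x - g x) (\<lambda>i x. D i x - E i x) (\<lambda>i j x. H i j x - K i j x)"
  unfolding C2_def
  using C2_D[OF f] C2_D[OF g] by (auto intro!: bdd_meas_diff simp: has_pderiv_def intro!: derivative_intros)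

lemma C2_const: "C2 n (\<lambda>_. c) (\<lambda>_ _. 0) (\<lambda>_ _ _. 0)"
  by (auto simp: C2_def has_pderiv_def)

text \<open>The left side repeats the second derivatives produced by \<open>C2_mult\<close>
  literally, so that the product rule for the Laplacian applies to them directly.\<close>

lemma lapl_mult:
  "lapl n (\<lambda>i j x. (H i j x * g x + D i x * E j x) + (D j x * E i x + f x * K i j x)) x =
   lapl n H x * g x + 2 * (\<Sum>i<n. D i x * E i x) + f x * lapl n K x"
  by (simp add: lapl_def sum.distrib sum_distrib_left sum_distrib_right algebra_simps)

text \<open>The Carleman hypothesis is only ever used for twice differentiable functions, for which all the
  norms in it are genuine integrals.\<close>

lemma Carleman_C2:
  assumes C: "Carleman_constant n \<theta>" and \<mu>: "\<mu> \<in> Carleman_exponents n" and n: "n \<ge> 3"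
    and w: "C2 n w D H" and ab: "0 < a" "a < b"
    and supp: "\<And>x. x \<in> Rn n \<Longrightarrow> pnorm n x < a \<or> pnorm n x > b \<Longrightarrow> w x = 0"
  shows "Lq_norm (LM n) (exponent_p' n) (\<lambda>x. pnorm n x powr (- \<mu>) * w x)
    \<le> \<theta> * Lq_norm (LM n) (exponent_p n) (\<lambda>x. pnorm n x powr (- \<mu>) * lapl n H x)"
proof -
  \<comment> \<open>The support has to lie inside the open ball together with its boundary points,
    since \<open>ess_support\<close> is closed in the whole space.\<close>
  define R where "R = b + 1"
  define B where "B = ball0 n R"
  have B[measurable]: "B \<in> sets (LM n)" by (simp add: B_def)
  have pp: "exponent_p n > 0" "exponent_p' n > 0" using n by (auto simp: exponent_p_def exponent_p'_def)
  have bndLp: "g \<in> Lp_space (leb_on n B) (ereal (exponent_p n))" if g: "bdd_meas n g" for g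
  proof -
    have "g \<in> borel_measurable (leb_on n B)"
      using g by (intro measurable_restrict_space1 LM_leb_measurable) (simp add: bdd_meas_def)
    moreover have "integrable (leb_on n B) (\<lambda>x. \<bar>g x\<bar> powr exponent_p n)"
    proof (subst integrable_leb_on_iff[OF B])
      show "(\<lambda>x. \<bar>g x\<bar> powr exponent_p n) \<in> borel_measurable (LM n)" using g by (intro measurable_abs_powr) (simp add: bdd_meas_def)
      have "bdd_supp n (indicat_real B)"
        unfolding bdd_supp_def bdd_meas_def box_supp_def
      proof (intro conjI exI ballI impI allI)
        fix x i assume "x \<in> Rn n" "indicat_real B x \<noteq> 0" "i < n"
        then have "(x i)\<^sup>2 \<le> (pnorm n x)\<^sup>2" "pnorm n x < R"
          using member_le_sum[of i "{..<n}" "\<lambda>i. (x i)\<^sup>2"]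
          by (auto simp: pnorm_eq sum_nonneg indicator_def B_def ball0_def split: if_splits)
        then show "\<bar>x i\<bar> \<le> R" using abs_le_square_iff[of "x i" "pnorm n x"] by auto
      next
        fix x show "\<bar>indicat_real B x\<bar> \<le> 1" by (auto simp: indicator_def)
      qed measurable
      then show "integrable (LM n) (\<lambda>x. indicat_real B x * \<bar>g x\<bar> powr exponent_p n)"
        using g pp by (intro bdd_supp_integrable bdd_supp_mult bdd_meas_powr) auto
    qed
    ultimately show ?thesis by (simp add: Lp_space_def)
  qed
  have wp: "weak_pderiv n B i w (D i)" if "i < n" for i using C2_D[OF w] that by (intro has_pderiv_weak_pderiv) auto
  have wp2: "weak_pderiv n B j (D i) (H i j)" if "i < n" "j < n" for i j using C2_D[OF w] that by (intro has_pderiv_weak_pderiv) auto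
  have sob: "w \<in> sobolev n B 2 (ereal (exponent_p n))"
    unfolding numeral_2_eq_2 sobolev.simps
  proof (intro CollectI conjI allI impI)
    show "w \<in> Lp_space (leb_on n B) (ereal (exponent_p n))" by (rule bndLp[OF C2_D(1)[OF w]])
    fix i assume i: "i < n"
    have "D i \<in> {f \<in> Lp_space (leb_on n B) (ereal (exponent_p n)).
      \<forall>j<n. \<exists>g\<in>Lp_space (leb_on n B) (ereal (exponent_p n)). weak_pderiv n B j f g}"
    proof (intro CollectI conjI allI impI)
      show "D i \<in> Lp_space (leb_on n B) (ereal (exponent_p n))" by (rule bndLp[OF C2_D(2)[OF w i]])
      fix j assume j: "j < n"
      show "\<exists>g\<in>Lp_space (leb_on n B) (ereal (exponent_p n)). weak_pderiv n B j (D i) g"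
        by (rule bexI[of _ "H i j"], rule wp2[OF i j], rule bndLp[OF C2_D(4)[OF w i j]])
    qed
    then show "\<exists>g\<in>{f \<in> Lp_space (leb_on n B) (ereal (exponent_p n)).
      \<forall>j<n. \<exists>g\<in>Lp_space (leb_on n B) (ereal (exponent_p n)). weak_pderiv n B j f g}. weak_pderiv n B i w g"
      by (rule bexI[of _ "D i", rotated]) (rule wp[OF i])
  qed
  have wl: "weak_laplacian n B w (lapl n H)"
    unfolding weak_laplacian_def by (intro exI[of _ D] exI[of _ "\<lambda>i. H i i"]) (use wp wp2 in \<open>auto simp: lapl_def\<close>)
  have ess: "ess_support n B w \<subseteq> B - {origin n}"
  proof
    fix x assume x: "x \<in> ess_support n B w"
    then have xR: "x \<in> Rn n" by (simp add: ess_support_def)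
    have tri: "pnorm n x - pdist n x y \<le> pnorm n y" "pnorm n y \<le> pnorm n x + pdist n x y" for y
      using L2_set_triangle_ineq[of "\<lambda>i. x i - y i" y "{..<n}"] L2_set_triangle_ineq[of "\<lambda>i. y i - x i" x "{..<n}"]
      by (auto simp: pnorm_def pdist_def L2_set_def power2_commute)
    have "\<not> (pnorm n x < a \<or> pnorm n x > b)"
    proof
      assume "pnorm n x < a \<or> pnorm n x > b"
      then obtain \<epsilon> where \<epsilon>: "\<epsilon> > 0" "pnorm n x + \<epsilon> < a \<or> pnorm n x - \<epsilon> > b"
        by (cases "pnorm n x < a") (use that[of "(a - pnorm n x) / 2"] that[of "(pnorm n x - b) / 2"] in \<open>auto simp: field_simps\<close>)
      have "AE y in leb_on n B. y \<in> pball n x \<epsilon> \<longrightarrow> w y = 0"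
      proof (rule AE_I2, intro impI)
        fix y assume "y \<in> pball n x \<epsilon>"
        then have "pdist n x y < \<epsilon>" "y \<in> Rn n" by (auto simp: pball_def)
        then show "w y = 0" using tri[of y] \<epsilon> by (intro supp) auto
      qed
      then show False using x \<epsilon>(1) by (auto simp: ess_support_def)
    qed
    moreover have "pnorm n (origin n) = 0" by (simp add: pnorm_eq origin_def)
    ultimately show "x \<in> B - {origin n}" using xR ab by (auto simp: B_def ball0_def R_def)
  qed
  have R0: "R > 0" using ab by (simp add: R_def)
  have key: "Lp_norm (leb_on n B) (ereal (exponent_p' n)) (\<lambda>x. pnorm n x powr (- \<mu>) * w x)
          \<le> \<theta> * Lp_norm (leb_on n B) (ereal (exponent_p n)) (\<lambda>x. pnorm n x powr (- \<mu>) * lapl n H x)"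
    using C R0 \<mu> sob ess wl unfolding Carleman_constant_def pball_origin B_def by blast
  have m1: "(\<lambda>x. pnorm n x powr (- \<mu>) * g x) \<in> borel_measurable (LM n)" if "g \<in> borel_measurable (LM n)" for g
    using measurable_abs_powr[OF pnorm_measurable, of n "-\<mu>"] that by (intro borel_measurable_times) simp_all
  \<comment> \<open>The hypothesis integrates over the ball only. Outside it the Laplacian vanishes
    as well, because \<open>w\<close>, and then each \<open>D i\<close>, vanishes for |x| > b; so
    both norms extend to the whole space.\<close>
  have z2: "lapl n H x = 0" if x: "x \<in> Rn n" "pnorm n x \<ge> R" for x
  proof -
    have "H i i x = 0" if i: "i < n" for i
    proof -
      have big: "w y = 0 \<and> (\<forall>j<n. D j y = 0)" if y: "y \<in> Rn n" "pnorm n y > b" for y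
      proof (intro conjI allI impI)
        show "w y = 0" using y by (intro supp) auto
        fix j assume j: "j < n"
        have "continuous_on UNIV (\<lambda>t. pnorm n (y(j := t)))"
          by (rule continuous_pnorm_line)
        then have "open {t. pnorm n (y(j := t)) > b}" by (intro open_Collect_less continuous_intros)
        moreover have "y j \<in> {t. pnorm n (y(j := t)) > b}" using y by simp
        ultimately have "eventually (\<lambda>t. t \<in> {t. pnorm n (y(j := t)) > b}) (nhds (y j))"
          by (rule eventually_nhds_in_open)
        then have ev: "eventually (\<lambda>t. w (y(j := t)) = 0) (nhds (y j))"
          by (rule eventually_mono) (use supp Rn_upd[OF y(1) j] in blast)
        have "((\<lambda>t. w (y(j := t))) has_real_derivative D j y) (at (y j))"
          using C2_D(3)[OF w j] y by (auto simp: has_pderiv_def)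
        from DERIV_cong_ev[THEN iffD1, OF refl ev refl this]
        show "D j y = 0" using DERIV_unique[OF _ DERIV_const[of 0]] by blast
      qed
      have "continuous_on UNIV (\<lambda>t. pnorm n (x(i := t)))"
        by (rule continuous_pnorm_line)
      then have "open {t. pnorm n (x(i := t)) > b}" by (intro open_Collect_less continuous_intros)
      moreover have "x i \<in> {t. pnorm n (x(i := t)) > b}" using x by (simp add: R_def)
      ultimately have "eventually (\<lambda>t. t \<in> {t. pnorm n (x(i := t)) > b}) (nhds (x i))"
        by (rule eventually_nhds_in_open)
      then have ev: "eventually (\<lambda>t. D i (x(i := t)) = 0) (nhds (x i))"
        by (rule eventually_mono) (use big Rn_upd[OF x(1) i] i in blast)
      have "((\<lambda>t. D i (x(i := t))) has_real_derivative H i i x) (at (x i))"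
        using C2_D(5)[OF w i i] x by (auto simp: has_pderiv_def)
      from DERIV_cong_ev[THEN iffD1, OF refl ev refl this]
      show ?thesis using DERIV_unique[OF _ DERIV_const[of 0]] by blast
    qed
    then show ?thesis by (simp add: lapl_def)
  qed
  have "Lq_norm (LM n) (exponent_p' n) (\<lambda>x. indicator B x * (pnorm n x powr (- \<mu>) * w x)) = Lq_norm (LM n) (exponent_p' n) (\<lambda>x. pnorm n x powr (- \<mu>) * w x)"
    using supp by (intro Lq_norm_cong) (auto simp: indicator_def B_def ball0_def R_def)
  moreover have "Lq_norm (LM n) (exponent_p n) (\<lambda>x. indicator B x * (pnorm n x powr (- \<mu>) * lapl n H x)) = Lq_norm (LM n) (exponent_p n) (\<lambda>x. pnorm n x powr (- \<mu>) * lapl n H x)"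
    using z2 by (intro Lq_norm_cong) (auto simp: indicator_def B_def ball0_def)
  ultimately show ?thesis
    using key leb_on_Lq_norm[OF B m1 pp(2), of w] leb_on_Lq_norm[OF B m1 pp(1), of "lapl n H"] C2_D[OF w]
    by (simp add: Lp_norm_eq_Lq_norm bdd_meas_def)
qed

section \<open>Radial cutoffs and coercivity\<close>

definition nsq :: "nat \<Rightarrow> point \<Rightarrow> real" where
  "nsq n x = (\<Sum>i<n. (x i)\<^sup>2)"

lemma nsq_pnorm: "nsq n x = (pnorm n x)\<^sup>2"
  by (simp add: nsq_def pnorm_eq sum_nonneg)

lemma nsq_upd: "i < n \<Longrightarrow> nsq n (x(i := t)) = nsq n x - (x i)\<^sup>2 + t\<^sup>2"
  by (simp add: nsq_def sum.remove[of "{..<n}" i])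

lemma nsq_measurable [measurable]: "nsq n \<in> borel_measurable (LM n)"
  unfolding nsq_pnorm[abs_def] by measurable

lemma abs_comp_le_pnorm: "i < n \<Longrightarrow> \<bar>x i\<bar> \<le> pnorm n x"
proof -
  assume "i < n"
  then have "(x i)\<^sup>2 \<le> (pnorm n x)\<^sup>2"
    using member_le_sum[of i "{..<n}" "\<lambda>i. (x i)\<^sup>2"] by (auto simp: nsq_pnorm[symmetric] nsq_def)
  then show ?thesis using abs_le_square_iff[of "x i" "pnorm n x"] by auto
qed

context step_fun
begin

text \<open>The profile is composed with |x|^2 instead of |x|: the inner function is then a
  polynomial, also at the origin.\<close>

definition up :: "nat \<Rightarrow> real \<Rightarrow> real \<Rightarrow> point \<Rightarrow> real" where
  "up n a b x = S ((nsq n x - a\<^sup>2) / (b\<^sup>2 - a\<^sup>2))"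

definition upD :: "nat \<Rightarrow> real \<Rightarrow> real \<Rightarrow> nat \<Rightarrow> point \<Rightarrow> real" where
  "upD n a b i x = S' ((nsq n x - a\<^sup>2) / (b\<^sup>2 - a\<^sup>2)) * (2 * x i / (b\<^sup>2 - a\<^sup>2))"

definition upH :: "nat \<Rightarrow> real \<Rightarrow> real \<Rightarrow> nat \<Rightarrow> nat \<Rightarrow> point \<Rightarrow> real" where
  "upH n a b i j x = S'' ((nsq n x - a\<^sup>2) / (b\<^sup>2 - a\<^sup>2)) * (2 * x j / (b\<^sup>2 - a\<^sup>2)) * (2 * x i / (b\<^sup>2 - a\<^sup>2))
     + S' ((nsq n x - a\<^sup>2) / (b\<^sup>2 - a\<^sup>2)) * ((if i = j then 2 else 0) / (b\<^sup>2 - a\<^sup>2))"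

lemma tau_cases:
  assumes "0 \<le> a" "a < b"
  shows "pnorm n x \<le> a \<Longrightarrow> (nsq n x - a\<^sup>2) / (b\<^sup>2 - a\<^sup>2) \<le> 0"
    "pnorm n x \<ge> b \<Longrightarrow> (nsq n x - a\<^sup>2) / (b\<^sup>2 - a\<^sup>2) \<ge> 1"
    "b\<^sup>2 - a\<^sup>2 > 0"
proof -
  show pos: "b\<^sup>2 - a\<^sup>2 > 0" using assms power_strict_mono[of a b 2] by simp
  show "(nsq n x - a\<^sup>2) / (b\<^sup>2 - a\<^sup>2) \<le> 0" if "pnorm n x \<le> a"
  proof -
    have "(pnorm n x)\<^sup>2 \<le> a\<^sup>2" using that by (intro power_mono) auto
    then show ?thesis using pos unfolding nsq_pnorm by (intro divide_nonpos_pos) auto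
  qed
  show "(nsq n x - a\<^sup>2) / (b\<^sup>2 - a\<^sup>2) \<ge> 1" if "pnorm n x \<ge> b"
  proof -
    have "b\<^sup>2 \<le> (pnorm n x)\<^sup>2" using that assms by (intro power_mono) auto
    then show ?thesis using pos unfolding nsq_pnorm by (simp add: field_simps)
  qed
qed

lemma S_measurable: "S \<in> borel_measurable borel" "S' \<in> borel_measurable borel"
proof -
  have "continuous_on UNIV S" "continuous_on UNIV S'"
    using S_DERIV S'_DERIV by (meson DERIV_isCont continuous_at_imp_continuous_on)+
  then show "S \<in> borel_measurable borel" "S' \<in> borel_measurable borel"
    by (auto intro: borel_measurable_continuous_onI)
qed

lemma up_vals:
  assumes "0 \<le> a" "a < b"
  shows "pnorm n x \<le> a \<Longrightarrow> up n a b x = 0" "pnorm n x \<ge> b \<Longrightarrow> up n a b x = 1"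
    "0 \<le> up n a b x" "up n a b x \<le> 1"
  using tau_cases[OF assms] S_zero S_one S_range unfolding up_def by auto

lemma upD_zero:
  assumes "0 \<le> a" "a < b" "\<not> (a < pnorm n x \<and> pnorm n x < b)"
  shows "upD n a b i x = 0" "upH n a b i j x = 0"
proof -
  have "(nsq n x - a\<^sup>2) / (b\<^sup>2 - a\<^sup>2) \<le> 0 \<or> (nsq n x - a\<^sup>2) / (b\<^sup>2 - a\<^sup>2) \<ge> 1"
    using tau_cases(1,2)[OF assms(1,2), of n x] assms(3) by linarith
  from S'_zero[OF this] show "upD n a b i x = 0" "upH n a b i j x = 0" by (simp_all add: upD_def upH_def)
qed

lemma has_pderiv_tau:
  assumes "i < n" "\<And>t. (F has_real_derivative F' t) (at t)"
  shows "has_pderiv n i (\<lambda>x. F ((nsq n x - \<alpha>) / \<beta>)) (\<lambda>x. F' ((nsq n x - \<alpha>) / \<beta>) * (2 * x i / \<beta>))"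
  unfolding has_pderiv_def
proof
  fix x assume "x \<in> Rn n"
  have "((\<lambda>t. (nsq n (x(i := t)) - \<alpha>) / \<beta>) has_real_derivative 2 * x i / \<beta>) (at (x i))"
    unfolding nsq_upd[OF assms(1)] by (rule DERIV_cdivide) (auto intro!: derivative_eq_intros)
  from DERIV_chain2[OF _ this, of F]
  show "((\<lambda>t. F ((nsq n (x(i := t)) - \<alpha>) / \<beta>)) has_real_derivative F' ((nsq n x - \<alpha>) / \<beta>) * (2 * x i / \<beta>)) (at (x i))"
    using assms(2) by simp
qed

lemma has_pderiv_coord: "has_pderiv n j (\<lambda>x. c * x i / \<beta>) (\<lambda>x. (if i = j then c else 0) / \<beta>)"
  unfolding has_pderiv_def
proof
  fix x assume "x \<in> Rn n"
  show "((\<lambda>t. c * (x(j := t)) i / \<beta>) has_real_derivative (if i = j then c else 0) / \<beta>) (at (x j))"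
    by (cases "i = j") (auto intro!: derivative_eq_intros simp: divide_inverse)
qed

lemma C2_up:
  assumes ab: "0 \<le> a" "a < b"
  shows "C2 n (up n a b) (upD n a b) (upH n a b)"
proof -
  let ?\<beta> = "b\<^sup>2 - a\<^sup>2"
  let ?\<tau> = "\<lambda>x. (nsq n x - a\<^sup>2) / ?\<beta>"
  have \<beta>: "?\<beta> > 0" by (rule tau_cases(3)[OF ab])
  have \<tau>: "?\<tau> \<in> borel_measurable (LM n)" by measurable
  have mS: "(\<lambda>x. S (?\<tau> x)) \<in> borel_measurable (LM n)" "(\<lambda>x. S' (?\<tau> x)) \<in> borel_measurable (LM n)"
    "(\<lambda>x. S'' (?\<tau> x)) \<in> borel_measurable (LM n)"
    using measurable_compose[OF \<tau>] S_measurable S''_meas by auto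
  have mc: "(\<lambda>x. 2 * x i / ?\<beta>) \<in> borel_measurable (LM n)" if "i < n" for i
    using measurable_comp_LM[OF that] by (intro borel_measurable_divide borel_measurable_times) auto
  have H0: "H \<ge> 0" using H_ge_1 by simp
  have c: "\<bar>2 * x i / ?\<beta>\<bar> \<le> 2 * b / ?\<beta>" if "i < n" "pnorm n x < b" for x i
    using abs_comp_le_pnorm[OF that(1), of x] that \<beta> by (auto simp: abs_mult divide_right_mono)
  have cpos: "0 \<le> 2 * b / ?\<beta>" using ab \<beta> by auto
  have 1: "bdd_meas n (up n a b)" unfolding bdd_meas_def
    using mS(1) up_vals(3,4)[OF ab] by (auto simp: up_def[abs_def] abs_le_iff intro!: exI[of _ 1])
  have 2: "bdd_meas n (upD n a b i)" if i: "i < n" for i unfolding bdd_meas_def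
  proof (intro conjI exI ballI)
    show "upD n a b i \<in> borel_measurable (LM n)"
      unfolding upD_def[abs_def] by (intro borel_measurable_times mS mc i)
    fix x show "\<bar>upD n a b i x\<bar> \<le> H * (2 * b / ?\<beta>)"
    proof (cases "pnorm n x < b")
      case True
      then show ?thesis unfolding upD_def abs_mult using S_bounds c[OF i True] H0 by (intro mult_mono) auto
    next
      case False then show ?thesis using upD_zero(1)[OF ab, of n x i] mult_nonneg_nonneg[OF H0 cpos] by simp
    qed
  qed
  have 3: "bdd_meas n (upH n a b i j)" if i: "i < n" and j: "j < n" for i j unfolding bdd_meas_def
  proof (intro conjI exI ballI)
    show "upH n a b i j \<in> borel_measurable (LM n)"
      unfolding upH_def[abs_def] by (intro borel_measurable_add borel_measurable_times mS mc i j borel_measurable_const)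
    fix x show "\<bar>upH n a b i j x\<bar> \<le> H * (2 * b / ?\<beta>) * (2 * b / ?\<beta>) + H * (2 / ?\<beta>)"
    proof (cases "pnorm n x < b")
      case True
      show ?thesis unfolding upH_def
      proof (rule order_trans[OF abs_triangle_ineq add_mono])
        show "\<bar>S'' (?\<tau> x) * (2 * x j / ?\<beta>) * (2 * x i / ?\<beta>)\<bar> \<le> H * (2 * b / ?\<beta>) * (2 * b / ?\<beta>)"
          unfolding abs_mult[of _ "2 * x i / ?\<beta>"] abs_mult[of _ "2 * x j / ?\<beta>"]
          using S_bounds(2) c[OF i True] c[OF j True] H0 cpos by (intro mult_mono mult_nonneg_nonneg) (auto simp del: times_divide_eq_right)
        show "\<bar>S' (?\<tau> x) * ((if i = j then 2 else 0) / ?\<beta>)\<bar> \<le> H * (2 / ?\<beta>)"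
          unfolding abs_mult using S_bounds \<beta> H0 by (intro mult_mono) auto
      qed
    next
      case False then show ?thesis using upD_zero(2)[OF ab, of n x i j] H0 cpos \<beta> by simp
    qed
  qed
  have p1: "has_pderiv n i (up n a b) (upD n a b i)" if "i < n" for i
    unfolding up_def[abs_def] upD_def[abs_def] by (rule has_pderiv_tau[OF that S_DERIV])
  have p2: "has_pderiv n j (upD n a b i) (upH n a b i j)" if "i < n" "j < n" for i j
    unfolding upD_def[abs_def] upH_def[abs_def] by (rule has_pderiv_mult[OF has_pderiv_tau[OF that(2) S'_DERIV] has_pderiv_coord])
  show ?thesis unfolding C2_def using 1 2 3 p1 p2 by blast
qed

text \<open>A cutoff that changes only in the layer a < |x| < b, with derivatives of the size that
  scaling predicts. The direction of the change is left open, so that \<open>v\<close> and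
  \<open>1 - v\<close> both qualify. The factor \<open>n\<close> in the Laplacian is the trace of
  the identity.\<close>

definition transition :: "nat \<Rightarrow> real \<Rightarrow> real \<Rightarrow> (point \<Rightarrow> real) \<Rightarrow> (nat \<Rightarrow> point \<Rightarrow> real) \<Rightarrow> (nat \<Rightarrow> nat \<Rightarrow> point \<Rightarrow> real) \<Rightarrow> bool" where
  "transition n a b v E K \<longleftrightarrow> C2 n v E K \<and> (\<forall>x. 0 \<le> v x \<and> v x \<le> 1) \<and>
     (\<forall>x. \<not> (a < pnorm n x \<and> pnorm n x < b) \<longrightarrow> (\<forall>i j. E i x = 0 \<and> K i j x = 0)) \<and>
     (\<forall>x. (\<Sum>i<n. (E i x)\<^sup>2) \<le> (16 * H / b)\<^sup>2) \<and> (\<forall>x. \<bar>lapl n K x\<bar> \<le> 272 * real n * H / b\<^sup>2)"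

text \<open>The hypothesis \<open>r\<close> says that the layer is not thin and lets 8/b^2 replace
  1/(b^2 - a^2). The gradient is then at most 2 H b (8/b^2), and the Laplacian at most (256 + 16 n)
  H / b^2.\<close>

lemma transition_up:
  assumes ab: "0 \<le> a" "a < b" and r: "b\<^sup>2 \<le> 8 * (b\<^sup>2 - a\<^sup>2)" and n: "n \<ge> 1"
  shows "transition n a b (up n a b) (upD n a b) (upH n a b)"
proof -
  let ?\<beta> = "b\<^sup>2 - a\<^sup>2"
  let ?\<tau> = "\<lambda>x. (nsq n x - a\<^sup>2) / ?\<beta>"
  have \<beta>: "?\<beta> > 0" by (rule tau_cases(3)[OF ab])
  have b: "b > 0" using ab by simp
  have ib: "1 / ?\<beta> \<le> 8 / b\<^sup>2" using r \<beta> b by (simp add: field_simps)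
  have H0: "H \<ge> 0" using H_ge_1 by simp
  have nb: "nsq n x \<le> b\<^sup>2" "nsq n x \<ge> 0" if "pnorm n x < b" for x
    unfolding nsq_pnorm using that by (auto intro!: power_mono)
  have 1: "(\<Sum>i<n. (upD n a b i x)\<^sup>2) \<le> (16 * H / b)\<^sup>2" for x
  proof (cases "pnorm n x < b")
    case True
    have "(\<Sum>i<n. (upD n a b i x)\<^sup>2) = 4 * (S' (?\<tau> x))\<^sup>2 * nsq n x * (1 / ?\<beta>)\<^sup>2"
      by (simp add: upD_def nsq_def sum_distrib_left sum_distrib_right power_mult_distrib power_divide mult_ac sum_divide_distrib)
    also have "\<dots> \<le> 4 * H\<^sup>2 * b\<^sup>2 * (8 / b\<^sup>2)\<^sup>2"
    proof (intro mult_mono power_mono[OF ib])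
      show "(S' (?\<tau> x))\<^sup>2 \<le> H\<^sup>2" using S_bounds(1)[of "?\<tau> x"] H0 by (metis abs_le_square_iff abs_of_nonneg)
    qed (use nb[OF True] \<beta> in auto)
    also have "\<dots> = (16 * H / b)\<^sup>2" using b by (simp add: power2_eq_square field_simps)
    finally show ?thesis .
  next
    case False then show ?thesis using upD_zero(1)[OF ab, of n x] by simp
  qed
  have 2: "\<bar>lapl n (upH n a b) x\<bar> \<le> 272 * real n * H / b\<^sup>2" for x
  proof (cases "pnorm n x < b")
    case True
    have lapl_eq: "lapl n (upH n a b) x = 4 * S'' (?\<tau> x) * nsq n x * (1 / ?\<beta>)\<^sup>2 + 2 * real n * S' (?\<tau> x) * (1 / ?\<beta>)"
      by (simp add: lapl_def upH_def nsq_def sum.distrib sum_distrib_left sum_distrib_right power2_eq_square sum_divide_distrib mult_ac)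
    have "\<bar>lapl n (upH n a b) x\<bar> \<le> 4 * H * b\<^sup>2 * (8 / b\<^sup>2)\<^sup>2 + 2 * real n * H * (8 / b\<^sup>2)"
      unfolding lapl_eq
    proof (rule order_trans[OF abs_triangle_ineq add_mono])
      show "\<bar>4 * S'' (?\<tau> x) * nsq n x * (1 / ?\<beta>)\<^sup>2\<bar> \<le> 4 * H * b\<^sup>2 * (8 / b\<^sup>2)\<^sup>2"
        unfolding abs_mult using S_bounds(2)[of "?\<tau> x"] nb[OF True] \<beta> ib H0
        by (intro mult_mono) (auto intro!: power_mono simp del: power_divide)
      show "\<bar>2 * real n * S' (?\<tau> x) * (1 / ?\<beta>)\<bar> \<le> 2 * real n * H * (8 / b\<^sup>2)"
        unfolding abs_mult using S_bounds(1)[of "?\<tau> x"] \<beta> ib H0 by (intro mult_mono) auto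
    qed
    also have "\<dots> = (256 + 16 * real n) * H / b\<^sup>2"
    proof -
      have "4 * H * B * (8 / B)\<^sup>2 + 2 * m * H * (8 / B) = (256 + 16 * m) * H / B" if "B > 0" for B m :: real
        using that by (simp add: power2_eq_square field_simps)
      from this[of "b\<^sup>2" "real n"] show ?thesis using b by (simp only: zero_less_power)
    qed
    also have "\<dots> \<le> (272 * real n) * H / b\<^sup>2"
      using n H0 by (intro divide_right_mono mult_right_mono) auto
    finally show ?thesis by simp
  next
    case False then show ?thesis using upD_zero(2)[OF ab, of n x] H0 by (simp add: lapl_def)
  qed
  show ?thesis unfolding transition_def
    using 1 2 C2_up[OF ab, of n] up_vals(3,4)[OF ab, of n] upD_zero[OF ab] by blast
qed

lemma transition_down:
  assumes "transition n a b v E K"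
  shows "transition n a b (\<lambda>x. 1 - v x) (\<lambda>i x. - E i x) (\<lambda>i j x. - K i j x)"
proof -
  have "C2 n v E K" using assms by (simp add: transition_def)
  from C2_diff[OF C2_const[of n 1] this] have "C2 n (\<lambda>x. 1 - v x) (\<lambda>i x. - E i x) (\<lambda>i j x. - K i j x)" by simp
  moreover have "lapl n (\<lambda>i j x. - K i j x) x = - lapl n K x" for x by (simp add: lapl_def sum_negf)
  ultimately show ?thesis using assms unfolding transition_def by simp
qed

lemma transition_D:
  assumes "transition n a b v E K"
  shows "C2 n v E K" "0 \<le> v x" "v x \<le> 1" "\<not> (a < pnorm n x \<and> pnorm n x < b) \<Longrightarrow> E i x = 0"
    "\<not> (a < pnorm n x \<and> pnorm n x < b) \<Longrightarrow> lapl n K x = 0"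
    "(\<Sum>i<n. (E i x)\<^sup>2) \<le> (16 * H / b)\<^sup>2" "\<bar>lapl n K x\<bar> \<le> 272 * real n * H / b\<^sup>2"
  using assms unfolding transition_def by (auto simp: lapl_def)

end

section \<open>Energy estimates and the passage between exponents\<close>

lemma bdd_supp_if_pnorm_support:
  assumes "bdd_meas n f" "\<And>x. x \<in> Rn n \<Longrightarrow> pnorm n x \<ge> R \<Longrightarrow> f x = 0" shows "bdd_supp n f"
  unfolding bdd_supp_def box_supp_def
proof (intro conjI assms exI ballI impI allI)
  fix x i assume "x \<in> Rn n" "f x \<noteq> 0" "i < n"
  then show "\<bar>x i\<bar> \<le> R" using assms(2)[of x] abs_comp_le_pnorm[of i n x] by linarith
qed

lemma sets_shell [measurable]: "shell n a b \<in> sets (LM n)"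
proof -
  have "{x \<in> space (LM n). a < pnorm n x \<and> pnorm n x < b} \<in> sets (LM n)" by measurable
  then show ?thesis by (simp add: shell_def)
qed

lemma bdd_supp_indicator_ball0: "bdd_supp n (indicat_real (ball0 n R))"
proof (rule bdd_supp_if_pnorm_support[of _ _ R])
  show "bdd_meas n (indicat_real (ball0 n R))" unfolding bdd_meas_def using sets_ball0[of n R] by (auto simp: indicator_def intro!: exI[of _ 1])
qed (auto simp: ball0_def)

lemma bdd_supp_indicator_shell: "bdd_supp n (indicat_real (shell n a b))"
proof (rule bdd_supp_if_pnorm_support[of _ _ b])
  show "bdd_meas n (indicat_real (shell n a b))" unfolding bdd_meas_def using sets_shell[of n a b] by (auto simp: indicator_def intro!: exI[of _ 1])
qed (auto simp: shell_def)

text \<open>The Hoelder relations among p, p', 2, n and n/2 on which the later estimates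
  draw.\<close>

lemma exponents:
  assumes "n \<ge> 3"
  shows "exponent_p n > 1" "exponent_p' n > 1" "1 / exponent_p n + 1 / exponent_p' n = 1"
    "1 / exponent_p n = 1 / (real n / 2) + 1 / exponent_p' n" "1 / exponent_p n = 1 / real n + 1 / 2"
    "1 / 2 = 1 / real n + 1 / exponent_p' n" "2 / exponent_p' n = (real n - 2) / real n" "real n / 2 > 1"
  using assms by (auto simp: exponent_p_def exponent_p'_def field_simps)

text \<open>The Laplacian is tested against \<eta>^2 f: the square of the gradient of \<eta> f
  equals f^2 |grad \<eta>|^2 - \<eta>^2 f \<Delta> f plus the divergence of \<eta>^2 f grad f, and
  the divergence integrates to 0.\<close>

lemma energy_identity:
  assumes f: "C2 n f D Hf" and \<eta>: "C2 n \<eta> E K" "bdd_supp n \<eta>"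
  shows "(\<Sum>i<n. \<integral>x. (E i x * f x + \<eta> x * D i x)\<^sup>2 \<partial>LM n) =
    (\<integral>x. (f x)\<^sup>2 * (\<Sum>i<n. (E i x)\<^sup>2) \<partial>LM n) - (\<integral>x. (\<eta> x)\<^sup>2 * f x * lapl n Hf x \<partial>LM n)"
proof -
  note F = C2_D[OF f] and X = C2_D[OF \<eta>(1)]
  have bE: "bdd_supp n (E i)" if "i < n" for i using has_pderiv_bdd_supp[OF X(3) _ \<eta>(2) X(2)] that by auto
  have b1: "bdd_supp n (\<lambda>x. (f x)\<^sup>2 * (E i x)\<^sup>2)" if "i < n" for i
    using F bE[OF that] by (intro bdd_supp_mult2 bdd_meas_power bdd_supp_power) auto
  have b2: "bdd_supp n (\<lambda>x. (\<eta> x)\<^sup>2 * f x * Hf i i x)" if "i < n" for i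
    using F that \<eta> by (intro bdd_supp_mult bdd_supp_power) auto
  have each: "(\<integral>x. (E i x * f x + \<eta> x * D i x)\<^sup>2 \<partial>LM n) = (\<integral>x. (f x)\<^sup>2 * (E i x)\<^sup>2 \<partial>LM n) - (\<integral>x. (\<eta> x)\<^sup>2 * f x * Hf i i x \<partial>LM n)"
    if i: "i < n" for i
  proof -
    let ?P = "\<lambda>x. ((\<eta> x * \<eta> x) * f x) * D i x"
    let ?Q = "\<lambda>x. ((E i x * \<eta> x + \<eta> x * E i x) * f x + (\<eta> x * \<eta> x) * D i x) * D i x + ((\<eta> x * \<eta> x) * f x) * Hf i i x"
    have pdP: "has_pderiv n i ?P ?Q" by (intro has_pderiv_mult X(3)[OF i] F(3)[OF i] F(5)[OF i i])
    have bP: "bdd_supp n ?P" by (intro bdd_supp_mult \<eta>(2) X(1) F(1) F(2)[OF i])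
    have bQ: "bdd_meas n ?Q" by (intro bdd_meas_add bdd_meas_mult X(1) X(2)[OF i] F(1) F(2)[OF i] F(4)[OF i i])
    have Q0: "(\<integral>x. ?Q x \<partial>LM n) = 0" by (rule integral_has_pderiv_eq_0[OF pdP i bP bQ])
    have bQ': "bdd_supp n ?Q" by (rule has_pderiv_bdd_supp[OF pdP i bP bQ])
    have "(\<integral>x. (E i x * f x + \<eta> x * D i x)\<^sup>2 \<partial>LM n) =
      (\<integral>x. ((f x)\<^sup>2 * (E i x)\<^sup>2 - (\<eta> x)\<^sup>2 * f x * Hf i i x) + ?Q x \<partial>LM n)"
      by (intro Bochner_Integration.integral_cong) (auto simp: power2_eq_square algebra_simps)
    also have "\<dots> = (\<integral>x. ((f x)\<^sup>2 * (E i x)\<^sup>2 - (\<eta> x)\<^sup>2 * f x * Hf i i x) \<partial>LM n) + (\<integral>x. ?Q x \<partial>LM n)"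
      by (rule Bochner_Integration.integral_add[OF bdd_supp_integrable[OF bdd_supp_diff[OF b1[OF i] b2[OF i]]] bdd_supp_integrable[OF bQ']])
    also have "\<dots> = (\<integral>x. (f x)\<^sup>2 * (E i x)\<^sup>2 \<partial>LM n) - (\<integral>x. (\<eta> x)\<^sup>2 * f x * Hf i i x \<partial>LM n)"
      unfolding Q0 using bdd_supp_integrable[OF b1[OF i]] bdd_supp_integrable[OF b2[OF i]] by simp
    finally show ?thesis .
  qed
  have "(\<Sum>i<n. \<integral>x. (E i x * f x + \<eta> x * D i x)\<^sup>2 \<partial>LM n) =
    (\<Sum>i<n. \<integral>x. (f x)\<^sup>2 * (E i x)\<^sup>2 \<partial>LM n) - (\<Sum>i<n. \<integral>x. (\<eta> x)\<^sup>2 * f x * Hf i i x \<partial>LM n)"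
    using each by (simp add: sum_subtractf)
  also have "(\<Sum>i<n. \<integral>x. (f x)\<^sup>2 * (E i x)\<^sup>2 \<partial>LM n) = (\<integral>x. (f x)\<^sup>2 * (\<Sum>i<n. (E i x)\<^sup>2) \<partial>LM n)"
    using bdd_supp_integrable[OF b1] by (subst Bochner_Integration.integral_sum[symmetric]) (auto simp: sum_distrib_left)
  also have "(\<Sum>i<n. \<integral>x. (\<eta> x)\<^sup>2 * f x * Hf i i x \<partial>LM n) = (\<integral>x. (\<eta> x)\<^sup>2 * f x * lapl n Hf x \<partial>LM n)"
    using bdd_supp_integrable[OF b2] by (subst Bochner_Integration.integral_sum[symmetric]) (auto simp: sum_distrib_left lapl_def)
  finally show ?thesis .
qed

text \<open>Since 1/p = 2/n + 1/p', multiplication by \<open>V\<close> maps the space on the left of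
  the Carleman inequality to the space on its right. A small norm of \<open>V\<close> therefore
  makes the potential term absorbable.\<close>

lemma in_Lq_V_mult:
  assumes "n \<ge> 3" "in_Lq (LM n) (real n / 2) V" "in_Lq (LM n) (exponent_p' n) w"
  shows "in_Lq (LM n) (exponent_p n) (\<lambda>x. V x * w x)"
    "Lq_norm (LM n) (exponent_p n) (\<lambda>x. V x * w x) \<le> Lq_norm (LM n) (real n / 2) V * Lq_norm (LM n) (exponent_p' n) w"
  using Holder_gen[OF assms(2,3), of "exponent_p n"] exponents[OF assms(1)] by auto

lemma Sobolev_Lq_norm:
  assumes "n \<ge> 3" "bdd_supp n w" "\<And>i. i < n \<Longrightarrow> bdd_meas n (D i)" "\<And>i. i < n \<Longrightarrow> has_pderiv n i w (D i)"
  shows "(Lq_norm (LM n) (exponent_p' n) w)\<^sup>2 \<le> 10/11 * (\<Sum>i<n. \<integral>x. (D i x)\<^sup>2 \<partial>LM n)"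
proof -
  have "(Lq_norm (LM n) (exponent_p' n) w)\<^sup>2 = Lq_norm (LM n) (exponent_p' n) w powr 2" by simp
  also have "\<dots> = (\<integral>x. \<bar>w x\<bar> powr (exponent_p' n) \<partial>LM n) powr ((real n - 2) / real n)"
    unfolding Lq_norm_def powr_powr using exponents(7)[OF assms(1)] by simp
  also have "\<dots> \<le> 10/11 * (\<Sum>i<n. \<integral>x. (D i x)\<^sup>2 \<partial>LM n)"
    unfolding exponent_p'_def by (rule Sobolev[OF assms])
  finally show ?thesis .
qed

text \<open>Since the constant in the Sobolev inequality is below \<open>1\<close>, the operator \<open>- \<Delta> + V\<close> is coercive with a
  universal constant as soon as the \<open>n/2\<close>-norm of \<open>V\<close> is at most \<open>1\<close>.\<close>

lemma energy_bound:
  assumes n: "n \<ge> 3" and f: "C2 n f D Hf" and \<eta>: "C2 n \<eta> E K" "bdd_supp n \<eta>"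
    and V: "in_Lq (LM n) (real n / 2) V" "Lq_norm (LM n) (real n / 2) V \<le> 1"
  defines "X \<equiv> sqrt (\<Sum>i<n. \<integral>x. (E i x * f x + \<eta> x * D i x)\<^sup>2 \<partial>LM n)"
    and "a \<equiv> sqrt (\<integral>x. (f x)\<^sup>2 * (\<Sum>i<n. (E i x)\<^sup>2) \<partial>LM n)"
    and "e \<equiv> Lq_norm (LM n) (exponent_p n) (\<lambda>x. \<eta> x * (lapl n Hf x - V x * f x))"
  shows "Lq_norm (LM n) (exponent_p' n) (\<lambda>x. \<eta> x * f x) \<le> X" "X \<le> 5 * a + 11 * e"
proof -
  note F = C2_D[OF f] and XX = C2_D[OF \<eta>(1)] and ex = exponents[OF n]
  define N where "N = Lq_norm (LM n) (exponent_p' n) (\<lambda>x. \<eta> x * f x)"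
  have bw: "bdd_supp n (\<lambda>x. \<eta> x * f x)" by (rule bdd_supp_mult[OF \<eta>(2) F(1)])
  have X2: "X\<^sup>2 = (\<Sum>i<n. \<integral>x. (E i x * f x + \<eta> x * D i x)\<^sup>2 \<partial>LM n)"
    unfolding X_def by (intro real_sqrt_pow2 sum_nonneg) auto
  have X0: "X \<ge> 0" unfolding X_def by (intro real_sqrt_ge_zero sum_nonneg) auto
  have N2: "N\<^sup>2 \<le> 10/11 * X\<^sup>2" unfolding N_def X2
    by (rule Sobolev_Lq_norm[OF n bw]) (use F XX \<eta> in \<open>auto intro!: bdd_meas_add bdd_meas_mult has_pderiv_mult\<close>)
  then have "N\<^sup>2 \<le> X\<^sup>2" using zero_le_power2[of X] by linarith
  then show NX: "Lq_norm (LM n) (exponent_p' n) (\<lambda>x. \<eta> x * f x) \<le> X"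
    using X0 unfolding N_def by (rule power2_le_imp_le)
  have a2: "a\<^sup>2 = (\<integral>x. (f x)\<^sup>2 * (\<Sum>i<n. (E i x)\<^sup>2) \<partial>LM n)"
    unfolding a_def by (intro real_sqrt_pow2 Bochner_Integration.integral_nonneg mult_nonneg_nonneg sum_nonneg) auto
  have a0: "a \<ge> 0" unfolding a_def by (intro real_sqrt_ge_zero Bochner_Integration.integral_nonneg mult_nonneg_nonneg sum_nonneg) auto
  have e0: "e \<ge> 0" by (simp add: e_def)
  have N0: "N \<ge> 0" by (simp add: N_def)
  have wL: "in_Lq (LM n) (exponent_p' n) (\<lambda>x. \<eta> x * f x)" using bw ex by (intro bdd_supp_in_Lq) auto
  note VW = in_Lq_V_mult[OF n V(1) wL]
  have lL: "in_Lq (LM n) (exponent_p n) (\<lambda>x. \<eta> x * lapl n Hf x)"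
    using ex by (intro bdd_supp_in_Lq bdd_supp_mult \<eta> F(6)) auto
  have eL: "in_Lq (LM n) (exponent_p n) (\<lambda>x. \<eta> x * (lapl n Hf x - V x * f x))"
    using in_Lq_diff[OF lL VW(1)] ex by (simp add: algebra_simps)
  have i1: "integrable (LM n) (\<lambda>x. (V x * (\<eta> x * f x)) * (\<eta> x * f x))"
    and i2: "integrable (LM n) (\<lambda>x. (\<eta> x * (lapl n Hf x - V x * f x)) * (\<eta> x * f x))"
    using ex by (auto intro!: integrable_mult_Holder[OF VW(1) wL] integrable_mult_Holder[OF eL wL])
  have "X\<^sup>2 = a\<^sup>2 - (\<integral>x. (\<eta> x)\<^sup>2 * f x * lapl n Hf x \<partial>LM n)"
    unfolding X2 a2 by (rule energy_identity[OF f \<eta>])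
  also have "(\<integral>x. (\<eta> x)\<^sup>2 * f x * lapl n Hf x \<partial>LM n) =
     (\<integral>x. (V x * (\<eta> x * f x)) * (\<eta> x * f x) + (\<eta> x * (lapl n Hf x - V x * f x)) * (\<eta> x * f x) \<partial>LM n)"
    by (intro Bochner_Integration.integral_cong) (auto simp: power2_eq_square algebra_simps)
  also have "\<dots> = (\<integral>x. (V x * (\<eta> x * f x)) * (\<eta> x * f x) \<partial>LM n) + (\<integral>x. (\<eta> x * (lapl n Hf x - V x * f x)) * (\<eta> x * f x) \<partial>LM n)"
    by (rule Bochner_Integration.integral_add[OF i1 i2])
  finally have *: "X\<^sup>2 = a\<^sup>2 - ((\<integral>x. (V x * (\<eta> x * f x)) * (\<eta> x * f x) \<partial>LM n) + (\<integral>x. (\<eta> x * (lapl n Hf x - V x * f x)) * (\<eta> x * f x) \<partial>LM n))" .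
  have "\<bar>\<integral>x. (V x * (\<eta> x * f x)) * (\<eta> x * f x) \<partial>LM n\<bar> \<le> Lq_norm (LM n) (exponent_p n) (\<lambda>x. V x * (\<eta> x * f x)) * N"
    unfolding N_def using ex by (intro order_trans[OF integral_abs_bound] Holder_inequality[OF VW(1) wL]) auto
  also have "\<dots> \<le> (1 * N) * N"
    using order_trans[OF VW(2)[folded N_def] mult_right_mono[OF V(2) N0]] N0 by (intro mult_right_mono) auto
  also have "\<dots> = N\<^sup>2" by (simp add: power2_eq_square)
  finally have h1: "\<bar>\<integral>x. (V x * (\<eta> x * f x)) * (\<eta> x * f x) \<partial>LM n\<bar> \<le> N\<^sup>2" .
  have "\<bar>\<integral>x. (\<eta> x * (lapl n Hf x - V x * f x)) * (\<eta> x * f x) \<partial>LM n\<bar> \<le> e * N"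
    unfolding N_def e_def using ex by (intro order_trans[OF integral_abs_bound] Holder_inequality[OF eL wL]) auto
  also have "\<dots> \<le> e * X" using NX e0 by (intro mult_left_mono) (auto simp: N_def)
  finally have h2: "\<bar>\<integral>x. (\<eta> x * (lapl n Hf x - V x * f x)) * (\<eta> x * f x) \<partial>LM n\<bar> \<le> e * X" .
  \<comment> \<open>One eleventh of \<open>X\<^sup>2\<close> survives on the left because the
    Sobolev constant is below 1. Young's inequality spends half of it on \<open>e * X\<close>, and
    22 \<le> 5^2.\<close>
  have main: "X\<^sup>2 \<le> a\<^sup>2 + 10/11 * X\<^sup>2 + e * X" using * h1 h2 N2 by linarith
  have "0 \<le> (X - 11 * e)\<^sup>2" by simp
  then have "2 * (11 * e * X) \<le> X\<^sup>2 + 121 * e\<^sup>2" by (simp add: power2_eq_square algebra_simps)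
  then have "X\<^sup>2 \<le> 22 * a\<^sup>2 + 121 * e\<^sup>2" using main by linarith
  also have "\<dots> \<le> (5 * a + 11 * e)\<^sup>2"
    using a0 e0 by (simp add: power2_eq_square algebra_simps)
  finally show "X \<le> 5 * a + 11 * e" by (rule power2_le_imp_le) (use a0 e0 in auto)
qed

text \<open>Since 1/2 = 1/n + 1/p', Hoelder's inequality against the indicator costs the
  \<open>n\<close>-th root of the volume, which supplies a factor n^(-1/2). The next lemma is the
  dual form, from 1/p = 1/n + 1/2.\<close>

lemma Lq_norm_2_le_p':
  assumes n: "n \<ge> 3" and T: "T \<in> sets (LM n)" "T \<subseteq> ball0 n d" "d > 0" and f: "in_Lq (LM n) (exponent_p' n) f"
  shows "Lq_norm (LM n) 2 (\<lambda>x. indicator T x * f x) \<le> 5 * d / sqrt (real n) * Lq_norm (LM n) (exponent_p' n) f"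
proof -
  have fin: "emeasure (LM n) T < \<infinity>"
    using emeasure_mono[OF T(2) sets_ball0] measure_ball0_root(1)[of n d] n T by (auto intro: le_less_trans)
  note ex = exponents[OF n]
  have "Lq_norm (LM n) 2 (\<lambda>x. indicator T x * f x) \<le> Lq_norm (LM n) (real n) (indicator T) * Lq_norm (LM n) (exponent_p' n) f"
    using n ex by (intro Holder_gen(2) in_Lq_indicator_set T fin f) auto
  also have "Lq_norm (LM n) (real n) (indicator T) = measure (LM n) T powr (1 / real n)"
    by (rule in_Lq_indicator_set[OF T(1) fin])
  also have "\<dots> \<le> measure (LM n) (ball0 n d) powr (1 / real n)"
    using T measure_ball0_root(1)[of n d] n
    by (intro powr_mono2 measure_mono_fmeasurable) (auto simp: fmeasurable_def)
  also have "\<dots> \<le> 5 * d / sqrt (real n)" using measure_ball0_root(2)[of n d] n T by auto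
  finally show ?thesis by (simp add: mult_right_mono)
qed

lemma Lq_norm_p_le_2:
  assumes n: "n \<ge> 3" and T: "T \<in> sets (LM n)" "T \<subseteq> ball0 n d" "d > 0" and f: "in_Lq (LM n) 2 f"
  shows "Lq_norm (LM n) (exponent_p n) (\<lambda>x. indicator T x * f x) \<le> 5 * d / sqrt (real n) * Lq_norm (LM n) 2 f"
proof -
  have fin: "emeasure (LM n) T < \<infinity>"
    using emeasure_mono[OF T(2) sets_ball0] measure_ball0_root(1)[of n d] n T by (auto intro: le_less_trans)
  note ex = exponents[OF n]
  have "Lq_norm (LM n) (exponent_p n) (\<lambda>x. indicator T x * f x) \<le> Lq_norm (LM n) (real n) (indicator T) * Lq_norm (LM n) 2 f"
    using n ex by (intro Holder_gen(2) in_Lq_indicator_set T fin f) auto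
  also have "Lq_norm (LM n) (real n) (indicator T) = measure (LM n) T powr (1 / real n)"
    by (rule in_Lq_indicator_set[OF T(1) fin])
  also have "\<dots> \<le> measure (LM n) (ball0 n d) powr (1 / real n)"
    using T measure_ball0_root(1)[of n d] n
    by (intro powr_mono2 measure_mono_fmeasurable) (auto simp: fmeasurable_def)
  also have "\<dots> \<le> 5 * d / sqrt (real n)" using measure_ball0_root(2)[of n d] n T by auto
  finally show ?thesis by (simp add: mult_right_mono)
qed

lemma sqrt_integral_Lq_norm: "sqrt (\<integral>x. (f x)\<^sup>2 \<partial>M) = Lq_norm M 2 f"
  by (simp add: Lq_norm_def powr_half_sqrt)

section \<open>Interior estimates for approximate solutions\<close>

text \<open>The defect of the equation \<Delta> f = V f on a ball; \<open>L\<close> stands for the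
  Laplacian of \<open>f\<close>. The interior estimates carry it as an error term, which tends to 0
  along mollifications of a solution.\<close>

definition residual_norm :: "nat \<Rightarrow> real \<Rightarrow> (point \<Rightarrow> real) \<Rightarrow> (point \<Rightarrow> real) \<Rightarrow> (point \<Rightarrow> real) \<Rightarrow> real" where
  "residual_norm n R V f L = Lq_norm (LM n) (exponent_p n) (\<lambda>x. indicator (ball0 n R) x * (L x - V x * f x))"

lemma residual_norm_in_Lq:
  assumes n: "n \<ge> 3" and f: "bdd_meas n f" "bdd_meas n L" and V: "in_Lq (LM n) (real n / 2) V"
  shows "in_Lq (LM n) (exponent_p n) (\<lambda>x. indicator (ball0 n R) x * (L x - V x * f x))"
proof -
  note ex = exponents[OF n]
  note b = bdd_supp_indicator_ball0[of n R]
  have "in_Lq (LM n) (exponent_p' n) (\<lambda>x. indicator (ball0 n R) x * f x)" using ex b f by (intro bdd_supp_in_Lq bdd_supp_mult) auto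
  from in_Lq_V_mult(1)[OF n V this]
  have 1: "in_Lq (LM n) (exponent_p n) (\<lambda>x. V x * (indicator (ball0 n R) x * f x))" .
  have "in_Lq (LM n) (exponent_p n) (\<lambda>x. indicator (ball0 n R) x * L x)" using ex b f by (intro bdd_supp_in_Lq bdd_supp_mult) auto
  from in_Lq_diff[OF this 1] ex show ?thesis by (simp add: algebra_simps)
qed

lemma residual_norm_bound:
  assumes n: "n \<ge> 3" and f: "bdd_meas n f" "bdd_meas n L" and V: "in_Lq (LM n) (real n / 2) V"
    and \<eta>: "\<eta> \<in> borel_measurable (LM n)" "\<And>x. x \<in> Rn n \<Longrightarrow> \<bar>\<eta> x\<bar> \<le> c" "\<And>x. x \<in> Rn n \<Longrightarrow> pnorm n x \<ge> R \<Longrightarrow> \<eta> x = 0" and c: "c \<ge> 0"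
  shows "Lq_norm (LM n) (exponent_p n) (\<lambda>x. \<eta> x * (L x - V x * f x)) \<le> c * residual_norm n R V f L"
proof -
  note ex = exponents[OF n]
  have [measurable]: "f \<in> borel_measurable (LM n)" "L \<in> borel_measurable (LM n)" "V \<in> borel_measurable (LM n)" "\<eta> \<in> borel_measurable (LM n)"
    using f V \<eta>(1) by (auto simp: bdd_meas_def in_Lq_def)
  have "Lq_norm (LM n) (exponent_p n) (\<lambda>x. \<eta> x * (L x - V x * f x)) \<le>
    Lq_norm (LM n) (exponent_p n) (\<lambda>x. c * (indicator (ball0 n R) x * (L x - V x * f x)))"
  proof (rule Lq_norm_mono)
    show "(\<lambda>x. \<eta> x * (L x - V x * f x)) \<in> borel_measurable (LM n)"
      using f V \<eta>(1) by (intro borel_measurable_times borel_measurable_diff) (auto simp: bdd_meas_def in_Lq_def)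
    show "in_Lq (LM n) (exponent_p n) (\<lambda>x. c * (indicator (ball0 n R) x * (L x - V x * f x)))"
      by (intro in_Lq_cmult residual_norm_in_Lq n f V)
    fix x assume "x \<in> space (LM n)"
    then show "\<bar>\<eta> x * (L x - V x * f x)\<bar> \<le> \<bar>c * (indicator (ball0 n R) x * (L x - V x * f x))\<bar>"
      using \<eta>(2,3)[of x] c by (cases "pnorm n x < R") (auto simp: abs_mult ball0_def intro!: mult_right_mono)
  qed (use ex in auto)
  also have "\<dots> = c * residual_norm n R V f L" using ex c by (simp add: Lq_norm_cmult residual_norm_def)
  finally show ?thesis .
qed

lemma nrm2_gradient_cutoff:
  assumes f: "bdd_meas n f" and E: "\<And>i. i < n \<Longrightarrow> bdd_supp n (E i)" and G: "G \<ge> 0"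
    "\<And>x. x \<in> Rn n \<Longrightarrow> (\<Sum>i<n. (E i x)\<^sup>2) \<le> G\<^sup>2"
    "\<And>x i. x \<in> Rn n \<Longrightarrow> \<not> (a < pnorm n x \<and> pnorm n x < b) \<Longrightarrow> i < n \<Longrightarrow> E i x = 0"
  shows "sqrt (\<integral>x. (f x)\<^sup>2 * (\<Sum>i<n. (E i x)\<^sup>2) \<partial>LM n) \<le> G * Lq_norm (LM n) 2 (\<lambda>x. indicator (shell n a b) x * f x)"
proof -
  note b = bdd_supp_indicator_shell[of n a b]
  have "(\<integral>x. (f x)\<^sup>2 * (\<Sum>i<n. (E i x)\<^sup>2) \<partial>LM n) \<le> (\<integral>x. G\<^sup>2 * (indicator (shell n a b) x * f x)\<^sup>2 \<partial>LM n)"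
  proof (rule integral_mono)
    show "integrable (LM n) (\<lambda>x. (f x)\<^sup>2 * (\<Sum>i<n. (E i x)\<^sup>2))"
      using f E by (intro bdd_supp_integrable bdd_supp_mult2 bdd_meas_power bdd_supp_sum bdd_supp_power) auto
    show "integrable (LM n) (\<lambda>x. G\<^sup>2 * (indicator (shell n a b) x * f x)\<^sup>2)"
      using f b by (intro bdd_supp_integrable bdd_supp_cmult bdd_supp_power bdd_supp_mult) auto
    fix x assume "x \<in> space (LM n)"
    then have x: "x \<in> Rn n" by simp
    show "(f x)\<^sup>2 * (\<Sum>i<n. (E i x)\<^sup>2) \<le> G\<^sup>2 * (indicator (shell n a b) x * f x)\<^sup>2"
    proof (cases "a < pnorm n x \<and> pnorm n x < b")
      case True
      then have "x \<in> shell n a b" using x by (simp add: shell_def)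
      then show ?thesis using mult_left_mono[OF G(2)[OF x] zero_le_power2[of "f x"]] by (simp add: mult.commute)
    next
      case False
      then show ?thesis using G(3)[OF x False] by simp
    qed
  qed
  also have "\<dots> = G\<^sup>2 * (\<integral>x. (indicator (shell n a b) x * f x)\<^sup>2 \<partial>LM n)" by simp
  finally have "sqrt (\<integral>x. (f x)\<^sup>2 * (\<Sum>i<n. (E i x)\<^sup>2) \<partial>LM n) \<le> sqrt (G\<^sup>2 * (\<integral>x. (indicator (shell n a b) x * f x)\<^sup>2 \<partial>LM n))"
    by (rule real_sqrt_le_mono)
  also have "\<dots> = G * Lq_norm (LM n) 2 (\<lambda>x. indicator (shell n a b) x * f x)"
    using G(1) by (simp add: real_sqrt_mult sqrt_integral_Lq_norm)
  finally show ?thesis .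
qed

context step_fun
begin

lemma transition_bdd_supp: assumes "transition n a b v E K" shows "i < n \<Longrightarrow> bdd_supp n (E i)" "bdd_supp n (lapl n K)"
proof -
  note T = transition_D[OF assms]
  show "i < n \<Longrightarrow> bdd_supp n (E i)"
    using T(4) C2_D(2)[OF T(1)] by (intro bdd_supp_if_pnorm_support[of _ _ b]) auto
  show "bdd_supp n (lapl n K)"
    using T(5) C2_D(6)[OF T(1)] by (intro bdd_supp_if_pnorm_support[of _ _ b]) auto
qed

text \<open>The cutoff is 1 on the inner ball and its gradient lives in the shell, so the energy
  bound sees \<open>f\<close> only there. The 1/b of the gradient cancels against the radius
  \<open>b\<close> in the volume factor, and 400 is 5 * 5 * 16.\<close>

lemma coercive_ball:
  assumes n: "n \<ge> 3" and f: "C2 n f D Hf"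
    and V: "in_Lq (LM n) (real n / 2) V" "Lq_norm (LM n) (real n / 2) V \<le> 1"
    and ab: "0 < a" "a < b" "b\<^sup>2 \<le> 8 * (b\<^sup>2 - a\<^sup>2)" "b \<le> R"
  shows "Lq_norm (LM n) 2 (\<lambda>x. indicator (ball0 n a) x * f x) \<le>
    400 * H * Lq_norm (LM n) 2 (\<lambda>x. indicator (shell n a b) x * f x) + 55 * b * residual_norm n R V f (lapl n Hf)"
proof -
  note ex = exponents[OF n] and F = C2_D[OF f]
  let ?u = "up n a b"
  have tu: "transition n a b ?u (upD n a b) (upH n a b)" using ab n by (intro transition_up) auto
  let ?\<eta> = "\<lambda>x. 1 - ?u x" and ?E = "\<lambda>i x. - upD n a b i x" and ?K = "\<lambda>i j x. - upH n a b i j x"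
  have td: "transition n a b ?\<eta> ?E ?K" by (rule transition_down[OF tu])
  note T = transition_D[OF td]
  have z: "?\<eta> x = 0" if "pnorm n x \<ge> b" for x using up_vals(2)[of a b n x] ab that by simp
  have one: "?\<eta> x = 1" if "pnorm n x \<le> a" for x using up_vals(1)[of a b n x] ab that by simp
  have \<eta>bdd_supp: "bdd_supp n ?\<eta>" using z C2_D(1)[OF T(1)] by (intro bdd_supp_if_pnorm_support[of _ _ b]) auto
  note E = energy_bound[OF n f T(1) \<eta>bdd_supp V]
  define F2 where "F2 = Lq_norm (LM n) 2 (\<lambda>x. indicator (shell n a b) x * f x)"
  define e where "e = residual_norm n R V f (lapl n Hf)"
  have H0: "H \<ge> 0" using H_ge_1 by simp
  have 1: "sqrt (\<integral>x. (f x)\<^sup>2 * (\<Sum>i<n. (?E i x)\<^sup>2) \<partial>LM n) \<le> (16 * H / b) * F2"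
    unfolding F2_def using H0 ab T(6) T(4) by (intro nrm2_gradient_cutoff[OF F(1) transition_bdd_supp(1)[OF td]]) auto
  have 2: "Lq_norm (LM n) (exponent_p n) (\<lambda>x. ?\<eta> x * (lapl n Hf x - V x * f x)) \<le> 1 * e"
    unfolding e_def
    by (rule residual_norm_bound[OF n F(1) F(6) V(1)]) (use C2_D(1)[OF T(1)] T(2,3) z ab in \<open>auto simp: bdd_meas_def\<close>)
  have "Lq_norm (LM n) (exponent_p' n) (\<lambda>x. ?\<eta> x * f x) \<le> 5 * ((16 * H / b) * F2) + 11 * e"
    using E 1 2 by linarith
  note N = this
  have "Lq_norm (LM n) 2 (\<lambda>x. indicator (ball0 n a) x * f x) = Lq_norm (LM n) 2 (\<lambda>x. indicator (ball0 n a) x * (?\<eta> x * f x))"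
    using one by (intro Lq_norm_cong) (auto simp: indicator_def ball0_def)
  also have "\<dots> \<le> 5 * b / sqrt (real n) * Lq_norm (LM n) (exponent_p' n) (\<lambda>x. ?\<eta> x * f x)"
    using ab ex \<eta>bdd_supp F(1) by (intro Lq_norm_2_le_p'[OF n] bdd_supp_in_Lq bdd_supp_mult) (auto simp: ball0_def[abs_def] intro: sets_ball0[unfolded ball0_def])
  also have "\<dots> \<le> 5 * b / 1 * (5 * ((16 * H / b) * F2) + 11 * e)"
    using N ab n by (intro mult_mono divide_left_mono) (auto simp: real_le_rsqrt)
  also have "\<dots> = 400 * H * F2 + 55 * b * e" using ab by (simp add: field_simps)
  finally show ?thesis by (simp add: F2_def e_def)
qed

text \<open>The cutoff is the product of a rising and a falling one and equals 1 on the inner shell;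
  there its own gradient vanishes, and the gradient of the product is that of \<open>f\<close>. The
  margins on both sides are where the cutoff is paid for by \<open>f\<close> itself. The constant
  160 is 5 * 32.\<close>

lemma Caccioppoli:
  assumes n: "n \<ge> 3" and f: "C2 n f D Hf"
    and V: "in_Lq (LM n) (real n / 2) V" "Lq_norm (LM n) (real n / 2) V \<le> 1"
    and ab: "0 < a0" "a0 < a" "a < b" "b < b0" "a\<^sup>2 \<le> 8 * (a\<^sup>2 - a0\<^sup>2)" "b0\<^sup>2 \<le> 8 * (b0\<^sup>2 - b\<^sup>2)" "b0 \<le> R"
  shows "sqrt (\<Sum>i<n. \<integral>x. (indicator (shell n a b) x * D i x)\<^sup>2 \<partial>LM n) \<le>
    160 * H / a * Lq_norm (LM n) 2 (\<lambda>x. indicator (shell n a0 b0) x * f x) + 11 * residual_norm n R V f (lapl n Hf)"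
proof -
  note F = C2_D[OF f]
  let ?u = "up n a0 a" and ?Eu = "upD n a0 a" and ?Ku = "upH n a0 a"
  let ?d = "\<lambda>x. 1 - up n b b0 x" and ?Ed = "\<lambda>i x. - upD n b b0 i x" and ?Kd = "\<lambda>i j x. - upH n b b0 i j x"
  have tu: "transition n a0 a ?u ?Eu ?Ku" using ab n by (intro transition_up) auto
  have td: "transition n b b0 ?d ?Ed ?Kd" using ab n by (intro transition_down transition_up) auto
  note U = transition_D[OF tu] and Dd = transition_D[OF td]
  let ?\<eta> = "\<lambda>x. ?u x * ?d x" and ?E = "\<lambda>i x. ?Eu i x * ?d x + ?u x * ?Ed i x"
  note C = C2_mult[OF U(1) Dd(1)]
  have z: "?\<eta> x = 0" if "pnorm n x \<ge> b0" for x using up_vals(2)[of b b0 n x] ab that by simp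
  have one: "?\<eta> x = 1" if "a < pnorm n x \<and> pnorm n x < b" for x
    using up_vals(1)[of b b0 n x] up_vals(2)[of a0 a n x] ab that by simp
  have E0: "?E i x = 0" if "a < pnorm n x \<and> pnorm n x < b" for i x
    using U(4)[of x i] Dd(4)[of x i] that by auto
  have \<eta>bdd_supp: "bdd_supp n ?\<eta>" using z C2_D(1)[OF C] by (intro bdd_supp_if_pnorm_support[of _ _ b0]) auto
  have Ebs: "bdd_supp n (?E i)" if "i < n" for i using has_pderiv_bdd_supp[OF C2_D(3)[OF C that] that \<eta>bdd_supp C2_D(2)[OF C that]] .
  note E = energy_bound[OF n f C \<eta>bdd_supp V]
  define F2 where "F2 = Lq_norm (LM n) 2 (\<lambda>x. indicator (shell n a0 b0) x * f x)"
  define e where "e = residual_norm n R V f (lapl n Hf)"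
  have H0: "H \<ge> 0" using H_ge_1 by simp
  have G: "(\<Sum>i<n. (?E i x)\<^sup>2) \<le> (32 * H / a)\<^sup>2" for x
  proof -
    have "(?E i x)\<^sup>2 \<le> 2 * (?Eu i x)\<^sup>2 + 2 * (?Ed i x)\<^sup>2" for i
    proof -
      have "(p + q)\<^sup>2 \<le> 2 * p\<^sup>2 + 2 * q\<^sup>2" for p q :: real
        using zero_le_power2[of "p - q"] by (simp add: power2_eq_square algebra_simps)
      then have "(?E i x)\<^sup>2 \<le> 2 * (?Eu i x * ?d x)\<^sup>2 + 2 * (?u x * ?Ed i x)\<^sup>2" .
      also have "(?Eu i x * ?d x)\<^sup>2 \<le> (?Eu i x)\<^sup>2 * 1" unfolding power_mult_distrib
        using Dd(2,3)[of x] by (intro mult_left_mono power_le_one) auto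
      also have "(?u x * ?Ed i x)\<^sup>2 \<le> 1 * (?Ed i x)\<^sup>2" unfolding power_mult_distrib
        using U(2,3)[of x] by (intro mult_right_mono power_le_one) auto
      finally show ?thesis by simp
    qed
    then have "(\<Sum>i<n. (?E i x)\<^sup>2) \<le> (\<Sum>i<n. 2 * (?Eu i x)\<^sup>2 + 2 * (?Ed i x)\<^sup>2)" by (rule sum_mono)
    also have "\<dots> = 2 * (\<Sum>i<n. (?Eu i x)\<^sup>2) + 2 * (\<Sum>i<n. (?Ed i x)\<^sup>2)"
      by (simp only: sum.distrib sum_distrib_left)
    also have "\<dots> \<le> 2 * (16 * H / a)\<^sup>2 + 2 * (16 * H / b0)\<^sup>2" using U(6)[of x] Dd(6)[of x] by linarith
    also have "(16 * H / b0)\<^sup>2 \<le> (16 * H / a)\<^sup>2" using ab H0 by (intro power_mono divide_left_mono) auto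
    finally show ?thesis by (simp add: power2_eq_square)
  qed
  have Ez: "?E i x = 0" if "\<not> (a0 < pnorm n x \<and> pnorm n x < b0)" for i x
    using U(4)[of x i] Dd(4)[of x i] ab that by auto
  have 1: "sqrt (\<integral>x. (f x)\<^sup>2 * (\<Sum>i<n. (?E i x)\<^sup>2) \<partial>LM n) \<le> (32 * H / a) * F2"
    unfolding F2_def by (rule nrm2_gradient_cutoff[OF F(1) Ebs _ G Ez]) (use H0 ab in auto)
  have 2: "Lq_norm (LM n) (exponent_p n) (\<lambda>x. ?\<eta> x * (lapl n Hf x - V x * f x)) \<le> 1 * e"
    unfolding e_def
    by (rule residual_norm_bound[OF n F(1) F(6) V(1)])
       (use C2_D(1)[OF C] U(2,3) Dd(2,3) z ab in \<open>auto simp: bdd_meas_def abs_mult intro!: mult_le_one\<close>)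
  have "sqrt (\<Sum>i<n. \<integral>x. (indicator (shell n a b) x * D i x)\<^sup>2 \<partial>LM n) \<le> sqrt (\<Sum>i<n. \<integral>x. (?E i x * f x + ?\<eta> x * D i x)\<^sup>2 \<partial>LM n)"
  proof (intro real_sqrt_le_mono sum_mono integral_mono)
    fix i assume i: "i \<in> {..<n}"
    show "integrable (LM n) (\<lambda>x. (indicator (shell n a b) x * D i x)\<^sup>2)"
      using i F by (intro bdd_supp_integrable bdd_supp_power bdd_supp_mult bdd_supp_indicator_shell) auto
    show "integrable (LM n) (\<lambda>x. (?E i x * f x + ?\<eta> x * D i x)\<^sup>2)"
      using i F by (intro bdd_supp_integrable bdd_supp_power bdd_supp_add bdd_supp_mult[OF Ebs] bdd_supp_mult[OF \<eta>bdd_supp]) auto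
    show "(indicator (shell n a b) x * D i x)\<^sup>2 \<le> (?E i x * f x + ?\<eta> x * D i x)\<^sup>2" for x
      using one[of x] E0[of x i] by (cases "x \<in> shell n a b") (auto simp: shell_def)
  qed
  also have "\<dots> \<le> 5 * ((32 * H / a) * F2) + 11 * e" using E 1 2 by linarith
  finally show ?thesis by (simp add: F2_def e_def)
qed

text \<open>The integrand without its weight is what the Laplacian of v f adds to v \<Delta> f. It
  lives in the layer, where the weight is at most a^(-\<mu>). The gradient of \<open>f\<close> is
  controlled by \<open>Caccioppoli\<close> on the wider shell, \<Delta> v by its size n/b^2, and the
  passage from L^2 to L^p turns this \<open>n\<close> into sqrt n.\<close>

lemma commutator_bound:
  assumes n: "n \<ge> 3" and f: "C2 n f D Hf"
    and V: "in_Lq (LM n) (real n / 2) V" "Lq_norm (LM n) (real n / 2) V \<le> 1"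
    and ab: "0 < a0" "a0 < a" "a < b" "b < b0" "a\<^sup>2 \<le> 8 * (a\<^sup>2 - a0\<^sup>2)" "b0\<^sup>2 \<le> 8 * (b0\<^sup>2 - b\<^sup>2)" "b0 \<le> R"
    and t: "transition n a b v E K" and \<mu>: "\<mu> \<ge> 0"
  shows "Lq_norm (LM n) (exponent_p n) (\<lambda>x. pnorm n x powr (- \<mu>) * (2 * (\<Sum>i<n. E i x * D i x) + f x * lapl n K x)) \<le>
    a powr (- \<mu>) * (27000 * H\<^sup>2 * sqrt (real n) / a * Lq_norm (LM n) 2 (\<lambda>x. indicator (shell n a0 b0) x * f x)
       + 1760 * H * residual_norm n R V f (lapl n Hf))"
proof -
  note ex = exponents[OF n] and F = C2_D[OF f] and T = transition_D[OF t]
  define F2 where "F2 = Lq_norm (LM n) 2 (\<lambda>x. indicator (shell n a0 b0) x * f x)"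
  define e where "e = residual_norm n R V f (lapl n Hf)"
  define X where "X = sqrt (\<Sum>i<n. \<integral>x. (indicator (shell n a b) x * D i x)\<^sup>2 \<partial>LM n)"
  have X: "X \<le> 160 * H / a * F2 + 11 * e"
    unfolding X_def F2_def e_def by (rule Caccioppoli[OF n f V ab])
  have H1: "H \<ge> 1" by (rule H_ge_1)
  have F20: "F2 \<ge> 0" by (simp add: F2_def)
  have e0: "e \<ge> 0" by (simp add: e_def residual_norm_def)
  have n0: "real n > 0" "sqrt (real n) \<ge> 1" using n by (auto simp: real_le_rsqrt)
  let ?Z1 = "\<lambda>x. \<Sum>i<n. E i x * D i x" and ?Z2 = "\<lambda>x. f x * lapl n K x"
  let ?Z = "\<lambda>x. 2 * ?Z1 x + ?Z2 x"
  have bE: "bdd_supp n (E i)" if "i < n" for i by (rule transition_bdd_supp(1)[OF t that])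
  have b1: "bdd_supp n ?Z1" using bE F by (intro bdd_supp_sum bdd_supp_mult) auto
  have b2: "bdd_supp n ?Z2" using F by (intro bdd_supp_mult2 transition_bdd_supp(2)[OF t]) auto
  have bZ: "bdd_supp n ?Z" by (intro bdd_supp_add bdd_supp_cmult b1 b2)
  have Zz: "?Z x = 0" if "\<not> (a < pnorm n x \<and> pnorm n x < b)" for x using T(4,5)[OF that] by simp
  have Z1: "Lq_norm (LM n) 2 ?Z1 \<le> 16 * H / b * X"
  proof -
    have "(\<integral>x. (?Z1 x)\<^sup>2 \<partial>LM n) \<le> (\<integral>x. (16 * H / b)\<^sup>2 * (\<Sum>i<n. (indicator (shell n a b) x * D i x)\<^sup>2) \<partial>LM n)"
    proof (rule integral_mono)
      show "integrable (LM n) (\<lambda>x. (?Z1 x)\<^sup>2)" by (intro bdd_supp_integrable bdd_supp_power b1) auto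
      show "integrable (LM n) (\<lambda>x. (16 * H / b)\<^sup>2 * (\<Sum>i<n. (indicator (shell n a b) x * D i x)\<^sup>2))"
        using F by (intro bdd_supp_integrable bdd_supp_cmult bdd_supp_sum bdd_supp_power bdd_supp_mult bdd_supp_indicator_shell) auto
      fix x assume "x \<in> space (LM n)"
      show "(?Z1 x)\<^sup>2 \<le> (16 * H / b)\<^sup>2 * (\<Sum>i<n. (indicator (shell n a b) x * D i x)\<^sup>2)"
      proof (cases "a < pnorm n x \<and> pnorm n x < b")
        case True
        then have "indicator (shell n a b) x = (1::real)" using \<open>x \<in> space (LM n)\<close> by (simp add: shell_def)
        moreover have "(?Z1 x)\<^sup>2 \<le> (\<Sum>i<n. (E i x)\<^sup>2) * (\<Sum>i<n. (D i x)\<^sup>2)" by (rule Cauchy_Schwarz_ineq_sum)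
        moreover have "\<dots> \<le> (16 * H / b)\<^sup>2 * (\<Sum>i<n. (D i x)\<^sup>2)" using T(6) by (intro mult_right_mono) (auto intro!: sum_nonneg)
        ultimately show ?thesis by simp
      next
        case False
        then show ?thesis using T(4)[OF False] by (simp add: sum_nonneg)
      qed
    qed
    also have "\<dots> = (16 * H / b)\<^sup>2 * (\<Sum>i<n. \<integral>x. (indicator (shell n a b) x * D i x)\<^sup>2 \<partial>LM n)"
      using F by (subst integral_mult_right_zero, subst Bochner_Integration.integral_sum)
        (auto intro!: bdd_supp_integrable bdd_supp_power bdd_supp_mult bdd_supp_indicator_shell)
    finally have "sqrt (\<integral>x. (?Z1 x)\<^sup>2 \<partial>LM n) \<le> sqrt ((16 * H / b)\<^sup>2 * (\<Sum>i<n. \<integral>x. (indicator (shell n a b) x * D i x)\<^sup>2 \<partial>LM n))"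
      by (rule real_sqrt_le_mono)
    also have "\<dots> = 16 * H / b * X" using H1 ab by (simp add: real_sqrt_mult X_def)
    finally show ?thesis by (simp add: sqrt_integral_Lq_norm)
  qed
  have Z2: "Lq_norm (LM n) 2 ?Z2 \<le> 272 * real n * H / b\<^sup>2 * F2"
  proof -
    have "Lq_norm (LM n) 2 ?Z2 \<le> Lq_norm (LM n) 2 (\<lambda>x. (272 * real n * H / b\<^sup>2) * (indicator (shell n a0 b0) x * f x))"
    proof (rule Lq_norm_mono)
      show "?Z2 \<in> borel_measurable (LM n)" by (rule bdd_supp_measurable[OF b2])
      show "in_Lq (LM n) 2 (\<lambda>x. (272 * real n * H / b\<^sup>2) * (indicator (shell n a0 b0) x * f x))"
        using F by (intro in_Lq_cmult bdd_supp_in_Lq bdd_supp_mult bdd_supp_indicator_shell) auto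
      fix x assume x: "x \<in> space (LM n)"
      show "\<bar>?Z2 x\<bar> \<le> \<bar>(272 * real n * H / b\<^sup>2) * (indicator (shell n a0 b0) x * f x)\<bar>"
      proof (cases "a < pnorm n x \<and> pnorm n x < b")
        case True
        then have "indicator (shell n a0 b0) x = (1::real)" using x ab by (simp add: shell_def)
        then show ?thesis using mult_right_mono[OF T(7)[of x] abs_ge_zero[of "f x"]] H1 by (simp add: abs_mult mult.commute)
      next
        case False then show ?thesis using T(5)[OF False] by simp
      qed
    qed simp
    also have "\<dots> = 272 * real n * H / b\<^sup>2 * F2" unfolding F2_def by (subst Lq_norm_cmult) (use H1 in auto)
    finally show ?thesis .
  qed
  have "Lq_norm (LM n) 2 ?Z \<le> Lq_norm (LM n) 2 (\<lambda>x. 2 * ?Z1 x) + Lq_norm (LM n) 2 ?Z2"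
    using b1 b2 by (intro Minkowski bdd_supp_in_Lq bdd_supp_cmult) auto
  also have "Lq_norm (LM n) 2 (\<lambda>x. 2 * ?Z1 x) = 2 * Lq_norm (LM n) 2 ?Z1" by (subst Lq_norm_cmult) auto
  finally have Z: "Lq_norm (LM n) 2 ?Z \<le> 2 * (16 * H / b * X) + 272 * real n * H / b\<^sup>2 * F2" using Z1 Z2 by linarith
  have sub: "shell n a b \<subseteq> ball0 n b" by (auto simp: shell_def ball0_def)
  have pw: "pnorm n x powr (- \<mu>) \<le> a powr (- \<mu>)" if "a < pnorm n x" for x
    using that ab \<mu> by (intro powr_mono2') auto
  have "Lq_norm (LM n) (exponent_p n) (\<lambda>x. pnorm n x powr (- \<mu>) * ?Z x) \<le>
    Lq_norm (LM n) (exponent_p n) (\<lambda>x. a powr (- \<mu>) * (indicator (shell n a b) x * ?Z x))"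
  proof (rule Lq_norm_mono)
    show "(\<lambda>x. pnorm n x powr (- \<mu>) * ?Z x) \<in> borel_measurable (LM n)"
      using measurable_abs_powr[OF pnorm_measurable, of n "-\<mu>"] bdd_supp_measurable[OF bZ] by (intro borel_measurable_times) simp_all
    show "in_Lq (LM n) (exponent_p n) (\<lambda>x. a powr (- \<mu>) * (indicator (shell n a b) x * ?Z x))"
      using bZ ex by (intro in_Lq_cmult bdd_supp_in_Lq bdd_supp_mult bdd_supp_indicator_shell bdd_supp_bdd_meas) auto
    fix x assume x: "x \<in> space (LM n)"
    show "\<bar>pnorm n x powr (- \<mu>) * ?Z x\<bar> \<le> \<bar>a powr (- \<mu>) * (indicator (shell n a b) x * ?Z x)\<bar>"
    proof (cases "a < pnorm n x \<and> pnorm n x < b")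
      case True
      then have "indicator (shell n a b) x = (1::real)" using x by (simp add: shell_def)
      then show ?thesis using pw[of x] True by (simp add: abs_mult mult_right_mono)
    next
      case False then show ?thesis using Zz[OF False] by simp
    qed
  qed (use ex in auto)
  also have "\<dots> = a powr (- \<mu>) * Lq_norm (LM n) (exponent_p n) (\<lambda>x. indicator (shell n a b) x * ?Z x)"
    using ex ab by (simp add: Lq_norm_cmult)
  also have "\<dots> \<le> a powr (- \<mu>) * (5 * b / sqrt (real n) * Lq_norm (LM n) 2 ?Z)"
    using ab bZ by (intro mult_left_mono Lq_norm_p_le_2[OF n sets_shell sub] bdd_supp_in_Lq) auto
  also have "\<dots> \<le> a powr (- \<mu>) * (27000 * H\<^sup>2 * sqrt (real n) / a * F2 + 1760 * H * e)"
  proof (rule mult_left_mono)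
    \<comment> \<open>160 = 5 * 2 * 16 multiplies the constants 160 and 11 of
      \<open>Caccioppoli\<close>, and 1360 = 5 * 272; the sum 25600 + 1360 is rounded up to
      27000.\<close>
    have "5 * b / sqrt (real n) * Lq_norm (LM n) 2 ?Z \<le> 5 * b / sqrt (real n) * (2 * (16 * H / b * X) + 272 * real n * H / b\<^sup>2 * F2)"
      using Z ab by (intro mult_left_mono) auto
    also have "\<dots> = (160 * H / sqrt (real n)) * X + 1360 * H * (real n / sqrt (real n)) / b * F2"
      using ab n0 by (simp add: field_simps power2_eq_square)
    also have "real n / sqrt (real n) = sqrt (real n)" using n0 by (simp add: real_div_sqrt)
    also have "(160 * H / sqrt (real n)) * X \<le> (160 * H / 1) * (160 * H / a * F2 + 11 * e)"
      using X n0 H1 F20 e0 ab by (intro mult_mono divide_left_mono) (auto simp: X_def intro!: sum_nonneg)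
    also have "1360 * H * sqrt (real n) / b * F2 \<le> 1360 * H\<^sup>2 * sqrt (real n) / a * F2"
      using ab H1 F20 n0 by (intro mult_right_mono frac_le) (auto simp: power2_eq_square)
    also have "(160 * H / 1) * (160 * H / a * F2 + 11 * e) = 25600 * H\<^sup>2 * 1 / a * F2 + 1760 * H * e"
      by (simp add: algebra_simps power2_eq_square)
    also have "25600 * H\<^sup>2 * 1 / a * F2 \<le> 25600 * H\<^sup>2 * sqrt (real n) / a * F2"
      using ab n0 F20 by (intro mult_right_mono divide_right_mono mult_left_mono) auto
    finally have fin: "5 * b / sqrt (real n) * Lq_norm (LM n) 2 ?Z \<le> 26960 * (H\<^sup>2 * sqrt (real n) / a * F2) + 1760 * H * e"
      by (simp add: algebra_simps)
    have Y0: "0 \<le> H\<^sup>2 * sqrt (real n) / a * F2" using ab F20 by simp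
    have Y: "27000 * H\<^sup>2 * sqrt (real n) / a * F2 = 27000 * (H\<^sup>2 * sqrt (real n) / a * F2)" by simp
    show "5 * b / sqrt (real n) * Lq_norm (LM n) 2 ?Z \<le> 27000 * H\<^sup>2 * sqrt (real n) / a * F2 + 1760 * H * e"
      unfolding Y by (rule order_trans[OF fin add_right_mono[OF mult_right_mono[OF _ Y0]]]) simp
  qed simp
  finally show ?thesis by (simp add: F2_def e_def)
qed

text \<open>Both cutoff annuli contribute a commutator; the one with weight \<open>(\<rho>/2) powr (- \<mu>)\<close> is the price for
  removing the origin, the other one gains the small factor that the choice of \<open>\<mu>\<close> exploits.\<close>

lemma Carleman_annulus:
  assumes n: "n \<ge> 3" and C: "Carleman_constant n \<theta>" and \<mu>: "\<mu> \<in> Carleman_exponents n" and f: "C2 n f D Hf"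
    and V: "in_Lq (LM n) (real n / 2) V" and \<theta>: "\<theta> * Lq_norm (LM n) (real n / 2) V \<le> \<kappa>" "\<kappa> < 1"
    and \<rho>: "0 < \<rho>" "\<rho> < r"
    and A: "A \<in> sets (LM n)" "A \<subseteq> ball0 n d" "0 < d" "\<And>x. x \<in> A \<Longrightarrow> 3 * \<rho> / 4 \<le> pnorm n x \<and> pnorm n x \<le> 9 * r / 8"
  shows "d powr (- \<mu> - 1) * Lq_norm (LM n) 2 (\<lambda>x. indicator A x * f x) \<le>
    135000 * H\<^sup>2 * (\<theta> / (1 - \<kappa>)) *
      ((\<rho> / 2) powr (- \<mu> - 1) * Lq_norm (LM n) 2 (\<lambda>x. indicator (shell n (\<rho> / 4) \<rho>) x * f x)
       + (9 * r / 8) powr (- \<mu> - 1) * Lq_norm (LM n) 2 (\<lambda>x. indicator (shell n r (13 * r / 4)) x * f x))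
    + 5 * (\<theta> / (1 - \<kappa>)) * ((\<rho> / 2) powr (- \<mu>) * (1 + 1760 * H) + (9 * r / 8) powr (- \<mu>) * 1760 * H)
      * residual_norm n (13 * r / 4) V f (lapl n Hf)"
proof -
  note ex = exponents[OF n] and F = C2_D[OF f]
  have \<theta>1: "\<theta> \<ge> 1" using C by (simp add: Carleman_constant_def)
  have \<mu>0: "\<mu> > 0" using \<mu> by (simp add: Carleman_exponents_def)
  have V1: "Lq_norm (LM n) (real n / 2) V \<le> 1"
    using \<theta> \<theta>1 mult_right_mono[OF \<theta>1 Lq_norm_nonneg[of "LM n" "real n / 2" V]] by linarith
  have H1: "H \<ge> 1" by (rule H_ge_1)
  let ?R = "13 * r / 4"
  have r: "r > 0" using \<rho> by simp
  have s: "\<And>x::real. x\<^sup>2 = x * x" by (simp add: power2_eq_square)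
  \<comment> \<open>The layers \<rho>/2 < |x| < 3\<rho>/4 and 9r/8 < |x| < 3r lie strictly inside
    the two shells of the statement; the margins are the room that \<open>commutator_bound\<close>
    needs.\<close>
  let ?u = "up n (\<rho> / 2) (3 * \<rho> / 4)" and ?Eu = "upD n (\<rho> / 2) (3 * \<rho> / 4)" and ?Ku = "upH n (\<rho> / 2) (3 * \<rho> / 4)"
  let ?d = "\<lambda>x. 1 - up n (9 * r / 8) (3 * r) x" and ?Ed = "\<lambda>i x. - upD n (9 * r / 8) (3 * r) i x"
    and ?Kd = "\<lambda>i j x. - upH n (9 * r / 8) (3 * r) i j x"
  have tu: "transition n (\<rho> / 2) (3 * \<rho> / 4) ?u ?Eu ?Ku" using \<rho> n by (intro transition_up) (auto simp: s)
  have td: "transition n (9 * r / 8) (3 * r) ?d ?Ed ?Kd" using \<rho> n by (intro transition_down transition_up) (auto simp: s)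
  note U = transition_D[OF tu] and Dd = transition_D[OF td]
  let ?\<eta> = "\<lambda>x. ?u x * ?d x"
  define E where "E = (\<lambda>i x. ?Eu i x * ?d x + ?u x * ?Ed i x)"
  define K where "K = (\<lambda>i j x. (?Ku i j x * ?d x + ?Eu i x * ?Ed j x) + (?Eu j x * ?Ed i x + ?u x * ?Kd i j x))"
  have CC: "C2 n ?\<eta> E K" unfolding E_def K_def by (rule C2_mult[OF U(1) Dd(1)])
  have z: "?\<eta> x = 0" if "pnorm n x \<le> \<rho> / 2 \<or> pnorm n x \<ge> 3 * r" for x
    using up_vals(2)[of "9 * r / 8" "3 * r" n x] up_vals(1)[of "\<rho> / 2" "3 * \<rho> / 4" n x] r \<rho> that by auto
  have u1: "?u x = 1" if "pnorm n x \<ge> 3 * \<rho> / 4" for x using up_vals(2)[of "\<rho> / 2" "3 * \<rho> / 4" n x] \<rho> that by simp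
  have d1: "?d x = 1" if "pnorm n x \<le> 9 * r / 8" for x using up_vals(1)[of "9 * r / 8" "3 * r" n x] r that by simp
  \<comment> \<open>The two layers are disjoint because \<rho> < r, and each cutoff is 1 where the
    other one varies. The derivatives of the product are thus sums without mixed terms.\<close>
  have EK: "E i x = ?Eu i x + ?Ed i x" "lapl n K x = lapl n ?Ku x + lapl n ?Kd x" if "x \<in> Rn n" for i x
  proof -
    have K': "lapl n K x = lapl n ?Ku x * ?d x + 2 * (\<Sum>i<n. ?Eu i x * ?Ed i x) + ?u x * lapl n ?Kd x"
      unfolding K_def by (rule lapl_mult)
    consider "pnorm n x \<le> 9 * r / 8" "pnorm n x \<ge> 3 * \<rho> / 4" | "pnorm n x < 3 * \<rho> / 4" | "pnorm n x > 9 * r / 8" by linarith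
    then have "E i x = ?Eu i x + ?Ed i x \<and> lapl n K x = lapl n ?Ku x + lapl n ?Kd x"
    proof cases
      case 1
      then show ?thesis using U(4)[of x] U(5)[of x] Dd(4)[of x] Dd(5)[of x] u1[of x] d1[of x] K' by (simp add: E_def)
    next
      case 2
      then have "pnorm n x \<le> 9 * r / 8" using \<rho> by linarith
      with 2 show ?thesis using Dd(4)[of x] Dd(5)[of x] d1[of x] K' by (simp add: E_def)
    next
      case 3
      then have "pnorm n x \<ge> 3 * \<rho> / 4" using \<rho> by linarith
      with 3 show ?thesis using U(4)[of x] U(5)[of x] u1[of x] K' by (simp add: E_def)
    qed
    then show "E i x = ?Eu i x + ?Ed i x" "lapl n K x = lapl n ?Ku x + lapl n ?Kd x" by auto
  qed
  let ?w = "\<lambda>x. ?\<eta> x * f x"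
  define Kw where "Kw = (\<lambda>i j x. (K i j x * f x + E i x * D j x) + (E j x * D i x + ?\<eta> x * Hf i j x))"
  have Cw: "C2 n ?w (\<lambda>i x. E i x * f x + ?\<eta> x * D i x) Kw"
    unfolding Kw_def by (rule C2_mult[OF CC f])
  let ?om = "\<lambda>x. pnorm n x powr (- \<mu>)"
  define N where "N = Lq_norm (LM n) (exponent_p' n) (\<lambda>x. ?om x * ?w x)"
  have Car: "N \<le> \<theta> * Lq_norm (LM n) (exponent_p n) (\<lambda>x. ?om x * lapl n Kw x)"
    unfolding N_def
  proof (rule Carleman_C2[OF C \<mu> n Cw, of "\<rho> / 2" "3 * r"])
    fix x assume "pnorm n x < \<rho> / 2 \<or> pnorm n x > 3 * r"
    then have "?\<eta> x = 0" by (intro z) auto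
    then show "?w x = 0" by simp
  qed (use \<rho> in auto)
  have m_om: "?om \<in> borel_measurable (LM n)" using measurable_abs_powr[OF pnorm_measurable, of n "-\<mu>"] by simp
  have om_le: "?om x \<le> c powr (- \<mu>)" if "c \<le> pnorm n x" "c > 0" for c x
    using that \<mu>0 by (intro powr_mono2') auto
  have \<eta>01: "0 \<le> ?\<eta> x" "?\<eta> x \<le> 1" for x using U(2,3)[of x] Dd(2,3)[of x] by (auto intro!: mult_le_one)
  have bom\<eta>: "bdd_supp n (\<lambda>x. ?om x * ?\<eta> x)"
  proof (rule bdd_supp_if_pnorm_support[of _ _ "3 * r"])
    show "bdd_meas n (\<lambda>x. ?om x * ?\<eta> x)" unfolding bdd_meas_def
    proof (intro conjI exI ballI)
      show "(\<lambda>x. ?om x * ?\<eta> x) \<in> borel_measurable (LM n)"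
        by (rule borel_measurable_times[OF m_om bdd_meas_measurable[OF C2_D(1)[OF CC]]])
      fix x
      show "\<bar>?om x * ?\<eta> x\<bar> \<le> (\<rho> / 2) powr (- \<mu>)"
      proof (cases "pnorm n x \<le> \<rho> / 2")
        case True
        have "?\<eta> x = 0" using True by (intro z) simp
        then show ?thesis by (simp only: mult_zero_right abs_zero powr_ge_zero)
      next
        case False
        then have "?om x * ?\<eta> x \<le> (\<rho> / 2) powr (- \<mu>) * 1" using om_le[of "\<rho> / 2" x] \<eta>01[of x] \<rho> by (intro mult_mono) auto
        moreover have "0 \<le> ?om x * ?\<eta> x" by (intro mult_nonneg_nonneg[OF powr_ge_zero] \<eta>01)
        ultimately show ?thesis by (simp only: abs_of_nonneg mult_1_right)
      qed
    qed
    show "?om x * ?\<eta> x = 0" if "pnorm n x \<ge> 3 * r" for x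
    proof -
      have "?\<eta> x = 0" using that by (intro z) simp
      then show ?thesis by (simp only: mult_zero_right)
    qed
  qed
  have bomw: "bdd_supp n (\<lambda>x. ?om x * ?w x)" using bdd_supp_mult[OF bom\<eta> F(1)] by (simp add: mult.assoc)
  have wL: "in_Lq (LM n) (exponent_p' n) (\<lambda>x. ?om x * ?w x)" using ex by (intro bdd_supp_in_Lq bomw) auto
  note VW = in_Lq_V_mult[OF n V wL]
  let ?Zu = "\<lambda>x. 2 * (\<Sum>i<n. ?Eu i x * D i x) + f x * lapl n ?Ku x"
  let ?Zd = "\<lambda>x. 2 * (\<Sum>i<n. ?Ed i x * D i x) + f x * lapl n ?Kd x"
  \<comment> \<open>Replacing \<Delta> f by V f plus the defect splits the weighted Laplacian of
    \<open>?w\<close> into a potential term, the residual and one commutator for each layer.\<close>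
  have dec: "?om x * lapl n Kw x = (V x * (?om x * ?w x) + (?om x * ?\<eta> x) * (lapl n Hf x - V x * f x)) + (?om x * ?Zu x + ?om x * ?Zd x)"
    if "x \<in> Rn n" for x
  proof -
    have "lapl n Kw x = lapl n K x * f x + 2 * (\<Sum>i<n. E i x * D i x) + ?\<eta> x * lapl n Hf x"
      unfolding Kw_def by (rule lapl_mult)
    also have "(\<Sum>i<n. E i x * D i x) = (\<Sum>i<n. ?Eu i x * D i x) + (\<Sum>i<n. ?Ed i x * D i x)"
      by (simp only: EK(1)[OF that] distrib_right sum.distrib)
    finally have L: "lapl n Kw x = (lapl n ?Ku x + lapl n ?Kd x) * f x + 2 * ((\<Sum>i<n. ?Eu i x * D i x) + (\<Sum>i<n. ?Ed i x * D i x)) + ?\<eta> x * lapl n Hf x"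
      by (simp add: EK(2)[OF that])
    show ?thesis unfolding L by (simp only: algebra_simps)
  qed
  define e where "e = residual_norm n ?R V f (lapl n Hf)"
  define Fi where "Fi = Lq_norm (LM n) 2 (\<lambda>x. indicator (shell n (\<rho> / 4) \<rho>) x * f x)"
  define Fo where "Fo = Lq_norm (LM n) 2 (\<lambda>x. indicator (shell n r ?R) x * f x)"
  \<comment> \<open>The weight is unbounded near the origin; the product is bounded because the
    commutator vanishes for |x| \<le> a.\<close>
  have Zbs: "bdd_supp n (\<lambda>x. ?om x * (2 * (\<Sum>i<n. E' i x * D i x) + f x * lapl n K' x))" if t: "transition n a b v E' K'" and a: "a > 0" for a b v E' K'
  proof (rule bdd_supp_if_pnorm_support[of _ _ b])
    let ?Z = "\<lambda>x. 2 * (\<Sum>i<n. E' i x * D i x) + f x * lapl n K' x"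
    have bZ: "bdd_supp n ?Z" using F transition_bdd_supp[OF t] by (intro bdd_supp_add bdd_supp_cmult bdd_supp_sum bdd_supp_mult bdd_supp_mult2) auto
    have zz: "?Z x = 0" if "\<not> (a < pnorm n x \<and> pnorm n x < b)" for x using transition_D(4,5)[OF t that] by simp
    obtain B where B: "B > 0" "\<And>x. x \<in> Rn n \<Longrightarrow> \<bar>?Z x\<bar> \<le> B" using bndE[OF bdd_supp_bdd_meas[OF bZ]] by metis
    show "bdd_meas n (\<lambda>x. ?om x * ?Z x)" unfolding bdd_meas_def
    proof (intro conjI exI ballI)
      show "(\<lambda>x. ?om x * ?Z x) \<in> borel_measurable (LM n)"
        using m_om bdd_supp_measurable[OF bZ] by (intro borel_measurable_times)
      fix x assume x: "x \<in> Rn n"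
      show "\<bar>?om x * ?Z x\<bar> \<le> a powr (- \<mu>) * B"
      proof (cases "a < pnorm n x")
        case True
        then show ?thesis unfolding abs_mult using om_le[of a x] a B(2)[OF x] by (intro mult_mono) auto
      next
        case False then show ?thesis using zz[of x] B(1) by simp
      qed
    qed
    show "?om x * ?Z x = 0" if "pnorm n x \<ge> b" for x using zz[of x] that by simp
  qed
  have bZu: "bdd_supp n (\<lambda>x. ?om x * ?Zu x)" by (rule Zbs[OF tu]) (use \<rho> in simp)
  have bZd: "bdd_supp n (\<lambda>x. ?om x * ?Zd x)" by (rule Zbs[OF td]) (use r in simp)
  have Zu: "Lq_norm (LM n) (exponent_p n) (\<lambda>x. ?om x * ?Zu x) \<le> (\<rho> / 2) powr (- \<mu>) * (27000 * H\<^sup>2 * sqrt (real n) / (\<rho> / 2) * Fi + 1760 * H * e)"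
    unfolding Fi_def e_def by (rule commutator_bound[OF n f V V1 _ _ _ _ _ _ _ tu]) (use \<rho> \<mu>0 in \<open>auto simp: s\<close>)
  have Zd: "Lq_norm (LM n) (exponent_p n) (\<lambda>x. ?om x * ?Zd x) \<le> (9 * r / 8) powr (- \<mu>) * (27000 * H\<^sup>2 * sqrt (real n) / (9 * r / 8) * Fo + 1760 * H * e)"
    unfolding Fo_def e_def by (rule commutator_bound[OF n f V V1 _ _ _ _ _ _ _ td]) (use \<rho> \<mu>0 in \<open>auto simp: s\<close>)
  have om\<eta>: "\<bar>?om x * ?\<eta> x\<bar> \<le> (\<rho> / 2) powr (- \<mu>)" for x
  proof (cases "pnorm n x \<le> \<rho> / 2")
    case True
    have "?\<eta> x = 0" using True by (intro z) simp
    then show ?thesis by (simp only: mult_zero_right abs_zero powr_ge_zero)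
  next
    case False
    then have "?om x * ?\<eta> x \<le> (\<rho> / 2) powr (- \<mu>) * 1" using om_le[of "\<rho> / 2" x] \<eta>01[of x] \<rho> by (intro mult_mono) auto
    moreover have "0 \<le> ?om x * ?\<eta> x" by (intro mult_nonneg_nonneg[OF powr_ge_zero] \<eta>01)
    ultimately show ?thesis by (simp only: abs_of_nonneg mult_1_right)
  qed
  have er: "Lq_norm (LM n) (exponent_p n) (\<lambda>x. (?om x * ?\<eta> x) * (lapl n Hf x - V x * f x)) \<le> (\<rho> / 2) powr (- \<mu>) * e"
    unfolding e_def
    by (rule residual_norm_bound[OF n F(1) F(6) V bdd_supp_measurable[OF bom\<eta>] om\<eta>]) (use z r in auto)
  have erL: "in_Lq (LM n) (exponent_p n) (\<lambda>x. (?om x * ?\<eta> x) * (lapl n Hf x - V x * f x))"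
  proof -
    have "in_Lq (LM n) (exponent_p n) (\<lambda>x. (?om x * ?\<eta> x) * lapl n Hf x)" using ex F by (intro bdd_supp_in_Lq bdd_supp_mult bom\<eta>) auto
    from in_Lq_diff[OF this VW(1)] ex show ?thesis by (simp add: algebra_simps)
  qed
  have "Lq_norm (LM n) (exponent_p n) (\<lambda>x. ?om x * lapl n Kw x) =
    Lq_norm (LM n) (exponent_p n) (\<lambda>x. (V x * (?om x * ?w x) + (?om x * ?\<eta> x) * (lapl n Hf x - V x * f x)) + (?om x * ?Zu x + ?om x * ?Zd x))"
    using dec by (intro Lq_norm_cong) simp
  also have "\<dots> \<le> Lq_norm (LM n) (exponent_p n) (\<lambda>x. V x * (?om x * ?w x) + (?om x * ?\<eta> x) * (lapl n Hf x - V x * f x))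
     + Lq_norm (LM n) (exponent_p n) (\<lambda>x. ?om x * ?Zu x + ?om x * ?Zd x)"
    using ex by (intro Minkowski in_Lq_add VW erL bdd_supp_in_Lq bZu bZd) auto
  also have "Lq_norm (LM n) (exponent_p n) (\<lambda>x. V x * (?om x * ?w x) + (?om x * ?\<eta> x) * (lapl n Hf x - V x * f x)) \<le>
     Lq_norm (LM n) (exponent_p n) (\<lambda>x. V x * (?om x * ?w x)) + Lq_norm (LM n) (exponent_p n) (\<lambda>x. (?om x * ?\<eta> x) * (lapl n Hf x - V x * f x))"
    using ex by (intro Minkowski VW erL) auto
  also have "Lq_norm (LM n) (exponent_p n) (\<lambda>x. ?om x * ?Zu x + ?om x * ?Zd x) \<le>
     Lq_norm (LM n) (exponent_p n) (\<lambda>x. ?om x * ?Zu x) + Lq_norm (LM n) (exponent_p n) (\<lambda>x. ?om x * ?Zd x)"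
    using ex by (intro Minkowski bdd_supp_in_Lq bZu bZd) auto
  finally have tot: "Lq_norm (LM n) (exponent_p n) (\<lambda>x. ?om x * lapl n Kw x) \<le> Lq_norm (LM n) (real n / 2) V * N + Q"
    if "Q = (\<rho> / 2) powr (- \<mu>) * e + (\<rho> / 2) powr (- \<mu>) * (27000 * H\<^sup>2 * sqrt (real n) / (\<rho> / 2) * Fi + 1760 * H * e)
      + (9 * r / 8) powr (- \<mu>) * (27000 * H\<^sup>2 * sqrt (real n) / (9 * r / 8) * Fo + 1760 * H * e)" for Q
    using VW(2) er Zu Zd that unfolding N_def by linarith
  define Q where "Q = (\<rho> / 2) powr (- \<mu>) * e + (\<rho> / 2) powr (- \<mu>) * (27000 * H\<^sup>2 * sqrt (real n) / (\<rho> / 2) * Fi + 1760 * H * e)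
      + (9 * r / 8) powr (- \<mu>) * (27000 * H\<^sup>2 * sqrt (real n) / (9 * r / 8) * Fo + 1760 * H * e)"
  have N0: "N \<ge> 0" by (simp add: N_def)
  \<comment> \<open>After multiplication by \<theta> the potential term is at most \<kappa> N and
    moves to the left; this produces \<theta>/(1 - \<kappa>), which becomes
    \<open>theta_tilde\<close> in the theorem.\<close>
  have "N \<le> \<theta> * (Lq_norm (LM n) (real n / 2) V * N + Q)"
    using Car tot[OF Q_def] \<theta>1 by (meson mult_left_mono order_trans zero_le_one)
  also have "\<dots> = (\<theta> * Lq_norm (LM n) (real n / 2) V) * N + \<theta> * Q" by (simp add: algebra_simps)
  also have "\<dots> \<le> \<kappa> * N + \<theta> * Q" using \<theta> N0 by (intro add_right_mono mult_right_mono)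
  finally have "(1 - \<kappa>) * N \<le> \<theta> * Q" by (simp add: algebra_simps)
  then have NQ: "N \<le> (\<theta> / (1 - \<kappa>)) * Q" using \<theta>(2) by (simp add: field_simps)
  \<comment> \<open>On \<open>A\<close> both cutoffs are 1 and the weight is at least d^(-\<mu>), so
    the weighted norm dominates the plain one.\<close>
  have "Lq_norm (LM n) 2 (\<lambda>x. indicator A x * f x) \<le> Lq_norm (LM n) 2 (\<lambda>x. d powr \<mu> * (indicator A x * (?om x * ?w x)))"
  proof (rule Lq_norm_mono)
    have iA: "bdd_supp n (indicat_real A)"
      by (rule bdd_supp_if_pnorm_support[of _ _ d]) (use A(1,2) in \<open>auto simp: bdd_meas_def indicator_def ball0_def intro!: exI[of _ 1]\<close>)
    show "(\<lambda>x. indicator A x * f x) \<in> borel_measurable (LM n)" by (rule bdd_supp_measurable[OF bdd_supp_mult[OF iA F(1)]])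
    show "in_Lq (LM n) 2 (\<lambda>x. d powr \<mu> * (indicator A x * (?om x * ?w x)))"
      by (intro in_Lq_cmult bdd_supp_in_Lq bdd_supp_mult2[OF bdd_supp_bdd_meas[OF iA] bomw]) auto
    fix x assume "x \<in> space (LM n)"
    show "\<bar>indicator A x * f x\<bar> \<le> \<bar>d powr \<mu> * (indicator A x * (?om x * ?w x))\<bar>"
    proof (cases "x \<in> A")
      case True
      then have px: "3 * \<rho> / 4 \<le> pnorm n x" "pnorm n x \<le> 9 * r / 8" "pnorm n x < d" using A(2,4) by (auto simp: ball0_def)
      have w: "?w x = f x" using u1[OF px(1)] d1[OF px(2)] by simp
      have "d powr (- \<mu>) \<le> ?om x" using px \<rho> \<mu>0 by (intro powr_mono2') auto
      then have "1 \<le> d powr \<mu> * ?om x" using A(3) by (simp add: powr_minus field_simps)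
      then have "\<bar>f x\<bar> * 1 \<le> \<bar>f x\<bar> * (d powr \<mu> * ?om x)" by (intro mult_left_mono) auto
      then show ?thesis unfolding w using True by (simp add: abs_mult mult_ac)
    qed simp
  qed simp
  also have "\<dots> = d powr \<mu> * Lq_norm (LM n) 2 (\<lambda>x. indicator A x * (?om x * ?w x))" by (simp add: Lq_norm_cmult)
  \<comment> \<open>A second volume factor n^(-1/2) appears here; it cancels the sqrt n that the
    commutators left in \<open>Q\<close>.\<close>
  also have "\<dots> \<le> d powr \<mu> * (5 * d / sqrt (real n) * N)"
    unfolding N_def by (intro mult_left_mono Lq_norm_2_le_p'[OF n A(1-3)] wL) auto
  also have "\<dots> \<le> d powr \<mu> * (5 * d / sqrt (real n) * ((\<theta> / (1 - \<kappa>)) * Q))"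
    using NQ A(3) by (intro mult_left_mono) auto
  finally have "d powr (- \<mu> - 1) * Lq_norm (LM n) 2 (\<lambda>x. indicator A x * f x) \<le>
     d powr (- \<mu> - 1) * (d powr \<mu> * (5 * d / sqrt (real n) * ((\<theta> / (1 - \<kappa>)) * Q)))"
    by (intro mult_left_mono) auto
  also have "\<dots> = (d powr (- \<mu> - 1) * d powr \<mu> * d) * (5 * (\<theta> / (1 - \<kappa>)) * (Q / sqrt (real n)))" by (simp add: divide_inverse mult_ac)
  also have "d powr (- \<mu> - 1) * d powr \<mu> * d = 1" using A(3) by (simp add: powr_diff powr_minus field_simps)
  also have "1 * (5 * (\<theta> / (1 - \<kappa>)) * (Q / sqrt (real n))) \<le> 5 * (\<theta> / (1 - \<kappa>)) *
     ((\<rho> / 2) powr (- \<mu>) * (27000 * H\<^sup>2 / (\<rho> / 2) * Fi) + (9 * r / 8) powr (- \<mu>) * (27000 * H\<^sup>2 / (9 * r / 8) * Fo)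
      + ((\<rho> / 2) powr (- \<mu>) * (1 + 1760 * H) + (9 * r / 8) powr (- \<mu>) * 1760 * H) * e)"
  proof -
    have sq: "sqrt (real n) \<ge> 1" using n by (auto simp: real_le_rsqrt)
    define P1 where "P1 = (\<rho> / 2) powr (- \<mu>) * (27000 * H\<^sup>2 / (\<rho> / 2) * Fi) + (9 * r / 8) powr (- \<mu>) * (27000 * H\<^sup>2 / (9 * r / 8) * Fo)"
    define P2 where "P2 = ((\<rho> / 2) powr (- \<mu>) * (1 + 1760 * H) + (9 * r / 8) powr (- \<mu>) * 1760 * H) * e"
    have e0: "e \<ge> 0" by (simp add: e_def residual_norm_def)
    have P20: "P2 \<ge> 0" unfolding P2_def using H1 e0 by (intro mult_nonneg_nonneg add_nonneg_nonneg) auto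
    have "Q = sqrt (real n) * P1 + P2" unfolding Q_def P1_def P2_def by (simp add: algebra_simps)
    then have "Q / sqrt (real n) = P1 + P2 / sqrt (real n)" using sq by (simp add: add_divide_distrib)
    also have "\<dots> \<le> P1 + P2" using P20 sq by (simp add: divide_le_eq mult_le_cancel_left1)
    finally have "Q / sqrt (real n) \<le> P1 + P2" .
    then show ?thesis unfolding P1_def P2_def mult_1 using \<theta>1 \<theta>(2) by (intro mult_left_mono) auto
  qed
  also have "\<dots> = 135000 * H\<^sup>2 * (\<theta> / (1 - \<kappa>)) * ((\<rho> / 2) powr (- \<mu> - 1) * Fi + (9 * r / 8) powr (- \<mu> - 1) * Fo)
    + 5 * (\<theta> / (1 - \<kappa>)) * ((\<rho> / 2) powr (- \<mu>) * (1 + 1760 * H) + (9 * r / 8) powr (- \<mu>) * 1760 * H) * e"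
  proof -
    have p: "c powr (- \<mu> - 1) = c powr (- \<mu>) / c" if "c > 0" for c :: real using that by (simp add: powr_diff)
    have gen: "5 * T * (p1 * (27000 * H\<^sup>2 / c1 * Fi) + p2 * (27000 * H\<^sup>2 / c2 * Fo) + P * e) =
      135000 * H\<^sup>2 * T * (p1 / c1 * Fi + p2 / c2 * Fo) + 5 * T * P * e" for T p1 p2 c1 c2 P :: real
      by (simp add: algebra_simps)
    have c2: "9 * r / 8 > 0" using r by simp
    show ?thesis unfolding p[OF half_gt_zero[OF \<rho>(1)]] p[OF c2] by (rule gen)
  qed
  finally show ?thesis by (simp add: Fi_def Fo_def e_def)
qed

end

section \<open>Mollification\<close>

text \<open>One factor per coordinate: replacing \<open>ph i\<close> by its derivative
  differentiates the kernel in direction \<open>i\<close>, and integrals of the kernel become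
  products.\<close>

definition prod_kernel :: "nat \<Rightarrow> (nat \<Rightarrow> real \<Rightarrow> real) \<Rightarrow> point \<Rightarrow> point \<Rightarrow> real" where
  "prod_kernel n ph x y = (\<Prod>j<n. ph j (x j - y j))"

definition kernel_conv :: "nat \<Rightarrow> (nat \<Rightarrow> real \<Rightarrow> real) \<Rightarrow> (point \<Rightarrow> real) \<Rightarrow> point \<Rightarrow> real" where
  "kernel_conv n ph U x = (\<integral>y. U y * prod_kernel n ph x y \<partial>LM n)"

definition compact_smooth :: "(real \<Rightarrow> real) \<Rightarrow> bool" where
  "compact_smooth h \<longleftrightarrow> smooth h \<and> (\<exists>R. \<forall>t. \<bar>t\<bar> > R \<longrightarrow> h t = 0)"

lemma compact_smooth_deriv: "compact_smooth h \<Longrightarrow> compact_smooth (deriv h)"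
proof -
  assume "compact_smooth h"
  then obtain R where R: "smooth h" "\<And>t. \<bar>t\<bar> > R \<Longrightarrow> h t = 0" by (auto simp: compact_smooth_def)
  have "deriv h t = 0" if "\<bar>t\<bar> > R + 1" for t
    by (rule deriv_zero_outside[OF R(1), of "R + 1"]) (use R that in auto)
  then show ?thesis using smooth_deriv[OF R(1)] by (auto simp: compact_smooth_def)
qed

lemma compact_smooth_bounded: "compact_smooth h \<Longrightarrow> \<exists>B>0. \<forall>t. \<bar>h t\<bar> \<le> B"
  by (auto simp: compact_smooth_def intro: smooth_bounded)

lemma compact_smooth_measurable: "compact_smooth h \<Longrightarrow> h \<in> borel_measurable borel"
  by (auto simp: compact_smooth_def intro: borel_measurable_continuous_onI smooth_continuous)

lemma prod_kernel_bound:
  assumes "\<And>j. j < n \<Longrightarrow> compact_smooth (ph j)" shows "\<exists>B>0. \<forall>x y. \<bar>prod_kernel n ph x y\<bar> \<le> B"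
proof -
  obtain B where B: "\<And>j. j < n \<Longrightarrow> B j > 0 \<and> (\<forall>t. \<bar>ph j t\<bar> \<le> B j)" using compact_smooth_bounded[OF assms] by metis
  have "\<bar>prod_kernel n ph x y\<bar> \<le> (\<Prod>j<n. B j)" for x y
    unfolding prod_kernel_def abs_prod using B by (intro prod_mono) auto
  moreover have "(\<Prod>j<n. B j) > 0" using B by (intro prod_pos) auto
  ultimately show ?thesis by blast
qed

lemma prod_kernel_measurable_pair:
  assumes "\<And>j. j < n \<Longrightarrow> compact_smooth (ph j)"
  shows "(\<lambda>(x, y). prod_kernel n ph x y) \<in> borel_measurable (LM n \<Otimes>\<^sub>M LM n)"
proof -
  have c: "(\<lambda>p. fst p j - snd p j) \<in> borel_measurable (LM n \<Otimes>\<^sub>M LM n)" if "j < n" for j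
    using measurable_comp_LM[OF that] by (intro borel_measurable_diff measurable_compose[OF measurable_fst] measurable_compose[OF measurable_snd])
  have "(\<lambda>p. \<Prod>j<n. ph j (fst p j - snd p j)) \<in> borel_measurable (LM n \<Otimes>\<^sub>M LM n)"
    by (intro borel_measurable_prod measurable_compose[OF c compact_smooth_measurable] assms) auto
  then show ?thesis by (simp add: prod_kernel_def case_prod_beta')
qed

lemma prod_kernel_measurable:
  assumes "\<And>j. j < n \<Longrightarrow> compact_smooth (ph j)" "x \<in> Rn n"
  shows "(\<lambda>y. prod_kernel n ph x y) \<in> borel_measurable (LM n)"
proof -
  have "(\<lambda>(x, y). prod_kernel n ph x y) \<in> borel_measurable (LM n \<Otimes>\<^sub>M LM n)" by (rule prod_kernel_measurable_pair) (rule assms(1))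
  from measurable_Pair2[OF this, of x] assms(2) show ?thesis by simp
qed

lemma integrable_prod_kernel:
  assumes "\<And>j. j < n \<Longrightarrow> compact_smooth (ph j)" "x \<in> Rn n" "integrable (LM n) U"
  shows "integrable (LM n) (\<lambda>y. U y * prod_kernel n ph x y)"
proof -
  obtain B where B: "B > 0" "\<And>x y. \<bar>prod_kernel n ph x y\<bar> \<le> B" using prod_kernel_bound[of n ph] assms(1) by metis
  show ?thesis
  proof (rule Bochner_Integration.integrable_bound[of _ "\<lambda>y. B * \<bar>U y\<bar>"])
    show "integrable (LM n) (\<lambda>y. B * \<bar>U y\<bar>)" using assms(3) by auto
    show "(\<lambda>y. U y * prod_kernel n ph x y) \<in> borel_measurable (LM n)"
      using assms(3) prod_kernel_measurable[OF assms(1,2)] by (intro borel_measurable_times) auto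
    show "AE y in LM n. norm (U y * prod_kernel n ph x y) \<le> norm (B * \<bar>U y\<bar>)"
    proof (intro AE_I2)
      fix y show "norm (U y * prod_kernel n ph x y) \<le> norm (B * \<bar>U y\<bar>)"
        using mult_left_mono[OF B(2)[of x y] abs_ge_zero[of "U y"]] B(1) by (simp add: abs_mult mult.commute)
    qed
  qed
qed

lemma kernel_conv_bdd_meas:
  assumes "\<And>j. j < n \<Longrightarrow> compact_smooth (ph j)" "integrable (LM n) U"
  shows "bdd_meas n (kernel_conv n ph U)"
  unfolding bdd_meas_def
proof (intro conjI)
  interpret A: sigma_finite_measure "LM n" by (rule sigma_finite_LM)
  have "(\<lambda>(x, y). U y * prod_kernel n ph x y) \<in> borel_measurable (LM n \<Otimes>\<^sub>M LM n)"
    using prod_kernel_measurable_pair[of n ph, OF assms(1)] measurable_compose[OF measurable_snd, of U "LM n" borel "LM n"] assms(2)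
    by (auto simp: case_prod_beta')
  then show "kernel_conv n ph U \<in> borel_measurable (LM n)"
    unfolding kernel_conv_def[abs_def] by (intro A.borel_measurable_lebesgue_integral)
  obtain B where B: "B > 0" "\<And>x y. \<bar>prod_kernel n ph x y\<bar> \<le> B" using prod_kernel_bound[of n ph] assms(1) by metis
  have "\<bar>kernel_conv n ph U x\<bar> \<le> (\<integral>y. B * \<bar>U y\<bar> \<partial>LM n)" if x: "x \<in> Rn n" for x
    unfolding kernel_conv_def
  proof (rule order_trans[OF integral_abs_bound integral_mono])
    show "integrable (LM n) (\<lambda>y. \<bar>U y * prod_kernel n ph x y\<bar>)" using integrable_prod_kernel[OF assms(1) x assms(2)] by auto
    show "integrable (LM n) (\<lambda>y. B * \<bar>U y\<bar>)" using assms(2) by auto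
    show "\<bar>U y * prod_kernel n ph x y\<bar> \<le> B * \<bar>U y\<bar>" for y
      using mult_left_mono[OF B(2)[of x y] abs_ge_zero[of "U y"]] by (simp add: abs_mult mult.commute)
  qed
  then show "\<exists>B. \<forall>x\<in>Rn n. \<bar>kernel_conv n ph U x\<bar> \<le> B" by blast
qed

lemma prod_kernel_upd:
  "i < n \<Longrightarrow> prod_kernel n ph (x(i := t)) y = ph i (t - y i) * (\<Prod>j\<in>{..<n} - {i}. ph j (x j - y j))"
  by (simp add: prod_kernel_def prod.remove[of "{..<n}" i])

lemma prod_kernel_DERIV:
  assumes "i < n" "smooth (ph i)"
  shows "((\<lambda>t. prod_kernel n ph (x(i := t)) y) has_real_derivative prod_kernel n (ph(i := deriv (ph i))) (x(i := t)) y) (at t)"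
proof -
  have "((\<lambda>t. ph i (t - y i)) has_real_derivative deriv (ph i) (t - y i)) (at t)"
    using DERIV_shift[of "ph i" "deriv (ph i) (t - y i)" t "- y i"] smooth_DERIV[OF assms(2)] by simp
  from DERIV_cmult_right[OF this, of "\<Prod>j\<in>{..<n} - {i}. ph j (x j - y j)"]
  show ?thesis unfolding prod_kernel_upd[OF assms(1)] by simp
qed

text \<open>Dominated convergence along sequences: by the mean value inequality all difference
  quotients are bounded by the supremum of the differentiated kernel times |U|.\<close>

lemma kernel_conv_has_pderiv:
  assumes compact_smooth: "\<And>j. j < n \<Longrightarrow> compact_smooth (ph j)" and U: "integrable (LM n) U" and i: "i < n"
  shows "has_pderiv n i (kernel_conv n ph U) (kernel_conv n (ph(i := deriv (ph i))) U)"
  unfolding has_pderiv_def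
proof
  fix x assume x: "x \<in> Rn n"
  let ?ph' = "ph(i := deriv (ph i))"
  have good': "compact_smooth (?ph' j)" if "j < n" for j using compact_smooth[OF that] compact_smooth_deriv by auto
  have sm: "smooth (ph i)" using compact_smooth[OF i] by (simp add: compact_smooth_def)
  obtain B where B: "B > 0" "\<And>x y. \<bar>prod_kernel n ?ph' x y\<bar> \<le> B" using prod_kernel_bound[of n ?ph'] good' by metis
  have "((\<lambda>h. (kernel_conv n ph U (x(i := x i + h)) - kernel_conv n ph U (x(i := x i))) / h) \<longlongrightarrow> kernel_conv n ?ph' U x) (at 0)"
  proof (subst tendsto_at_iff_sequentially, intro allI impI)
    fix s :: "nat \<Rightarrow> real" assume s: "\<forall>k. s k \<in> UNIV - {0}" "s \<longlonglongrightarrow> 0"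
    let ?q = "\<lambda>k y. U y * ((prod_kernel n ph (x(i := x i + s k)) y - prod_kernel n ph x y) / s k)"
    have L: "(\<lambda>k. \<integral>y. ?q k y \<partial>LM n) \<longlonglongrightarrow> (\<integral>y. U y * prod_kernel n ?ph' x y \<partial>LM n)"
    proof (rule integral_dominated_convergence[where w="\<lambda>y. B * \<bar>U y\<bar>"])
      show "(\<lambda>y. U y * prod_kernel n ?ph' x y) \<in> borel_measurable (LM n)"
        by (rule borel_measurable_integrable, rule integrable_prod_kernel[OF _ x U], rule good')
      show "?q k \<in> borel_measurable (LM n)" for k
        using U prod_kernel_measurable[OF compact_smooth Rn_upd[OF x i]] prod_kernel_measurable[OF compact_smooth x]
        by (intro borel_measurable_times borel_measurable_divide borel_measurable_diff) auto
      show "integrable (LM n) (\<lambda>y. B * \<bar>U y\<bar>)" using U by auto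
      show "AE y in LM n. (\<lambda>k. ?q k y) \<longlonglongrightarrow> U y * prod_kernel n ?ph' x y"
      proof (intro AE_I2 tendsto_mult tendsto_const)
        fix y
        have "((\<lambda>h. (prod_kernel n ph (x(i := x i + h)) y - prod_kernel n ph (x(i := x i)) y) / h) \<longlongrightarrow> prod_kernel n ?ph' (x(i := x i)) y) (at 0)"
          using prod_kernel_DERIV[of i n ph x y "x i", OF i sm] by (simp add: DERIV_def)
        then show "(\<lambda>k. (prod_kernel n ph (x(i := x i + s k)) y - prod_kernel n ph x y) / s k) \<longlonglongrightarrow> prod_kernel n ?ph' x y"
          using s by (subst (asm) tendsto_at_iff_sequentially) (auto simp: o_def)
      qed
      show "AE y in LM n. norm (?q k y) \<le> B * \<bar>U y\<bar>" for k
      proof (intro AE_I2)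
        fix y
        have sk: "s k \<noteq> 0" using s by auto
        have "\<bar>prod_kernel n ph (x(i := x i + s k)) y - prod_kernel n ph (x(i := x i)) y\<bar> \<le> B * \<bar>(x i + s k) - x i\<bar>"
          using field_differentiable_bound[of UNIV "\<lambda>t. prod_kernel n ph (x(i := t)) y" "\<lambda>t. prod_kernel n ?ph' (x(i := t)) y" B "x i" "x i + s k"]
            prod_kernel_DERIV[of i n ph x y, OF i sm] B(2) by (auto simp: has_field_derivative_at_within)
        then have "\<bar>(prod_kernel n ph (x(i := x i + s k)) y - prod_kernel n ph x y) / s k\<bar> \<le> B"
          using sk by (simp add: divide_le_eq)
        then show "norm (?q k y) \<le> B * \<bar>U y\<bar>" by (simp only: real_norm_def abs_mult mult.commute[of B] mult_left_mono[OF _ abs_ge_zero])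
      qed
    qed
    have E: "(\<integral>y. ?q k y \<partial>LM n) = (kernel_conv n ph U (x(i := x i + s k)) - kernel_conv n ph U x) / s k" for k
    proof -
      have "?q k = (\<lambda>y. (U y * prod_kernel n ph (x(i := x i + s k)) y - U y * prod_kernel n ph x y) / s k)"
        by (auto simp: algebra_simps diff_divide_distrib)
      then show ?thesis unfolding kernel_conv_def
        using integrable_prod_kernel[OF compact_smooth x U] integrable_prod_kernel[OF compact_smooth Rn_upd[OF x i] U] by simp
    qed
    show "((\<lambda>h. (kernel_conv n ph U (x(i := x i + h)) - kernel_conv n ph U (x(i := x i))) / h) \<circ> s) \<longlonglongrightarrow> kernel_conv n ?ph' U x"
      using L unfolding E by (simp add: o_def kernel_conv_def[of n ?ph'])
  qed
  then show "((\<lambda>t. kernel_conv n ph U (x(i := t))) has_real_derivative kernel_conv n ?ph' U x) (at (x i))"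
    by (simp add: DERIV_def)
qed

section \<open>The approximate identity\<close>

definition moll_kernel :: "nat \<Rightarrow> real \<Rightarrow> real" where
  "moll_kernel k t = real (Suc k) * bump (real (Suc k) * t)"

lemma compact_smooth_moll_kernel: "compact_smooth (moll_kernel k)"
proof -
  have "smooth (moll_kernel k)" using smooth_affine[OF smooth_bump, of "real (Suc k)" "real (Suc k)" 0] by (simp add: moll_kernel_def[abs_def])
  moreover have "moll_kernel k t = 0" if "\<bar>t\<bar> > 1" for t
  proof -
    have "1 * 1 \<le> real (Suc k) * \<bar>t\<bar>" using that by (intro mult_mono) auto
    then show ?thesis by (simp add: moll_kernel_def bump_zero abs_mult)
  qed
  ultimately show ?thesis by (auto simp: compact_smooth_def)
qed

lemma moll_kernel_zero: "\<bar>t\<bar> \<ge> 1 / real (Suc k) \<Longrightarrow> moll_kernel k t = 0"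
proof -
  assume "\<bar>t\<bar> \<ge> 1 / real (Suc k)"
  then have "1 \<le> real (Suc k) * \<bar>t\<bar>" by (simp add: field_simps)
  then show ?thesis by (simp add: moll_kernel_def bump_zero abs_mult)
qed

lemma moll_kernel_nonneg: "moll_kernel k t \<ge> 0"
  by (simp add: moll_kernel_def bump_nonneg)

lemma moll_kernel_integral: "integrable lborel (\<lambda>t. moll_kernel k (c - t))" "(\<integral>t. moll_kernel k (c - t) \<partial>lborel) = 1"
  "integrable lborel (\<lambda>t. moll_kernel k (t - c))" "(\<integral>t. moll_kernel k (t - c) \<partial>lborel) = 1"
proof -
  define a where "a = real (Suc k)"
  have a: "a > 0" by (simp add: a_def)
  have aff: "integrable lborel (\<lambda>t. a * bump (b + m * t))" "(\<integral>t. a * bump (b + m * t) \<partial>lborel) = 1" if "\<bar>m\<bar> = a" for b m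
  proof -
    have m: "m \<noteq> 0" using a that by auto
    show "integrable lborel (\<lambda>t. a * bump (b + m * t))"
      by (intro integrable_mult_right lborel_integrable_real_affine[OF integrable_bump(1) m])
    have "1 = a * (\<integral>t. bump (b + m * t) \<partial>lborel)"
      using lborel_integral_real_affine[OF m, of bump b] integrable_bump(2) that by simp
    then show "(\<integral>t. a * bump (b + m * t) \<partial>lborel) = 1" by simp
  qed
  have 1: "moll_kernel k (c - t) = a * bump (a * c + (- a) * t)" for t by (simp add: moll_kernel_def a_def algebra_simps)
  have 2: "moll_kernel k (t - c) = a * bump (- (a * c) + a * t)" for t by (simp add: moll_kernel_def a_def algebra_simps)
  show "integrable lborel (\<lambda>t. moll_kernel k (c - t))" "(\<integral>t. moll_kernel k (c - t) \<partial>lborel) = 1" unfolding 1 by (rule aff; use a in simp)+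
  show "integrable lborel (\<lambda>t. moll_kernel k (t - c))" "(\<integral>t. moll_kernel k (t - c) \<partial>lborel) = 1" unfolding 2 by (rule aff; use a in simp)+
qed

abbreviation moll_kernels :: "nat \<Rightarrow> nat \<Rightarrow> real \<Rightarrow> real" where
  "moll_kernels k \<equiv> (\<lambda>_. moll_kernel k)"

lemma prod_kernel_moll_kernels_nonneg: "prod_kernel n (moll_kernels k) x y \<ge> 0"
  by (auto simp: prod_kernel_def intro!: prod_nonneg moll_kernel_nonneg)

lemma prod_kernel_moll_kernels_integral:
  "integrable (LM n) (\<lambda>y. prod_kernel n (moll_kernels k) x y)" "(\<integral>y. prod_kernel n (moll_kernels k) x y \<partial>LM n) = 1"
  "integrable (LM n) (\<lambda>x. prod_kernel n (moll_kernels k) x y)" "(\<integral>x. prod_kernel n (moll_kernels k) x y \<partial>LM n) = 1"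
  unfolding prod_kernel_def using lb.product_integrable_prod[of "{..<n}" "\<lambda>j t. moll_kernel k (x j - t)"]
    lb.product_integral_prod[of "{..<n}" "\<lambda>j t. moll_kernel k (x j - t)"]
    lb.product_integrable_prod[of "{..<n}" "\<lambda>j t. moll_kernel k (t - y j)"]
    lb.product_integral_prod[of "{..<n}" "\<lambda>j t. moll_kernel k (t - y j)"] moll_kernel_integral by auto

text \<open>Jensen's inequality for a probability kernel, obtained from Hoelder's inequality by
  splitting the kernel into its powers 1/q and 1/q'; q = 1 has no conjugate exponent and is
  immediate. The integration in \<open>x\<close> uses that the kernel has integral 1 in that
  variable too.\<close>

lemma kernel_conv_contraction:
  assumes q: "q \<ge> 1" and U: "in_Lq (LM n) q U" "integrable (LM n) U"
  shows "in_Lq (LM n) q (kernel_conv n (moll_kernels k) U)" "Lq_norm (LM n) q (kernel_conv n (moll_kernels k) U) \<le> Lq_norm (LM n) q U"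
proof -
  interpret A: sigma_finite_measure "LM n" by (rule sigma_finite_LM)
  interpret P: pair_sigma_finite "LM n" "LM n" ..
  let ?k = "prod_kernel n (moll_kernels k)"
  have mU[measurable]: "U \<in> borel_measurable (LM n)" using U by auto
  have bC: "bdd_meas n (kernel_conv n (moll_kernels k) U)" by (rule kernel_conv_bdd_meas[OF compact_smooth_moll_kernel U(2)])
  have mk: "(\<lambda>(x, y). ?k x y) \<in> borel_measurable (LM n \<Otimes>\<^sub>M LM n)" by (rule prod_kernel_measurable_pair[OF compact_smooth_moll_kernel])
  have mkx: "(\<lambda>y. ?k x y) \<in> borel_measurable (LM n)" if "x \<in> Rn n" for x by (rule prod_kernel_measurable[OF compact_smooth_moll_kernel that])
  have mUq: "(\<lambda>y. \<bar>U y\<bar> powr q) \<in> borel_measurable (LM n)" by (rule measurable_abs_powr[OF mU])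
  have iUq: "integrable (LM n) (\<lambda>y. \<bar>U y\<bar> powr q)" by (rule in_Lq_integrable[OF U(1)])
  have pt: "\<bar>kernel_conv n (moll_kernels k) U x\<bar> powr q \<le> (\<integral>y. \<bar>U y\<bar> powr q * ?k x y \<partial>LM n)" if x: "x \<in> Rn n" for x
  proof -
    have iUk: "integrable (LM n) (\<lambda>y. \<bar>U y\<bar> powr q * ?k x y)" by (rule integrable_prod_kernel[OF compact_smooth_moll_kernel x iUq])
    have "\<bar>kernel_conv n (moll_kernels k) U x\<bar> \<le> (\<integral>y. \<bar>U y\<bar> * ?k x y \<partial>LM n)"
      unfolding kernel_conv_def using integral_abs_bound[of "LM n" "\<lambda>y. U y * ?k x y"] prod_kernel_moll_kernels_nonneg[of n k x] by (simp add: abs_mult)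
    also have "\<dots> \<le> (\<integral>y. \<bar>U y\<bar> powr q * ?k x y \<partial>LM n) powr (1 / q)"
    proof (cases "q = 1")
      case True
      have "(\<integral>y. \<bar>U y\<bar> * ?k x y \<partial>LM n) \<ge> 0" using prod_kernel_moll_kernels_nonneg[of n k x] by (intro Bochner_Integration.integral_nonneg) auto
      then show ?thesis using True by simp
    next
      case False
      then have q1: "q > 1" using q by simp
      define q' where "q' = q / (q - 1)"
      have q': "q' > 1" "1 / q + 1 / q' = 1" using q1 by (auto simp: q'_def field_simps)
      have kp: "(?k x y powr (1 / q)) powr q = ?k x y" "(?k x y powr (1 / q')) powr q' = ?k x y" for y
        using prod_kernel_moll_kernels_nonneg[of n k x y] q1 q' by (auto simp: powr_powr)
      have mkp: "(\<lambda>y. ?k x y powr s) \<in> borel_measurable (LM n)" for s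
        using measurable_abs_powr[OF mkx[OF x], of s] prod_kernel_moll_kernels_nonneg[of n k x] by (simp add: abs_of_nonneg)
      have 1: "in_Lq (LM n) q (\<lambda>y. \<bar>U y\<bar> * ?k x y powr (1 / q))"
        unfolding in_Lq_def using iUk mU mkp by (auto simp: abs_mult powr_mult kp intro!: borel_measurable_times)
      have 2: "in_Lq (LM n) q' (\<lambda>y. ?k x y powr (1 / q'))"
        unfolding in_Lq_def using prod_kernel_moll_kernels_integral(1)[of n k x] mkp by (auto simp: kp)
      have "(\<integral>y. \<bar>(\<bar>U y\<bar> * ?k x y powr (1 / q)) * ?k x y powr (1 / q')\<bar> \<partial>LM n) \<le>
        Lq_norm (LM n) q (\<lambda>y. \<bar>U y\<bar> * ?k x y powr (1 / q)) * Lq_norm (LM n) q' (\<lambda>y. ?k x y powr (1 / q'))"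
        by (rule Holder_inequality[OF 1 2 q1 q'])
      also have "Lq_norm (LM n) q' (\<lambda>y. ?k x y powr (1 / q')) = 1"
        using prod_kernel_moll_kernels_integral(2)[of n k x] by (simp add: Lq_norm_def kp)
      also have "Lq_norm (LM n) q (\<lambda>y. \<bar>U y\<bar> * ?k x y powr (1 / q)) = (\<integral>y. \<bar>U y\<bar> powr q * ?k x y \<partial>LM n) powr (1 / q)"
        by (simp add: Lq_norm_def abs_mult powr_mult kp)
      also have "(\<lambda>y. \<bar>(\<bar>U y\<bar> * ?k x y powr (1 / q)) * ?k x y powr (1 / q')\<bar>) = (\<lambda>y. \<bar>U y\<bar> * ?k x y)"
        using q' prod_kernel_moll_kernels_nonneg[of n k x] by (auto simp: fun_eq_iff abs_mult mult.assoc powr_add[symmetric])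
      finally show ?thesis by simp
    qed
    finally have "\<bar>kernel_conv n (moll_kernels k) U x\<bar> powr q \<le> ((\<integral>y. \<bar>U y\<bar> powr q * ?k x y \<partial>LM n) powr (1 / q)) powr q"
      using q by (intro powr_mono2) auto
    also have "\<dots> = (\<integral>y. \<bar>U y\<bar> powr q * ?k x y \<partial>LM n)"
      using q prod_kernel_moll_kernels_nonneg[of n k x] by (simp add: powr_powr)
    finally show ?thesis .
  qed
  have mprod: "(\<lambda>(y, x). \<bar>U y\<bar> powr q * ?k x y) \<in> borel_measurable (LM n \<Otimes>\<^sub>M LM n)"
  proof -
    have "(\<lambda>p. ?k (snd p) (fst p)) \<in> borel_measurable (LM n \<Otimes>\<^sub>M LM n)"
      using measurable_compose[OF measurable_pair_swap' mk] by (simp add: case_prod_beta')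
    then show ?thesis
      using measurable_compose[OF measurable_fst mUq, of "LM n"] by (simp add: case_prod_beta')
  qed
  have iprod: "integrable (LM n \<Otimes>\<^sub>M LM n) (\<lambda>(y, x). \<bar>U y\<bar> powr q * ?k x y)"
  proof (rule P.Fubini_integrable[OF mprod])
    have "(\<integral>x. norm (\<bar>U y\<bar> powr q * ?k x y) \<partial>LM n) = \<bar>U y\<bar> powr q" for y
      using prod_kernel_moll_kernels_integral(4)[of n k y] prod_kernel_moll_kernels_nonneg[of n k _ y] by (simp add: abs_mult)
    then show "integrable (LM n) (\<lambda>y. \<integral>x. norm (case (y, x) of (y, x) \<Rightarrow> \<bar>U y\<bar> powr q * ?k x y) \<partial>LM n)"
      using iUq by simp
    show "AE y in LM n. integrable (LM n) (\<lambda>x. case (y, x) of (y, x) \<Rightarrow> \<bar>U y\<bar> powr q * ?k x y)"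
      using prod_kernel_moll_kernels_integral(3)[of n k] by auto
  qed
  have iR: "integrable (LM n) (\<lambda>x. \<integral>y. \<bar>U y\<bar> powr q * ?k x y \<partial>LM n)"
    using P.integrable_snd[OF iprod] .
  have eqR: "(\<integral>x. (\<integral>y. \<bar>U y\<bar> powr q * ?k x y \<partial>LM n) \<partial>LM n) = (\<integral>y. \<bar>U y\<bar> powr q \<partial>LM n)"
    using P.Fubini_integral[OF iprod] prod_kernel_moll_kernels_integral(4)[of n k] by simp
  have iC: "integrable (LM n) (\<lambda>x. \<bar>kernel_conv n (moll_kernels k) U x\<bar> powr q)"
    by (rule Bochner_Integration.integrable_bound[OF iR])
       (use pt bC in \<open>auto simp: bdd_meas_def intro!: measurable_abs_powr AE_I2 intro: order_trans[OF _ abs_ge_self]\<close>)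
  then show "in_Lq (LM n) q (kernel_conv n (moll_kernels k) U)" using bC by (simp add: in_Lq_def bdd_meas_def)
  have "(\<integral>x. \<bar>kernel_conv n (moll_kernels k) U x\<bar> powr q \<partial>LM n) \<le> (\<integral>y. \<bar>U y\<bar> powr q \<partial>LM n)"
    unfolding eqR[symmetric] by (rule integral_mono[OF iC iR]) (use pt in auto)
  then show "Lq_norm (LM n) q (kernel_conv n (moll_kernels k) U) \<le> Lq_norm (LM n) q U"
    unfolding Lq_norm_def using q by (intro powr_mono2) auto
qed

section \<open>Convergence of mollifications\<close>

lemma kernel_conv_diff:
  assumes "integrable (LM n) U" "integrable (LM n) W" "x \<in> Rn n"
  shows "kernel_conv n (moll_kernels k) (\<lambda>y. U y - W y) x = kernel_conv n (moll_kernels k) U x - kernel_conv n (moll_kernels k) W x"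
  unfolding kernel_conv_def left_diff_distrib
  by (rule Bochner_Integration.integral_diff; rule integrable_prod_kernel[OF compact_smooth_moll_kernel]; fact)

text \<open>The functions for which convergence is already known. The class is enlarged from boxes
  to Borel sets inside a cube, to simple functions and to all of L^q with bounded support.\<close>

definition mollifies :: "nat \<Rightarrow> real \<Rightarrow> (point \<Rightarrow> real) \<Rightarrow> bool" where
  "mollifies n q U \<longleftrightarrow> in_Lq (LM n) q U \<and> box_supp n U \<and> (\<lambda>k. Lq_norm (LM n) q (\<lambda>x. kernel_conv n (moll_kernels k) U x - U x)) \<longlonglongrightarrow> 0"

lemma in_Lq_box_supp_integrable:
  assumes "in_Lq (LM n) q U" "box_supp n U" "q \<ge> 1" shows "integrable (LM n) U"
proof -
  obtain R where R: "\<And>x. x \<in> Rn n \<Longrightarrow> U x \<noteq> 0 \<Longrightarrow> (\<forall>i<n. \<bar>x i\<bar> \<le> R)" using assms(2) by (auto simp: box_supp_def)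
  show ?thesis
  proof (rule Bochner_Integration.integrable_bound)
    show "integrable (LM n) (\<lambda>x. indicat_real (cube n R) x + \<bar>U x\<bar> powr q)"
      using emeasure_cube[of n R] in_Lq_integrable[OF assms(1)] by (intro Bochner_Integration.integrable_add integrable_real_indicator) auto
    show "U \<in> borel_measurable (LM n)" using assms(1) by (simp add: in_Lq_def)
    show "AE x in LM n. norm (U x) \<le> norm (indicat_real (cube n R) x + \<bar>U x\<bar> powr q)"
    proof (intro AE_I2)
      fix x assume "x \<in> space (LM n)"
      then have x: "x \<in> Rn n" by simp
      show "norm (U x) \<le> norm (indicat_real (cube n R) x + \<bar>U x\<bar> powr q)"
      proof (cases "U x = 0")
        case False
        then have c: "x \<in> cube n R" using R[OF x] x by (simp add: cube_iff)
        have "\<bar>U x\<bar> \<le> 1 + \<bar>U x\<bar> powr q"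
        proof (cases "\<bar>U x\<bar> \<le> 1")
          case True then show ?thesis using powr_ge_zero[of "\<bar>U x\<bar>" q] by linarith
        next
          case False
          then have "\<bar>U x\<bar> powr 1 \<le> \<bar>U x\<bar> powr q" using assms(3) by (intro powr_mono) auto
          then show ?thesis using False by simp
        qed
        then show ?thesis using c by simp
      qed simp
    qed
  qed
qed

lemma box_supp_add: "box_supp n f \<Longrightarrow> box_supp n g \<Longrightarrow> box_supp n (\<lambda>x. f x + g x)"
proof -
  assume "box_supp n f" "box_supp n g"
  then obtain R S where "\<forall>x\<in>Rn n. f x \<noteq> 0 \<longrightarrow> (\<forall>i<n. \<bar>x i\<bar> \<le> R)" "\<forall>x\<in>Rn n. g x \<noteq> 0 \<longrightarrow> (\<forall>i<n. \<bar>x i\<bar> \<le> S)"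
    by (auto simp: box_supp_def)
  then show ?thesis unfolding box_supp_def by (intro exI[of _ "max R S"]) (metis add_0 le_max_iff_disj)
qed

lemma box_supp_cmult: "box_supp n f \<Longrightarrow> box_supp n (\<lambda>x. c * f x)"
  by (auto simp: box_supp_def)

lemma kernel_conv_in_Lq:
  assumes "in_Lq (LM n) q U" "box_supp n U" "q \<ge> 1" shows "in_Lq (LM n) q (kernel_conv n (moll_kernels k) U)"
  using kernel_conv_contraction(1)[OF assms(3,1) in_Lq_box_supp_integrable[OF assms]] .

text \<open>A three-epsilon argument: the contraction property makes the error for U - W independent
  of \<open>k\<close>.\<close>

lemma mollifies_limit:
  assumes q: "q \<ge> 1" and U: "in_Lq (LM n) q U" "box_supp n U"
    and W: "\<And>\<epsilon>. \<epsilon> > 0 \<Longrightarrow> \<exists>W. mollifies n q W \<and> Lq_norm (LM n) q (\<lambda>x. U x - W x) < \<epsilon>"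
  shows "mollifies n q U"
  unfolding mollifies_def
proof (intro conjI U LIMSEQ_I)
  fix \<epsilon> :: real assume "\<epsilon> > 0"
  then obtain W where W: "mollifies n q W" "Lq_norm (LM n) q (\<lambda>x. U x - W x) < \<epsilon> / 3" using W[of "\<epsilon> / 3"] by auto
  have WL: "in_Lq (LM n) q W" "box_supp n W" using W(1) by (auto simp: mollifies_def)
  have lim: "(\<lambda>k. Lq_norm (LM n) q (\<lambda>x. kernel_conv n (moll_kernels k) W x - W x)) \<longlonglongrightarrow> 0" using W(1) by (simp add: mollifies_def)
  obtain k0 where k0: "\<And>k. k \<ge> k0 \<Longrightarrow> Lq_norm (LM n) q (\<lambda>x. kernel_conv n (moll_kernels k) W x - W x) < \<epsilon> / 3"
    using LIMSEQ_D[OF lim, of "\<epsilon> / 3"] \<open>\<epsilon> > 0\<close> by auto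
  show "\<exists>no. \<forall>k\<ge>no. norm (Lq_norm (LM n) q (\<lambda>x. kernel_conv n (moll_kernels k) U x - U x) - 0) < \<epsilon>"
  proof (intro exI[of _ k0] allI impI)
    fix k assume k: "k \<ge> k0"
    have iU: "integrable (LM n) U" "integrable (LM n) W"
      using in_Lq_box_supp_integrable[OF U q] in_Lq_box_supp_integrable[OF WL q] by auto
    have dL: "in_Lq (LM n) q (\<lambda>x. U x - W x)" by (rule in_Lq_diff[OF U(1) WL(1) q])
    note cc = kernel_conv_contraction[OF q dL Bochner_Integration.integrable_diff[OF iU], of k]
    note cU = kernel_conv_in_Lq[OF U q, of k] and cW = kernel_conv_in_Lq[OF WL q, of k]
    have "Lq_norm (LM n) q (\<lambda>x. kernel_conv n (moll_kernels k) U x - U x) \<le>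
      Lq_norm (LM n) q (\<lambda>x. kernel_conv n (moll_kernels k) U x - kernel_conv n (moll_kernels k) W x) + Lq_norm (LM n) q (\<lambda>x. kernel_conv n (moll_kernels k) W x - U x)"
      by (rule Lq_norm_diff_triangle[OF cU cW U(1) q])
    also have "Lq_norm (LM n) q (\<lambda>x. kernel_conv n (moll_kernels k) W x - U x) \<le>
      Lq_norm (LM n) q (\<lambda>x. kernel_conv n (moll_kernels k) W x - W x) + Lq_norm (LM n) q (\<lambda>x. W x - U x)"
      by (rule Lq_norm_diff_triangle[OF cW WL(1) U(1) q])
    also have "Lq_norm (LM n) q (\<lambda>x. kernel_conv n (moll_kernels k) U x - kernel_conv n (moll_kernels k) W x) = Lq_norm (LM n) q (kernel_conv n (moll_kernels k) (\<lambda>x. U x - W x))"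
      by (rule Lq_norm_cong) (simp add: kernel_conv_diff[OF iU])
    finally have "Lq_norm (LM n) q (\<lambda>x. kernel_conv n (moll_kernels k) U x - U x) < \<epsilon> / 3 + \<epsilon> / 3 + \<epsilon> / 3"
      using cc(2) W(2) k0[OF k] Lq_norm_minus_commute[of "LM n" q W U] by linarith
    then show "norm (Lq_norm (LM n) q (\<lambda>x. kernel_conv n (moll_kernels k) U x - U x) - 0) < \<epsilon>" by simp
  qed
qed

lemma mollifies_add:
  assumes "mollifies n q U" "mollifies n q W" "q \<ge> 1" shows "mollifies n q (\<lambda>x. U x + W x)"
  unfolding mollifies_def
proof (intro conjI)
  have U: "in_Lq (LM n) q U" "box_supp n U" and W: "in_Lq (LM n) q W" "box_supp n W" using assms by (auto simp: mollifies_def)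
  show "in_Lq (LM n) q (\<lambda>x. U x + W x)" "box_supp n (\<lambda>x. U x + W x)" using U W assms(3) by (auto intro: in_Lq_add box_supp_add)
  have iU: "integrable (LM n) U" "integrable (LM n) W"
    using in_Lq_box_supp_integrable[OF U assms(3)] in_Lq_box_supp_integrable[OF W assms(3)] by auto
  have lim: "(\<lambda>k. Lq_norm (LM n) q (\<lambda>x. kernel_conv n (moll_kernels k) U x - U x) + Lq_norm (LM n) q (\<lambda>x. kernel_conv n (moll_kernels k) W x - W x)) \<longlonglongrightarrow> 0"
    using assms unfolding mollifies_def by (auto intro: tendsto_add_zero)
  show "(\<lambda>k. Lq_norm (LM n) q (\<lambda>x. kernel_conv n (moll_kernels k) (\<lambda>x. U x + W x) x - (U x + W x))) \<longlonglongrightarrow> 0"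
  proof (rule Lim_null_comparison[OF _ lim], intro always_eventually allI)
    fix k
    have ad: "kernel_conv n (moll_kernels k) (\<lambda>x. U x + W x) x = kernel_conv n (moll_kernels k) U x + kernel_conv n (moll_kernels k) W x" if "x \<in> Rn n" for x
      unfolding kernel_conv_def distrib_right
      by (rule Bochner_Integration.integral_add; rule integrable_prod_kernel[OF compact_smooth_moll_kernel that]; fact)
    have "Lq_norm (LM n) q (\<lambda>x. kernel_conv n (moll_kernels k) (\<lambda>x. U x + W x) x - (U x + W x)) =
      Lq_norm (LM n) q (\<lambda>x. (kernel_conv n (moll_kernels k) U x - U x) + (kernel_conv n (moll_kernels k) W x - W x))"
      by (rule Lq_norm_cong) (simp add: ad algebra_simps)
    also have "\<dots> \<le> Lq_norm (LM n) q (\<lambda>x. kernel_conv n (moll_kernels k) U x - U x) + Lq_norm (LM n) q (\<lambda>x. kernel_conv n (moll_kernels k) W x - W x)"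
      by (intro Minkowski in_Lq_diff kernel_conv_in_Lq U W assms(3))
    finally show "norm (Lq_norm (LM n) q (\<lambda>x. kernel_conv n (moll_kernels k) (\<lambda>x. U x + W x) x - (U x + W x)))
      \<le> Lq_norm (LM n) q (\<lambda>x. kernel_conv n (moll_kernels k) U x - U x) + Lq_norm (LM n) q (\<lambda>x. kernel_conv n (moll_kernels k) W x - W x)" by simp
  qed
qed

lemma mollifies_cmult:
  assumes "mollifies n q U" "q \<ge> 1" shows "mollifies n q (\<lambda>x. c * U x)"
  unfolding mollifies_def
proof (intro conjI)
  have U: "in_Lq (LM n) q U" "box_supp n U" using assms by (auto simp: mollifies_def)
  show "in_Lq (LM n) q (\<lambda>x. c * U x)" "box_supp n (\<lambda>x. c * U x)" using U by (auto intro: in_Lq_cmult box_supp_cmult)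
  have "kernel_conv n (moll_kernels k) (\<lambda>x. c * U x) x - c * U x = c * (kernel_conv n (moll_kernels k) U x - U x)" for k x
    by (simp add: kernel_conv_def mult.assoc right_diff_distrib)
  then have "Lq_norm (LM n) q (\<lambda>x. kernel_conv n (moll_kernels k) (\<lambda>x. c * U x) x - c * U x) = \<bar>c\<bar> * Lq_norm (LM n) q (\<lambda>x. kernel_conv n (moll_kernels k) U x - U x)" for k
    using assms(2) by (simp add: Lq_norm_cmult)
  then show "(\<lambda>k. Lq_norm (LM n) q (\<lambda>x. kernel_conv n (moll_kernels k) (\<lambda>x. c * U x) x - c * U x)) \<longlonglongrightarrow> 0"
    using assms(1) unfolding mollifies_def by (auto intro: tendsto_mult_right_zero)
qed

lemma mollifies_0: "q \<ge> 1 \<Longrightarrow> mollifies n q (\<lambda>_. 0)"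
  by (simp add: mollifies_def in_Lq_def box_supp_def kernel_conv_def Lq_norm_def)

lemma mollifies_sum:
  "finite A \<Longrightarrow> (\<And>i. i \<in> A \<Longrightarrow> mollifies n q (f i)) \<Longrightarrow> q \<ge> 1 \<Longrightarrow> mollifies n q (\<lambda>x. \<Sum>i\<in>A. f i x)"
  by (induction A rule: finite_induct) (auto intro: mollifies_0 mollifies_add)

lemma mollifies_cong:
  assumes "mollifies n q U" "\<And>x. x \<in> Rn n \<Longrightarrow> U x = W x" shows "mollifies n q W"
proof -
  have "kernel_conv n (moll_kernels k) W x = kernel_conv n (moll_kernels k) U x" for k x
    unfolding kernel_conv_def using assms(2) by (intro Bochner_Integration.integral_cong) auto
  then have "Lq_norm (LM n) q (\<lambda>x. kernel_conv n (moll_kernels k) W x - W x) = Lq_norm (LM n) q (\<lambda>x. kernel_conv n (moll_kernels k) U x - U x)" for k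
    using assms(2) by (intro Lq_norm_cong) auto
  moreover have "in_Lq (LM n) q W = in_Lq (LM n) q U" using assms(2) by (intro in_Lq_cong) auto
  moreover have "box_supp n U \<Longrightarrow> box_supp n W" using assms(2) by (auto simp: box_supp_def)
  ultimately show ?thesis using assms(1) by (auto simp: mollifies_def)
qed

lemma AE_comp_neq:
  assumes "i < n" shows "AE x in LM n. x i \<noteq> c"
proof -
  define E where "E = (\<Pi>\<^sub>E j\<in>{..<n}. if j = i then {c} else (UNIV :: real set))"
  have E: "E \<in> sets (LM n)" unfolding E_def by (intro sets_PiM_I_finite) auto
  have "emeasure (LM n) E = (\<Prod>j<n. emeasure lborel (if j = i then {c} else (UNIV :: real set)))"
    unfolding E_def by (rule lb.emeasure_PiM) auto
  also have "\<dots> = 0" using assms by (intro prod_zero) (auto intro!: bexI[of _ i])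
  finally have "emeasure (LM n) E = 0" .
  then have "E \<in> null_sets (LM n)" using E by auto
  moreover have "{x \<in> space (LM n). \<not> x i \<noteq> c} \<subseteq> E" using assms by (auto simp: E_def Rn_def PiE_iff extensional_def)
  ultimately show ?thesis by (rule AE_I'[rotated 0])
qed

text \<open>The mollification of the indicator of a box is a product of one-dimensional ones, and it agrees with
  the indicator away from the faces of the box once the kernel is narrow enough.\<close>

lemma mollifies_box:
  assumes R: "R > 0" and a: "\<And>i. i < n \<Longrightarrow> a i \<le> R"
  shows "mollifies n 1 (indicator (\<Pi>\<^sub>E i\<in>{..<n}. {-R..a i}))"
proof -
  let ?A = "\<Pi>\<^sub>E i\<in>{..<n}. {-R..a i}"
  have A: "?A \<in> sets (LM n)" by (intro sets_PiM_I_finite) auto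
  have sub: "?A \<subseteq> cube n R"
    unfolding cube_def by (rule PiE_mono) (use a in auto)
  have fin: "emeasure (LM n) ?A < \<infinity>" using emeasure_mono[OF sub sets_cube] emeasure_cube[of n R] by (auto intro: le_less_trans)
  have bx: "box_supp n (indicat_real ?A)" unfolding box_supp_def
    by (intro exI[of _ R]) (use sub cube_iff in \<open>auto simp: indicator_def split: if_splits\<close>)
  have iL: "in_Lq (LM n) 1 (indicat_real ?A)" by (rule in_Lq_indicator_set[OF A fin])
  have ind: "indicat_real ?A x = (\<Prod>j<n. indicat_real {-R..a j} (x j))" if "x \<in> Rn n" for x
    using that by (auto simp: indicator_def PiE_iff Rn_def prod_zero_iff)
  have ib: "integrable lborel (\<lambda>t. indicat_real {-R..b} t * moll_kernel k (c - t))" for b c k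
    using integrable_mult_indicator[OF _ moll_kernel_integral(1)[of k c], of "{-R..b}"] by simp
  have kernel_conv: "kernel_conv n (moll_kernels k) (indicat_real ?A) x = (\<Prod>j<n. \<integral>t. indicat_real {-R..a j} t * moll_kernel k (x j - t) \<partial>lborel)" for k x
  proof -
    have "kernel_conv n (moll_kernels k) (indicat_real ?A) x = (\<integral>y. (\<Prod>j<n. indicat_real {-R..a j} (y j) * moll_kernel k (x j - y j)) \<partial>LM n)"
      unfolding kernel_conv_def prod_kernel_def by (intro Bochner_Integration.integral_cong) (auto simp: ind prod.distrib)
    also have "\<dots> = (\<Prod>j<n. \<integral>t. indicat_real {-R..a j} t * moll_kernel k (x j - t) \<partial>lborel)"
      by (rule lb.product_integral_prod) (auto intro: ib)
    finally show ?thesis .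
  qed
  have fac: "0 \<le> (\<integral>t. indicat_real {-R..a j} t * moll_kernel k (c - t) \<partial>lborel)" "(\<integral>t. indicat_real {-R..a j} t * moll_kernel k (c - t) \<partial>lborel) \<le> 1" for j k c
  proof -
    show "0 \<le> (\<integral>t. indicat_real {-R..a j} t * moll_kernel k (c - t) \<partial>lborel)" using moll_kernel_nonneg by (intro Bochner_Integration.integral_nonneg) auto
    have "(\<integral>t. indicat_real {-R..a j} t * moll_kernel k (c - t) \<partial>lborel) \<le> (\<integral>t. moll_kernel k (c - t) \<partial>lborel)"
      by (intro integral_mono ib moll_kernel_integral(1)) (auto simp: indicator_def moll_kernel_nonneg)
    then show "(\<integral>t. indicat_real {-R..a j} t * moll_kernel k (c - t) \<partial>lborel) \<le> 1" by (simp add: moll_kernel_integral)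
  qed
  have ev: "eventually (\<lambda>k. (\<integral>t. indicat_real {-R..a j} t * moll_kernel k (c - t) \<partial>lborel) = indicat_real {-R..a j} c) sequentially"
    if c: "c \<noteq> -R" "c \<noteq> a j" for j c
  proof -
    \<comment> \<open>The distance of \<open>c\<close> to the two faces: once the kernel is narrower
      than this, the indicator is constant on its support.\<close>
    define \<delta> where "\<delta> = min \<bar>c + R\<bar> \<bar>c - a j\<bar>"
    have \<delta>: "\<delta> > 0" using c by (auto simp: \<delta>_def)
    obtain k0 where k0: "1 / real (Suc k0) < \<delta>" using nat_approx_posE[OF \<delta>] by blast
    show ?thesis
    proof (rule eventually_sequentiallyI[of k0])
      fix k assume k: "k \<ge> k0"
      have "1 / real (Suc k) \<le> 1 / real (Suc k0)" using k by (intro divide_left_mono) auto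
      then have small: "1 / real (Suc k) < \<delta>" using k0 by linarith
      have eq: "indicat_real {-R..a j} t * moll_kernel k (c - t) = indicat_real {-R..a j} c * moll_kernel k (c - t)" for t
      proof (cases "\<bar>c - t\<bar> \<ge> 1 / real (Suc k)")
        case True then show ?thesis by (simp add: moll_kernel_zero)
      next
        case False
        then have "\<bar>c - t\<bar> < \<delta>" using small by linarith
        then have "t \<in> {-R..a j} \<longleftrightarrow> c \<in> {-R..a j}" unfolding \<delta>_def by (auto simp: abs_if split: if_splits)
        then show ?thesis by (simp add: indicator_def)
      qed
      show "(\<integral>t. indicat_real {-R..a j} t * moll_kernel k (c - t) \<partial>lborel) = indicat_real {-R..a j} c"
        unfolding eq by (simp add: moll_kernel_integral)
    qed
  qed
  have iA: "integrable (LM n) (indicat_real ?A)" using A fin by (intro integrable_real_indicator) auto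
  \<comment> \<open>The kernels have width at most 1, so every mollification vanishes outside the
    cube of half side R + 1; inside, both functions lie between 0 and 1. The indicator of this cube
    is the dominating function.\<close>
  have "(\<lambda>k. \<integral>x. \<bar>kernel_conv n (moll_kernels k) (indicat_real ?A) x - indicat_real ?A x\<bar> \<partial>LM n) \<longlonglongrightarrow> (\<integral>x. 0 \<partial>LM n)"
  proof (rule integral_dominated_convergence[where w="\<lambda>x. indicat_real (cube n (R + 1)) x"])
    show "(\<lambda>x. \<bar>kernel_conv n (moll_kernels k) (indicat_real ?A) x - indicat_real ?A x\<bar>) \<in> borel_measurable (LM n)" for k
      using kernel_conv_bdd_meas[where ph="moll_kernels k", OF compact_smooth_moll_kernel iA] iA by (intro borel_measurable_abs borel_measurable_diff) (auto simp: bdd_meas_def)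
    show "integrable (LM n) (indicat_real (cube n (R + 1)))" using emeasure_cube by (intro integrable_real_indicator) auto
    have "AE x in LM n. \<forall>j\<in>{..<n}. x j \<noteq> -R \<and> x j \<noteq> a j"
      by (intro AE_finite_allI AE_conjI AE_comp_neq) auto
    then show "AE x in LM n. (\<lambda>k. \<bar>kernel_conv n (moll_kernels k) (indicat_real ?A) x - indicat_real ?A x\<bar>) \<longlonglongrightarrow> 0"
    proof (rule AE_mp, intro AE_I2 impI)
      fix x assume "x \<in> space (LM n)" and nb: "\<forall>j\<in>{..<n}. x j \<noteq> -R \<and> x j \<noteq> a j"
      then have x: "x \<in> Rn n" by simp
      have "eventually (\<lambda>k. \<forall>j\<in>{..<n}. (\<integral>t. indicat_real {-R..a j} t * moll_kernel k (x j - t) \<partial>lborel) = indicat_real {-R..a j} (x j)) sequentially"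
        using nb ev by (intro eventually_ball_finite) auto
      then have "eventually (\<lambda>k. \<bar>kernel_conv n (moll_kernels k) (indicat_real ?A) x - indicat_real ?A x\<bar> = 0) sequentially"
        by (rule eventually_mono) (simp add: kernel_conv ind[OF x])
      then show "(\<lambda>k. \<bar>kernel_conv n (moll_kernels k) (indicat_real ?A) x - indicat_real ?A x\<bar>) \<longlonglongrightarrow> 0"
        by (rule tendsto_eventually)
    qed
    show "AE x in LM n. norm \<bar>kernel_conv n (moll_kernels k) (indicat_real ?A) x - indicat_real ?A x\<bar> \<le> indicat_real (cube n (R + 1)) x" for k
    proof (intro AE_I2)
      fix x assume "x \<in> space (LM n)"
      then have x: "x \<in> Rn n" by simp
      have c01: "0 \<le> kernel_conv n (moll_kernels k) (indicat_real ?A) x" "kernel_conv n (moll_kernels k) (indicat_real ?A) x \<le> 1"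
        unfolding kernel_conv using fac by (auto intro!: prod_nonneg prod_le_1)
      show "norm \<bar>kernel_conv n (moll_kernels k) (indicat_real ?A) x - indicat_real ?A x\<bar> \<le> indicat_real (cube n (R + 1)) x"
      proof (cases "x \<in> cube n (R + 1)")
        case True then show ?thesis using c01 by (auto simp: indicator_def abs_le_iff)
      next
        case False
        then have "\<not> (\<forall>j<n. \<bar>x j\<bar> \<le> R + 1)" unfolding cube_iff[OF x] .
        then obtain j where j: "j < n" "\<bar>x j\<bar> > R + 1" by (meson not_le)
        have "x \<notin> ?A"
        proof
          assume "x \<in> ?A"
          then have "x \<in> cube n R" using sub by blast
          then have "\<bar>x j\<bar> \<le> R" using j(1) unfolding cube_iff[OF x] by blast
          then show False using j(2) by linarith
        qed
        moreover have "(\<integral>t. indicat_real {-R..a j} t * moll_kernel k (x j - t) \<partial>lborel) = 0"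
        proof -
          have z: "indicat_real {-R..a j} t * moll_kernel k (x j - t) = 0" for t
          proof (cases "t \<in> {-R..a j}")
            case True
            then have "\<bar>x j - t\<bar> \<ge> 1" using a[OF j(1)] j(2) R by (auto simp: abs_if split: if_splits)
            moreover have "1 / real (Suc k) \<le> 1" by simp
            ultimately have "\<bar>x j - t\<bar> \<ge> 1 / real (Suc k)" by linarith
            then show ?thesis by (simp add: moll_kernel_zero)
          qed simp
          show ?thesis unfolding z by simp
        qed
        then have "kernel_conv n (moll_kernels k) (indicat_real ?A) x = 0" unfolding kernel_conv using j(1) by (intro prod_zero) auto
        ultimately show ?thesis by simp
      qed
    qed
  qed auto
  then show ?thesis using iL bx by (simp add: mollifies_def Lq_norm_def)
qed

text \<open>Closed orthants are stable under intersection, as the induction over complements and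
  disjoint unions requires of a generator.\<close>

lemma sets_LM_orthants:
  "sets (LM n) = sigma_sets (Rn n) {{x \<in> Rn n. \<forall>i<n. x i \<le> a i} | a. True}"
proof -
  define E :: "nat \<Rightarrow> real set set" where "E i = range atMost" for i
  have cov: "\<exists>S\<subseteq>E i. countable S \<and> (UNIV :: real set) = \<Union> S" for i
  proof (intro exI conjI)
    show "range (\<lambda>k::nat. {..real k}) \<subseteq> E i" by (auto simp: E_def)
    show "UNIV = \<Union> (range (\<lambda>k::nat. {..real k}))" using real_arch_simple by auto
  qed simp
  define P where "P = {{f \<in> \<Pi>\<^sub>E i\<in>{..<n}. UNIV. \<forall>i\<in>j. f i \<in> A i} | A j. j \<in> {{..<n}} \<and> A \<in> Pi j E}"
  have "sets (\<Pi>\<^sub>M i\<in>{..<n}. sigma UNIV (E i)) = sets (sigma (\<Pi>\<^sub>E i\<in>{..<n}. UNIV) P)"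
    unfolding P_def by (rule sets_PiM_sigma) (use cov in auto)
  also have "sets (\<Pi>\<^sub>M i\<in>{..<n}. sigma UNIV (E i)) = sets (LM n)"
    by (rule sets_PiM_cong) (auto simp: E_def borel_eq_atMost)
  also have "sets (sigma (\<Pi>\<^sub>E i\<in>{..<n}. UNIV) P) = sigma_sets (Rn n) P"
    by (subst sets_measure_of) (auto simp: P_def Rn_def)
  also have "P = {{x \<in> Rn n. \<forall>i<n. x i \<le> a i} | a. True}"
  proof (intro equalityI subsetI)
    fix X assume "X \<in> P"
    then obtain A where A: "X = {f \<in> Rn n. \<forall>i<n. f i \<in> A i}" "\<And>i. i < n \<Longrightarrow> A i \<in> range atMost"
      by (auto simp: P_def E_def Rn_def Pi_iff)
    then have "\<exists>a. \<forall>i<n. A i = {..a i}" by (intro choice_iff'[THEN iffD1]) auto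
    then obtain a where "\<And>i. i < n \<Longrightarrow> A i = {..a i}" by auto
    then show "X \<in> {{x \<in> Rn n. \<forall>i<n. x i \<le> a i} | a. True}" using A by auto
  next
    fix X assume "X \<in> {{x \<in> Rn n. \<forall>i<n. x i \<le> a i} | a. True}"
    then obtain a where "X = {x \<in> Rn n. \<forall>i<n. x i \<le> a i}" by auto
    then show "X \<in> P" unfolding P_def
      by (intro CollectI exI[of _ "\<lambda>i. {..a i}"] exI[of _ "{..<n}"]) (auto simp: Rn_def E_def)
  qed
  finally show ?thesis .
qed

text \<open>Induction over the sets generated by orthants. Intersecting with a cube keeps all norms
  finite and turns the complement into a difference inside the cube; disjoint unions are limits of
  finite sums.\<close>

lemma mollifies_indicator_1:
  assumes R: "R > 0" and A: "A \<in> sets (LM n)"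
  shows "mollifies n 1 (indicator (A \<inter> cube n R))"
proof -
  define G where "G = {{x \<in> Rn n. \<forall>i<n. x i \<le> a i} | a. True}"
  have fin: "emeasure (LM n) (B \<inter> cube n R) < \<infinity>" for B
    using emeasure_mono[of "B \<inter> cube n R" "cube n R" "LM n"] emeasure_cube[of n R] by (auto intro: le_less_trans)
  have bx: "box_supp n (indicat_real (B \<inter> cube n R))" for B
    unfolding box_supp_def by (intro exI[of _ R]) (use cube_iff in \<open>auto simp: indicator_def split: if_splits\<close>)
  have cub: "mollifies n 1 (indicator (cube n R))"
    using mollifies_box[of R n "\<lambda>_. R"] R by (simp add: cube_def)
  have Asig: "A \<in> sigma_sets (Rn n) G" using A sets_LM_orthants by (simp add: G_def)
  have IS: "Int_stable G"
  proof (rule Int_stableI)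
    fix X Y assume "X \<in> G" "Y \<in> G"
    then obtain a b where "X = {x \<in> Rn n. \<forall>i<n. x i \<le> a i}" "Y = {x \<in> Rn n. \<forall>i<n. x i \<le> b i}" by (auto simp: G_def)
    then have "X \<inter> Y = {x \<in> Rn n. \<forall>i<n. x i \<le> min (a i) (b i)}" by auto
    then show "X \<inter> Y \<in> G" unfolding G_def by (intro CollectI exI[of _ "\<lambda>i. min (a i) (b i)"]) simp
  qed
  have GP: "G \<subseteq> Pow (Rn n)" by (auto simp: G_def)
  from IS GP Asig show ?thesis
  proof (induction rule: sigma_sets_induct_disjoint)
    case (basic X)
    then obtain a where a: "X = {x \<in> Rn n. \<forall>i<n. x i \<le> a i}" by (auto simp: G_def)
    have "X \<inter> cube n R = (\<Pi>\<^sub>E i\<in>{..<n}. {-R..min (a i) R})"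
    proof (intro equalityI subsetI)
      fix x assume x: "x \<in> X \<inter> cube n R"
      then have xR: "x \<in> Rn n" and le: "\<And>i. i < n \<Longrightarrow> x i \<le> a i" by (simp_all add: a)
      have ab: "\<And>i. i < n \<Longrightarrow> \<bar>x i\<bar> \<le> R" using x cube_iff[OF xR] by blast
      show "x \<in> (\<Pi>\<^sub>E i\<in>{..<n}. {-R..min (a i) R})"
      proof (rule PiE_I)
        fix i assume "i \<in> {..<n}"
        then show "x i \<in> {-R..min (a i) R}" using le[of i] ab[of i] by (simp add: abs_le_iff)
      next
        fix i assume "i \<notin> {..<n}"
        then show "x i = undefined" using PiE_arb[OF xR[unfolded Rn_def]] by blast
      qed
    next
      fix x assume x: "x \<in> (\<Pi>\<^sub>E i\<in>{..<n}. {-R..min (a i) R})"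
      have xR: "x \<in> Rn n" unfolding Rn_def by (rule subsetD[OF PiE_mono x]) simp
      have b: "x i \<le> a i \<and> \<bar>x i\<bar> \<le> R" if "i < n" for i
        using PiE_mem[OF x, of i] that by (simp add: abs_le_iff)
      then show "x \<in> X \<inter> cube n R" using xR by (simp add: a cube_iff)
    qed
    then show ?case using mollifies_box[of R n "\<lambda>i. min (a i) R"] R by simp
  next
    case empty
    show ?case using mollifies_0[of 1 n] by (simp add: indicator_def[abs_def])
  next
    case (compl X)
    have "mollifies n 1 (\<lambda>x. indicat_real (cube n R) x + (-1) * indicat_real (X \<inter> cube n R) x)"
      by (intro mollifies_add mollifies_cmult cub compl) auto
    then show ?case by (rule mollifies_cong) (auto simp: indicator_def)
  next
    case (union X)
    note disj = union(1) and X = union(2) and IH = union(3)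
    have Xs: "X i \<in> sets (LM n)" for i using X sets_LM_orthants[of n] by (auto simp: G_def)
    let ?Y = "(\<Union>i. X i) \<inter> cube n R"
    let ?S = "\<lambda>m x. \<Sum>i<m. indicat_real (X i \<inter> cube n R) x"
    have Sm: "mollifies n 1 (?S m)" for m using IH by (intro mollifies_sum) auto
    have SY: "?S m x = indicat_real ((\<Union>i<m. X i) \<inter> cube n R) x" for m x
    proof -
      have d: "disjoint_family_on (\<lambda>i. X i \<inter> cube n R) {..<m}" using disj by (auto simp: disjoint_family_on_def)
      have "(\<Sum>i<m. indicat_real (X i \<inter> cube n R) x) = indicat_real (\<Union>i<m. X i \<inter> cube n R) x"
        by (rule indicator_UN_disjoint[symmetric]) (use d in auto)
      also have "(\<Union>i<m. X i \<inter> cube n R) = (\<Union>i<m. X i) \<inter> cube n R" by auto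
      finally show ?thesis .
    qed
    have YL: "in_Lq (LM n) 1 (indicat_real ?Y)" using Xs fin by (intro in_Lq_indicator_set) auto
    have "(\<lambda>m. \<integral>x. \<bar>indicat_real ?Y x - ?S m x\<bar> \<partial>LM n) \<longlonglongrightarrow> (\<integral>x. 0 \<partial>LM n)"
    proof (rule integral_dominated_convergence[where w="indicat_real (cube n R)"])
      show "integrable (LM n) (indicat_real (cube n R))" using emeasure_cube by (intro integrable_real_indicator) auto
      show "(\<lambda>x. \<bar>indicat_real ?Y x - ?S m x\<bar>) \<in> borel_measurable (LM n)" for m
        using Xs by (intro borel_measurable_abs borel_measurable_diff borel_measurable_sum borel_measurable_indicator) auto
      show "AE x in LM n. (\<lambda>m. \<bar>indicat_real ?Y x - ?S m x\<bar>) \<longlonglongrightarrow> 0"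
      proof (intro AE_I2)
        fix x
        show "(\<lambda>m. \<bar>indicat_real ?Y x - ?S m x\<bar>) \<longlonglongrightarrow> 0"
        proof (cases "x \<in> ?Y")
          case True
          then obtain j where j: "x \<in> X j" by auto
          show ?thesis
          proof (rule tendsto_eventually, rule eventually_sequentiallyI[of "Suc j"])
            fix m assume "m \<ge> Suc j"
            then have "x \<in> (\<Union>i<m. X i) \<inter> cube n R" using j True by auto
            then show "\<bar>indicat_real ?Y x - ?S m x\<bar> = 0" unfolding SY using True by simp
          qed
        next
          case False
          then have "x \<notin> (\<Union>i<m. X i) \<inter> cube n R" for m by auto
          then show ?thesis unfolding SY using False by simp
        qed
      qed
      show "AE x in LM n. norm \<bar>indicat_real ?Y x - ?S m x\<bar> \<le> indicat_real (cube n R) x" for m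
        unfolding SY by (auto simp: indicator_def)
    qed auto
    then have lim: "(\<lambda>m. Lq_norm (LM n) 1 (\<lambda>x. indicat_real ?Y x - ?S m x)) \<longlonglongrightarrow> 0" by (simp add: Lq_norm_def)
    show ?case
    proof (rule mollifies_limit[OF _ YL bx])
      fix \<epsilon> :: real assume "\<epsilon> > 0"
      from LIMSEQ_D[OF lim this] obtain m where "Lq_norm (LM n) 1 (\<lambda>x. indicat_real ?Y x - ?S m x) < \<epsilon>" by auto
      then show "\<exists>W. mollifies n 1 W \<and> Lq_norm (LM n) 1 (\<lambda>x. indicat_real ?Y x - W x) < \<epsilon>" using Sm by blast
    qed simp
  qed
qed

text \<open>The mollification of an indicator differs from it by at most 1, so the
  \<open>q\<close>-th power of the error is dominated by the error itself, and convergence in L^1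
  suffices.\<close>

lemma mollifies_indicator:
  assumes q: "q \<ge> 1" and R: "R > 0" and A: "A \<in> sets (LM n)"
  shows "mollifies n q (indicator (A \<inter> cube n R))"
proof -
  let ?f = "indicat_real (A \<inter> cube n R)"
  have m1: "mollifies n 1 ?f" by (rule mollifies_indicator_1[OF R A])
  have fin: "emeasure (LM n) (A \<inter> cube n R) < \<infinity>"
    using emeasure_mono[of "A \<inter> cube n R" "cube n R" "LM n"] emeasure_cube[of n R] by (auto intro: le_less_trans)
  have fL: "in_Lq (LM n) q ?f" using A fin by (intro in_Lq_indicator_set) auto
  have bx: "box_supp n ?f" using m1 by (simp add: mollifies_def)
  have i: "integrable (LM n) ?f" using A fin by (intro integrable_real_indicator) auto
  have le1: "\<bar>kernel_conv n (moll_kernels k) ?f x - ?f x\<bar> \<le> 1" if x: "x \<in> Rn n" for k x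
  proof -
    have "0 \<le> kernel_conv n (moll_kernels k) ?f x" unfolding kernel_conv_def using prod_kernel_moll_kernels_nonneg by (intro Bochner_Integration.integral_nonneg) auto
    moreover have "kernel_conv n (moll_kernels k) ?f x \<le> (\<integral>y. prod_kernel n (moll_kernels k) x y \<partial>LM n)"
      unfolding kernel_conv_def using integrable_prod_kernel[OF compact_smooth_moll_kernel x i] prod_kernel_moll_kernels_integral(1)[of n k x] prod_kernel_moll_kernels_nonneg
      by (intro integral_mono) (auto simp: indicator_def)
    ultimately show ?thesis by (auto simp: prod_kernel_moll_kernels_integral(2) indicator_def)
  qed
  have 1: "in_Lq (LM n) 1 ?f" using m1 by (simp add: mollifies_def)
  have le: "Lq_norm (LM n) q (\<lambda>x. kernel_conv n (moll_kernels k) ?f x - ?f x) \<le> (Lq_norm (LM n) 1 (\<lambda>x. kernel_conv n (moll_kernels k) ?f x - ?f x)) powr (1 / q)" for k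
  proof -
    have d1: "in_Lq (LM n) 1 (\<lambda>x. kernel_conv n (moll_kernels k) ?f x - ?f x)" by (intro in_Lq_diff kernel_conv_in_Lq 1 bx) auto
    have dq: "in_Lq (LM n) q (\<lambda>x. kernel_conv n (moll_kernels k) ?f x - ?f x)" by (intro in_Lq_diff kernel_conv_in_Lq fL bx q)
    have "(\<integral>x. \<bar>kernel_conv n (moll_kernels k) ?f x - ?f x\<bar> powr q \<partial>LM n) \<le> (\<integral>x. \<bar>kernel_conv n (moll_kernels k) ?f x - ?f x\<bar> powr 1 \<partial>LM n)"
    proof (rule integral_mono[OF in_Lq_integrable[OF dq] in_Lq_integrable[OF d1]])
      fix x assume "x \<in> space (LM n)"
      then show "\<bar>kernel_conv n (moll_kernels k) ?f x - ?f x\<bar> powr q \<le> \<bar>kernel_conv n (moll_kernels k) ?f x - ?f x\<bar> powr 1"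
        using le1[of x k] by (intro powr_mono' q) auto
    qed
    then have "Lq_norm (LM n) q (\<lambda>x. kernel_conv n (moll_kernels k) ?f x - ?f x) \<le> (\<integral>x. \<bar>kernel_conv n (moll_kernels k) ?f x - ?f x\<bar> powr 1 \<partial>LM n) powr (1 / q)"
      unfolding Lq_norm_def using q by (intro powr_mono2) auto
    then show ?thesis by (simp add: Lq_norm_def)
  qed
  have "(\<lambda>k. (Lq_norm (LM n) 1 (\<lambda>x. kernel_conv n (moll_kernels k) ?f x - ?f x)) powr (1 / q)) \<longlonglongrightarrow> 0 powr (1 / q)"
    using m1 q by (intro tendsto_powr2) (auto simp: mollifies_def)
  then have "(\<lambda>k. (Lq_norm (LM n) 1 (\<lambda>x. kernel_conv n (moll_kernels k) ?f x - ?f x)) powr (1 / q)) \<longlonglongrightarrow> 0" by simp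
  from Lim_null_comparison[OF _ this, of "\<lambda>k. Lq_norm (LM n) q (\<lambda>x. kernel_conv n (moll_kernels k) ?f x - ?f x)"] le
  have "(\<lambda>k. Lq_norm (LM n) q (\<lambda>x. kernel_conv n (moll_kernels k) ?f x - ?f x)) \<longlonglongrightarrow> 0" by auto
  then show ?thesis using fL bx by (simp add: mollifies_def)
qed

theorem mollification_converges:
  assumes q: "q \<ge> 1" and U: "in_Lq (LM n) q U" "box_supp n U"
  shows "(\<lambda>k. Lq_norm (LM n) q (\<lambda>x. kernel_conv n (moll_kernels k) U x - U x)) \<longlonglongrightarrow> 0"
proof -
  obtain R0 where R0: "\<And>x. x \<in> Rn n \<Longrightarrow> U x \<noteq> 0 \<Longrightarrow> (\<forall>i<n. \<bar>x i\<bar> \<le> R0)" using U(2) by (auto simp: box_supp_def)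
  define R where "R = \<bar>R0\<bar> + 1"
  have R: "R > 0" "\<And>x. x \<in> Rn n \<Longrightarrow> U x \<noteq> 0 \<Longrightarrow> x \<in> cube n R"
    using R0 by (auto simp: R_def cube_iff) fastforce
  have mU: "U \<in> borel_measurable (LM n)" using U(1) by (simp add: in_Lq_def)
  \<comment> \<open>The simple functions satisfy |F i| \<le> 2 |U|: they vanish where
    \<open>U\<close> does, hence off the cube, and dominated convergence applies to the
    \<open>q\<close>-th powers.\<close>
  obtain F where F: "\<And>i. simple_function (LM n) (F i)" "\<And>x. x \<in> space (LM n) \<Longrightarrow> (\<lambda>i. F i x) \<longlonglongrightarrow> U x"
     "\<And>i x. x \<in> space (LM n) \<Longrightarrow> dist (F i x) 0 \<le> 2 * dist (U x) 0"
    using borel_measurable_implies_sequence_metric[OF mU, of 0] by blast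
  have FU: "\<bar>F i x\<bar> \<le> 2 * \<bar>U x\<bar>" if "x \<in> Rn n" for i x using F(3)[of x i] that by simp
  have Fconv: "mollifies n q (F i)" for i
  proof -
    have fin: "finite (F i ` space (LM n))" using F(1) by (simp add: simple_function_def)
    have s: "F i -` {c} \<inter> space (LM n) \<in> sets (LM n)" for c using F(1)[of i] by (rule simple_functionD(2))
    have "mollifies n q (\<lambda>x. \<Sum>c\<in>F i ` space (LM n). c * indicator ((F i -` {c} \<inter> space (LM n)) \<inter> cube n R) x)"
      by (intro mollifies_sum fin mollifies_cmult mollifies_indicator q R s)
    then show ?thesis
    proof (rule mollifies_cong)
      fix x assume x: "x \<in> Rn n"
      show "(\<Sum>c\<in>F i ` space (LM n). c * indicator ((F i -` {c} \<inter> space (LM n)) \<inter> cube n R) x) = F i x"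
      proof (cases "F i x = 0")
        case True
        then have "c * indicator ((F i -` {c} \<inter> space (LM n)) \<inter> cube n R) x = 0" for c :: real by (auto simp: indicator_def)
        then show ?thesis unfolding True by (intro sum.neutral) blast
      next
        case False
        then have "x \<in> cube n R" using FU[OF x, of i] R(2)[OF x] by fastforce
        then have "(\<Sum>c\<in>F i ` space (LM n). c * indicator ((F i -` {c} \<inter> space (LM n)) \<inter> cube n R) x)
          = (\<Sum>c\<in>F i ` space (LM n). if c = F i x then F i x else 0)"
          using x by (intro sum.cong) (auto simp: indicator_def)
        also have "\<dots> = F i x" using fin x by (subst sum.delta) auto
        finally show ?thesis .
      qed
    qed
  qed
  have "(\<lambda>i. \<integral>x. \<bar>U x - F i x\<bar> powr q \<partial>LM n) \<longlonglongrightarrow> (\<integral>x. 0 \<partial>LM n)"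
  proof (rule integral_dominated_convergence[where w="\<lambda>x. 3 powr q * \<bar>U x\<bar> powr q"])
    show "integrable (LM n) (\<lambda>x. 3 powr q * \<bar>U x\<bar> powr q)" using in_Lq_integrable[OF U(1)] by simp
    show "(\<lambda>x. \<bar>U x - F i x\<bar> powr q) \<in> borel_measurable (LM n)" for i
      using mU borel_measurable_simple_function[OF F(1)[of i]] by (intro measurable_abs_powr borel_measurable_diff) auto
    show "AE x in LM n. (\<lambda>i. \<bar>U x - F i x\<bar> powr q) \<longlonglongrightarrow> 0"
    proof (intro AE_I2)
      fix x assume "x \<in> space (LM n)"
      then have "(\<lambda>i. \<bar>U x - F i x\<bar>) \<longlonglongrightarrow> \<bar>U x - U x\<bar>" by (intro tendsto_intros F(2))
      then have "(\<lambda>i. \<bar>U x - F i x\<bar> powr q) \<longlonglongrightarrow> \<bar>U x - U x\<bar> powr q" using q by (intro tendsto_powr2) auto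
      then show "(\<lambda>i. \<bar>U x - F i x\<bar> powr q) \<longlonglongrightarrow> 0" by simp
    qed
    show "AE x in LM n. norm (\<bar>U x - F i x\<bar> powr q) \<le> 3 powr q * \<bar>U x\<bar> powr q" for i
    proof (intro AE_I2)
      fix x assume "x \<in> space (LM n)"
      then have "\<bar>U x - F i x\<bar> \<le> 3 * \<bar>U x\<bar>" using FU[of x i] by simp
      then have "\<bar>U x - F i x\<bar> powr q \<le> (3 * \<bar>U x\<bar>) powr q" using q by (intro powr_mono2) auto
      then show "norm (\<bar>U x - F i x\<bar> powr q) \<le> 3 powr q * \<bar>U x\<bar> powr q" by (simp add: powr_mult)
    qed
  qed auto
  then have "(\<lambda>i. (\<integral>x. \<bar>U x - F i x\<bar> powr q \<partial>LM n) powr (1 / q)) \<longlonglongrightarrow> 0 powr (1 / q)"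
    using q by (intro tendsto_powr2) auto
  then have lim: "(\<lambda>i. Lq_norm (LM n) q (\<lambda>x. U x - F i x)) \<longlonglongrightarrow> 0" by (simp add: Lq_norm_def)
  have "mollifies n q U"
  proof (rule mollifies_limit[OF q U])
    fix \<epsilon> :: real assume "\<epsilon> > 0"
    from LIMSEQ_D[OF lim this] obtain m where "Lq_norm (LM n) q (\<lambda>x. U x - F m x) < \<epsilon>" by auto
    then show "\<exists>W. mollifies n q W \<and> Lq_norm (LM n) q (\<lambda>x. U x - W x) < \<epsilon>" using Fconv by blast
  qed
  then show ?thesis by (simp add: mollifies_def)
qed

section \<open>Mollified weak solutions\<close>

definition tensor :: "nat \<Rightarrow> (nat \<Rightarrow> real \<Rightarrow> real) \<Rightarrow> point \<Rightarrow> real" where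
  "tensor n ps y = (\<Prod>j<n. ps j (y j))"

lemma partial_deriv_tensor:
  assumes "i < n" "smooth (ps i)"
  shows "partial_deriv i (tensor n ps) = tensor n (ps(i := deriv (ps i)))"
    "((\<lambda>t. tensor n ps (x(i := t))) has_real_derivative tensor n (ps(i := deriv (ps i))) (x(i := t))) (at t)"
proof -
  have upd: "tensor n qs (x(i := t)) = qs i t * (\<Prod>j\<in>{..<n} - {i}. qs j (x j))" for qs x t
    using assms(1) by (simp add: tensor_def prod.remove[of "{..<n}" i])
  have d: "((\<lambda>t. tensor n ps (x(i := t))) has_real_derivative tensor n (ps(i := deriv (ps i))) (x(i := t))) (at t)" for x t
  proof -
    from DERIV_cmult_right[OF smooth_DERIV[OF assms(2)], of "\<Prod>j\<in>{..<n} - {i}. ps j (x j)" t]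
    show ?thesis unfolding upd by simp
  qed
  then show "((\<lambda>t. tensor n ps (x(i := t))) has_real_derivative tensor n (ps(i := deriv (ps i))) (x(i := t))) (at t)" .
  show "partial_deriv i (tensor n ps) = tensor n (ps(i := deriv (ps i)))"
  proof
    fix x show "partial_deriv i (tensor n ps) x = tensor n (ps(i := deriv (ps i))) x"
      unfolding partial_deriv_def using DERIV_imp_deriv[OF d[of x "x i"]] by simp
  qed
qed

lemma Ck_tensor: "(\<And>j. j < n \<Longrightarrow> smooth (ps j)) \<Longrightarrow> Ck n m (tensor n ps)"
proof (induction m arbitrary: ps)
  have c: "continuous_map (Rn_top n) euclideanreal (tensor n ps)" if ps: "\<And>j. j < n \<Longrightarrow> smooth (ps j)" for ps
  proof -
    have "continuous_map (Rn_top n) euclideanreal (\<lambda>y. ps j (y j))" if j: "j < n" for j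
    proof -
      have "continuous_map (Rn_top n) euclideanreal (\<lambda>y. y j)"
        unfolding Rn_top_def using j by (intro continuous_map_product_projection) auto
      moreover have "continuous_map euclideanreal euclideanreal (ps j)"
        using smooth_continuous[OF ps[OF j]] by simp
      ultimately show ?thesis using continuous_map_compose[of _ _ "\<lambda>y. y j" _ "ps j"] by (simp add: o_def)
    qed
    then show ?thesis unfolding tensor_def[abs_def] by (intro continuous_map_prod) auto
  qed
  case 0 then show ?case using c by simp
next
  case (Suc m)
  have c: "Ck n 0 (tensor n ps)"
    unfolding Ck.simps tensor_def[abs_def]
  proof (intro continuous_map_prod)
    fix j assume "j \<in> {..<n}"
    then have j: "j < n" by simp
    have "continuous_map (Rn_top n) euclideanreal (\<lambda>y. y j)"
      unfolding Rn_top_def using j by (intro continuous_map_product_projection) auto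
    moreover have "continuous_map euclideanreal euclideanreal (ps j)"
      using smooth_continuous[OF Suc.prems[OF j]] by simp
    ultimately show "continuous_map (Rn_top n) euclideanreal (\<lambda>y. ps j (y j))"
      using continuous_map_compose[of _ _ "\<lambda>y. y j" _ "ps j"] by (simp add: o_def)
  qed simp
  show ?case unfolding Ck.simps(2)
  proof (intro conjI allI impI ballI)
    show "continuous_map (Rn_top n) euclideanreal (tensor n ps)" using c by simp
    fix i assume i: "i < n"
    note pt = partial_deriv_tensor[of i n ps, OF i Suc.prems[OF i]]
    show "(\<lambda>t. tensor n ps (x(i := t))) differentiable at (x i)" for x
      using pt(2)[of x "x i"] real_differentiable_def by blast
    show "Ck n m (partial_deriv i (tensor n ps))" unfolding pt(1)
      by (rule Suc.IH) (use Suc.prems smooth_deriv in auto)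
  qed
qed

lemma smooth_moll_kernel: "smooth (moll_kernel k)"
  using compact_smooth_moll_kernel by (simp add: compact_smooth_def)

text \<open>The translated kernels are the test functions through which the weak equation is used.\<close>

lemma kernel_test_function:
  assumes x: "x \<in> Rn n" and sub: "\<And>y. y \<in> Rn n \<Longrightarrow> (\<And>j. j < n \<Longrightarrow> \<bar>x j - y j\<bar> \<le> 1 / real (Suc k)) \<Longrightarrow> y \<in> \<Omega>"
  shows "prod_kernel n (moll_kernels k) x \<in> test_functions n \<Omega>"
    "i < n \<Longrightarrow> partial_deriv i (partial_deriv i (prod_kernel n (moll_kernels k) x)) y = prod_kernel n ((moll_kernels k)(i := deriv (deriv (moll_kernel k)))) x y"
proof -
  \<comment> \<open>Written as an affine substitution to fit \<open>deriv_affine\<close>.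
    Differentiating twice in \<open>y\<close> gives the sign (-1)^2, so the second derivative in
    \<open>y\<close> is the kernel with its factor differentiated twice in its own argument.\<close>
  define ps where "ps j = (\<lambda>t. 1 * moll_kernel k ((-1) * t + x j))" for j
  have sm: "smooth (ps j)" for j unfolding ps_def by (intro smooth_affine smooth_moll_kernel)
  have eq: "prod_kernel n (moll_kernels k) x = tensor n ps"
    by (auto simp: fun_eq_iff prod_kernel_def tensor_def ps_def)
  have d1: "deriv (ps j) = (\<lambda>t. (1 * (-1)) * deriv (moll_kernel k) ((-1) * t + x j))" for j
    unfolding ps_def by (rule deriv_affine[OF smooth_moll_kernel])
  have d2: "deriv (deriv (ps j)) = (\<lambda>t. ((1 * (-1)) * (-1)) * deriv (deriv (moll_kernel k)) ((-1) * t + x j))" for j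
    unfolding d1 by (rule deriv_affine[OF smooth_deriv[OF smooth_moll_kernel]])
  let ?K = "\<Pi>\<^sub>E j\<in>{..<n}. {x j - 1 / real (Suc k)..x j + 1 / real (Suc k)}"
  show "prod_kernel n (moll_kernels k) x \<in> test_functions n \<Omega>"
    unfolding test_functions_def
  proof (intro CollectI conjI allI exI[of _ ?K])
    show "Ck n m (prod_kernel n (moll_kernels k) x)" for m unfolding eq using sm by (intro Ck_tensor)
    show "compactin (Rn_top n) ?K" unfolding Rn_top_def by (subst compactin_PiE) auto
    show "?K \<subseteq> \<Omega>"
    proof
      fix y assume y: "y \<in> ?K"
      show "y \<in> \<Omega>"
      proof (rule sub)
        show "y \<in> Rn n" unfolding Rn_def by (rule subsetD[OF PiE_mono y]) simp
        fix j assume "j < n" then show "\<bar>x j - y j\<bar> \<le> 1 / real (Suc k)" using PiE_mem[OF y, of j] by (simp add: abs_le_iff)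
      qed
    qed
    show "\<forall>y\<in>Rn n - ?K. prod_kernel n (moll_kernels k) x y = 0"
    proof
      fix y assume y: "y \<in> Rn n - ?K"
      have "\<exists>j<n. \<not> (\<bar>x j - y j\<bar> \<le> 1 / real (Suc k))"
      proof (rule ccontr)
        assume "\<not> (\<exists>j<n. \<not> (\<bar>x j - y j\<bar> \<le> 1 / real (Suc k)))"
        then have c: "\<And>j. j < n \<Longrightarrow> \<bar>x j - y j\<bar> \<le> 1 / real (Suc k)" by blast
        have "y \<in> ?K"
        proof (rule PiE_I)
          fix j assume "j \<in> {..<n}" then show "y j \<in> {x j - 1 / real (Suc k)..x j + 1 / real (Suc k)}"
            using c[of j] by (simp add: abs_le_iff)
        next
          fix j assume "j \<notin> {..<n}" then show "y j = undefined" using y PiE_arb[of y "{..<n}" "\<lambda>_. UNIV" j] unfolding Rn_def by blast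
        qed
        then show False using y by blast
      qed
      then obtain j where "j < n" "\<bar>x j - y j\<bar> \<ge> 1 / real (Suc k)" by (auto simp: not_le)
      then show "prod_kernel n (moll_kernels k) x y = 0" unfolding prod_kernel_def by (intro prod_zero) (auto intro!: bexI[of _ j] moll_kernel_zero)
    qed
  qed
  assume i: "i < n"
  have pp: "partial_deriv i (partial_deriv i (tensor n ps)) = tensor n (ps(i := deriv (deriv (ps i))))"
    using partial_deriv_tensor(1)[of i n ps, OF i sm] partial_deriv_tensor(1)[of i n "ps(i := deriv (ps i))", OF i] smooth_deriv[OF sm]
    by simp
  have "tensor n (ps(i := deriv (deriv (ps i)))) y = prod_kernel n ((moll_kernels k)(i := deriv (deriv (moll_kernel k)))) x y"
    unfolding tensor_def prod_kernel_def
  proof (intro prod.cong refl)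
    have e: "deriv (deriv (ps i)) (y i) = deriv (deriv (moll_kernel k)) (x i - y i)" unfolding d2 by simp
    fix j show "(ps(i := deriv (deriv (ps i)))) j (y j) = ((moll_kernels k)(i := deriv (deriv (moll_kernel k)))) j (x j - y j)"
    proof (cases "j = i")
      case True then show ?thesis using e by simp
    next
      case False then show ?thesis by (simp add: ps_def)
    qed
  qed
  then show "partial_deriv i (partial_deriv i (prod_kernel n (moll_kernels k) x)) y = prod_kernel n ((moll_kernels k)(i := deriv (deriv (moll_kernel k)))) x y"
    unfolding eq pp .
qed

section \<open>The mollified equation\<close>

definition mD :: "nat \<Rightarrow> nat \<Rightarrow> (point \<Rightarrow> real) \<Rightarrow> nat \<Rightarrow> point \<Rightarrow> real" where
  "mD n k U i = kernel_conv n ((moll_kernels k)(i := deriv (moll_kernel k))) U"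

text \<open>The second update acts on the family already modified, so that for i = j the same factor
  is differentiated twice.\<close>

definition mH :: "nat \<Rightarrow> nat \<Rightarrow> (point \<Rightarrow> real) \<Rightarrow> nat \<Rightarrow> nat \<Rightarrow> point \<Rightarrow> real" where
  "mH n k U i j = kernel_conv n (((moll_kernels k)(i := deriv (moll_kernel k)))(j := deriv (((moll_kernels k)(i := deriv (moll_kernel k))) j))) U"

lemma C2_kernel_conv:
  assumes U: "integrable (LM n) U" shows "C2 n (kernel_conv n (moll_kernels k) U) (mD n k U) (mH n k U)"
proof -
  have g: "compact_smooth (((moll_kernels k)(i := deriv (moll_kernel k))) j)" for i j using compact_smooth_moll_kernel compact_smooth_deriv by auto
  have g2: "compact_smooth ((((moll_kernels k)(i := deriv (moll_kernel k)))(j := deriv (((moll_kernels k)(i := deriv (moll_kernel k))) j))) l)" for i j l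
    using g compact_smooth_deriv compact_smooth_moll_kernel by auto
  show ?thesis unfolding C2_def mD_def mH_def
    by (intro conjI allI impI kernel_conv_bdd_meas kernel_conv_has_pderiv compact_smooth_moll_kernel g g2 U)
qed

text \<open>The equation \<open>\<Delta> U = G\<close>, tested only against the kernels whose support lies in \<open>\<Omega>\<close>.\<close>

definition kernel_eq :: "nat \<Rightarrow> point set \<Rightarrow> (point \<Rightarrow> real) \<Rightarrow> (point \<Rightarrow> real) \<Rightarrow> bool" where
  "kernel_eq n \<Omega> U G \<longleftrightarrow> (\<forall>k. \<forall>x\<in>Rn n.
     (\<forall>y\<in>Rn n. (\<forall>j<n. \<bar>x j - y j\<bar> \<le> 1 / real (Suc k)) \<longrightarrow> y \<in> \<Omega>) \<longrightarrow>
     (\<integral>y. U y * (\<Sum>i<n. prod_kernel n ((moll_kernels k)(i := deriv (deriv (moll_kernel k)))) x y) \<partial>LM n) = (\<integral>y. G y * prod_kernel n (moll_kernels k) x y \<partial>LM n))"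

text \<open>Both derivatives fall on the kernel, where they agree with second derivatives in the
  variable of integration; the equation tested with the kernel at \<open>x\<close> then yields the
  mollified right side.\<close>

lemma lapl_kernel_conv:
  assumes U: "integrable (LM n) U" and x: "x \<in> Rn n"
    and sub: "\<And>y. y \<in> Rn n \<Longrightarrow> (\<And>j. j < n \<Longrightarrow> \<bar>x j - y j\<bar> \<le> 1 / real (Suc k)) \<Longrightarrow> y \<in> \<Omega>"
    and weak: "kernel_eq n \<Omega> U G"
  shows "lapl n (mH n k U) x = kernel_conv n (moll_kernels k) G x"
proof -
  have g: "compact_smooth (((moll_kernels k)(i := deriv (deriv (moll_kernel k)))) j)" for i j using compact_smooth_moll_kernel compact_smooth_deriv by auto
  have "lapl n (mH n k U) x = (\<Sum>i<n. \<integral>y. U y * prod_kernel n ((moll_kernels k)(i := deriv (deriv (moll_kernel k)))) x y \<partial>LM n)"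
    by (simp add: lapl_def mH_def kernel_conv_def)
  also have "\<dots> = (\<integral>y. (\<Sum>i<n. U y * prod_kernel n ((moll_kernels k)(i := deriv (deriv (moll_kernel k)))) x y) \<partial>LM n)"
    by (rule Bochner_Integration.integral_sum[symmetric]) (rule integrable_prod_kernel[OF g x U])
  also have "\<dots> = (\<integral>y. U y * (\<Sum>i<n. prod_kernel n ((moll_kernels k)(i := deriv (deriv (moll_kernel k)))) x y) \<partial>LM n)"
    by (simp add: sum_distrib_left)
  also have "\<dots> = kernel_conv n (moll_kernels k) G x"
    unfolding kernel_conv_def using weak x sub unfolding kernel_eq_def by blast
  finally show ?thesis .
qed

text \<open>A crude bound by the sum over the coordinates. The factor \<open>n\<close> is harmless,
  since it only decides how narrow a kernel must be.\<close>

lemma pnorm_diff_le: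
  assumes "\<And>j. j < n \<Longrightarrow> \<bar>x j - y j\<bar> \<le> \<epsilon>" "\<epsilon> \<ge> 0"
  shows "pnorm n y \<le> pnorm n x + real n * \<epsilon>"
proof -
  have "pnorm n y \<le> pnorm n x + L2_set (\<lambda>i. y i - x i) {..<n}"
    using L2_set_triangle_ineq[of "\<lambda>i. y i - x i" x "{..<n}"] by (simp add: pnorm_def)
  also have "L2_set (\<lambda>i. y i - x i) {..<n} \<le> (\<Sum>i<n. \<bar>y i - x i\<bar>)" by (rule L2_set_le_sum_abs)
  also have "\<dots> \<le> (\<Sum>i<n. \<epsilon>)" using assms by (intro sum_mono) (simp add: abs_minus_commute)
  finally show ?thesis by simp
qed

context step_fun
begin

text \<open>On the ball of radius 13r/4 the residual of a mollification f is (g - V U) - V (f - U),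
  where g is V U mollified. The first part tends to 0 in L^p. For the second part f - U has to be
  small in the dual space, although \<open>U\<close> is only in L^2: the energy bound shows that the
  cut-off sequence is Cauchy there, and Fatou's lemma carries the bound over to the limit.\<close>

lemma smooth_approximation:
  assumes n: "n \<ge> 3" and r: "r > 0"
    and U: "in_Lq (LM n) 2 U" "\<And>x. x \<in> Rn n \<Longrightarrow> x \<notin> ball0 n (4 * r) \<Longrightarrow> U x = 0"
    and V: "in_Lq (LM n) (real n / 2) V" and G: "in_Lq (LM n) (exponent_p n) (\<lambda>x. V x * U x)"
    and weak: "kernel_eq n (ball0 n (4 * r)) U (\<lambda>x. V x * U x)"
  shows "\<exists>f D Hf. (\<forall>k::nat. C2 n (f k) (D k) (Hf k)) \<and> (\<forall>k. in_Lq (LM n) 2 (f k)) \<and>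
    (\<lambda>k. Lq_norm (LM n) 2 (\<lambda>x. f k x - U x)) \<longlonglongrightarrow> 0 \<and>
    (\<lambda>k. residual_norm n (13 * r / 4) V (f k) (lapl n (Hf k))) \<longlonglongrightarrow> 0"
proof -
  note ex = exponents[OF n]
  define G' where "G' = (\<lambda>x. V x * U x)"
  have n0: "n > 0" using n by simp
  have bU: "box_supp n U" and bG: "box_supp n G'"
  proof -
    have "\<forall>x\<in>Rn n. x \<in> ball0 n (4 * r) \<longrightarrow> (\<forall>i<n. \<bar>x i\<bar> \<le> 4 * r)"
    proof (intro ballI impI allI)
      fix x i assume "x \<in> ball0 n (4 * r)" "i < n"
      then show "\<bar>x i\<bar> \<le> 4 * r" using abs_comp_le_pnorm[of i n x] by (simp add: ball0_def)
    qed
    then show "box_supp n U" "box_supp n G'" using U(2) unfolding box_supp_def G'_def by (metis mult_zero_right)+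
  qed
  have iU: "integrable (LM n) U" by (rule in_Lq_box_supp_integrable[OF U(1) bU]) simp
  have GL: "in_Lq (LM n) (exponent_p n) G'" using G by (simp add: G'_def)
  have p1: "exponent_p n \<ge> 1" "exponent_p' n \<ge> 1" using ex by auto
  \<comment> \<open>From this index on, a kernel centred at |x| < 7r/2 stays inside the ball of
    radius 4r, even with the crude factor \<open>n\<close>. Dropping the earlier kernels makes
    \<open>lapg\<close> hold for all indices.\<close>
  obtain k0 where k0: "1 / real (Suc k0) < r / (2 * real n)" using nat_approx_posE[of "r / (2 * real n)"] r n0 by auto
  define f where "f k = kernel_conv n (moll_kernels (k + k0)) U" for k
  define g where "g k = kernel_conv n (moll_kernels (k + k0)) G'" for k
  define D where "D k = mD n (k + k0) U" for k
  define Hf where "Hf k = mH n (k + k0) U" for k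
  have C: "C2 n (f k) (D k) (Hf k)" for k unfolding f_def D_def Hf_def by (rule C2_kernel_conv[OF iU])
  have fL: "in_Lq (LM n) 2 (f k)" for k unfolding f_def by (rule kernel_conv_in_Lq[OF U(1) bU]) simp
  have gL: "in_Lq (LM n) (exponent_p n) (g k)" for k unfolding g_def by (rule kernel_conv_in_Lq[OF GL bG p1(1)])
  have lapg: "lapl n (Hf k) x = g k x" if x: "x \<in> Rn n" "pnorm n x < 7 * r / 2" for k x
    unfolding Hf_def g_def
  proof (rule lapl_kernel_conv[OF iU x(1)])
    fix y assume y: "y \<in> Rn n" "\<And>j. j < n \<Longrightarrow> \<bar>x j - y j\<bar> \<le> 1 / real (Suc (k + k0))"
    have "1 / real (Suc (k + k0)) \<le> 1 / real (Suc k0)" by (intro divide_left_mono) auto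
    then have "real n * (1 / real (Suc (k + k0))) \<le> real n * (r / (2 * real n))" using k0 by (intro mult_left_mono) auto
    also have "\<dots> = r / 2" using n0 by simp
    finally have e: "real n * (1 / real (Suc (k + k0))) \<le> r / 2" .
    have "pnorm n y \<le> pnorm n x + real n * (1 / real (Suc (k + k0)))"
      by (rule pnorm_diff_le[OF y(2)]) simp_all
    then have "pnorm n y < 4 * r" using e x(2) by linarith
    then show "y \<in> ball0 n (4 * r)" using y(1) by (simp add: ball0_def)
  qed (use weak in \<open>simp add: G'_def\<close>)
  define \<alpha> where "\<alpha> k = Lq_norm (LM n) 2 (\<lambda>x. f k x - U x)" for k
  define \<beta> where "\<beta> k = Lq_norm (LM n) (exponent_p n) (\<lambda>x. g k x - G' x)" for k
  have \<alpha>0: "\<alpha> \<longlonglongrightarrow> 0" unfolding \<alpha>_def f_def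
    using LIMSEQ_ignore_initial_segment[OF mollification_converges[OF _ U(1) bU], of k0] by simp
  have \<beta>0: "\<beta> \<longlonglongrightarrow> 0" unfolding \<beta>_def g_def
    by (rule LIMSEQ_ignore_initial_segment[OF mollification_converges[OF p1(1) GL bG], of k0])
  let ?v = "\<lambda>x. 1 - up n (13 * r / 4) (7 * r / 2) x"
  let ?E = "\<lambda>i x. - upD n (13 * r / 4) (7 * r / 2) i x" and ?K = "\<lambda>i j x. - upH n (13 * r / 4) (7 * r / 2) i j x"
  have tv: "transition n (13 * r / 4) (7 * r / 2) ?v ?E ?K"
    using r n by (intro transition_down transition_up) (auto simp: power2_eq_square)
  note T = transition_D[OF tv]
  have vz: "?v x = 0" if "pnorm n x \<ge> 7 * r / 2" for x using up_vals(2)[of "13 * r / 4" "7 * r / 2" n x] r that by simp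
  have v1: "?v x = 1" if "pnorm n x \<le> 13 * r / 4" for x using up_vals(1)[of "13 * r / 4" "7 * r / 2" n x] r that by simp
  have vbs: "bdd_supp n ?v" using vz C2_D(1)[OF T(1)] by (intro bdd_supp_if_pnorm_support[of _ _ "7 * r / 2"]) auto
  have mv: "?v \<in> borel_measurable (LM n)" by (rule bdd_supp_measurable[OF vbs])
  define c where "c = 5 * (16 * H / (7 * r / 2))"
  have H0: "H \<ge> 0" using H_ge_1 by simp
  have c0: "c \<ge> 0" using H0 r by (simp add: c_def)
  have cauchy: "Lq_norm (LM n) (exponent_p' n) (\<lambda>x. ?v x * (f k x - f l x)) \<le> c * (\<alpha> k + \<alpha> l) + 11 * (\<beta> k + \<beta> l)" for k l
  proof -
    note Cd = C2_diff[OF C[of k] C[of l]]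
    \<comment> \<open>The potential is taken to be 0, so that the difference of the mollified right
      sides is the whole error term; with \<open>V\<close> in the operator the error would contain
      the convergence that is to be proved.\<close>
    have V0: "in_Lq (LM n) (real n / 2) (\<lambda>_. 0)" "Lq_norm (LM n) (real n / 2) (\<lambda>_. 0) \<le> 1" by (auto simp: in_Lq_def Lq_norm_def)
    note EB = energy_bound[OF n Cd T(1) vbs V0]
    have 1: "sqrt (\<integral>x. (f k x - f l x)\<^sup>2 * (\<Sum>i<n. (?E i x)\<^sup>2) \<partial>LM n)
      \<le> (16 * H / (7 * r / 2)) * Lq_norm (LM n) 2 (\<lambda>x. indicator (shell n (13 * r / 4) (7 * r / 2)) x * (f k x - f l x))"
      using H0 r T(6) T(4) by (intro nrm2_gradient_cutoff[OF C2_D(1)[OF Cd] transition_bdd_supp(1)[OF tv]]) auto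
    have dL: "in_Lq (LM n) 2 (\<lambda>x. f k x - f l x)" by (rule in_Lq_diff[OF fL fL]) simp
    have "Lq_norm (LM n) 2 (\<lambda>x. indicator (shell n (13 * r / 4) (7 * r / 2)) x * (f k x - f l x)) \<le> Lq_norm (LM n) 2 (\<lambda>x. f k x - f l x)"
      by (rule Lq_norm_mono[OF _ dL]) (use in_Lq_indicator[OF dL sets_shell] in \<open>auto simp: in_Lq_def indicator_def\<close>)
    also have "\<dots> \<le> \<alpha> k + \<alpha> l"
      using Lq_norm_diff_triangle[OF fL[of k] U(1) fL[of l]] Lq_norm_minus_commute[of "LM n" 2 U "f l"] by (simp add: \<alpha>_def)
    finally have "(16 * H / (7 * r / 2)) * Lq_norm (LM n) 2 (\<lambda>x. indicator (shell n (13 * r / 4) (7 * r / 2)) x * (f k x - f l x)) \<le> (16 * H / (7 * r / 2)) * (\<alpha> k + \<alpha> l)"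
      using H0 r by (intro mult_left_mono) auto
    with 1 have h1: "5 * sqrt (\<integral>x. (f k x - f l x)\<^sup>2 * (\<Sum>i<n. (?E i x)\<^sup>2) \<partial>LM n) \<le> c * (\<alpha> k + \<alpha> l)"
      unfolding c_def by linarith
    have gd: "in_Lq (LM n) (exponent_p n) (\<lambda>x. g k x - g l x)" by (rule in_Lq_diff[OF gL gL p1(1)])
    have lapd: "lapl n (\<lambda>i j x. Hf k i j x - Hf l i j x) x = lapl n (Hf k) x - lapl n (Hf l) x" for x
      by (simp add: lapl_def sum_subtractf)
    have "Lq_norm (LM n) (exponent_p n) (\<lambda>x. ?v x * (lapl n (\<lambda>i j x. Hf k i j x - Hf l i j x) x - 0 * (f k x - f l x))) \<le>
      Lq_norm (LM n) (exponent_p n) (\<lambda>x. g k x - g l x)"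
    proof (rule Lq_norm_mono[OF _ gd])
      show "(\<lambda>x. ?v x * (lapl n (\<lambda>i j x. Hf k i j x - Hf l i j x) x - 0 * (f k x - f l x))) \<in> borel_measurable (LM n)"
        using borel_measurable_times[OF mv bdd_meas_measurable[OF C2_D(6)[OF Cd]]] by simp
      fix x assume "x \<in> space (LM n)"
      then have x: "x \<in> Rn n" by simp
      show "\<bar>?v x * (lapl n (\<lambda>i j x. Hf k i j x - Hf l i j x) x - 0 * (f k x - f l x))\<bar> \<le> \<bar>g k x - g l x\<bar>"
      proof (cases "pnorm n x < 7 * r / 2")
        case True
        have "\<bar>?v x\<bar> * \<bar>g k x - g l x\<bar> \<le> 1 * \<bar>g k x - g l x\<bar>" using T(2,3)[of x] by (intro mult_right_mono) auto
        then show ?thesis by (simp add: lapd lapg[OF x True] abs_mult)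
      next
        case False
        then have "?v x = 0" by (intro vz) simp
        then show ?thesis by (simp only: mult_zero_left abs_zero abs_ge_zero)
      qed
    qed (use ex in auto)
    also have "\<dots> \<le> \<beta> k + \<beta> l"
      using Lq_norm_diff_triangle[OF gL[of k] GL gL[of l] p1(1)] Lq_norm_minus_commute[of "LM n" "exponent_p n" G' "g l"] by (simp add: \<beta>_def)
    finally have h2: "Lq_norm (LM n) (exponent_p n) (\<lambda>x. ?v x * (lapl n (\<lambda>i j x. Hf k i j x - Hf l i j x) x - 0 * (f k x - f l x))) \<le> \<beta> k + \<beta> l" .
    show ?thesis
      by (rule order_trans[OF EB(1) order_trans[OF EB(2) add_mono[OF h1 mult_left_mono[OF h2]]]]) simp
  qed
  obtain s :: "nat \<Rightarrow> nat" where s: "strict_mono s" and sae: "AE x in LM n. (\<lambda>j. f (s j) x) \<longlonglongrightarrow> U x"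
    using Lq_norm_tendsto_AE_subseq[OF fL U(1) _ \<alpha>0[unfolded \<alpha>_def]] by auto
  have wL: "in_Lq (LM n) (exponent_p' n) (\<lambda>x. ?v x * (f k x - f l x))" for k l
    using C2_D(1)[OF C2_diff[OF C[of k] C[of l]]] p1 by (intro bdd_supp_in_Lq bdd_supp_mult vbs) auto
  have wUm: "(\<lambda>x. ?v x * (f k x - U x)) \<in> borel_measurable (LM n)" for k
    by (rule borel_measurable_times[OF mv borel_measurable_diff[OF in_Lq_measurable[OF fL] in_Lq_measurable[OF U(1)]]])
  define \<gamma> where "\<gamma> k = Lq_norm (LM n) (exponent_p' n) (\<lambda>x. ?v x * (f k x - U x))" for k
  \<comment> \<open>One index is fixed while the other runs through a tail of the subsequence that
    converges almost everywhere; in this tail both errors are below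
    \<open>\<epsilon>\<close>.\<close>
  have lim: "in_Lq (LM n) (exponent_p' n) (\<lambda>x. ?v x * (f k x - U x)) \<and> \<gamma> k \<le> c * \<alpha> k + 11 * \<beta> k + (c + 11) * \<epsilon>" if \<epsilon>: "\<epsilon> > 0" for k \<epsilon>
  proof -
    obtain N1 where N1: "\<And>l. l \<ge> N1 \<Longrightarrow> \<alpha> l < \<epsilon>" using LIMSEQ_D[OF \<alpha>0 \<epsilon>] by (auto simp: abs_less_iff)
    obtain N2 where N2: "\<And>l. l \<ge> N2 \<Longrightarrow> \<beta> l < \<epsilon>" using LIMSEQ_D[OF \<beta>0 \<epsilon>] by (auto simp: abs_less_iff)
    define J where "J = N1 + N2"
    have sJ: "s (j + J) \<ge> N1" "s (j + J) \<ge> N2" for j using seq_suble[OF s, of "j + J"] by (auto simp: J_def)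
    have ae: "AE x in LM n. (\<lambda>j. ?v x * (f k x - f (s (j + J)) x)) \<longlonglongrightarrow> ?v x * (f k x - U x)"
      using sae
    proof (rule eventually_mono)
      fix x assume "(\<lambda>j. f (s j) x) \<longlonglongrightarrow> U x"
      from LIMSEQ_ignore_initial_segment[OF this, of J]
      show "(\<lambda>j. ?v x * (f k x - f (s (j + J)) x)) \<longlonglongrightarrow> ?v x * (f k x - U x)" by (intro tendsto_intros)
    qed
    have bd: "Lq_norm (LM n) (exponent_p' n) (\<lambda>x. ?v x * (f k x - f (s (j + J)) x)) \<le> c * \<alpha> k + 11 * \<beta> k + (c + 11) * \<epsilon>" for j
    proof -
      have "c * \<alpha> (s (j + J)) \<le> c * \<epsilon>" using N1[OF sJ(1)[of j]] c0 by (intro mult_left_mono) auto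
      moreover have "11 * \<beta> (s (j + J)) \<le> 11 * \<epsilon>" using N2[OF sJ(2)[of j]] by simp
      ultimately show ?thesis using cauchy[of k "s (j + J)"] by (simp add: algebra_simps)
    qed
    have p0: "exponent_p' n > 0" using p1 by simp
    show ?thesis unfolding \<gamma>_def using Fatou_Lq_norm[OF wL wUm p0 ae bd] by auto
  qed
  have wUL: "in_Lq (LM n) (exponent_p' n) (\<lambda>x. ?v x * (f k x - U x))" for k using lim[of 1 k] by simp
  have \<gamma>le: "\<gamma> k \<le> c * \<alpha> k + 11 * \<beta> k" for k
  proof (rule field_le_epsilon)
    fix e :: real assume e: "e > 0"
    have "e / (c + 11) > 0" using e c0 by (intro divide_pos_pos) auto
    from lim[OF this, of k] show "\<gamma> k \<le> c * \<alpha> k + 11 * \<beta> k + e" using c0 by simp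
  qed
  have errle: "residual_norm n (13 * r / 4) V (f k) (lapl n (Hf k)) \<le> \<beta> k + Lq_norm (LM n) (real n / 2) V * (c * \<alpha> k + 11 * \<beta> k)" for k
  proof -
    let ?I = "indicat_real (ball0 n (13 * r / 4))"
    note VW = in_Lq_V_mult[OF n V wUL[of k]]
    have gd: "in_Lq (LM n) (exponent_p n) (\<lambda>x. g k x - G' x)" by (rule in_Lq_diff[OF gL GL p1(1)])
    have sumL: "in_Lq (LM n) (exponent_p n) (\<lambda>x. (g k x - G' x) + (-1) * (V x * (?v x * (f k x - U x))))"
      by (rule in_Lq_add[OF gd in_Lq_cmult[OF VW(1)] p1(1)])
    have "residual_norm n (13 * r / 4) V (f k) (lapl n (Hf k)) \<le>
      Lq_norm (LM n) (exponent_p n) (\<lambda>x. (g k x - G' x) + (-1) * (V x * (?v x * (f k x - U x))))"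
      unfolding residual_norm_def
    proof (rule Lq_norm_mono[OF _ sumL])
      show "(\<lambda>x. ?I x * (lapl n (Hf k) x - V x * f k x)) \<in> borel_measurable (LM n)"
        using residual_norm_in_Lq[OF n C2_D(1)[OF C] C2_D(6)[OF C] V] by (simp add: in_Lq_def)
      fix x assume "x \<in> space (LM n)"
      then have x: "x \<in> Rn n" by simp
      show "\<bar>?I x * (lapl n (Hf k) x - V x * f k x)\<bar> \<le> \<bar>(g k x - G' x) + (-1) * (V x * (?v x * (f k x - U x)))\<bar>"
      proof (cases "x \<in> ball0 n (13 * r / 4)")
        case True
        then have px: "pnorm n x < 13 * r / 4" by (simp add: ball0_def)
        have v: "?v x = 1" using px by (intro v1) simp
        have "lapl n (Hf k) x = g k x" using px r by (intro lapg[OF x]) simp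
        then show ?thesis unfolding v using True by (simp add: G'_def algebra_simps)
      qed simp
    qed (use ex in auto)
    also have "\<dots> \<le> \<beta> k + Lq_norm (LM n) (exponent_p n) (\<lambda>x. (-1) * (V x * (?v x * (f k x - U x))))"
      unfolding \<beta>_def by (rule Minkowski[OF gd in_Lq_cmult[OF VW(1)] p1(1)])
    also have "Lq_norm (LM n) (exponent_p n) (\<lambda>x. (-1) * (V x * (?v x * (f k x - U x)))) = Lq_norm (LM n) (exponent_p n) (\<lambda>x. V x * (?v x * (f k x - U x)))"
      using ex by (subst Lq_norm_cmult) auto
    also have "\<dots> \<le> Lq_norm (LM n) (real n / 2) V * \<gamma> k" using VW(2) by (simp add: \<gamma>_def)
    also have "\<dots> \<le> Lq_norm (LM n) (real n / 2) V * (c * \<alpha> k + 11 * \<beta> k)" by (intro mult_left_mono \<gamma>le) simp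
    finally show ?thesis by simp
  qed
  have "(\<lambda>k. \<beta> k + Lq_norm (LM n) (real n / 2) V * (c * \<alpha> k + 11 * \<beta> k)) \<longlonglongrightarrow> 0 + Lq_norm (LM n) (real n / 2) V * (c * 0 + 11 * 0)"
    by (intro tendsto_intros \<alpha>0 \<beta>0)
  then have lim0: "(\<lambda>k. \<beta> k + Lq_norm (LM n) (real n / 2) V * (c * \<alpha> k + 11 * \<beta> k)) \<longlonglongrightarrow> 0" by simp
  have err0: "(\<lambda>k. residual_norm n (13 * r / 4) V (f k) (lapl n (Hf k))) \<longlonglongrightarrow> 0"
    by (rule Lim_null_comparison[OF _ lim0]) (use errle in \<open>auto simp: residual_norm_def\<close>)
  show ?thesis using C fL \<alpha>0 err0 unfolding \<alpha>_def by blast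
qed

end

lemma Lq_norm_indicator_tendsto:
  assumes "\<And>k. in_Lq M 2 (f k)" "in_Lq M 2 U" "(\<lambda>k. Lq_norm M 2 (\<lambda>x. f k x - U x)) \<longlonglongrightarrow> 0" "A \<in> sets M"
  shows "(\<lambda>k. Lq_norm M 2 (\<lambda>x. indicator A x * f k x)) \<longlonglongrightarrow> Lq_norm M 2 (\<lambda>x. indicator A x * U x)"
proof (rule tendsto_Lq_norm)
  show "in_Lq M 2 (\<lambda>x. indicator A x * f k x)" for k using assms by (intro in_Lq_indicator) auto
  show "in_Lq M 2 (\<lambda>x. indicator A x * U x)" using assms by (intro in_Lq_indicator) auto
  show "(\<lambda>k. Lq_norm M 2 (\<lambda>x. indicator A x * f k x - indicator A x * U x)) \<longlonglongrightarrow> 0"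
  proof (rule Lim_null_comparison[OF _ assms(3)], intro always_eventually allI)
    fix k
    have d: "in_Lq M 2 (\<lambda>x. f k x - U x)" using assms by (intro in_Lq_diff) auto
    have "Lq_norm M 2 (\<lambda>x. indicator A x * f k x - indicator A x * U x) = Lq_norm M 2 (\<lambda>x. indicator A x * (f k x - U x))"
      by (simp add: algebra_simps)
    also have "\<dots> \<le> Lq_norm M 2 (\<lambda>x. f k x - U x)"
      by (rule Lq_norm_mono[OF _ d]) (use in_Lq_indicator[OF d assms(4)] in \<open>auto simp: in_Lq_def indicator_def\<close>)
    finally show "norm (Lq_norm M 2 (\<lambda>x. indicator A x * f k x - indicator A x * U x)) \<le> Lq_norm M 2 (\<lambda>x. f k x - U x)" by simp
  qed
qed simp

section \<open>The doubling inequality at the origin\<close>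

text \<open>These are the midpoints between consecutive points of N + (n-2)/2: a natural number is
  at most \<open>j\<close> or at least \<open>j + 1\<close>, so no point comes closer than
  1/2.\<close>

lemma Carleman_exponents_mem:
  assumes "n \<ge> 3" shows "real j + 1/2 + (real n - 2) / 2 \<in> Carleman_exponents n"
proof -
  let ?\<mu> = "real j + 1/2 + (real n - 2) / 2"
  let ?S = "range (\<lambda>k::nat. real k + (real n - 2) / 2)"
  have ne: "?S \<noteq> {}" by simp
  have "infdist ?\<mu> ?S = 1/2"
  proof (rule antisym)
    have "infdist ?\<mu> ?S \<le> dist ?\<mu> (real j + (real n - 2) / 2)" by (rule infdist_le) auto
    then show "infdist ?\<mu> ?S \<le> 1/2" by (simp add: dist_real_def)
    show "1/2 \<le> infdist ?\<mu> ?S"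
      unfolding infdist_notempty[of ?S, OF ne]
    proof (intro cINF_greatest)
      fix a assume "a \<in> ?S"
      then obtain k where a: "a = real k + (real n - 2) / 2" by blast
      have "k \<le> j \<or> k \<ge> j + 1" by linarith
      then have "real k \<le> real j \<or> real k \<ge> real j + 1" by auto
      then show "1/2 \<le> dist ?\<mu> a" by (auto simp: a dist_real_def abs_if)
    qed (rule ne)
  qed
  moreover have "?\<mu> > 0" using assms by (intro add_nonneg_pos) auto
  ultimately show ?thesis unfolding Carleman_exponents_def by blast
qed

text \<open>The midpoints have spacing 1, so one of them lies within distance 1 above
  \<open>l\<close>; starting at j = 8 accounts for the second term of the maximum.\<close>

lemma Carleman_exponent_between:
  assumes "n \<ge> 3" and l: "l \<ge> 0"
  shows "\<exists>\<mu>\<in>Carleman_exponents n. l \<le> \<mu> \<and> \<mu> \<le> max (l + 1) (8 + 1/2 + (real n - 2) / 2)"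
proof -
  define c where "c = 1/2 + (real n - 2) / 2"
  define j where "j = max 8 (nat \<lceil>l - c\<rceil>)"
  have "l - c \<le> real (nat \<lceil>l - c\<rceil>)" by linarith
  then have "l - c \<le> real j" by (simp add: j_def)
  then have 1: "l \<le> real j + 1/2 + (real n - 2) / 2" by (simp add: c_def)
  have "real j \<le> max 8 (l - c + 1)"
  proof (cases "l - c \<le> 0")
    case True then show ?thesis by (simp add: j_def)
  next
    case False
    then have "real (nat \<lceil>l - c\<rceil>) \<le> l - c + 1" by linarith
    then show ?thesis by (auto simp: j_def max_def)
  qed
  then have 2: "real j + 1/2 + (real n - 2) / 2 \<le> max (l + 1) (8 + 1/2 + (real n - 2) / 2)"
    by (auto simp: c_def max_def split: if_splits)
  show ?thesis by (rule bexI[OF _ Carleman_exponents_mem[OF assms(1)]]) (use 1 2 in blast)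
qed

text \<open>The situation after \<open>x0\<close> is moved to the origin, with the solution cut off
  to the ball of radius 4r. \<open>\<kappa>\<close> is an upper bound rather than a value, because
  in the theorem it is formed with the norm of the potential over the whole domain.\<close>

locale core =
  fixes n :: nat and \<theta> r \<kappa> :: real and U V :: "point \<Rightarrow> real"
  assumes n: "n \<ge> 3" and C: "Carleman_constant n \<theta>" and r: "r > 0"
    and U: "in_Lq (LM n) 2 U" "\<And>x. x \<in> Rn n \<Longrightarrow> x \<notin> ball0 n (4 * r) \<Longrightarrow> U x = 0"
    and V: "in_Lq (LM n) (real n / 2) V" "\<theta> * Lq_norm (LM n) (real n / 2) V \<le> \<kappa>" "\<kappa> < 1"
    and G: "in_Lq (LM n) (exponent_p n) (\<lambda>x. V x * U x)"
    and weak: "kernel_eq n (ball0 n (4 * r)) U (\<lambda>x. V x * U x)"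

context step_fun
begin

definition C1 :: real where "C1 = 135000 * H\<^sup>2"

lemma C1_ge: "C1 \<ge> 1"
proof -
  have "1 * 1 \<le> H * H" using H_ge_1 by (intro mult_mono) auto
  then show ?thesis by (simp add: C1_def power2_eq_square)
qed

text \<open>The coefficient of the residual in \<open>Carleman_annulus\<close> is the same for all
  approximations, so the residual term disappears in the limit.\<close>

lemma limit_annulus:
  assumes c: "core n \<theta> r \<kappa> U V" and \<mu>: "\<mu> \<in> Carleman_exponents n"
    and \<rho>: "0 < \<rho>" "\<rho> < r"
    and A: "A \<in> sets (LM n)" "A \<subseteq> ball0 n d" "0 < d" "\<And>x. x \<in> A \<Longrightarrow> 3 * \<rho> / 4 \<le> pnorm n x \<and> pnorm n x \<le> 9 * r / 8"
  shows "d powr (- \<mu> - 1) * Lq_norm (LM n) 2 (\<lambda>x. indicator A x * U x) \<le>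
    C1 * (\<theta> / (1 - \<kappa>)) *
      ((\<rho> / 2) powr (- \<mu> - 1) * Lq_norm (LM n) 2 (\<lambda>x. indicator (shell n (\<rho> / 4) \<rho>) x * U x)
       + (9 * r / 8) powr (- \<mu> - 1) * Lq_norm (LM n) 2 (\<lambda>x. indicator (shell n r (13 * r / 4)) x * U x))"
proof -
  interpret core n \<theta> r \<kappa> U V by (rule c)
  obtain f D Hf where f: "\<And>k::nat. C2 n (f k) (D k) (Hf k)" "\<And>k. in_Lq (LM n) 2 (f k)"
    "(\<lambda>k. Lq_norm (LM n) 2 (\<lambda>x. f k x - U x)) \<longlonglongrightarrow> 0" "(\<lambda>k. residual_norm n (13 * r / 4) V (f k) (lapl n (Hf k))) \<longlonglongrightarrow> 0"
    using smooth_approximation[OF n r U V(1) G weak] by blast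
  note t = Lq_norm_indicator_tendsto[OF f(2) U(1) f(3)]
  let ?N = "\<lambda>A g. Lq_norm (LM n) 2 (\<lambda>x. indicator A x * g x)"
  let ?CE = "5 * (\<theta> / (1 - \<kappa>)) * ((\<rho> / 2) powr (- \<mu>) * (1 + 1760 * H) + (9 * r / 8) powr (- \<mu>) * 1760 * H)"
  have l: "(\<lambda>k. d powr (- \<mu> - 1) * ?N A (f k)) \<longlonglongrightarrow> d powr (- \<mu> - 1) * ?N A U"
    by (intro tendsto_intros t A)
  have "(\<lambda>k. C1 * (\<theta> / (1 - \<kappa>)) *
      ((\<rho> / 2) powr (- \<mu> - 1) * ?N (shell n (\<rho> / 4) \<rho>) (f k)
       + (9 * r / 8) powr (- \<mu> - 1) * ?N (shell n r (13 * r / 4)) (f k)) + ?CE * residual_norm n (13 * r / 4) V (f k) (lapl n (Hf k)))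
    \<longlonglongrightarrow> C1 * (\<theta> / (1 - \<kappa>)) *
      ((\<rho> / 2) powr (- \<mu> - 1) * ?N (shell n (\<rho> / 4) \<rho>) U
       + (9 * r / 8) powr (- \<mu> - 1) * ?N (shell n r (13 * r / 4)) U) + ?CE * 0"
    by (intro tendsto_add tendsto_mult tendsto_const t sets_shell f(4))
  then have rr: "(\<lambda>k. C1 * (\<theta> / (1 - \<kappa>)) *
      ((\<rho> / 2) powr (- \<mu> - 1) * ?N (shell n (\<rho> / 4) \<rho>) (f k)
       + (9 * r / 8) powr (- \<mu> - 1) * ?N (shell n r (13 * r / 4)) (f k)) + ?CE * residual_norm n (13 * r / 4) V (f k) (lapl n (Hf k)))
    \<longlonglongrightarrow> C1 * (\<theta> / (1 - \<kappa>)) *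
      ((\<rho> / 2) powr (- \<mu> - 1) * ?N (shell n (\<rho> / 4) \<rho>) U
       + (9 * r / 8) powr (- \<mu> - 1) * ?N (shell n r (13 * r / 4)) U)" by simp
  show ?thesis
    by (rule LIMSEQ_le[OF l rr]) (use Carleman_annulus[OF n C \<mu> f(1) V \<rho> A] in \<open>auto simp: C1_def\<close>)
qed

lemma limit_coercive:
  assumes c: "core n \<theta> r \<kappa> U V" and ab: "0 < a" "a < b" "b\<^sup>2 \<le> 8 * (b\<^sup>2 - a\<^sup>2)" "b \<le> 13 * r / 4"
  shows "Lq_norm (LM n) 2 (\<lambda>x. indicator (ball0 n a) x * U x) \<le> 400 * H * Lq_norm (LM n) 2 (\<lambda>x. indicator (shell n a b) x * U x)"
proof -
  interpret core n \<theta> r \<kappa> U V by (rule c)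
  obtain f D Hf where f: "\<And>k::nat. C2 n (f k) (D k) (Hf k)" "\<And>k. in_Lq (LM n) 2 (f k)"
    "(\<lambda>k. Lq_norm (LM n) 2 (\<lambda>x. f k x - U x)) \<longlonglongrightarrow> 0" "(\<lambda>k. residual_norm n (13 * r / 4) V (f k) (lapl n (Hf k))) \<longlonglongrightarrow> 0"
    using smooth_approximation[OF n r U V(1) G weak] by blast
  note t = Lq_norm_indicator_tendsto[OF f(2) U(1) f(3)]
  have \<theta>1: "\<theta> \<ge> 1" using C by (simp add: Carleman_constant_def)
  have V1: "Lq_norm (LM n) (real n / 2) V \<le> 1"
    using V(2,3) mult_right_mono[OF \<theta>1 Lq_norm_nonneg[of "LM n" "real n / 2" V]] by linarith
  let ?N = "\<lambda>A g. Lq_norm (LM n) 2 (\<lambda>x. indicator A x * g x)"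
  have "(\<lambda>k. 400 * H * ?N (shell n a b) (f k) + 55 * b * residual_norm n (13 * r / 4) V (f k) (lapl n (Hf k))) \<longlonglongrightarrow> 400 * H * ?N (shell n a b) U + 55 * b * 0"
    by (intro tendsto_add tendsto_mult tendsto_const t sets_shell f(4))
  then have rr: "(\<lambda>k. 400 * H * ?N (shell n a b) (f k) + 55 * b * residual_norm n (13 * r / 4) V (f k) (lapl n (Hf k))) \<longlonglongrightarrow> 400 * H * ?N (shell n a b) U" by simp
  show ?thesis
    by (rule LIMSEQ_le[OF t[OF sets_ball0] rr]) (use coercive_ball[OF n f(1) V(1) V1 ab] in auto)
qed

text \<open>800 \<open>C1\<close> H is what the absorption of \<theta>/(1 - \<kappa>) into
  (9/4)^\<mu> costs in \<open>core_doubling\<close>; it depends on the profile only.\<close>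

definition k0 :: real where "k0 = 800 * C1 * H + 2"

text \<open>
  Since \<open>Q\<close> is bounded below, \<open>\<theta> / (1 - \<kappa>)\<close> is at most a constant times \<open>(9/4) powr \<mu>\<close>. With the factor \<open>4 powr \<mu>\<close>
  that the weights at \<open>\<rho>/2\<close> and \<open>2\<rho>\<close> produce this is \<open>9 powr \<mu>\<close>, and \<open>\<rho> < 3/32 < 1/9\<close> turns it into \<open>\<rho> powr (- \<mu>)\<close>.
\<close>

theorem core_doubling:
  assumes c: "core n \<theta> r \<kappa> U V" and r34: "r < 3/4" and \<kappa>0: "\<kappa> \<ge> 0" and K: "K \<ge> 1"
  defines "Q \<equiv> Lq_norm (LM n) 2 (\<lambda>x. indicator (shell n r (13 * r / 4)) x * U x) / Lq_norm (LM n) 2 (\<lambda>x. indicator (shell n (r / 4) (r / 2)) x * U x)"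
  defines "lt \<equiv> 1 / ln (9 / 4) * ln (1 + 4 * inverse r * k0 * (\<theta> / (1 - \<kappa>)) * K * Q)"
  defines "lb \<equiv> 2 + max (lt + 1) (8 + 1 / 2 + (real n - 2) / 2)"
  assumes \<rho>: "0 < \<rho>" "\<rho> < r / 8"
  shows "Lq_norm (LM n) 2 (\<lambda>x. indicator (ball0 n (2 * \<rho>)) x * U x) \<le>
    \<rho> powr (- lb) * (k0 * K * lb\<^sup>2) * Lq_norm (LM n) 2 (\<lambda>x. indicator (ball0 n \<rho>) x * U x)"
proof -
  interpret core n \<theta> r \<kappa> U V by (rule c)
  let ?N = "\<lambda>A. Lq_norm (LM n) 2 (\<lambda>x. indicator A x * U x)"
  define A where "A = ?N (shell n (r / 4) (r / 2))"
  define B where "B = ?N (shell n r (13 * r / 4))"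
  define P where "P = ?N (ball0 n \<rho>)"
  have H1: "H \<ge> 1" by (rule H_ge_1)
  have C1: "C1 \<ge> 1" by (rule C1_ge)
  have CH: "1 * 1 \<le> C1 * H" using C1 H1 by (intro mult_mono) auto
  have k0: "k0 \<ge> 2" "k0 \<ge> C1" "k0 \<ge> 800 * C1 * H"
  proof -
    have "C1 * 1 \<le> C1 * H" using C1 H1 by (intro mult_left_mono) auto
    then show "k0 \<ge> 2" "k0 \<ge> C1" "k0 \<ge> 800 * C1 * H" using CH C1 unfolding k0_def mult.assoc by linarith+
  qed
  have nn: "A \<ge> 0" "B \<ge> 0" "P \<ge> 0" by (auto simp: A_def B_def P_def)
  have mono: "?N X \<le> ?N Y" if "X \<subseteq> Y" "X \<in> sets (LM n)" "Y \<in> sets (LM n)" for X Y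
    using that by (intro Lq_norm_indicator_mono U) auto
  have II1: "?N (ball0 n (r / 4)) \<le> 400 * H * A"
    unfolding A_def by (rule limit_coercive[OF c]) (use r in \<open>auto simp: power2_eq_square\<close>)
  \<comment> \<open>The shell r < |x| < 9r/8 is part of r < |x| < 13r/4, so the outer norm controls
    the ball of radius \<open>r\<close> and with it the inner annulus. This gives the lower bound
    for \<open>Q\<close>.\<close>
  have II2: "?N (ball0 n r) \<le> 400 * H * B"
  proof -
    have "?N (ball0 n r) \<le> 400 * H * ?N (shell n r (9 * r / 8))"
      by (rule limit_coercive[OF c]) (use r in \<open>auto simp: power2_eq_square\<close>)
    also have "\<dots> \<le> 400 * H * B" unfolding B_def
      using H1 r by (intro mult_left_mono mono sets_shell) (auto simp: shell_def)
    finally show ?thesis .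
  qed
  have "shell n (r / 4) (r / 2) \<subseteq> ball0 n r" using r by (auto simp: shell_def ball0_def)
  from order_trans[OF mono[OF this sets_shell sets_ball0] II2] have AB: "A \<le> 400 * H * B" unfolding A_def .
  have \<theta>1: "\<theta> \<ge> 1" using C by (simp add: Carleman_constant_def)
  define T where "T = \<theta> / (1 - \<kappa>)"
  have T1: "T \<ge> 1" unfolding T_def using \<theta>1 \<kappa>0 V(3) by (simp add: field_simps)
  have n2: "0 \<le> (real n - 2) / 2" using n by simp
  have "8 + 1 / 2 + (real n - 2) / 2 \<le> max (lt + 1) (8 + 1 / 2 + (real n - 2) / 2)" by (rule max.cobounded2)
  then have lb1: "lb \<ge> 1" unfolding lb_def using n2 by linarith
  show ?thesis
  proof (cases "A = 0")
    \<comment> \<open>If the denominator of \<open>Q\<close> vanishes, \<open>Q\<close> is 0 by the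
      convention for division and the exponents remain defined. Coercivity forces \<open>U\<close>
      to vanish almost everywhere on the ball of radius r/4, which contains the ball of radius
      2\<rho>.\<close>
    case True
    have "?N (ball0 n (2 * \<rho>)) \<le> ?N (ball0 n (r / 4))" using \<rho> by (intro mono sets_ball0) (auto simp: ball0_def)
    also have "\<dots> \<le> 0" using II1 True by simp
    also have "0 \<le> \<rho> powr (- lb) * (k0 * K * lb\<^sup>2) * P" using k0 K nn by simp
    finally show ?thesis by (simp add: P_def)
  next
    case False
    then have A: "A > 0" using nn by simp
    have Q: "Q = B / A" by (simp add: Q_def A_def B_def)
    have Qlow: "1 \<le> 400 * H * Q" using AB A by (simp add: Q field_simps)
    then have Q0: "Q > 0" using H1 by (smt (verit) mult_nonneg_nonpos)
    \<comment> \<open>\<open>lt\<close> is the logarithm of \<open>X\<close> to base 9/4. As 1/r and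
      \<open>K\<close> are at least 1, \<open>X\<close> dominates 4 \<open>k0\<close> T Q.\<close>
    define X where "X = 1 + 4 * inverse r * k0 * T * K * Q"
    have Xbig: "4 * k0 * (T * Q) \<le> X"
    proof -
      have "1 \<le> inverse r" using r r34 by (simp add: one_le_inverse_iff)
      then have "1 * 1 \<le> inverse r * K" using K r by (intro mult_mono) auto
      then have "(4 * k0 * (T * Q)) * 1 \<le> (4 * k0 * (T * Q)) * (inverse r * K)"
        using k0 T1 Q0 by (intro mult_left_mono) auto
      then show ?thesis by (simp add: X_def algebra_simps)
    qed
    have X1: "X \<ge> 1" using Xbig k0 T1 Q0 r K by (simp add: X_def)
    have lt: "lt = ln X / ln (9/4)" by (simp add: lt_def X_def T_def)
    have lt0: "lt \<ge> 0" using X1 by (simp add: lt)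
    have Xlt: "X = (9/4) powr lt" using X1 by (simp add: lt powr_def)
    obtain \<mu> where \<mu>: "\<mu> \<in> Carleman_exponents n" "lt \<le> \<mu>" "\<mu> \<le> max (lt + 1) (8 + 1/2 + (real n - 2) / 2)"
      using Carleman_exponent_between[OF n lt0] by blast
    define W where "W = (9/4 :: real) powr \<mu>"
    have XW: "X \<le> W" unfolding Xlt W_def using \<mu>(2) by (intro powr_mono) auto
    have W0: "W > 0" by (simp add: W_def)
    define I where "I = C1 * T * ((\<rho> / 2) powr (- \<mu> - 1) * P)"
    define O' where "O' = C1 * T * ((9 * r / 8) powr (- \<mu> - 1) * B)"
    have F: "?N (shell n (\<rho> / 4) \<rho>) \<le> P" unfolding P_def by (intro mono sets_shell sets_ball0) (auto simp: shell_def ball0_def)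
    have basic: "d powr (- \<mu> - 1) * ?N Y \<le> I + O'"
      if "Y \<in> sets (LM n)" "Y \<subseteq> ball0 n d" "0 < d" "\<And>x. x \<in> Y \<Longrightarrow> 3 * \<rho> / 4 \<le> pnorm n x \<and> pnorm n x \<le> 9 * r / 8" for Y d
    proof -
      have "d powr (- \<mu> - 1) * ?N Y \<le> C1 * T * ((\<rho> / 2) powr (- \<mu> - 1) * ?N (shell n (\<rho> / 4) \<rho>) + (9 * r / 8) powr (- \<mu> - 1) * B)"
        unfolding T_def B_def by (rule limit_annulus[OF c \<mu>(1) _ _ that]) (use \<rho> r in auto)
      also have "\<dots> \<le> C1 * T * ((\<rho> / 2) powr (- \<mu> - 1) * P + (9 * r / 8) powr (- \<mu> - 1) * B)"
        using F C1 T1 by (intro mult_left_mono add_right_mono) auto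
      finally show ?thesis by (simp add: I_def O'_def algebra_simps)
    qed
    define L where "L = (r / 2) powr (- \<mu> - 1) * A"
    have LI: "L \<le> I + O'" unfolding L_def A_def
      by (rule basic[OF sets_shell]) (use \<rho> r in \<open>auto simp: shell_def ball0_def\<close>)
    have OL: "O' \<le> L / 2"
    proof -
      \<comment> \<open>The outer weight is (9/4)^(-\<mu> - 1) times the inner one. Since \<mu> is
        at least \<open>lt\<close>, this factor is below 1/X and beats the ratio \<open>Q\<close> of
        the norms.\<close>
      have "(9 * r / 8) powr (- \<mu> - 1) = ((r / 2) * (9/4)) powr (- \<mu> - 1)" by (simp add: mult.commute)
      also have "\<dots> = (r / 2) powr (- \<mu> - 1) * (9/4) powr (- \<mu> - 1)" using r by (subst powr_mult) auto
      also have "(9/4 :: real) powr (- \<mu> - 1) = 4/9 * inverse W" by (simp add: W_def powr_diff powr_minus)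
      finally have e: "(9 * r / 8) powr (- \<mu> - 1) = (r / 2) powr (- \<mu> - 1) * (4/9 * inverse W)" .
      have B: "B = Q * A" using A by (simp add: Q)
      have "O' = (r / 2) powr (- \<mu> - 1) * A * (4/9 * C1 * (T * Q) / W)" unfolding O'_def e B using W0 by (simp add: field_simps)
      also have "\<dots> \<le> (r / 2) powr (- \<mu> - 1) * A * (1/2)"
      proof (rule mult_left_mono)
        have "4 * C1 * (T * Q) \<le> 4 * k0 * (T * Q)" using k0(2) T1 Q0 by (intro mult_right_mono) auto
        then have "4 * C1 * (T * Q) \<le> W" using Xbig XW by linarith
        then show "4/9 * C1 * (T * Q) / W \<le> 1/2" using W0 by (simp add: field_simps)
      qed (use A in auto)
      finally show ?thesis by (simp add: L_def)
    qed
    then have OI: "O' \<le> I" using LI by simp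
    \<comment> \<open>A second application with the same exponent, now on \<rho> \<le> |x| <
      2\<rho>. As \<open>O'\<close> is at most \<open>I\<close>, the right side is bounded by twice
      the inner commutator.\<close>
    define Y where "Y = ball0 n (2 * \<rho>) - ball0 n \<rho>"
    have Ys: "Y \<in> sets (LM n)" unfolding Y_def by (intro sets.Diff sets_ball0)
    have "(2 * \<rho>) powr (- \<mu> - 1) * ?N Y \<le> I + O'"
      by (rule basic[OF Ys]) (use \<rho> r in \<open>auto simp: Y_def ball0_def\<close>)
    also have "\<dots> \<le> 2 * I" using OI by simp
    finally have NY0: "(2 * \<rho>) powr (- \<mu> - 1) * ?N Y \<le> 2 * I" .
    have \<mu>0: "\<mu> \<ge> 0" using lt0 \<mu>(2) by simp
    have NY: "?N Y \<le> 8 * C1 * T * 4 powr \<mu> * P"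
    proof -
      have "?N Y = (2 * \<rho>) powr (\<mu> + 1) * ((2 * \<rho>) powr (- \<mu> - 1) * ?N Y)"
        using \<rho> by (simp add: powr_add[symmetric] mult.assoc[symmetric])
      also have "\<dots> \<le> (2 * \<rho>) powr (\<mu> + 1) * (2 * I)" using NY0 by (intro mult_left_mono) auto
      also have "\<dots> = 2 * C1 * T * ((2 * \<rho>) powr (\<mu> + 1) * (\<rho> / 2) powr (- \<mu> - 1)) * P" by (simp add: I_def)
      also have "(2 * \<rho>) powr (\<mu> + 1) * (\<rho> / 2) powr (- \<mu> - 1) = 4 * 4 powr \<mu>"
      proof -
        have "(2 * \<rho>) powr (\<mu> + 1) = (4 * (\<rho> / 2)) powr (\<mu> + 1)" by simp
        also have "\<dots> = 4 powr (\<mu> + 1) * (\<rho> / 2) powr (\<mu> + 1)" using \<rho> by (subst powr_mult) auto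
        finally have "(2 * \<rho>) powr (\<mu> + 1) * (\<rho> / 2) powr (- \<mu> - 1) = 4 powr (\<mu> + 1) * ((\<rho> / 2) powr (\<mu> + 1) * (\<rho> / 2) powr (- \<mu> - 1))"
          by simp
        also have "(\<rho> / 2) powr (\<mu> + 1) * (\<rho> / 2) powr (- \<mu> - 1) = 1" using \<rho> by (simp add: powr_add[symmetric])
        finally show ?thesis by (simp add: powr_add)
      qed
      finally show ?thesis by (simp add: algebra_simps)
    qed
    \<comment> \<open>Multiplication by 400 H Q \<ge> 1 replaces \<open>T\<close> by
      \<open>T * Q\<close>, which \<open>X\<close> controls. Thus \<theta>/(1 - \<kappa>) is
      absorbed by (9/4)^\<mu> and stays out of the doubling constant.\<close>
    have Tb: "k0 * T \<le> 100 * H * W"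
    proof -
      have "k0 * T * 1 \<le> k0 * T * (400 * H * Q)" using Qlow k0 T1 by (intro mult_left_mono) auto
      also have "\<dots> = 100 * H * (4 * k0 * (T * Q))" by simp
      also have "\<dots> \<le> 100 * H * W" using Xbig XW H1 by (intro mult_left_mono) auto
      finally show ?thesis by simp
    qed
    \<comment> \<open>The size of \<open>k0\<close> enters here: 800 \<open>C1\<close> H cancels on
      both sides and leaves 8 \<open>C1\<close> T \<le> (9/4)^\<mu> without a further
      constant.\<close>
    have "800 * C1 * H * (8 * C1 * T) \<le> k0 * (8 * C1 * T)" using k0(3) C1 T1 by (intro mult_right_mono) auto
    also have "\<dots> = 8 * C1 * (k0 * T)" by simp
    also have "\<dots> \<le> 8 * C1 * (100 * H * W)" using Tb C1 by (intro mult_left_mono) auto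
    also have "\<dots> = 800 * C1 * H * W" by simp
    finally have "(800 * C1 * H) * (8 * C1 * T) \<le> (800 * C1 * H) * W" .
    moreover have "800 * C1 * H > 0" using C1 H1 by simp
    ultimately have "8 * C1 * T \<le> W" by (rule mult_left_le_imp_le)
    then have "8 * C1 * T * 4 powr \<mu> * P \<le> W * 4 powr \<mu> * P" using nn by (intro mult_right_mono) auto
    also have "W * 4 powr \<mu> = 9 powr \<mu>" unfolding W_def by (subst powr_mult[symmetric]) auto
    finally have NY9: "?N Y \<le> 9 powr \<mu> * P" using NY by linarith
    have "?N (ball0 n (2 * \<rho>)) = Lq_norm (LM n) 2 (\<lambda>x. indicator (ball0 n \<rho>) x * U x + indicator Y x * U x)"
      using \<rho> by (intro Lq_norm_cong) (auto simp: Y_def ball0_def indicator_def)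
    also have "\<dots> \<le> P + ?N Y" unfolding P_def
      by (intro Minkowski in_Lq_indicator U Ys sets_ball0) auto
    also have "\<dots> \<le> 1 * P + 9 powr \<mu> * P" using NY9 by simp
    also have "\<dots> \<le> 9 powr \<mu> * P + 9 powr \<mu> * P" using nn \<mu>0 by (intro add_right_mono mult_right_mono) (auto intro: ge_one_powr_ge_zero)
    also have "\<dots> = 9 powr \<mu> * 2 * P" by simp
    also have "\<dots> \<le> \<rho> powr (- lb) * (k0 * K * lb\<^sup>2) * P"
    proof (intro mult_right_mono mult_mono)
      have "\<rho> < 1/9" using \<rho> r34 by simp
      then have "9 \<le> 1 / \<rho>" using \<rho> by (simp add: field_simps)
      then have "9 powr \<mu> \<le> (1 / \<rho>) powr \<mu>" using \<mu>0 by (intro powr_mono2) auto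
      also have "\<dots> \<le> (1 / \<rho>) powr lb" using \<mu>(3) \<open>9 \<le> 1 / \<rho>\<close> by (intro powr_mono) (auto simp: lb_def)
      also have "\<dots> = \<rho> powr (- lb)" using \<rho> by (simp add: powr_divide powr_minus_divide)
      finally show "9 powr \<mu> \<le> \<rho> powr (- lb)" .
      have "1 \<le> lb\<^sup>2" using lb1 by simp
      then have "1 * 1 \<le> K * lb\<^sup>2" using K by (intro mult_mono) auto
      then have "2 * 1 \<le> k0 * (K * lb\<^sup>2)" using k0(1) by (intro mult_mono) auto
      then show "2 \<le> k0 * K * lb\<^sup>2" by (simp add: mult.assoc)
    qed (use nn in auto)
    finally show ?thesis by (simp add: P_def)
  qed
qed

end

section \<open>Translation and Borel representatives\<close>

lemma padd_Rn: "padd n a x \<in> Rn n"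
  by (simp add: padd_def Rn_def)

lemma padd_nth: "i < n \<Longrightarrow> padd n a x i = a i + x i"
  by (simp add: padd_def)

lemma measurable_padd: "padd n a \<in> LM n \<rightarrow>\<^sub>M LM n"
  unfolding padd_def[abs_def]
proof (rule measurable_restrict)
  fix i assume "i \<in> {..<n}"
  then show "(\<lambda>x. a i + x i) \<in> LM n \<rightarrow>\<^sub>M lborel" using measurable_comp_LM[of i n] by simp
qed

lemma distr_padd: "distr (LM n) (LM n) (padd n a) = LM n"
proof (rule lb.PiM_eqI)
  show "finite {..<n}" by simp
  show "sets (distr (LM n) (LM n) (padd n a)) = sets (LM n)" by simp
  fix A :: "nat \<Rightarrow> real set" assume A: "\<And>i. i \<in> {..<n} \<Longrightarrow> A i \<in> sets lborel"
  have "emeasure (distr (LM n) (LM n) (padd n a)) (Pi\<^sub>E {..<n} A) = emeasure (LM n) (padd n a -` (Pi\<^sub>E {..<n} A) \<inter> space (LM n))"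
    using A by (intro emeasure_distr measurable_padd sets_PiM_I_finite) auto
  also have "padd n a -` (Pi\<^sub>E {..<n} A) \<inter> space (LM n) = (\<Pi>\<^sub>E i\<in>{..<n}. (\<lambda>t. a i + t) -` A i)"
    by (auto simp: padd_def Rn_def PiE_def Pi_def)
  also have "emeasure (LM n) \<dots> = (\<Prod>i<n. emeasure lborel ((\<lambda>t. a i + t) -` A i))"
  proof (rule lb.emeasure_PiM)
    fix i assume i: "i \<in> {..<n}"
    have "(\<lambda>t. a i + t) \<in> borel_measurable borel" by measurable
    from measurable_sets[OF this, of "A i"] show "(\<lambda>t. a i + t) -` A i \<in> sets lborel" using A[OF i] by simp
  qed simp
  also have "\<dots> = (\<Prod>i<n. emeasure lborel (A i))"
  proof (rule prod.cong[OF refl])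
    fix i assume "i \<in> {..<n}"
    then have "emeasure lborel (A i) = emeasure (distr lborel borel ((+) (a i))) (A i)" by (simp add: lborel_distr_plus)
    also have "\<dots> = emeasure lborel ((\<lambda>t. a i + t) -` A i)" using A \<open>i \<in> {..<n}\<close> by (subst emeasure_distr) auto
    finally show "emeasure lborel ((\<lambda>t. a i + t) -` A i) = emeasure lborel (A i)" by simp
  qed
  finally show "emeasure (distr (LM n) (LM n) (padd n a)) (Pi\<^sub>E {..<n} A) = (\<Prod>i<n. emeasure lborel (A i))" .
qed

lemma integral_padd:
  assumes "(f :: point \<Rightarrow> real) \<in> borel_measurable (LM n)"
  shows "(\<integral>x. f (padd n a x) \<partial>LM n) = (\<integral>x. f x \<partial>LM n)"
  using integral_distr[OF measurable_padd assms, of a] by (simp add: distr_padd)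

lemma integrable_padd:
  assumes "(f :: point \<Rightarrow> real) \<in> borel_measurable (LM n)"
  shows "integrable (LM n) (\<lambda>x. f (padd n a x)) \<longleftrightarrow> integrable (LM n) f"
  using integrable_distr_eq[OF measurable_padd assms, of a] by (simp add: distr_padd)

lemma Lq_norm_padd:
  assumes "f \<in> borel_measurable (LM n)"
  shows "Lq_norm (LM n) q (\<lambda>x. f (padd n a x)) = Lq_norm (LM n) q f"
  unfolding Lq_norm_def using integral_padd[OF measurable_abs_powr[OF assms]] by simp

lemma in_Lq_padd:
  assumes "in_Lq (LM n) q f" shows "in_Lq (LM n) q (\<lambda>x. f (padd n a x))"
proof -
  have f: "f \<in> borel_measurable (LM n)" using assms by (simp add: in_Lq_def)
  have "(\<lambda>x. f (padd n a x)) \<in> borel_measurable (LM n)" by (rule measurable_compose[OF measurable_padd f])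
  then show ?thesis using integrable_padd[OF measurable_abs_powr[OF f, of q], of a] assms by (simp add: in_Lq_def)
qed

lemma AE_padd:
  assumes "AE x in LM n. P x" shows "AE x in LM n. P (padd n a x)"
proof -
  obtain N where N: "{x \<in> space (LM n). \<not> P x} \<subseteq> N" "emeasure (LM n) N = 0" "N \<in> sets (LM n)"
    using assms by (rule AE_E)
  have "emeasure (LM n) (padd n a -` N \<inter> space (LM n)) = emeasure (distr (LM n) (LM n) (padd n a)) N"
    by (rule emeasure_distr[OF measurable_padd N(3), symmetric])
  then have "padd n a -` N \<inter> space (LM n) \<in> null_sets (LM n)"
    using N measurable_sets[OF measurable_padd N(3), of a] by (auto simp: distr_padd)
  then show ?thesis by (rule AE_I') (use N(1) padd_Rn in \<open>auto simp: subset_iff\<close>)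
qed

lemma pdist_padd: "y \<in> Rn n \<Longrightarrow> pdist n x0 (padd n x0 y) = pnorm n y"
  unfolding pdist_def pnorm_def L2_set_def by (simp add: padd_nth)

lemma padd_in_pball: "y \<in> Rn n \<Longrightarrow> padd n x0 y \<in> pball n x0 R \<longleftrightarrow> y \<in> ball0 n R"
  by (simp add: pball_def ball0_def pdist_padd padd_Rn)

lemma sets_pball [measurable]: "pball n x0 R \<in> sets (LM n)"
proof -
  have "(\<lambda>y. pdist n x0 y) \<in> borel_measurable (LM n)"
    unfolding pdist_def[abs_def] L2_set_def using measurable_comp_LM[of _ n]
    by (intro measurable_compose[OF _ borel_measurable_sqrt] borel_measurable_sum borel_measurable_power borel_measurable_diff) auto
  then have "{y \<in> space (LM n). pdist n x0 y < R} \<in> sets (LM n)" by measurable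
  then show ?thesis by (simp add: pball_def)
qed

section \<open>Borel versions of Lebesgue measurable functions\<close>

lemma measurable_completion_AE_eq:
  fixes f g :: "'a \<Rightarrow> real"
  assumes "g \<in> borel_measurable (completion M)" "AE x in M. f x = g x"
  shows "f \<in> borel_measurable (completion M)"
proof (rule measurableI)
  fix A :: "real set" assume A: "A \<in> sets borel"
  show "f -` A \<inter> space (completion M) \<in> sets (completion M)"
  proof (rule completion.in_sets_AE)
    show "g -` A \<inter> space (completion M) \<in> sets (completion M)" by (rule measurable_sets[OF assms(1) A])
    show "AE x in completion M. (x \<in> g -` A \<inter> space (completion M)) = (x \<in> f -` A \<inter> space (completion M))"
      using AE_completion[OF assms(2)] by (auto elim!: eventually_mono)
  qed auto
qed simp

text \<open>Because \<open>leb\<close> is complete, agreement almost everywhere with a Borel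
  function makes measurability of \<open>f\<close> on \<open>A\<close> a conclusion, and integrals
  over \<open>A\<close> are those of the Borel function.\<close>

lemma leb_on_version:
  fixes f g :: "point \<Rightarrow> real"
  assumes A: "A \<in> sets (LM n)" and g: "g \<in> borel_measurable (LM n)" and eq: "AE x in LM n. x \<in> A \<longrightarrow> f x = g x"
  shows "(LINT x|leb_on n A. f x) = (LINT x|LM n. indicator A x * g x)"
    "integrable (leb_on n A) f \<longleftrightarrow> integrable (LM n) (\<lambda>x. indicator A x * g x)"
    "f \<in> borel_measurable (leb_on n A)"
proof -
  have *: "A \<inter> space (leb n) \<in> sets (leb n)" using A sets_LM_leb by (metis sets.Int_space_eq2)
  have m: "(\<lambda>x. indicator A x * g x) \<in> borel_measurable (LM n)"
    by (intro borel_measurable_times borel_measurable_indicator A g)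
  have ae: "AE x in LM n. indicator A x * f x = indicator A x * g x"
    using eq by (auto elim!: eventually_mono simp: indicator_def)
  have mg: "(\<lambda>x. indicator A x * g x) \<in> borel_measurable (leb n)" by (rule LM_leb_measurable[OF m])
  have mf: "(\<lambda>x. indicator A x * f x) \<in> borel_measurable (leb n)"
    unfolding leb_def by (rule measurable_completion_AE_eq[OF measurable_completion[OF m] ae])
  have ae': "AE x in leb n. indicator A x * f x = indicator A x * g x"
    unfolding leb_def by (rule AE_completion[OF ae])
  have "(LINT x|leb_on n A. f x) = (LINT x|leb n. indicator A x * f x)"
    using integral_restrict_space[OF *, of f] by simp
  also have "\<dots> = (LINT x|leb n. indicator A x * g x)" by (rule integral_cong_AE[OF mf mg ae'])
  also have "\<dots> = (LINT x|LM n. indicator A x * g x)" unfolding leb_def by (rule integral_completion[OF m])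
  finally show "(LINT x|leb_on n A. f x) = (LINT x|LM n. indicator A x * g x)" .
  have "integrable (leb_on n A) f \<longleftrightarrow> integrable (leb n) (\<lambda>x. indicator A x * f x)"
    using integrable_restrict_space[OF *, of f] by simp
  also have "\<dots> \<longleftrightarrow> integrable (leb n) (\<lambda>x. indicator A x * g x)" by (rule integrable_cong_AE[OF mf mg ae'])
  also have "\<dots> \<longleftrightarrow> integrable (LM n) (\<lambda>x. indicator A x * g x)" unfolding leb_def by (rule integrable_completion[OF m])
  finally show "integrable (leb_on n A) f \<longleftrightarrow> integrable (LM n) (\<lambda>x. indicator A x * g x)" .
  show "f \<in> borel_measurable (leb_on n A)"
    unfolding borel_measurable_restrict_space_iff[OF *] using mf by simp
qed

lemma leb_on_version_Lq_norm:
  assumes A: "A \<in> sets (LM n)" and g: "g \<in> borel_measurable (LM n)" and eq: "AE x in LM n. x \<in> A \<longrightarrow> f x = g x" and q: "q > 0"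
  shows "Lq_norm (leb_on n A) q f = Lq_norm (LM n) q (\<lambda>x. indicator A x * g x)"
    "in_Lq (leb_on n A) q f \<longleftrightarrow> in_Lq (LM n) q (\<lambda>x. indicator A x * g x)"
proof -
  have mq: "(\<lambda>x. \<bar>g x\<bar> powr q) \<in> borel_measurable (LM n)" by (rule measurable_abs_powr[OF g])
  have eqq: "AE x in LM n. x \<in> A \<longrightarrow> \<bar>f x\<bar> powr q = \<bar>g x\<bar> powr q" using eq by (auto elim!: eventually_mono)
  have i: "(\<lambda>x. indicator A x * \<bar>g x\<bar> powr q) = (\<lambda>x. \<bar>indicator A x * g x\<bar> powr q)"
    using q by (auto simp: indicator_def)
  note v = leb_on_version[OF A mq eqq]
  show "Lq_norm (leb_on n A) q f = Lq_norm (LM n) q (\<lambda>x. indicator A x * g x)"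
    unfolding Lq_norm_def v(1) i ..
  have m: "(\<lambda>x. indicator A x * g x) \<in> borel_measurable (LM n)"
    by (intro borel_measurable_times borel_measurable_indicator A g)
  show "in_Lq (leb_on n A) q f \<longleftrightarrow> in_Lq (LM n) q (\<lambda>x. indicator A x * g x)"
    unfolding in_Lq_def v(2) i using m leb_on_version(3)[OF A g eq] by simp
qed

lemma leb_on_borel_version:
  assumes A: "A \<in> sets (LM n)" and f: "(f :: point \<Rightarrow> real) \<in> borel_measurable (leb_on n A)"
  obtains g where "g \<in> borel_measurable (LM n)" "AE x in LM n. x \<in> A \<longrightarrow> f x = g x"
proof -
  have *: "A \<inter> space (leb n) \<in> sets (leb n)" using A sets_LM_leb by (metis sets.Int_space_eq2)
  have "(\<lambda>x. indicator A x * f x) \<in> borel_measurable (leb n)"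
    using f unfolding borel_measurable_restrict_space_iff[OF *] by simp
  then obtain g where g: "g \<in> borel_measurable (LM n)" "AE x in LM n. indicator A x * f x = g x"
    unfolding leb_def using completion_ex_borel_measurable_real by blast
  have "AE x in LM n. x \<in> A \<longrightarrow> f x = g x" using g(2) by (auto elim!: eventually_mono simp: indicator_def)
  with g(1) show thesis by (rule that)
qed

lemma AE_leb_on: "A \<in> sets (LM n) \<Longrightarrow> (AE x in leb_on n A. P x) \<longleftrightarrow> (AE x in LM n. x \<in> A \<longrightarrow> P x)"
proof -
  assume A: "A \<in> sets (LM n)"
  have *: "A \<inter> space (leb n) \<in> sets (leb n)" using A sets_LM_leb by (metis sets.Int_space_eq2)
  show ?thesis unfolding AE_restrict_space_iff[OF *] unfolding leb_def by (rule AE_completion_iff)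
qed

section \<open>The weak equation tested with kernels\<close>

lemma test_function_partial_deriv:
  assumes "\<phi> \<in> test_functions n \<Omega>" "i < n" shows "partial_deriv i \<phi> \<in> test_functions n \<Omega>"
proof -
  obtain K where K: "compactin (Rn_top n) K" "K \<subseteq> \<Omega>" "\<forall>x\<in>Rn n - K. \<phi> x = 0" and Ck: "\<And>k. Ck n k \<phi>"
    using assms unfolding test_functions_def by blast
  \<comment> \<open>Viewing \<phi> as a test function for its own compact set \<open>K\<close> shows
    that the derivative vanishes off \<open>K\<close>, not merely off \<Omega>.\<close>
  have "\<phi> \<in> test_functions n K" unfolding test_functions_def using K Ck by blast
  from test_function_facts(5)[OF this _ assms(2)] have "\<forall>x\<in>Rn n - K. partial_deriv i \<phi> x = 0" by blast
  moreover have "Ck n k (partial_deriv i \<phi>)" for k using Ck[of "Suc k"] assms(2) by simp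
  ultimately show ?thesis unfolding test_functions_def using K by blast
qed

text \<open>Local integrability refers to compact subsets of \<Omega>. The test function vanishes
  off such a set and is bounded on it.\<close>

lemma locally_integrable_mult_test:
  assumes f: "locally_integrable n \<Omega> f" and \<phi>: "\<phi> \<in> test_functions n \<Omega>" and \<Omega>: "\<Omega> \<in> sets (LM n)"
  shows "integrable (leb_on n \<Omega>) (\<lambda>x. f x * \<phi> x)"
proof -
  obtain K where K: "compactin (Rn_top n) K" "K \<subseteq> \<Omega>" "\<And>x. x \<in> Rn n - K \<Longrightarrow> \<phi> x = 0"
    using \<phi> unfolding test_functions_def by blast
  have Ks: "K \<in> sets (LM n)" by (rule compactin_Rn_sets[OF K(1)])
  have Kl: "K \<inter> space (leb n) \<in> sets (leb n)" "\<Omega> \<inter> space (leb n) \<in> sets (leb n)"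
    using Ks \<Omega> sets_LM_leb by (metis sets.Int_space_eq2)+
  have iK: "integrable (leb n) (\<lambda>x. indicator K x * f x)"
    using f K integrable_restrict_space[OF Kl(1), of f] by (auto simp: locally_integrable_def)
  have b: "bdd_supp n \<phi>" by (rule test_function_facts(1)[OF \<phi>])
  obtain B where B: "B > 0" "\<And>x. x \<in> Rn n \<Longrightarrow> \<bar>\<phi> x\<bar> \<le> B" using bndE[OF bdd_supp_bdd_meas[OF b]] by metis
  have "integrable (leb n) (\<lambda>x. (indicator K x * f x) * \<phi> x)"
  proof (rule Bochner_Integration.integrable_bound[of _ "\<lambda>x. B * (indicator K x * f x)"])
    show "integrable (leb n) (\<lambda>x. B * (indicator K x * f x))" using iK by simp
    show "(\<lambda>x. indicator K x * f x * \<phi> x) \<in> borel_measurable (leb n)"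
      by (rule borel_measurable_times[OF borel_measurable_integrable[OF iK] LM_leb_measurable[OF bdd_supp_measurable[OF b]]])
    show "AE x in leb n. norm (indicator K x * f x * \<phi> x) \<le> norm (B * (indicator K x * f x))"
    proof (rule AE_I2)
      fix x assume "x \<in> space (leb n)"
      then have "\<bar>indicator K x * f x\<bar> * \<bar>\<phi> x\<bar> \<le> \<bar>indicator K x * f x\<bar> * B" using B(2) by (intro mult_left_mono) auto
      then show "norm (indicator K x * f x * \<phi> x) \<le> norm (B * (indicator K x * f x))"
        using B(1) by (simp add: abs_mult mult_ac)
    qed
  qed
  then have "integrable (leb n) (\<lambda>x. indicator \<Omega> x * (f x * \<phi> x))"
    by (rule Bochner_Integration.integrable_cong[OF refl, THEN iffD1, rotated])
       (use K(2,3) in \<open>auto simp: indicator_def\<close>)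
  then show ?thesis using integrable_restrict_space[OF Kl(2), of "\<lambda>x. f x * \<phi> x"] by simp
qed

text \<open>The weak derivative relation is used twice, with a partial derivative of \<phi> as test
  function and with \<phi> itself, so the two signs cancel.\<close>

lemma weak_laplacian_eq:
  assumes wl: "weak_laplacian n \<Omega> u w" and \<phi>: "\<phi> \<in> test_functions n \<Omega>" and \<Omega>: "\<Omega> \<in> sets (LM n)"
    and w: "w \<in> borel_measurable (leb_on n \<Omega>)"
  shows "(LINT x|leb_on n \<Omega>. u x * (\<Sum>i<n. partial_deriv i (partial_deriv i \<phi>) x)) = (LINT x|leb_on n \<Omega>. w x * \<phi> x)"
proof -
  obtain D H where D: "\<And>i. i < n \<Longrightarrow> weak_pderiv n \<Omega> i u (D i)" "\<And>i. i < n \<Longrightarrow> weak_pderiv n \<Omega> i (D i) (H i)"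
    and ae: "AE x in leb_on n \<Omega>. w x = (\<Sum>i<n. H i x)" using wl unfolding weak_laplacian_def by blast
  have iu: "integrable (leb_on n \<Omega>) (\<lambda>x. u x * partial_deriv i (partial_deriv i \<phi>) x)" if i: "i < n" for i
    by (rule locally_integrable_mult_test[OF _ test_function_partial_deriv[OF test_function_partial_deriv[OF \<phi> i] i] \<Omega>])
       (use D(1)[OF i] in \<open>simp add: weak_pderiv_def\<close>)
  have iH: "integrable (leb_on n \<Omega>) (\<lambda>x. H i x * \<phi> x)" if i: "i < n" for i
    by (rule locally_integrable_mult_test[OF _ \<phi> \<Omega>]) (use D(2)[OF i] in \<open>simp add: weak_pderiv_def\<close>)
  have each: "(LINT x|leb_on n \<Omega>. u x * partial_deriv i (partial_deriv i \<phi>) x) = (LINT x|leb_on n \<Omega>. H i x * \<phi> x)" if i: "i < n" for i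
    using D[OF i] test_function_partial_deriv[OF \<phi> i] \<phi> unfolding weak_pderiv_def by simp
  have "(LINT x|leb_on n \<Omega>. u x * (\<Sum>i<n. partial_deriv i (partial_deriv i \<phi>) x)) =
    (\<Sum>i<n. LINT x|leb_on n \<Omega>. u x * partial_deriv i (partial_deriv i \<phi>) x)"
    unfolding sum_distrib_left by (rule Bochner_Integration.integral_sum) (use iu in auto)
  also have "\<dots> = (\<Sum>i<n. LINT x|leb_on n \<Omega>. H i x * \<phi> x)" using each by simp
  also have "\<dots> = (LINT x|leb_on n \<Omega>. (\<Sum>i<n. H i x * \<phi> x))"
    by (rule Bochner_Integration.integral_sum[symmetric]) (use iH in auto)
  also have "\<dots> = (LINT x|leb_on n \<Omega>. w x * \<phi> x)"
  proof (rule integral_cong_AE)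
    show "(\<lambda>x. \<Sum>i<n. H i x * \<phi> x) \<in> borel_measurable (leb_on n \<Omega>)" using iH by (intro borel_measurable_sum) auto
    show "(\<lambda>x. w x * \<phi> x) \<in> borel_measurable (leb_on n \<Omega>)"
      using w measurable_restrict_space1[OF LM_leb_measurable[OF bdd_supp_measurable[OF test_function_facts(1)[OF \<phi>]]]]
      by (intro borel_measurable_times)
    show "AE x in leb_on n \<Omega>. (\<Sum>i<n. H i x * \<phi> x) = w x * \<phi> x"
      using ae by (auto elim!: eventually_mono simp: sum_distrib_right)
  qed
  finally show ?thesis .
qed

text \<open>\<open>deriv_zero_outside\<close> asks for vanishing where |t| \<ge> R and concludes
  where |t| > R; the intermediate radius \<open>m\<close> makes room for two applications.\<close>

lemma moll_kernel_dd_zero: "\<bar>t\<bar> > 1 / real (Suc k) \<Longrightarrow> deriv (deriv (moll_kernel k)) t = 0"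
proof -
  assume t: "\<bar>t\<bar> > 1 / real (Suc k)"
  define m where "m = (\<bar>t\<bar> + 1 / real (Suc k)) / 2"
  have m: "1 / real (Suc k) < m" "m < \<bar>t\<bar>" using t by (auto simp: m_def)
  have d: "deriv (moll_kernel k) s = 0" if "\<bar>s\<bar> \<ge> m" for s
    by (rule deriv_zero_outside[OF smooth_moll_kernel, of "1 / real (Suc k)"]) (use moll_kernel_zero that m in auto)
  show ?thesis by (rule deriv_zero_outside[OF smooth_deriv[OF smooth_moll_kernel] d m(2)])
qed

lemma kernel_eq_of_weak:
  assumes wl: "weak_laplacian n \<Omega> u w" and \<Omega>: "\<Omega> \<in> sets (LM n)" and sub: "pball n x0 R \<subseteq> \<Omega>"
    and u': "u' \<in> borel_measurable (LM n)" "AE x in LM n. x \<in> \<Omega> \<longrightarrow> u x = u' x"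
    and w': "w' \<in> borel_measurable (LM n)" "AE x in LM n. x \<in> \<Omega> \<longrightarrow> w x = w' x"
  shows "kernel_eq n (ball0 n R) (\<lambda>x. indicator (ball0 n R) x * u' (padd n x0 x)) (\<lambda>x. indicator (ball0 n R) x * w' (padd n x0 x))"
  unfolding kernel_eq_def
proof (intro allI ballI impI)
  fix k x assume x: "x \<in> Rn n" and cub: "\<forall>y\<in>Rn n. (\<forall>j<n. \<bar>x j - y j\<bar> \<le> 1 / real (Suc k)) \<longrightarrow> y \<in> ball0 n R"
  let ?z = "padd n x0 x"
  let ?\<phi> = "prod_kernel n (moll_kernels k) ?z"
  let ?dd = "\<lambda>i. (moll_kernels k)(i := deriv (deriv (moll_kernel k)))"
  have subz: "y \<in> pball n x0 R" if y: "y \<in> Rn n" "\<And>j. j < n \<Longrightarrow> \<bar>?z j - y j\<bar> \<le> 1 / real (Suc k)" for y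
  proof -
    let ?y = "padd n (\<lambda>j. - x0 j) y"
    have e: "padd n x0 ?y = y" using y(1) by (auto simp: padd_def fun_eq_iff Rn_def PiE_def extensional_def)
    have "\<bar>x j - ?y j\<bar> \<le> 1 / real (Suc k)" if "j < n" for j using y(2)[OF that] that by (simp add: padd_nth algebra_simps)
    then have "?y \<in> ball0 n R" using cub padd_Rn[of n "\<lambda>j. - x0 j" y] by blast
    then show ?thesis using padd_in_pball[of ?y n x0 R] padd_Rn[of n "\<lambda>j. - x0 j" y] by (simp add: e)
  qed
  have \<phi>: "?\<phi> \<in> test_functions n \<Omega>"
    by (rule kernel_test_function(1)[OF padd_Rn]) (use subz sub in blast)
  have dd: "partial_deriv i (partial_deriv i ?\<phi>) y = prod_kernel n (?dd i) ?z y" if "i < n" for i y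
    by (rule kernel_test_function(2)[OF padd_Rn subz that])
  have gdd: "compact_smooth (?dd i j)" for i j using compact_smooth_moll_kernel compact_smooth_deriv by auto
  have mdd: "(\<lambda>y. prod_kernel n (?dd i) v y) \<in> borel_measurable (LM n)" if "v \<in> Rn n" for i v by (rule prod_kernel_measurable[OF gdd that])
  have mk: "(\<lambda>y. prod_kernel n (moll_kernels k) v y) \<in> borel_measurable (LM n)" if "v \<in> Rn n" for v by (rule prod_kernel_measurable[OF compact_smooth_moll_kernel that])
  have mS: "(\<lambda>y. \<Sum>i<n. prod_kernel n (?dd i) v y) \<in> borel_measurable (LM n)" if "v \<in> Rn n" for v
    by (intro borel_measurable_sum mdd that)
  have kz: "prod_kernel n (moll_kernels k) v y = 0" "prod_kernel n (?dd i) v y = 0" if ex: "\<exists>j<n. \<bar>v j - y j\<bar> > 1 / real (Suc k)" for v y i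
  proof -
    obtain j where j: "j < n" "\<bar>v j - y j\<bar> > 1 / real (Suc k)" using ex by blast
    show "prod_kernel n (moll_kernels k) v y = 0" unfolding prod_kernel_def using j by (intro prod_zero) (auto intro!: bexI[of _ j] moll_kernel_zero)
    show "prod_kernel n (?dd i) v y = 0" unfolding prod_kernel_def using j by (intro prod_zero) (auto intro!: bexI[of _ j] moll_kernel_zero moll_kernel_dd_zero)
  qed
  have out: "\<exists>j<n. \<bar>?z j - y j\<bar> > 1 / real (Suc k)" if "y \<in> Rn n" "y \<notin> \<Omega>" for y
    using subz[OF that(1)] sub that(2) by (meson not_le subsetD)
  have tr: "prod_kernel n ph ?z (padd n x0 y) = prod_kernel n ph x y" for ph y
    unfolding prod_kernel_def by (intro prod.cong) (auto simp: padd_nth)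
  have w\<Omega>: "w \<in> borel_measurable (leb_on n \<Omega>)" by (rule leb_on_version(3)[OF \<Omega> w'])
  have "(LINT y|leb_on n \<Omega>. u y * (\<Sum>i<n. partial_deriv i (partial_deriv i ?\<phi>) y)) = (LINT y|leb_on n \<Omega>. w y * ?\<phi> y)"
    by (rule weak_laplacian_eq[OF wl \<phi> \<Omega> w\<Omega>])
  then have weq: "(LINT y|leb_on n \<Omega>. u y * (\<Sum>i<n. prod_kernel n (?dd i) ?z y)) = (LINT y|leb_on n \<Omega>. w y * ?\<phi> y)"
    by (simp add: dd)
  have "(LINT y|leb_on n \<Omega>. u y * (\<Sum>i<n. prod_kernel n (?dd i) ?z y)) = (LINT y|LM n. indicator \<Omega> y * (u' y * (\<Sum>i<n. prod_kernel n (?dd i) ?z y)))"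
    using u' by (intro leb_on_version(1)[OF \<Omega>] borel_measurable_times mS padd_Rn) (auto elim!: eventually_mono)
  also have "\<dots> = (LINT y|LM n. u' y * (\<Sum>i<n. prod_kernel n (?dd i) ?z y))"
    using kz(2)[OF out] by (intro Bochner_Integration.integral_cong) (auto simp: indicator_def)
  also have "\<dots> = (LINT y|LM n. u' (padd n x0 y) * (\<Sum>i<n. prod_kernel n (?dd i) ?z (padd n x0 y)))"
    by (rule integral_padd[symmetric]) (intro borel_measurable_times u' mS padd_Rn)
  also have "\<dots> = (LINT y|LM n. (indicator (ball0 n R) y * u' (padd n x0 y)) * (\<Sum>i<n. prod_kernel n (?dd i) x y))"
  proof (intro Bochner_Integration.integral_cong refl)
    fix y assume "y \<in> space (LM n)"
    then have y: "y \<in> Rn n" by simp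
    show "u' (padd n x0 y) * (\<Sum>i<n. prod_kernel n (?dd i) ?z (padd n x0 y)) = (indicator (ball0 n R) y * u' (padd n x0 y)) * (\<Sum>i<n. prod_kernel n (?dd i) x y)"
    proof (cases "y \<in> ball0 n R")
      case False
      then have "\<exists>j<n. \<bar>x j - y j\<bar> > 1 / real (Suc k)" using cub y by (meson not_le)
      then show ?thesis using kz(2)[of x y] by (simp add: tr)
    qed (simp add: tr)
  qed
  finally have L: "(LINT y|leb_on n \<Omega>. u y * (\<Sum>i<n. prod_kernel n (?dd i) ?z y)) =
    (LINT y|LM n. (indicator (ball0 n R) y * u' (padd n x0 y)) * (\<Sum>i<n. prod_kernel n (?dd i) x y))" .
  have "(LINT y|leb_on n \<Omega>. w y * ?\<phi> y) = (LINT y|LM n. indicator \<Omega> y * (w' y * ?\<phi> y))"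
    using w' by (intro leb_on_version(1)[OF \<Omega>] borel_measurable_times mk padd_Rn) (auto elim!: eventually_mono)
  also have "\<dots> = (LINT y|LM n. w' y * ?\<phi> y)"
    using kz(1)[OF out] by (intro Bochner_Integration.integral_cong) (auto simp: indicator_def)
  also have "\<dots> = (LINT y|LM n. w' (padd n x0 y) * ?\<phi> (padd n x0 y))"
    by (rule integral_padd[symmetric]) (intro borel_measurable_times w' mk padd_Rn)
  also have "\<dots> = (LINT y|LM n. (indicator (ball0 n R) y * w' (padd n x0 y)) * prod_kernel n (moll_kernels k) x y)"
  proof (intro Bochner_Integration.integral_cong refl)
    fix y assume "y \<in> space (LM n)"
    then have y: "y \<in> Rn n" by simp
    show "w' (padd n x0 y) * ?\<phi> (padd n x0 y) = (indicator (ball0 n R) y * w' (padd n x0 y)) * prod_kernel n (moll_kernels k) x y"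
    proof (cases "y \<in> ball0 n R")
      case False
      then have "\<exists>j<n. \<bar>x j - y j\<bar> > 1 / real (Suc k)" using cub y by (meson not_le)
      then show ?thesis using kz(1)[of x y] by (simp add: tr)
    qed (simp add: tr)
  qed
  finally show "(LINT y|LM n. (indicator (ball0 n R) y * u' (padd n x0 y)) * (\<Sum>i<n. prod_kernel n (?dd i) x y)) =
    (LINT y|LM n. (indicator (ball0 n R) y * w' (padd n x0 y)) * prod_kernel n (moll_kernels k) x y)" using weq L by simp
qed

text \<open>The fundamental lemma of the calculus of variations, with the kernels as test functions.\<close>

lemma kernel_eq_unique:
  assumes 1: "kernel_eq n (ball0 n R) U G" and 2: "kernel_eq n (ball0 n R) U G'"
    and i: "\<And>\<rho>. \<rho> < R \<Longrightarrow> integrable (LM n) (\<lambda>x. indicator (ball0 n \<rho>) x * G x)"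
      "\<And>\<rho>. \<rho> < R \<Longrightarrow> integrable (LM n) (\<lambda>x. indicator (ball0 n \<rho>) x * G' x)"
    and n: "n \<ge> 1" and R: "R > 0"
  shows "AE x in LM n. x \<in> ball0 n R \<longrightarrow> G x = G' x"
proof -
  have inner: "AE x in LM n. x \<in> ball0 n \<rho> \<longrightarrow> G x = G' x" if \<rho>: "0 < \<rho>" "\<rho> < R" for \<rho>
  proof -
    \<comment> \<open>Room for the kernels: at points of the smaller ball the mollification of
      \<open>Z\<close> involves only values inside the larger one, where both right sides are
      integrable.\<close>
    define \<rho>' where "\<rho>' = (\<rho> + R) / 2"
    have \<rho>': "\<rho> < \<rho>'" "\<rho>' < R" using \<rho> by (auto simp: \<rho>'_def)
    define Z where "Z = (\<lambda>x. indicator (ball0 n \<rho>') x * G x - indicator (ball0 n \<rho>') x * G' x)"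
    have iZ: "integrable (LM n) Z" unfolding Z_def using i \<rho>' by auto
    have ZL: "in_Lq (LM n) 1 Z" using iZ by (simp add: in_Lq_def)
    have bZ: "box_supp n Z" unfolding box_supp_def
    proof (intro exI[of _ \<rho>'] ballI impI allI)
      fix x j assume "Z x \<noteq> 0" "j < n"
      then have "x \<in> ball0 n \<rho>'" by (auto simp: Z_def indicator_def split: if_splits)
      then show "\<bar>x j\<bar> \<le> \<rho>'" using abs_comp_le_pnorm[OF \<open>j < n\<close>, of x] by (simp add: ball0_def)
    qed
    have "(\<rho>' - \<rho>) / real n > 0" using \<rho>' n by simp
    then obtain k0 where k0: "1 / real (Suc k0) < (\<rho>' - \<rho>) / real n" using nat_approx_posE by metis
    have z: "kernel_conv n (moll_kernels k) Z x = 0" if k: "k \<ge> k0" and x: "x \<in> ball0 n \<rho>" for k x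
    proof -
      have xR: "x \<in> Rn n" using x by (simp add: ball0_def)
      have "1 / real (Suc k) \<le> 1 / real (Suc k0)" using k by (intro divide_left_mono) auto
      then have "1 / real (Suc k) \<le> (\<rho>' - \<rho>) / real n" using k0 by linarith
      then have nk: "real n * (1 / real (Suc k)) \<le> \<rho>' - \<rho>" using n by (simp add: field_simps)
      have cub: "y \<in> ball0 n \<rho>'" if "y \<in> Rn n" "\<And>j. j < n \<Longrightarrow> \<bar>x j - y j\<bar> \<le> 1 / real (Suc k)" for y
      proof -
        have "pnorm n y \<le> pnorm n x + real n * (1 / real (Suc k))" by (rule pnorm_diff_le[OF that(2)]) simp_all
        then show ?thesis using nk x that(1) by (simp add: ball0_def)
      qed
      then have cubR: "\<forall>y\<in>Rn n. (\<forall>j<n. \<bar>x j - y j\<bar> \<le> 1 / real (Suc k)) \<longrightarrow> y \<in> ball0 n R"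
        using \<rho>'(2) by (force simp: ball0_def)
      have e1: "(\<integral>y. U y * (\<Sum>i<n. prod_kernel n ((moll_kernels k)(i := deriv (deriv (moll_kernel k)))) x y) \<partial>LM n) = (\<integral>y. G y * prod_kernel n (moll_kernels k) x y \<partial>LM n)"
        using 1 xR cubR unfolding kernel_eq_def by blast
      have e2: "(\<integral>y. U y * (\<Sum>i<n. prod_kernel n ((moll_kernels k)(i := deriv (deriv (moll_kernel k)))) x y) \<partial>LM n) = (\<integral>y. G' y * prod_kernel n (moll_kernels k) x y \<partial>LM n)"
        using 2 xR cubR unfolding kernel_eq_def by blast
      have "(\<integral>y. G y * prod_kernel n (moll_kernels k) x y \<partial>LM n) = (\<integral>y. G' y * prod_kernel n (moll_kernels k) x y \<partial>LM n)"
        by (rule trans[OF sym[OF e1] e2])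
      moreover have loc: "(\<integral>y. F y * prod_kernel n (moll_kernels k) x y \<partial>LM n) = (\<integral>y. (indicator (ball0 n \<rho>') y * F y) * prod_kernel n (moll_kernels k) x y \<partial>LM n)" for F
      proof (intro Bochner_Integration.integral_cong refl)
        fix y assume "y \<in> space (LM n)"
        then have y: "y \<in> Rn n" by simp
        show "F y * prod_kernel n (moll_kernels k) x y = (indicator (ball0 n \<rho>') y * F y) * prod_kernel n (moll_kernels k) x y"
        proof (cases "y \<in> ball0 n \<rho>'")
          case False
          then obtain j where "j < n" "\<bar>x j - y j\<bar> > 1 / real (Suc k)" using cub[OF y] by (meson not_le)
          then have "prod_kernel n (moll_kernels k) x y = 0" unfolding prod_kernel_def by (intro prod_zero) (auto intro!: bexI[of _ j] moll_kernel_zero)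
          then show ?thesis by simp
        qed simp
      qed
      ultimately have e: "(\<integral>y. (indicator (ball0 n \<rho>') y * G y) * prod_kernel n (moll_kernels k) x y \<partial>LM n) = (\<integral>y. (indicator (ball0 n \<rho>') y * G' y) * prod_kernel n (moll_kernels k) x y \<partial>LM n)" by simp
      have "kernel_conv n (moll_kernels k) Z x = kernel_conv n (moll_kernels k) (\<lambda>x. indicator (ball0 n \<rho>') x * G x) x - kernel_conv n (moll_kernels k) (\<lambda>x. indicator (ball0 n \<rho>') x * G' x) x"
        unfolding Z_def by (rule kernel_conv_diff[OF i(1)[OF \<rho>'(2)] i(2)[OF \<rho>'(2)] xR])
      then show ?thesis using e by (simp add: kernel_conv_def)
    qed
    have lim: "(\<lambda>k. Lq_norm (LM n) 1 (\<lambda>x. kernel_conv n (moll_kernels k) Z x - Z x)) \<longlonglongrightarrow> 0" by (rule mollification_converges[OF _ ZL bZ]) simp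
    have le: "Lq_norm (LM n) 1 (\<lambda>x. indicator (ball0 n \<rho>) x * Z x) \<le> Lq_norm (LM n) 1 (\<lambda>x. kernel_conv n (moll_kernels k) Z x - Z x)" if "k \<ge> k0" for k
    proof (rule Lq_norm_mono)
      show "(\<lambda>x. indicator (ball0 n \<rho>) x * Z x) \<in> borel_measurable (LM n)" using in_Lq_indicator[OF ZL sets_ball0] by (simp add: in_Lq_def)
      show "in_Lq (LM n) 1 (\<lambda>x. kernel_conv n (moll_kernels k) Z x - Z x)" by (intro in_Lq_diff kernel_conv_in_Lq ZL bZ) auto
      fix x show "\<bar>indicator (ball0 n \<rho>) x * Z x\<bar> \<le> \<bar>kernel_conv n (moll_kernels k) Z x - Z x\<bar>" using z[OF that] by (cases "x \<in> ball0 n \<rho>") auto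
    qed simp
    have "Lq_norm (LM n) 1 (\<lambda>x. indicator (ball0 n \<rho>) x * Z x) \<le> 0"
      by (rule LIMSEQ_le_const[OF lim]) (use le in blast)
    then have "Lq_norm (LM n) 1 (\<lambda>x. indicator (ball0 n \<rho>) x * Z x) = 0" using Lq_norm_nonneg by (metis antisym)
    then have "AE x in LM n. indicator (ball0 n \<rho>) x * Z x = 0"
      by (intro Lq_norm_eq_0_AE[OF in_Lq_indicator[OF ZL sets_ball0]]) auto
    then show ?thesis
    proof (rule eventually_mono, intro impI)
      fix x assume a: "indicator (ball0 n \<rho>) x * Z x = 0" "x \<in> ball0 n \<rho>"
      then have "x \<in> ball0 n \<rho>'" using \<rho>' by (simp add: ball0_def)
      then show "G x = G' x" using a by (simp add: Z_def)
    qed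
  qed
  \<comment> \<open>Countably many radii exhaust the open ball, so the exceptional sets unite to a
    null set; \<open>m + 2\<close> keeps the first radius positive.\<close>
  have "AE x in LM n. \<forall>m::nat. x \<in> ball0 n (R * (1 - 1 / real (m + 2))) \<longrightarrow> G x = G' x"
    unfolding AE_all_countable
  proof (intro allI inner)
    fix m :: nat
    have "1 / real (m + 2) < 1" "1 / real (m + 2) > 0" by auto
    then show "0 < R * (1 - 1 / real (m + 2))" using R by (intro mult_pos_pos) auto
    have "R * (1 - 1 / real (m + 2)) < R * 1" using R \<open>1 / real (m + 2) > 0\<close> by (intro mult_strict_left_mono) auto
    then show "R * (1 - 1 / real (m + 2)) < R" by simp
  qed
  then show ?thesis
  proof (rule eventually_mono, intro impI)
    fix x assume a: "\<forall>m::nat. x \<in> ball0 n (R * (1 - 1 / real (m + 2))) \<longrightarrow> G x = G' x" and x: "x \<in> ball0 n R"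
    have "(R - pnorm n x) / R > 0" using x R by (simp add: ball0_def)
    then obtain m where m: "1 / real (Suc m) < (R - pnorm n x) / R" using nat_approx_posE by metis
    have "1 / real (m + 2) \<le> 1 / real (Suc m)" by (intro divide_left_mono) auto
    then have "1 / real (m + 2) < (R - pnorm n x) / R" using m by linarith
    then have "R * (1 / real (m + 2)) < R * ((R - pnorm n x) / R)" by (rule mult_strict_left_mono[OF _ R])
    also have "\<dots> = R - pnorm n x" using R by simp
    finally have "R * (1 / real (m + 2)) < R - pnorm n x" .
    then have "pnorm n x < R * (1 - 1 / real (m + 2))" by (simp add: algebra_simps)
    then show "G x = G' x" using a x by (auto simp: ball0_def)
  qed
qed

lemma compactin_closed_pball: "compactin (Rn_top n) {x \<in> Rn n. pdist n x0 x \<le> \<rho>}"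
proof (rule closed_compactin)
  show "compactin (Rn_top n) (\<Pi>\<^sub>E i\<in>{..<n}. {x0 i - \<rho>..x0 i + \<rho>})"
    unfolding Rn_top_def by (subst compactin_PiE) auto
  show "{x \<in> Rn n. pdist n x0 x \<le> \<rho>} \<subseteq> (\<Pi>\<^sub>E i\<in>{..<n}. {x0 i - \<rho>..x0 i + \<rho>})"
  proof
    fix x assume x: "x \<in> {x \<in> Rn n. pdist n x0 x \<le> \<rho>}"
    have "\<bar>x0 i - x i\<bar> \<le> \<rho>" if "i < n" for i
      using abs_comp_le_pnorm[OF that, of "\<lambda>i. x0 i - x i"] x by (simp add: pdist_def pnorm_def)
    then have "x i \<in> {x0 i - \<rho>..x0 i + \<rho>}" if "i < n" for i using that by (fastforce simp: abs_le_iff)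
    then show "x \<in> (\<Pi>\<^sub>E i\<in>{..<n}. {x0 i - \<rho>..x0 i + \<rho>})" using x by (simp add: Rn_def PiE_iff)
  qed
  have c: "continuous_map (Rn_top n) euclideanreal (\<lambda>x. \<Sum>i<n. (x0 i - x i) ^ 2)"
    unfolding Rn_top_def
    by (intro continuous_map_sum continuous_map_real_pow continuous_map_diff continuous_map_product_projection) auto
  have "continuous_map (Rn_top n) euclideanreal (sqrt \<circ> (\<lambda>x. \<Sum>i<n. (x0 i - x i) ^ 2))"
    by (rule continuous_map_compose[OF c]) (simp add: continuous_on_real_sqrt)
  then have "continuous_map (Rn_top n) euclideanreal (pdist n x0)"
    by (simp add: o_def pdist_def[abs_def] L2_set_def)
  from closedin_continuous_map_preimage[OF this, of "{..\<rho>}"]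
  show "closedin (Rn_top n) {x \<in> Rn n. pdist n x0 x \<le> \<rho>}" by simp
qed

section \<open>Reduction of the hypotheses of the theorem to \<open>core\<close>\<close>

lemma pball_subset_if_inner:
  assumes "x0 \<in> inner_set n \<Omega> R" shows "pball n x0 R \<subseteq> \<Omega>"
proof
  fix y assume y: "y \<in> pball n x0 R"
  show "y \<in> \<Omega>"
  proof (rule ccontr)
    assume "y \<notin> \<Omega>"
    then have "(INF y\<in>Rn n - \<Omega>. pdist n x0 y) \<le> pdist n x0 y"
      using y by (intro cINF_lower bdd_belowI[of _ 0]) (auto simp: pball_def pdist_def)
    then show False using assms y by (simp add: inner_set_def pball_def)
  qed
qed

lemma bounded_domain_measure:
  assumes "bounded_lipschitz_domain n \<Omega>" "n \<ge> 1"
  shows "\<Omega> \<in> sets (LM n)" "emeasure (LM n) \<Omega> < \<infinity>"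
proof -
  show "\<Omega> \<in> sets (LM n)" using assms by (auto simp: bounded_lipschitz_domain_def intro: openin_Rn_sets)
  obtain R where "\<Omega> \<subseteq> ball0 n R" using assms by (auto simp: bounded_lipschitz_domain_def pball_origin)
  then have "\<Omega> \<subseteq> ball0 n (max R 1)" by (auto simp: ball0_def)
  then have "emeasure (LM n) \<Omega> \<le> emeasure (LM n) (ball0 n (max R 1))" by (intro emeasure_mono sets_ball0)
  also have "\<dots> < \<infinity>" by (rule measure_ball0_root(1)[OF assms(2)]) simp
  finally show "emeasure (LM n) \<Omega> < \<infinity>" .
qed

lemma in_Lq_lower_exponent:
  assumes f: "in_Lq M a f" and c: "0 < c" "c \<le> a" and A: "A \<in> sets M" "emeasure M A < \<infinity>"
    and z: "\<And>x. x \<in> space M \<Longrightarrow> x \<notin> A \<Longrightarrow> f x = 0"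
  shows "in_Lq M c f"
  unfolding in_Lq_def
proof
  show [measurable]: "f \<in> borel_measurable M" using f by (simp add: in_Lq_def)
  show "integrable M (\<lambda>x. \<bar>f x\<bar> powr c)"
  proof (rule Bochner_Integration.integrable_bound)
    show "integrable M (\<lambda>x. indicator A x + \<bar>f x\<bar> powr a)"
      using A in_Lq_integrable[OF f] by (intro Bochner_Integration.integrable_add) auto
    show "AE x in M. norm (\<bar>f x\<bar> powr c) \<le> norm (indicator A x + \<bar>f x\<bar> powr a)"
    proof (rule AE_I2)
      fix x assume x: "x \<in> space M"
      show "norm (\<bar>f x\<bar> powr c) \<le> norm (indicator A x + \<bar>f x\<bar> powr a)"
      proof (cases "x \<in> A")
        case True
        have "\<bar>f x\<bar> powr c \<le> 1 + \<bar>f x\<bar> powr a"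
        proof (cases "\<bar>f x\<bar> \<le> 1")
          case True
          then have "\<bar>f x\<bar> powr c \<le> 1" using powr_mono2[of c "\<bar>f x\<bar>" 1] c by simp
          then show ?thesis using powr_ge_zero[of "\<bar>f x\<bar>" a] by linarith
        next
          case False
          then have "\<bar>f x\<bar> powr c \<le> \<bar>f x\<bar> powr a" using c by (intro powr_mono) auto
          then show ?thesis by linarith
        qed
        then show ?thesis using True by simp
      qed (use z[OF x] in simp)
    qed
  qed measurable
qed

lemma Lp_space_version_in_Lq:
  assumes f: "f \<in> Lp_space (leb_on n \<Omega>) q" and \<Omega>: "\<Omega> \<in> sets (LM n)" "emeasure (LM n) \<Omega> < \<infinity>"
    and c: "0 < c" "ereal c \<le> q" and g: "g \<in> borel_measurable (LM n)" "AE x in LM n. x \<in> \<Omega> \<longrightarrow> f x = g x"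
  shows "in_Lq (LM n) c (\<lambda>x. indicator \<Omega> x * g x)"
proof -
  have m: "(\<lambda>x. indicator \<Omega> x * g x) \<in> borel_measurable (LM n)"
    by (intro borel_measurable_times borel_measurable_indicator \<Omega> g)
  show ?thesis
  proof (cases q)
    case (real a)
    then have "in_Lq (leb_on n \<Omega>) a f" using f by (simp add: Lp_space_def in_Lq_def)
    then have "in_Lq (LM n) a (\<lambda>x. indicator \<Omega> x * g x)"
      using leb_on_version_Lq_norm(2)[OF \<Omega>(1) g, of a] c real by simp
    then show ?thesis by (rule in_Lq_lower_exponent[OF _ c(1) _ \<Omega>]) (use c real in auto)
  next
    case PInf
    then obtain C where "AE x in leb_on n \<Omega>. \<bar>f x\<bar> \<le> C" using f by (auto simp: Lp_space_def)
    then have "AE x in LM n. x \<in> \<Omega> \<longrightarrow> \<bar>f x\<bar> \<le> C" by (simp add: AE_leb_on[OF \<Omega>(1)])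
    then have ae: "AE x in LM n. \<bar>indicator \<Omega> x * g x\<bar> \<le> \<bar>C * indicator \<Omega> x\<bar>"
      using g(2) by eventually_elim (auto simp: indicator_def)
    show ?thesis by (rule in_Lq_bounded[OF m in_Lq_cmult[OF in_Lq_indicator_set(1)[OF \<Omega>]] ae]) (use c in simp)
  next
    case MInf
    then show ?thesis using c by simp
  qed
qed

text \<open>The closed ball is a compact subset of \<Omega>, and the second weak derivatives behind
  \<open>w\<close> are locally integrable by definition. This is the integrability that
  \<open>kernel_eq_unique\<close> asks for.\<close>

lemma weak_laplacian_integrable_on_ball:
  assumes wl: "weak_laplacian n \<Omega> u w" and \<Omega>: "\<Omega> \<in> sets (LM n)" and sub: "pball n x0 R \<subseteq> \<Omega>" and \<rho>: "\<rho> < R"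
    and w': "w' \<in> borel_measurable (LM n)" "AE x in LM n. x \<in> \<Omega> \<longrightarrow> w x = w' x"
  shows "integrable (LM n) (\<lambda>x. indicator (ball0 n \<rho>) x * (indicator (ball0 n R) x * w' (padd n x0 x)))"
proof -
  let ?K = "{x \<in> Rn n. pdist n x0 x \<le> \<rho>}"
  have K: "compactin (Rn_top n) ?K" by (rule compactin_closed_pball)
  have Ks: "?K \<in> sets (LM n)" by (rule compactin_Rn_sets[OF K])
  have K\<Omega>: "?K \<subseteq> \<Omega>" using sub \<rho> by (auto simp: pball_def)
  obtain D H where H: "\<And>i. i < n \<Longrightarrow> weak_pderiv n \<Omega> i (D i) (H i)" "AE x in leb_on n \<Omega>. w x = (\<Sum>i<n. H i x)"
    using wl unfolding weak_laplacian_def by blast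
  have "integrable (leb_on n ?K) (H i)" if "i < n" for i
    using H(1)[OF that] K K\<Omega> unfolding weak_pderiv_def locally_integrable_def by blast
  then have i: "integrable (leb_on n ?K) (\<lambda>x. \<Sum>i<n. H i x)" by (intro Bochner_Integration.integrable_sum) auto
  have "AE x in LM n. x \<in> \<Omega> \<longrightarrow> w x = (\<Sum>i<n. H i x)" using H(2) by (simp add: AE_leb_on[OF \<Omega>])
  then have "AE x in LM n. x \<in> ?K \<longrightarrow> (\<Sum>i<n. H i x) = w' x" using w'(2) by eventually_elim (use K\<Omega> in auto)
  from leb_on_version(2)[OF Ks w'(1) this] i have iK: "integrable (LM n) (\<lambda>x. indicator ?K x * w' x)" by simp
  have m: "(\<lambda>x. indicator ?K x * w' x) \<in> borel_measurable (LM n)"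
    by (rule borel_measurable_integrable[OF iK])
  have "integrable (LM n) (\<lambda>x. indicator ?K (padd n x0 x) * w' (padd n x0 x))"
    using integrable_padd[OF m, of x0] iK by simp
  from integrable_mult_indicator[OF sets_ball0 this, of \<rho>]
  show ?thesis
    by (rule Bochner_Integration.integrable_cong[OF refl, THEN iffD1, rotated])
       (use \<rho> in \<open>auto simp: indicator_def ball0_def pdist_padd padd_Rn\<close>)
qed

text \<open>Membership in the Sobolev space yields a weak Laplacian built from functions in L^q. It
  is not yet the \<open>w\<close> of \<open>schrodinger_solution\<close>; the two are compared by
  testing with kernels.\<close>

lemma sobolev_2_laplacian:
  assumes u: "u \<in> sobolev n \<Omega> 2 q"
  obtains H where "\<And>i. i < n \<Longrightarrow> H i \<in> Lp_space (leb_on n \<Omega>) q" "weak_laplacian n \<Omega> u (\<lambda>x. \<Sum>i<n. H i x)"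
proof -
  have "\<forall>i<n. \<exists>g. g \<in> sobolev n \<Omega> (Suc 0) q \<and> weak_pderiv n \<Omega> i u g"
    using u by (auto simp: numeral_2_eq_2 simp del: sobolev.simps(1))
  then obtain D where D: "\<And>i. i < n \<Longrightarrow> D i \<in> sobolev n \<Omega> (Suc 0) q" "\<And>i. i < n \<Longrightarrow> weak_pderiv n \<Omega> i u (D i)"
    by metis
  have "\<forall>i<n. \<exists>g. g \<in> Lp_space (leb_on n \<Omega>) q \<and> weak_pderiv n \<Omega> i (D i) g" using D(1) by auto
  then obtain H where H: "\<And>i. i < n \<Longrightarrow> H i \<in> Lp_space (leb_on n \<Omega>) q" "\<And>i. i < n \<Longrightarrow> weak_pderiv n \<Omega> i (D i) (H i)"
    by metis
  have "weak_laplacian n \<Omega> u (\<lambda>x. \<Sum>i<n. H i x)"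
    unfolding weak_laplacian_def using D(2) H(2) by (intro exI[of _ D] exI[of _ H]) auto
  with H(1) show thesis by (rule that)
qed

text \<open>The clause of \<open>core\<close> with content is that V U lies in L^p. It is read off
  from two weak Laplacians of \<open>u\<close>: the one in the equation equals V u, the one from the
  Sobolev space lies in L^p, and \<open>kernel_eq_unique\<close> shows that they agree on the
  ball.\<close>

lemma core_of_solution:
  assumes n: "n \<ge> 3" and dom: "bounded_lipschitz_domain n \<Omega>" and C: "Carleman_constant n \<theta>" and s: "ereal (real n / 2) < s"
    and r: "0 < r" and sub: "pball n x0 (4 * r) \<subseteq> \<Omega>" and V: "V \<in> potentials n \<theta> \<Omega> s" and u: "u \<in> X_space n \<Omega> s"
    and sol: "schrodinger_solution n \<Omega> V u" and u1: "Lp_norm (leb_on n \<Omega>) 2 u \<noteq> 0"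
  obtains u' V' where "u' \<in> borel_measurable (LM n)" "AE x in LM n. x \<in> \<Omega> \<longrightarrow> u x = u' x"
    "core n \<theta> r (\<theta> * kappa_tilde n \<Omega> V) (\<lambda>x. indicator (ball0 n (4 * r)) x * u' (padd n x0 x)) V'"
proof -
  let ?B = "ball0 n (4 * r)"
  have n1: "n \<ge> 1" using n by simp
  note \<Omega> = bounded_domain_measure[OF dom n1]
  note ex = exponents[OF n]
  have p0: "exponent_p n > 0" using ex(1) by simp
  have n2: "real n / 2 > 0" using n by simp
  \<comment> \<open>For s = \<infinity> the exponent is 2, otherwise p. As \<Omega> has finite
    measure and p \<le> 2, the second derivatives are in L^p in both cases.\<close>
  obtain q where q: "u \<in> sobolev n \<Omega> 2 q" "ereal (exponent_p n) \<le> q"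
  proof (cases "s = \<infinity>")
    case True
    have "exponent_p n \<le> 2" by (simp add: exponent_p_def field_simps)
    then have "ereal (exponent_p n) \<le> ereal 2" by (simp only: ereal_less_eq(3))
    then show thesis using that[of 2] True u by (simp add: X_space_def)
  next
    case False
    then show thesis using that[of "ereal (exponent_p n)"] u by (simp add: X_space_def)
  qed
  have "u \<in> Lp_space (leb_on n \<Omega>) q" using q(1) by (auto simp: numeral_2_eq_2)
  then have um: "u \<in> borel_measurable (leb_on n \<Omega>)" by (simp add: Lp_space_def)
  obtain u' where u': "u' \<in> borel_measurable (LM n)" "AE x in LM n. x \<in> \<Omega> \<longrightarrow> u x = u' x"
    by (rule leb_on_borel_version[OF \<Omega>(1) um])
  \<comment> \<open>The integral of a function that is not integrable is 0 by convention, so a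
    nonzero norm implies that |u|^2 is integrable.\<close>
  have "(LINT x|leb_on n \<Omega>. \<bar>u x\<bar> powr 2) \<noteq> 0" using u1 unfolding Lp_norm_2_eq_Lq_norm Lq_norm_def powr_eq_0_iff .
  then have "integrable (leb_on n \<Omega>) (\<lambda>x. \<bar>u x\<bar> powr 2)" using not_integrable_integral_eq by blast
  then have "in_Lq (leb_on n \<Omega>) 2 u" using um by (simp add: in_Lq_def)
  then have uL: "in_Lq (LM n) 2 (\<lambda>x. indicator \<Omega> x * u' x)" using leb_on_version_Lq_norm(2)[OF \<Omega>(1) u', of 2] by simp
  have VL: "V \<in> Lp_space (leb_on n \<Omega>) s" and Vk: "\<theta> * kappa_tilde n \<Omega> V < 1" using V by (auto simp: potentials_def)
  have Vm: "V \<in> borel_measurable (leb_on n \<Omega>)" using VL by (simp add: Lp_space_def)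
  obtain V' where V': "V' \<in> borel_measurable (LM n)" "AE x in LM n. x \<in> \<Omega> \<longrightarrow> V x = V' x"
    by (rule leb_on_borel_version[OF \<Omega>(1) Vm])
  have VL': "in_Lq (LM n) (real n / 2) (\<lambda>x. indicator \<Omega> x * V' x)"
    by (rule Lp_space_version_in_Lq[OF VL \<Omega> n2 less_imp_le[OF s] V'])
  have Vn: "kappa_tilde n \<Omega> V = Lq_norm (LM n) (real n / 2) (\<lambda>x. indicator \<Omega> x * V' x)"
    unfolding kappa_tilde_def Lp_norm_eq_Lq_norm by (rule leb_on_version_Lq_norm(1)[OF \<Omega>(1) V' n2])
  \<comment> \<open>Translated points of the ball lie in \<Omega>, so the indicator of \<Omega> can
    be inserted and the bounds over \<Omega> apply.\<close>
  have cut: "indicator ?B x * f (padd n x0 x) = indicator ?B x * (indicator \<Omega> (padd n x0 x) * f (padd n x0 x))"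
    if "x \<in> Rn n" for f :: "point \<Rightarrow> real" and x
    using padd_in_pball[OF that, of x0 "4 * r"] sub by (auto simp: indicator_def)
  have cutL: "in_Lq (LM n) c (\<lambda>x. indicator ?B x * f (padd n x0 x))" "Lq_norm (LM n) c (\<lambda>x. indicator ?B x * f (padd n x0 x)) \<le> Lq_norm (LM n) c (\<lambda>x. indicator \<Omega> x * f x)"
    if f: "in_Lq (LM n) c (\<lambda>x. indicator \<Omega> x * f x)" and c: "c > 0" for c f
  proof -
    note t = in_Lq_padd[OF f, of x0]
    have e: "in_Lq (LM n) c (\<lambda>x. indicator ?B x * f (padd n x0 x)) \<longleftrightarrow>
        in_Lq (LM n) c (\<lambda>x. indicator ?B x * (indicator \<Omega> (padd n x0 x) * f (padd n x0 x)))"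
      by (rule in_Lq_cong) (simp add: cut)
    show 1: "in_Lq (LM n) c (\<lambda>x. indicator ?B x * f (padd n x0 x))"
      unfolding e by (rule in_Lq_indicator[OF t sets_ball0]) (use c in simp)
    have "Lq_norm (LM n) c (\<lambda>x. indicator ?B x * f (padd n x0 x)) \<le> Lq_norm (LM n) c (\<lambda>x. indicator \<Omega> (padd n x0 x) * f (padd n x0 x))"
    proof (rule Lq_norm_mono[OF in_Lq_measurable[OF 1] t _ c])
      fix x assume "x \<in> space (LM n)"
      then have "x \<in> Rn n" by simp
      from cut[OF this, of f]
      show "\<bar>indicator ?B x * f (padd n x0 x)\<bar> \<le> \<bar>indicator \<Omega> (padd n x0 x) * f (padd n x0 x)\<bar>"
        by (cases "x \<in> ?B") auto
    qed
    also have "\<dots> = Lq_norm (LM n) c (\<lambda>x. indicator \<Omega> x * f x)" by (rule Lq_norm_padd[OF in_Lq_measurable[OF f]])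
    finally show "Lq_norm (LM n) c (\<lambda>x. indicator ?B x * f (padd n x0 x)) \<le> Lq_norm (LM n) c (\<lambda>x. indicator \<Omega> x * f x)" .
  qed
  obtain w where w: "weak_laplacian n \<Omega> u w" "AE x in leb_on n \<Omega>. - w x + V x * u x = 0"
    using sol unfolding schrodinger_solution_def by blast
  have "AE x in LM n. x \<in> \<Omega> \<longrightarrow> - w x + V x * u x = 0" using w(2) by (simp add: AE_leb_on[OF \<Omega>(1)])
  then have w': "AE x in LM n. x \<in> \<Omega> \<longrightarrow> w x = V' x * u' x" using u'(2) V'(2) by eventually_elim auto
  have mw: "(\<lambda>x. V' x * u' x) \<in> borel_measurable (LM n)" by (intro borel_measurable_times u' V')
  obtain H where H: "\<And>i. i < n \<Longrightarrow> H i \<in> Lp_space (leb_on n \<Omega>) q" and Hw: "weak_laplacian n \<Omega> u (\<lambda>x. \<Sum>i<n. H i x)"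
    by (rule sobolev_2_laplacian[OF q(1)]) blast
  have "\<forall>i\<in>{..<n}. \<exists>g. g \<in> borel_measurable (LM n) \<and> (AE x in LM n. x \<in> \<Omega> \<longrightarrow> H i x = g x)"
  proof
    fix i assume "i \<in> {..<n}"
    then have "H i \<in> borel_measurable (leb_on n \<Omega>)" using H by (auto simp: Lp_space_def)
    from leb_on_borel_version[OF \<Omega>(1) this]
    show "\<exists>g. g \<in> borel_measurable (LM n) \<and> (AE x in LM n. x \<in> \<Omega> \<longrightarrow> H i x = g x)" by blast
  qed
  from bchoice[OF this] obtain H' where H': "\<And>i. i < n \<Longrightarrow> H' i \<in> borel_measurable (LM n)" "\<And>i. i < n \<Longrightarrow> AE x in LM n. x \<in> \<Omega> \<longrightarrow> H i x = H' i x"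
    by auto
  define h where "h = (\<lambda>x. \<Sum>i<n. H' i x)"
  have mh: "h \<in> borel_measurable (LM n)" unfolding h_def by (intro borel_measurable_sum) (use H' in auto)
  have "AE x in LM n. \<forall>i\<in>{..<n}. x \<in> \<Omega> \<longrightarrow> H i x = H' i x" by (intro AE_finite_allI) (use H' in auto)
  then have h: "AE x in LM n. x \<in> \<Omega> \<longrightarrow> (\<Sum>i<n. H i x) = h x" by (auto elim!: eventually_mono simp: h_def)
  have "in_Lq (LM n) (exponent_p n) (\<lambda>x. \<Sum>i<n. indicator \<Omega> x * H' i x)"
    by (rule in_Lq_sum) (use Lp_space_version_in_Lq[OF H \<Omega> p0 q(2) H'] ex(1) in auto)
  then have hL: "in_Lq (LM n) (exponent_p n) (\<lambda>x. indicator \<Omega> x * h x)" by (simp add: h_def sum_distrib_left)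
  let ?U = "\<lambda>x. indicator ?B x * u' (padd n x0 x)" and ?V = "\<lambda>x. indicator ?B x * V' (padd n x0 x)"
  let ?h = "\<lambda>x. indicator ?B x * h (padd n x0 x)"
  have VU: "(\<lambda>x. ?V x * ?U x) = (\<lambda>x. indicator ?B x * (V' (padd n x0 x) * u' (padd n x0 x)))"
    by (auto simp: indicator_def)
  have kw: "kernel_eq n ?B ?U (\<lambda>x. ?V x * ?U x)"
    unfolding VU by (rule kernel_eq_of_weak[OF w(1) \<Omega>(1) sub u' mw w'])
  have kh: "kernel_eq n ?B ?U ?h" by (rule kernel_eq_of_weak[OF Hw \<Omega>(1) sub u' mh h])
  have ae: "AE x in LM n. x \<in> ?B \<longrightarrow> ?V x * ?U x = ?h x"
  proof (rule kernel_eq_unique[OF kw kh _ _ n1])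
    show "integrable (LM n) (\<lambda>x. indicator (ball0 n \<rho>) x * (?V x * ?U x))" if "\<rho> < 4 * r" for \<rho>
      unfolding VU[THEN fun_cong] by (rule weak_laplacian_integrable_on_ball[OF w(1) \<Omega>(1) sub that mw w'])
    show "integrable (LM n) (\<lambda>x. indicator (ball0 n \<rho>) x * ?h x)" if "\<rho> < 4 * r" for \<rho>
      by (rule weak_laplacian_integrable_on_ball[OF Hw \<Omega>(1) sub that mh h])
  qed (use r in simp)
  have mVU: "(\<lambda>x. ?V x * ?U x) \<in> borel_measurable (LM n)"
    unfolding VU by (intro borel_measurable_times borel_measurable_indicator sets_ball0 measurable_compose[OF measurable_padd] u' V')
  have "in_Lq (LM n) (exponent_p n) (\<lambda>x. ?V x * ?U x)"
    by (rule in_Lq_bounded[OF mVU cutL(1)[OF hL p0]])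
       (use ae p0 in \<open>auto elim!: eventually_mono simp: indicator_def\<close>)
  moreover have "\<theta> * Lq_norm (LM n) (real n / 2) ?V \<le> \<theta> * kappa_tilde n \<Omega> V"
    unfolding Vn using C by (intro mult_left_mono cutL(2)[OF VL' n2]) (auto simp: Carleman_constant_def)
  ultimately have "core n \<theta> r (\<theta> * kappa_tilde n \<Omega> V) ?U ?V"
    using n C r cutL(1)[OF uL] cutL(1)[OF VL' n2] Vk kw by unfold_locales auto
  with u' show thesis by (rule that)
qed

lemma Lp_norm_ball_padd:
  assumes u': "u' \<in> borel_measurable (LM n)" "AE x in LM n. x \<in> \<Omega> \<longrightarrow> u x = u' x"
    and sub: "pball n x0 R \<subseteq> \<Omega>" and b: "b \<le> R"
  shows "Lp_norm (leb_on n (pball n x0 b)) 2 u = Lq_norm (LM n) 2 (\<lambda>x. indicator (ball0 n b) x * (indicator (ball0 n R) x * u' (padd n x0 x)))"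
proof -
  have "pball n x0 b \<subseteq> \<Omega>" using sub b by (auto simp: pball_def)
  then have ae: "AE x in LM n. x \<in> pball n x0 b \<longrightarrow> u x = u' x" using u'(2) by (auto elim!: eventually_mono)
  have m: "(\<lambda>x. indicator (pball n x0 b) x * u' x) \<in> borel_measurable (LM n)"
    by (intro borel_measurable_times borel_measurable_indicator sets_pball u')
  have "Lp_norm (leb_on n (pball n x0 b)) 2 u = Lq_norm (LM n) 2 (\<lambda>x. indicator (pball n x0 b) x * u' x)"
    unfolding Lp_norm_2_eq_Lq_norm by (rule leb_on_version_Lq_norm(1)[OF sets_pball u'(1) ae]) simp
  also have "\<dots> = Lq_norm (LM n) 2 (\<lambda>x. indicator (pball n x0 b) (padd n x0 x) * u' (padd n x0 x))"
    by (rule Lq_norm_padd[OF m, symmetric])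
  also have "\<dots> = Lq_norm (LM n) 2 (\<lambda>x. indicator (ball0 n b) x * (indicator (ball0 n R) x * u' (padd n x0 x)))"
  proof (rule Lq_norm_cong)
    fix x assume "x \<in> space (LM n)"
    then have "padd n x0 x \<in> pball n x0 b \<longleftrightarrow> x \<in> ball0 n b" by (intro padd_in_pball) simp
    moreover have "x \<in> ball0 n b \<Longrightarrow> x \<in> ball0 n R" using b by (simp add: ball0_def)
    ultimately show "\<bar>indicator (pball n x0 b) (padd n x0 x) * u' (padd n x0 x)\<bar> = \<bar>indicator (ball0 n b) x * (indicator (ball0 n R) x * u' (padd n x0 x))\<bar>"
      by (auto simp: indicator_def)
  qed
  finally show ?thesis .
qed

lemma Lp_norm_shell_padd:
  assumes u': "u' \<in> borel_measurable (LM n)" "AE x in LM n. x \<in> \<Omega> \<longrightarrow> u x = u' x"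
    and sub: "pball n x0 R \<subseteq> \<Omega>" and b: "b \<le> R"
  shows "Lp_norm (leb_on n (shell n a b)) 2 (\<lambda>x. u (padd n x0 x)) =
    Lq_norm (LM n) 2 (\<lambda>x. indicator (shell n a b) x * (indicator (ball0 n R) x * u' (padd n x0 x)))"
proof -
  have in\<Omega>: "padd n x0 x \<in> \<Omega>" "x \<in> ball0 n R" if "x \<in> shell n a b" for x
  proof -
    show "x \<in> ball0 n R" using that b by (simp add: shell_def ball0_def)
    moreover have "x \<in> Rn n" using that by (simp add: shell_def)
    ultimately show "padd n x0 x \<in> \<Omega>" using padd_in_pball[of x n x0 R] sub by blast
  qed
  have ae: "AE x in LM n. x \<in> shell n a b \<longrightarrow> u (padd n x0 x) = u' (padd n x0 x)"
    using AE_padd[OF u'(2), of x0] by (rule eventually_mono) (use in\<Omega> in blast)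
  have m: "(\<lambda>x. u' (padd n x0 x)) \<in> borel_measurable (LM n)" by (rule measurable_compose[OF measurable_padd u'(1)])
  have "Lp_norm (leb_on n (shell n a b)) 2 (\<lambda>x. u (padd n x0 x)) = Lq_norm (LM n) 2 (\<lambda>x. indicator (shell n a b) x * u' (padd n x0 x))"
    unfolding Lp_norm_2_eq_Lq_norm by (rule leb_on_version_Lq_norm(1)[OF sets_shell m ae]) simp
  also have "\<dots> = Lq_norm (LM n) 2 (\<lambda>x. indicator (shell n a b) x * (indicator (ball0 n R) x * u' (padd n x0 x)))"
    by (rule Lq_norm_cong) (use in\<Omega>(2) in \<open>auto simp: indicator_def\<close>)
  finally show ?thesis .
qed

theorem theorem7p2:
  shows "\<exists>k::real. k > 0 \<and>
    (\<forall>(n::nat) (\<Omega>::point set) (\<theta>::real) (s::ereal).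
      n \<ge> 3 \<and> bounded_lipschitz_domain n \<Omega> \<and> Carleman_constant n \<theta> \<and> ereal (real n / 2) < s \<longrightarrow>
      (\<forall>(r0::real) (r::real) x0.
        0 < r0 \<and> r0 < 3 / 4 \<and> inner_set n \<Omega> (4 * r0) \<noteq> {} \<and>
        0 < r \<and> r < r0 \<and> x0 \<in> inner_set n \<Omega> (4 * r) \<longrightarrow>
        (\<forall>V \<in> potentials n \<theta> \<Omega> s. \<forall>u \<in> X_space n \<Omega> s.
          schrodinger_solution n \<Omega> V u \<and> Lp_norm (leb_on n \<Omega>) 2 u = 1 \<longrightarrow>
          (let K = 1 + kappa n \<Omega> s V powr iota_exp n s;
               lam_tilde = 1 / ln (9 / 4) *
                 ln (1 + 4 * inverse r * k * theta_tilde n \<theta> \<Omega> V * K *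
                   (Lp_norm (leb_on n (shell n r (13 * r / 4))) 2 (\<lambda>x. u (padd n x0 x)) /
                    Lp_norm (leb_on n (shell n (r / 4) (r / 2))) 2 (\<lambda>x. u (padd n x0 x))));
               lam_bar = 2 + max (lam_tilde + 1) (8 + 1 / 2 + (real n - 2) / 2);
               M = k * K * lam_bar\<^sup>2
           in \<forall>\<rho>. 0 < \<rho> \<and> \<rho> < r / 8 \<longrightarrow>
                Lp_norm (leb_on n (pball n x0 (2 * \<rho>))) 2 u
                \<le> \<rho> powr (- lam_bar) * M * Lp_norm (leb_on n (pball n x0 \<rho>)) 2 u))))"
proof -
  \<comment> \<open>The profile is fixed before any of the data, so \<open>H\<close>,
    \<open>C1\<close> and \<open>k0\<close> depend on none of them, and \<open>k0\<close> can serve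
    as the universal constant.\<close>
  obtain S S' S'' H where "step_fun S S' S'' H" using step_fun_exists by blast
  then interpret step_fun S S' S'' H .
  have "C1 * H \<ge> 1 * 1" using C1_ge H_ge_1 by (intro mult_mono) auto
  then have k0: "k0 > 0" by (simp add: k0_def)
  show ?thesis
  proof (intro exI[of _ k0] conjI allI impI ballI k0, elim conjE)
    fix n \<Omega> \<theta> s r0 r x0 V u
    assume n: "3 \<le> (n::nat)" and dom: "bounded_lipschitz_domain n \<Omega>" and C: "Carleman_constant n \<theta>" and s: "ereal (real n / 2) < s"
      and r0: "r0 < 3 / 4" and r: "0 < r" "r < r0" and x0: "x0 \<in> inner_set n \<Omega> (4 * r)"
      and V: "V \<in> potentials n \<theta> \<Omega> s" and u: "u \<in> X_space n \<Omega> s" and sol: "schrodinger_solution n \<Omega> V u"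
      and u1: "Lp_norm (leb_on n \<Omega>) 2 u = 1"
    have sub: "pball n x0 (4 * r) \<subseteq> \<Omega>" by (rule pball_subset_if_inner[OF x0])
    obtain u' V' where u': "u' \<in> borel_measurable (LM n)" "AE x in LM n. x \<in> \<Omega> \<longrightarrow> u x = u' x"
      and c: "core n \<theta> r (\<theta> * kappa_tilde n \<Omega> V) (\<lambda>x. indicator (ball0 n (4 * r)) x * u' (padd n x0 x)) V'"
      by (rule core_of_solution[OF n dom C s r(1) sub V u sol]) (use u1 in auto)
    have \<kappa>: "\<theta> * kappa_tilde n \<Omega> V \<ge> 0"
      using C by (simp add: Carleman_constant_def kappa_tilde_def Lp_norm_eq_Lq_norm)
    have K: "1 + kappa n \<Omega> s V powr iota_exp n s \<ge> 1" by simp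
    have sh: "Lp_norm (leb_on n (shell n a b)) 2 (\<lambda>x. u (padd n x0 x)) =
        Lq_norm (LM n) 2 (\<lambda>x. indicator (shell n a b) x * (indicator (ball0 n (4 * r)) x * u' (padd n x0 x)))" if "b \<le> 4 * r" for a b
      by (rule Lp_norm_shell_padd[OF u' sub that])
    have ba: "Lp_norm (leb_on n (pball n x0 b)) 2 u =
        Lq_norm (LM n) 2 (\<lambda>x. indicator (ball0 n b) x * (indicator (ball0 n (4 * r)) x * u' (padd n x0 x)))" if "b \<le> 4 * r" for b
      by (rule Lp_norm_ball_padd[OF u' sub that])
    have le: "13 * r / 4 \<le> 4 * r" "r / 2 \<le> 4 * r" using r by auto
    have r34: "r < 3 / 4" using r r0 by simp
    show "let K = 1 + kappa n \<Omega> s V powr iota_exp n s;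
               lam_tilde = 1 / ln (9 / 4) *
                 ln (1 + 4 * inverse r * k0 * theta_tilde n \<theta> \<Omega> V * K *
                   (Lp_norm (leb_on n (shell n r (13 * r / 4))) 2 (\<lambda>x. u (padd n x0 x)) /
                    Lp_norm (leb_on n (shell n (r / 4) (r / 2))) 2 (\<lambda>x. u (padd n x0 x))));
               lam_bar = 2 + max (lam_tilde + 1) (8 + 1 / 2 + (real n - 2) / 2);
               M = k0 * K * lam_bar\<^sup>2
           in \<forall>\<rho>. 0 < \<rho> \<and> \<rho> < r / 8 \<longrightarrow>
                Lp_norm (leb_on n (pball n x0 (2 * \<rho>))) 2 u
                \<le> \<rho> powr (- lam_bar) * M * Lp_norm (leb_on n (pball n x0 \<rho>)) 2 u"
      unfolding Let_def sh[OF le(1)] sh[OF le(2)] theta_tilde_def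
    proof (intro allI impI, elim conjE)
      fix \<rho> :: real assume \<rho>: "0 < \<rho>" "\<rho> < r / 8"
      then have bl: "2 * \<rho> \<le> 4 * r" "\<rho> \<le> 4 * r" by auto
      show "Lp_norm (leb_on n (pball n x0 (2 * \<rho>))) 2 u \<le> \<rho> powr (- (2 + max (1 / ln (9 / 4) *
                 ln (1 + 4 * inverse r * k0 * (\<theta> / (1 - \<theta> * kappa_tilde n \<Omega> V)) * (1 + kappa n \<Omega> s V powr iota_exp n s) *
                   (Lq_norm (LM n) 2 (\<lambda>x. indicator (shell n r (13 * r / 4)) x * (indicator (ball0 n (4 * r)) x * u' (padd n x0 x))) /
                    Lq_norm (LM n) 2 (\<lambda>x. indicator (shell n (r / 4) (r / 2)) x * (indicator (ball0 n (4 * r)) x * u' (padd n x0 x))))) + 1)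
                 (8 + 1 / 2 + (real n - 2) / 2))) * (k0 * (1 + kappa n \<Omega> s V powr iota_exp n s) * (2 + max (1 / ln (9 / 4) *
                 ln (1 + 4 * inverse r * k0 * (\<theta> / (1 - \<theta> * kappa_tilde n \<Omega> V)) * (1 + kappa n \<Omega> s V powr iota_exp n s) *
                   (Lq_norm (LM n) 2 (\<lambda>x. indicator (shell n r (13 * r / 4)) x * (indicator (ball0 n (4 * r)) x * u' (padd n x0 x))) /
                    Lq_norm (LM n) 2 (\<lambda>x. indicator (shell n (r / 4) (r / 2)) x * (indicator (ball0 n (4 * r)) x * u' (padd n x0 x))))) + 1)
                 (8 + 1 / 2 + (real n - 2) / 2))\<^sup>2) * Lp_norm (leb_on n (pball n x0 \<rho>)) 2 u"
        unfolding ba[OF bl(1)] ba[OF bl(2)] by (rule core_doubling[OF c r34 \<kappa> K \<rho>])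
    qed
  qed
qed

end
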